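(* Let $\mathbb K$ be a field, let $\triangle$ be a simplicial complex on a finite vertex set and let $\mathbb K[\triangle]$ be its Stanley-Reisner ring. Then \[ \mathrm H^j(\operatorname{Spec}\mathbb K[\triangle],\mathcal O^* )=0\quad\text{for all } j\geq1. \]
   Context: A simplicial complex on $V=[n]$ is a collection $\triangle$ of subsets (faces) of $V$ closed under taking subsets, with all singletons assumed to be faces. $\mathbb K[\triangle]=\mathbb K[X_1,\dots,X_n]/I_\triangle$, where $I_\triangle$ is generated by the squarefree monomials $\prod_{i\in F}X_i$ with $F\subseteq V$ not a face. $\mathcal O^*$ is the sheaf of units of the structure sheaf of the affine scheme $\operatorname{Spec}\mathbb K[\triangle]$, and $\mathrm H^j$ is sheaf cohomology in the Zariski topology. *)

theory Defs
  imports
    "HOL-Algebra.QuotRing"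
    "HOL-Algebra.Product_Groups"
    "HOL-Algebra.Elementary_Groups"
    "HOL-Analysis.Abstract_Topology"
    "HOL-Library.Poly_Mapping"
begin

section \<open>Stanley--Reisner rings\<close>

definition abstract_simplicial_complex :: "'v set \<Rightarrow> 'v set set \<Rightarrow> bool" where
  "abstract_simplicial_complex V \<Delta> \<longleftrightarrow>
     \<Delta> \<subseteq> Pow V \<and>
     (\<forall>F\<in>\<Delta>. \<forall>G. G \<subseteq> F \<longrightarrow> G \<in> \<Delta>) \<and>
     (\<forall>v\<in>V. {v} \<in> \<Delta>)"

text \<open>Exponent vectors are finitely supported functions \<open>'v \<Rightarrow>\<^sub>0 nat\<close>, and polynomials are
  finitely supported coefficient functions on exponent vectors, with the convolution product of
  \<^theory>\<open>HOL-Library.Poly_Mapping\<close>. The ring \<open>K[X\<^sub>v | v \<in> V]\<close> consists of the polynomials in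
  which only variables from \<open>V\<close> occur.\<close>

type_synonym ('v, 'k) mpolynomial = "('v \<Rightarrow>\<^sub>0 nat) \<Rightarrow>\<^sub>0 'k"

definition mpolynomial_ring :: "'v set \<Rightarrow> ('v, 'k::comm_ring_1) mpolynomial ring" where
  "mpolynomial_ring V =
     \<lparr>carrier = {p. \<forall>m\<in>Poly_Mapping.keys p. Poly_Mapping.keys m \<subseteq> V},
      monoid.mult = (*), one = 1, ring.zero = 0, add = (+)\<rparr>"

definition variable :: "'v \<Rightarrow> ('v, 'k::comm_ring_1) mpolynomial" where
  "variable v = Poly_Mapping.single (Poly_Mapping.single v 1) 1"

definition stanley_reisner_ideal ::
    "'v set \<Rightarrow> 'v set set \<Rightarrow> ('v, 'k::comm_ring_1) mpolynomial set" where
  "stanley_reisner_ideal V \<Delta> =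
     genideal (mpolynomial_ring V) {\<Prod>v\<in>F. variable v | F. F \<subseteq> V \<and> F \<notin> \<Delta>}"

definition stanley_reisner_ring ::
    "'v set \<Rightarrow> 'v set set \<Rightarrow> ('v, 'k::comm_ring_1) mpolynomial set ring" where
  "stanley_reisner_ring V \<Delta> = mpolynomial_ring V Quot stanley_reisner_ideal V \<Delta>"


section \<open>The affine scheme of a commutative ring\<close>

definition Spec :: "('a, 'm) ring_scheme \<Rightarrow> 'a set set" where
  "Spec R = {P. primeideal P R}"

text \<open>The closed sets are the sets of primes containing a given subset of the ring.\<close>

definition zariski_open :: "('a, 'm) ring_scheme \<Rightarrow> 'a set set \<Rightarrow> bool" where
  "zariski_open R U \<longleftrightarrow> (\<exists>S\<subseteq>carrier R. U = Spec R - {P \<in> Spec R. S \<subseteq> P})"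

definition zariski_topology :: "('a, 'm) ring_scheme \<Rightarrow> 'a set topology" where
  "zariski_topology R = topology (zariski_open R)"

lemma istopology_zariski_open: "istopology (zariski_open R)"
  unfolding istopology_def
proof (intro conjI allI impI)
  fix A B assume "zariski_open R A" "zariski_open R B"
  then obtain S T where S: "S \<subseteq> carrier R" "A = Spec R - {P \<in> Spec R. S \<subseteq> P}"
    and T: "T \<subseteq> carrier R" "B = Spec R - {P \<in> Spec R. T \<subseteq> P}"
    unfolding zariski_open_def by blast
  let ?ST = "{s \<otimes>\<^bsub>R\<^esub> t | s t. s \<in> S \<and> t \<in> T} \<inter> carrier R"
  have "A \<inter> B = Spec R - {P \<in> Spec R. ?ST \<subseteq> P}"
  proof (intro Set.set_eqI iffI)
    fix P assume "P \<in> A \<inter> B"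
    then obtain s t where st: "s \<in> S" "s \<notin> P" "t \<in> T" "t \<notin> P" and P: "P \<in> Spec R"
      using S T by blast
    interpret primeideal P R using P by (simp add: Spec_def)
    have "s \<otimes>\<^bsub>R\<^esub> t \<notin> P" using st S T I_prime by blast
    moreover have "s \<otimes>\<^bsub>R\<^esub> t \<in> ?ST" using st S T by blast
    ultimately show "P \<in> Spec R - {P \<in> Spec R. ?ST \<subseteq> P}" using P by blast
  next
    fix P assume "P \<in> Spec R - {P \<in> Spec R. ?ST \<subseteq> P}"
    then obtain s t where st: "s \<in> S" "t \<in> T" "s \<otimes>\<^bsub>R\<^esub> t \<notin> P" and P: "P \<in> Spec R" by blast
    interpret primeideal P R using P by (simp add: Spec_def)
    have "s \<notin> P" "t \<notin> P" using st S T I_r_closed I_l_closed by blast+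
    then show "P \<in> A \<inter> B" using st P S T by blast
  qed
  then show "zariski_open R (A \<inter> B)" unfolding zariski_open_def by blast
next
  fix \<K> assume \<K>: "\<forall>K\<in>\<K>. zariski_open R K"
  define D where "D S = Spec R - {P \<in> Spec R. S \<subseteq> P}" for S
  let ?T = "{S. S \<subseteq> carrier R \<and> D S \<in> \<K>}"
  have "\<exists>S\<subseteq>carrier R. K = D S" if "K \<in> \<K>" for K
    using \<K> that unfolding zariski_open_def D_def by (rule bspec)
  then have "K \<in> D ` ?T" if "K \<in> \<K>" for K
    using that by force
  then have "\<K> = D ` ?T" by blast
  then have "\<Union>\<K> = (\<Union>S\<in>?T. D S)" by (rule arg_cong)
  also have "\<dots> = D (\<Union>?T)" unfolding D_def by blast
  finally have "\<Union>\<K> = D (\<Union>?T)" .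
  moreover have "\<Union>?T \<subseteq> carrier R" by blast
  ultimately have "\<exists>S\<subseteq>carrier R. \<Union>\<K> = D S" by blast
  then show "zariski_open R (\<Union>\<K>)" unfolding zariski_open_def D_def .
qed

text \<open>The fraction \<open>a/s\<close> in the localization \<open>R\<^sub>P\<close> is the set of all pairs \<open>(b,t)\<close> with
  \<open>u(ta - sb) = 0\<close> for some \<open>u\<close> outside \<open>P\<close>. Products and sums of classes are formed as unions
  over all representatives, in the style of \<^const>\<open>set_mult\<close>.\<close>

definition fraction :: "('a, 'm) ring_scheme \<Rightarrow> 'a set \<Rightarrow> 'a \<Rightarrow> 'a \<Rightarrow> ('a \<times> 'a) set" where
  "fraction R P a s =
     {(b, t) \<in> carrier R \<times> (carrier R - P).
        \<exists>u\<in>carrier R - P. u \<otimes>\<^bsub>R\<^esub> (t \<otimes>\<^bsub>R\<^esub> a \<ominus>\<^bsub>R\<^esub> s \<otimes>\<^bsub>R\<^esub> b) = \<zero>\<^bsub>R\<^esub>}"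

definition localization :: "('a, 'm) ring_scheme \<Rightarrow> 'a set \<Rightarrow> ('a \<times> 'a) set ring" where
  "localization R P =
     \<lparr>carrier = {fraction R P a s | a s. a \<in> carrier R \<and> s \<in> carrier R - P},
      monoid.mult = (\<lambda>A B. \<Union>(a, s)\<in>A. \<Union>(b, t)\<in>B. fraction R P (a \<otimes>\<^bsub>R\<^esub> b) (s \<otimes>\<^bsub>R\<^esub> t)),
      one = fraction R P \<one>\<^bsub>R\<^esub> \<one>\<^bsub>R\<^esub>,
      ring.zero = fraction R P \<zero>\<^bsub>R\<^esub> \<one>\<^bsub>R\<^esub>,
      add = (\<lambda>A B. \<Union>(a, s)\<in>A. \<Union>(b, t)\<in>B.
               fraction R P (t \<otimes>\<^bsub>R\<^esub> a \<oplus>\<^bsub>R\<^esub> s \<otimes>\<^bsub>R\<^esub> b) (s \<otimes>\<^bsub>R\<^esub> t))\<rparr>"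

text \<open>The sections of the structure sheaf over an open set are the functions into the
  localizations that are locally given by a fraction of ring elements.\<close>

definition structure_sections ::
    "('a, 'm) ring_scheme \<Rightarrow> 'a set set \<Rightarrow> ('a set \<Rightarrow> ('a \<times> 'a) set) ring" where
  "structure_sections R U =
     \<lparr>carrier =
        {f \<in> (\<Pi>\<^sub>E P\<in>U. carrier (localization R P)).
           \<forall>P\<in>U. \<exists>W. openin (zariski_topology R) W \<and> P \<in> W \<and> W \<subseteq> U \<and>
             (\<exists>a\<in>carrier R. \<exists>s\<in>carrier R. \<forall>Q\<in>W. s \<notin> Q \<and> f Q = fraction R Q a s)},
      monoid.mult = (\<lambda>f g. \<lambda>P\<in>U. f P \<otimes>\<^bsub>localization R P\<^esub> g P),
      one = (\<lambda>P\<in>U. \<one>\<^bsub>localization R P\<^esub>),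
      ring.zero = (\<lambda>P\<in>U. \<zero>\<^bsub>localization R P\<^esub>),
      add = (\<lambda>f g. \<lambda>P\<in>U. f P \<oplus>\<^bsub>localization R P\<^esub> g P)\<rparr>"


section \<open>Presheaves of abelian groups\<close>

text \<open>Abelian groups are written multiplicatively, as everywhere in HOL-Algebra.
  \<open>restr F U V\<close> is the restriction map from \<open>U\<close> to a smaller open set \<open>V\<close>.\<close>

record ('x, 'a) presheaf =
  sections :: "'x set \<Rightarrow> 'a monoid"
  restr :: "'x set \<Rightarrow> 'x set \<Rightarrow> 'a \<Rightarrow> 'a"

locale ab_presheaf =
  fixes X :: "'x topology" and F :: "('x, 'a) presheaf"
  assumes comm_group_sections: "openin X U \<Longrightarrow> comm_group (sections F U)"
    and restr_hom: "\<lbrakk>openin X U; openin X V; V \<subseteq> U\<rbrakk> \<Longrightarrow>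
          restr F U V \<in> hom (sections F U) (sections F V)"
    and restr_id: "\<lbrakk>openin X U; s \<in> carrier (sections F U)\<rbrakk> \<Longrightarrow> restr F U U s = s"
    and restr_restr: "\<lbrakk>openin X U; openin X V; openin X W; W \<subseteq> V; V \<subseteq> U;
          s \<in> carrier (sections F U)\<rbrakk> \<Longrightarrow> restr F V W (restr F U V s) = restr F U W s"

definition units_sheaf ::
    "('a, 'm) ring_scheme \<Rightarrow> ('a set, 'a set \<Rightarrow> ('a \<times> 'a) set) presheaf" where
  "units_sheaf R =
     \<lparr>sections = (\<lambda>U. units_of (structure_sections R U)), restr = (\<lambda>U V f. restrict f V)\<rparr>"

text \<open>The germ at \<open>x\<close> of a section \<open>s\<close> over \<open>U\<close>, as an equivalence class of pairs \<open>(U, s)\<close>,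
  and the stalk at \<open>x\<close>.\<close>

definition germ ::
    "'x topology \<Rightarrow> ('x, 'a) presheaf \<Rightarrow> 'x \<Rightarrow> 'x set \<Rightarrow> 'a \<Rightarrow> ('x set \<times> 'a) set" where
  "germ X F x U s =
     {(V, t). openin X V \<and> x \<in> V \<and> t \<in> carrier (sections F V) \<and>
        (\<exists>W. openin X W \<and> x \<in> W \<and> W \<subseteq> U \<inter> V \<and> restr F U W s = restr F V W t)}"

definition stalk ::
    "'x topology \<Rightarrow> ('x, 'a) presheaf \<Rightarrow> 'x \<Rightarrow> ('x set \<times> 'a) set monoid" where
  "stalk X F x =
     \<lparr>carrier = {germ X F x U s | U s. openin X U \<and> x \<in> U \<and> s \<in> carrier (sections F U)},
      monoid.mult = (\<lambda>A B. \<Union>(U, s)\<in>A. \<Union>(V, t)\<in>B.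
        germ X F x (U \<inter> V) (restr F U (U \<inter> V) s \<otimes>\<^bsub>sections F (U \<inter> V)\<^esub> restr F V (U \<inter> V) t)),
      one = germ X F x (topspace X) \<one>\<^bsub>sections F (topspace X)\<^esub>\<rparr>"


section \<open>Sheaf cohomology via the canonical flasque resolution\<close>

text \<open>\<open>H\<^sup>n(X, F)\<close> is the \<open>n\<close>-th cohomology group of the global sections of Godement's canonical
  flasque resolution of \<open>F\<close>. Flasque sheaves are acyclic, so this is the right derived functor of
  global sections.\<close>

text \<open>Godement's sheaf of discontinuous sections, \<open>U \<mapsto> \<Prod>\<^bsub>x\<in>U\<^esub> F\<^sub>x\<close>, with the canonical map
  from \<open>F\<close> into it.\<close>

definition godement ::
    "'x topology \<Rightarrow> ('x, 'a) presheaf \<Rightarrow> ('x, 'x \<Rightarrow> ('x set \<times> 'a) set) presheaf" where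
  "godement X F =
     \<lparr>sections = (\<lambda>U. product_group U (stalk X F)), restr = (\<lambda>U V f. restrict f V)\<rparr>"

definition godement_unit ::
    "'x topology \<Rightarrow> ('x, 'a) presheaf \<Rightarrow> 'x set \<Rightarrow> 'a \<Rightarrow> 'x \<Rightarrow> ('x set \<times> 'a) set" where
  "godement_unit X F U s = (\<lambda>x\<in>U. germ X F x U s)"

text \<open>The presheaf cokernel of the canonical map. It need not be a sheaf, but in the canonical
  resolution it is only used through its stalks, which sheafification does not change.\<close>

definition godement_image ::
    "'x topology \<Rightarrow> ('x, 'a) presheaf \<Rightarrow> 'x set \<Rightarrow> ('x \<Rightarrow> ('x set \<times> 'a) set) set" where
  "godement_image X F U = godement_unit X F U ` carrier (sections F U)"

definition godement_coker ::
    "'x topology \<Rightarrow> ('x, 'a) presheaf \<Rightarrow> ('x, ('x \<Rightarrow> ('x set \<times> 'a) set) set) presheaf" where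
  "godement_coker X F =
     \<lparr>sections = (\<lambda>U. sections (godement X F) U Mod godement_image X F U),
      restr = (\<lambda>U V c. \<Union>f\<in>c.
        godement_image X F V #>\<^bsub>sections (godement X F) V\<^esub> restr (godement X F) U V f)\<rparr>"

text \<open>Iterating the cokernel construction would change the type of the sections at every step.
  To stay within a single type, each cokernel presheaf is replaced by an isomorphic copy whose
  sections are trees: \<open>encode\<close> picks a representative \<open>f\<close> of a coset and then a representative
  \<open>(V, t)\<close> of each germ \<open>f x\<close>. It is injective on the sections over each open set, as the
  lemma \<open>inj_on_encode\<close> below confirms.\<close>

datatype ('x, 'a) tree = Leaf 'a | Node "'x \<Rightarrow> 'x set \<times> ('x, 'a) tree"

definition encode :: "('x \<Rightarrow> ('x set \<times> ('x, 'a) tree) set) set \<Rightarrow> ('x, 'a) tree" where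
  "encode c = Node (\<lambda>x. SOME p. p \<in> (SOME f. f \<in> c) x)"

text \<open>Transport of structure along a map that is injective on all groups of sections.\<close>

definition relabel :: "('a \<Rightarrow> 'b) \<Rightarrow> ('x, 'a) presheaf \<Rightarrow> ('x, 'b) presheaf" where
  "relabel e F =
     (let dec = (\<lambda>U. inv_into (carrier (sections F U)) e) in
      \<lparr>sections = (\<lambda>U.
         \<lparr>carrier = e ` carrier (sections F U),
          monoid.mult = (\<lambda>a b. e (dec U a \<otimes>\<^bsub>sections F U\<^esub> dec U b)),
          one = e \<one>\<^bsub>sections F U\<^esub>\<rparr>),
       restr = (\<lambda>U V a. e (restr F U V (dec U a)))\<rparr>)"

text \<open>The \<open>n\<close>-th syzygy \<open>Z\<^sup>n\<close> of the canonical resolution: \<open>Z\<^sup>0\<close> is \<open>F\<close> and \<open>Z\<^sup>n\<^sup>+\<^sup>1\<close> is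
  the cokernel of \<open>Z\<^sup>n \<rightarrow> C\<^sup>n\<close>, where \<open>C\<^sup>n\<close> is the sheaf of discontinuous sections of \<open>Z\<^sup>n\<close>.
  The differential is the composite \<open>C\<^sup>n \<rightarrow> Z\<^sup>n\<^sup>+\<^sup>1 \<rightarrow> C\<^sup>n\<^sup>+\<^sup>1\<close>.\<close>

primrec syzygy ::
    "'x topology \<Rightarrow> ('x, 'a) presheaf \<Rightarrow> nat \<Rightarrow> ('x, ('x, 'a) tree) presheaf" where
  "syzygy X F 0 = relabel Leaf F"
| "syzygy X F (Suc n) = relabel encode (godement_coker X (syzygy X F n))"

definition canonical_resolution ::
    "'x topology \<Rightarrow> ('x, 'a) presheaf \<Rightarrow> nat \<Rightarrow>
      ('x, 'x \<Rightarrow> ('x set \<times> ('x, 'a) tree) set) presheaf" where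
  "canonical_resolution X F n = godement X (syzygy X F n)"

definition differential ::
    "'x topology \<Rightarrow> ('x, 'a) presheaf \<Rightarrow> nat \<Rightarrow> 'x set \<Rightarrow>
      ('x \<Rightarrow> ('x set \<times> ('x, 'a) tree) set) \<Rightarrow> 'x \<Rightarrow> ('x set \<times> ('x, 'a) tree) set" where
  "differential X F n U f =
     godement_unit X (syzygy X F (Suc n)) U
       (encode (godement_image X (syzygy X F n) U
          #>\<^bsub>sections (canonical_resolution X F n) U\<^esub> f))"

definition cocycles ::
    "'x topology \<Rightarrow> ('x, 'a) presheaf \<Rightarrow> nat \<Rightarrow> ('x \<Rightarrow> ('x set \<times> ('x, 'a) tree) set) set" where
  "cocycles X F n =
     kernel (sections (canonical_resolution X F n) (topspace X))
            (sections (canonical_resolution X F (Suc n)) (topspace X))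
            (differential X F n (topspace X))"

primrec coboundaries ::
    "'x topology \<Rightarrow> ('x, 'a) presheaf \<Rightarrow> nat \<Rightarrow> ('x \<Rightarrow> ('x set \<times> ('x, 'a) tree) set) set" where
  "coboundaries X F 0 = {\<one>\<^bsub>sections (canonical_resolution X F 0) (topspace X)\<^esub>}"
| "coboundaries X F (Suc n) =
     differential X F n (topspace X) ` carrier (sections (canonical_resolution X F n) (topspace X))"

definition sheaf_cohomology ::
    "nat \<Rightarrow> 'x topology \<Rightarrow> ('x, 'a) presheaf \<Rightarrow> ('x \<Rightarrow> ('x set \<times> ('x, 'a) tree) set) set monoid"
  where
  "sheaf_cohomology n X F =
     sections (canonical_resolution X F n) (topspace X)\<lparr>carrier := cocycles X F n\<rparr>
       Mod coboundaries X F n"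


section \<open>Well-definedness\<close>

text \<open>For a presheaf of abelian groups, the stalks and all terms of the canonical resolution are
  abelian groups, the differentials are homomorphisms with \<open>d \<circ> d = 1\<close>, and cohomology is an
  abelian group; \<^const>\<open>encode\<close> is injective where it is used. For a commutative ring, the
  localizations are commutative rings and the units of the structure sheaf form a presheaf of
  abelian groups. The Stanley--Reisner ring is a commutative ring.\<close>

context ab_presheaf
begin

lemma grp: "openin X U \<Longrightarrow> group (sections F U)"
  using comm_group_sections comm_group.axioms(2) by blast

lemma restr_closed: "\<lbrakk>openin X U; openin X V; V \<subseteq> U; s \<in> carrier (sections F U)\<rbrakk>
   \<Longrightarrow> restr F U V s \<in> carrier (sections F V)"
  using restr_hom hom_in_carrier by metis

lemma germ_mem: "(V,t) \<in> germ X F x U s \<longleftrightarrow> openin X V \<and> x \<in> V \<and> t \<in> carrier (sections F V) \<and>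
        (\<exists>W. openin X W \<and> x \<in> W \<and> W \<subseteq> U \<inter> V \<and> restr F U W s = restr F V W t)"
  by (simp add: germ_def)

lemma germ_self: "\<lbrakk>openin X U; x \<in> U; s \<in> carrier (sections F U)\<rbrakk> \<Longrightarrow> (U,s) \<in> germ X F x U s"
  by (auto simp: germ_mem)

lemma germ_eq_iff:
  assumes "openin X U" "x \<in> U" "s \<in> carrier (sections F U)"
    "openin X V" "x \<in> V" "t \<in> carrier (sections F V)"
  shows "germ X F x U s = germ X F x V t \<longleftrightarrow>
    (\<exists>W. openin X W \<and> x \<in> W \<and> W \<subseteq> U \<inter> V \<and> restr F U W s = restr F V W t)" (is "?L \<longleftrightarrow> ?R")
proof
  assume ?L
  then have "(V,t) \<in> germ X F x U s" using germ_self assms by metis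
  then show ?R by (simp add: germ_mem)
next
  have key: "germ X F x V t \<subseteq> germ X F x U s" 
    if a: "openin X U" "x \<in> U" "s \<in> carrier (sections F U)"
    "openin X V" "x \<in> V" "t \<in> carrier (sections F V)" 
    and W: "openin X W" "x \<in> W" "W \<subseteq> U \<inter> V" "restr F U W s = restr F V W t" for U s V t W
  proof (clarsimp simp: germ_mem)
    fix V' t' W' assume b: "openin X V'" "x \<in> V'" "t' \<in> carrier (sections F V')" "openin X W'"
      "x \<in> W'" "W' \<subseteq> V" "W' \<subseteq> V'" "restr F V W' t = restr F V' W' t'"
    have o: "openin X (W \<inter> W')" using W b by blast
    have "restr F U (W \<inter> W') s = restr F W (W \<inter> W') (restr F U W s)"
      by (rule restr_restr[symmetric]) (use a W o in auto)
    also have "\<dots> = restr F V (W \<inter> W') t" unfolding W(4) by (rule restr_restr) (use a W o in auto)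
    also have "\<dots> = restr F W' (W \<inter> W') (restr F V W' t)" by (rule restr_restr[symmetric]) (use a b o in auto)
    also have "\<dots> = restr F V' (W \<inter> W') t'" unfolding b(8) by (rule restr_restr) (use b(1-7) o in auto)
    finally show "\<exists>W. openin X W \<and> x \<in> W \<and> W \<subseteq> U \<and> W \<subseteq> V' \<and> restr F U W s = restr F V' W t'"
      using o W b by (intro exI[of _ "W \<inter> W'"]) auto
  qed
  assume ?R
  then obtain W where W: "openin X W" "x \<in> W" "W \<subseteq> U \<inter> V" "restr F U W s = restr F V W t" by blast
  show ?L using key[OF assms W] key[OF assms(4-6,1-3) W(1,2) _ W(4)[symmetric]] W(3) by blast
qed

lemma germ_restr:
  assumes "openin X U" "openin X V" "V \<subseteq> U" "x \<in> V" "s \<in> carrier (sections F U)"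
  shows "germ X F x V (restr F U V s) = germ X F x U s"
proof -
  have "x \<in> U" using assms by blast
  have c: "restr F U V s \<in> carrier (sections F V)" by (rule restr_closed) (use assms in auto)
  have "restr F V V (restr F U V s) = restr F U V s" by (rule restr_id) (use assms c in auto)
  then show ?thesis using germ_eq_iff[OF assms(2,4) c assms(1) \<open>x \<in> U\<close> assms(5)] assms(2-4) by blast
qed

lemma germ_memD:
  assumes "openin X U" "x \<in> U" "s \<in> carrier (sections F U)" "(V,t) \<in> germ X F x U s"
  shows "openin X V" "x \<in> V" "t \<in> carrier (sections F V)" "germ X F x V t = germ X F x U s"
proof -
  show V: "openin X V" "x \<in> V" "t \<in> carrier (sections F V)" using assms(4) unfolding germ_mem by blast+
  show "germ X F x V t = germ X F x U s" using germ_eq_iff[OF assms(1-3) V] assms(4) unfolding germ_mem by blast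
qed

lemma stalk_carrier: "carrier (stalk X F x) = 
   {germ X F x U s | U s. openin X U \<and> x \<in> U \<and> s \<in> carrier (sections F U)}"
  by (simp add: stalk_def)

lemma germ_in_stalk: "\<lbrakk>openin X U; x \<in> U; s \<in> carrier (sections F U)\<rbrakk> \<Longrightarrow> germ X F x U s \<in> carrier (stalk X F x)"
  by (auto simp: stalk_carrier)

lemma stalk_mult0:
  assumes a: "openin X U" "x \<in> U" "s \<in> carrier (sections F U)" "t \<in> carrier (sections F U)"
  shows "germ X F x U s \<otimes>\<^bsub>stalk X F x\<^esub> germ X F x U t = germ X F x U (s \<otimes>\<^bsub>sections F U\<^esub> t)"
proof -
  have k: "germ X F x (V \<inter> V') (restr F V (V \<inter> V') s' \<otimes>\<^bsub>sections F (V \<inter> V')\<^esub> restr F V' (V \<inter> V') t') 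
     = germ X F x U (s \<otimes>\<^bsub>sections F U\<^esub> t)" (is "?G = _")
    if m: "(V,s') \<in> germ X F x U s" "(V',t') \<in> germ X F x U t" for V s' V' t'
  proof -
    note 1 = germ_memD[OF a(1-3) m(1)] and 2 = germ_memD[OF a(1,2,4) m(2)]
    obtain W where W: "openin X W" "x \<in> W" "W \<subseteq> U \<inter> V" "restr F U W s = restr F V W s'"
      using m(1) unfolding germ_mem by blast
    obtain W' where W': "openin X W'" "x \<in> W'" "W' \<subseteq> U \<inter> V'" "restr F U W' t = restr F V' W' t'"
      using m(2) unfolding germ_mem by blast
    let ?W = "W \<inter> W'" let ?V = "V \<inter> V'"
    have o: "openin X ?W" "openin X ?V" using W(1) W'(1) 1(1) 2(1) by (auto intro: openin_Int)
    have sub: "?W \<subseteq> ?V" "?W \<subseteq> U" using W(3) W'(3) by blast+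
    have e1: "restr F V ?W s' = restr F U ?W s"
    proof -
      have "restr F V ?W s' = restr F W ?W (restr F V W s')" by (rule restr_restr[symmetric]) (use W(1-3) o 1(1-3) in auto)
      also have "\<dots> = restr F U ?W s" unfolding W(4)[symmetric] by (rule restr_restr) (use W(1-3) o a in auto)
      finally show ?thesis .
    qed
    have e2: "restr F V' ?W t' = restr F U ?W t"
    proof -
      have "restr F V' ?W t' = restr F W' ?W (restr F V' W' t')" by (rule restr_restr[symmetric]) (use W'(1-3) o 2(1-3) in auto)
      also have "\<dots> = restr F U ?W t" unfolding W'(4)[symmetric] by (rule restr_restr) (use W'(1-3) o a in auto)
      finally show ?thesis .
    qed
    have c: "restr F V ?V s' \<in> carrier (sections F ?V)" "restr F V' ?V t' \<in> carrier (sections F ?V)"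
      using restr_closed[of V ?V s'] restr_closed[of V' ?V t'] 1(1-3) 2(1-3) o(2) by auto
    interpret gV: group "sections F ?V" using grp o by blast
    interpret gU: group "sections F U" using grp a by blast
    have "restr F ?V ?W (restr F V ?V s' \<otimes>\<^bsub>sections F ?V\<^esub> restr F V' ?V t') 
      = restr F ?V ?W (restr F V ?V s') \<otimes>\<^bsub>sections F ?W\<^esub> restr F ?V ?W (restr F V' ?V t')"
      using hom_mult[OF restr_hom[OF o(2) o(1) sub(1)]] c by blast
    also have "\<dots> = restr F U ?W s \<otimes>\<^bsub>sections F ?W\<^esub> restr F U ?W t"
    proof -
      have "restr F ?V ?W (restr F V ?V s') = restr F V ?W s'" by (rule restr_restr) (use o 1(1-3) sub in auto)
      moreover have "restr F ?V ?W (restr F V' ?V t') = restr F V' ?W t'" by (rule restr_restr) (use o 2(1-3) sub in auto)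
      ultimately show ?thesis by (simp only: e1 e2)
    qed
    also have "\<dots> = restr F U ?W (s \<otimes>\<^bsub>sections F U\<^esub> t)" 
      by (rule hom_mult[OF restr_hom[OF a(1) o(1) sub(2)], symmetric]) (use a in auto)
    finally have fin: "restr F ?V ?W (restr F V ?V s' \<otimes>\<^bsub>sections F ?V\<^esub> restr F V' ?V t') = restr F U ?W (s \<otimes>\<^bsub>sections F U\<^esub> t)" .
    have x: "x \<in> ?W" "x \<in> ?V" using W(2) W'(2) 1(2) 2(2) by blast+
    have "?W \<subseteq> ?V \<inter> U" using sub by blast
    with fin o x show ?thesis
      using germ_eq_iff[OF o(2) x(2) gV.m_closed[OF c] a(1,2) gU.m_closed[OF a(3,4)]] by blast
  qed
  have "germ X F x U s \<otimes>\<^bsub>stalk X F x\<^esub> germ X F x U t = (\<Union>(V, s')\<in>germ X F x U s. \<Union>(V', t')\<in>germ X F x U t. 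
      germ X F x U (s \<otimes>\<^bsub>sections F U\<^esub> t))"
    unfolding stalk_def monoid.simps partial_object.simps by (intro SUP_cong refl) (auto simp: k split: prod.splits)
  also have "\<dots> = germ X F x U (s \<otimes>\<^bsub>sections F U\<^esub> t)"
    using germ_self[OF a(1-3)] germ_self[OF a(1,2,4)] by auto
  finally show ?thesis .
qed

lemma stalk_one: "\<lbrakk>openin X U; x \<in> U\<rbrakk> \<Longrightarrow> \<one>\<^bsub>stalk X F x\<^esub> = germ X F x U \<one>\<^bsub>sections F U\<^esub>"
proof -
  assume a: "openin X U" "x \<in> U"
  have sub: "U \<subseteq> topspace X" using a openin_subset by blast
  interpret g: group "sections F U" using grp a by blast
  interpret gt: group "sections F (topspace X)" using grp by blast
  have "restr F (topspace X) U \<one>\<^bsub>sections F (topspace X)\<^esub> = \<one>\<^bsub>sections F U\<^esub>"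
    using hom_one[OF restr_hom] a sub gt.group_axioms g.group_axioms by auto
  then show ?thesis using germ_restr[of "topspace X" U x "\<one>\<^bsub>sections F (topspace X)\<^esub>"] a sub
    by (simp add: stalk_def)
qed

lemma stalk_common2:
  assumes "A \<in> carrier (stalk X F x)" "B \<in> carrier (stalk X F x)"
  obtains U s t where "openin X U" "x \<in> U" "s \<in> carrier (sections F U)" "t \<in> carrier (sections F U)"
    "A = germ X F x U s" "B = germ X F x U t"
proof -
  obtain U s V t where a: "openin X U" "x \<in> U" "s \<in> carrier (sections F U)" "A = germ X F x U s"
   "openin X V" "x \<in> V" "t \<in> carrier (sections F V)" "B = germ X F x V t"
    using assms by (auto simp: stalk_carrier)
  have o: "openin X (U \<inter> V)" using a by blast
  show ?thesis
    by (rule that[of "U \<inter> V" "restr F U (U \<inter> V) s" "restr F V (U \<inter> V) t"])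
       (use a o restr_closed germ_restr in auto)
qed

lemma stalk_common3:
  assumes "A \<in> carrier (stalk X F x)" "B \<in> carrier (stalk X F x)" "C \<in> carrier (stalk X F x)"
  obtains U s t r where "openin X U" "x \<in> U" "s \<in> carrier (sections F U)" "t \<in> carrier (sections F U)"
    "r \<in> carrier (sections F U)" "A = germ X F x U s" "B = germ X F x U t" "C = germ X F x U r"
proof -
  obtain U s t where a: "openin X U" "x \<in> U" "s \<in> carrier (sections F U)" "t \<in> carrier (sections F U)"
    "A = germ X F x U s" "B = germ X F x U t" using stalk_common2 assms by metis
  obtain V r where b: "openin X V" "x \<in> V" "r \<in> carrier (sections F V)" "C = germ X F x V r"
    using assms by (auto simp: stalk_carrier)
  have o: "openin X (U \<inter> V)" using a b by blast
  show ?thesis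
    by (rule that[of "U \<inter> V" "restr F U (U \<inter> V) s" "restr F U (U \<inter> V) t" "restr F V (U \<inter> V) r"])
       (use a b o restr_closed germ_restr in auto)
qed

lemma comm_group_stalk: assumes x: "x \<in> topspace X" shows "comm_group (stalk X F x)"
proof (rule comm_groupI)
  fix A B assume "A \<in> carrier (stalk X F x)" "B \<in> carrier (stalk X F x)"
  then obtain U s t where a: "openin X U" "x \<in> U" "s \<in> carrier (sections F U)" "t \<in> carrier (sections F U)"
    "A = germ X F x U s" "B = germ X F x U t" using stalk_common2 by metis
  interpret g: comm_group "sections F U" using comm_group_sections a by blast
  show "A \<otimes>\<^bsub>stalk X F x\<^esub> B \<in> carrier (stalk X F x)"
    using a stalk_mult0 germ_in_stalk by simp
  show "A \<otimes>\<^bsub>stalk X F x\<^esub> B = B \<otimes>\<^bsub>stalk X F x\<^esub> A"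
    using a stalk_mult0 g.m_comm by simp
next
  have "openin X (topspace X)" by simp
  then show "\<one>\<^bsub>stalk X F x\<^esub> \<in> carrier (stalk X F x)"
    using stalk_one germ_in_stalk x grp group.is_monoid monoid.one_closed by metis
next
  fix A B C assume "A \<in> carrier (stalk X F x)" "B \<in> carrier (stalk X F x)" "C \<in> carrier (stalk X F x)"
  then obtain U s t r where a: "openin X U" "x \<in> U" "s \<in> carrier (sections F U)" "t \<in> carrier (sections F U)"
    "r \<in> carrier (sections F U)" "A = germ X F x U s" "B = germ X F x U t" "C = germ X F x U r" 
    using stalk_common3 by metis
  interpret g: comm_group "sections F U" using comm_group_sections a by blast
  show "A \<otimes>\<^bsub>stalk X F x\<^esub> B \<otimes>\<^bsub>stalk X F x\<^esub> C = A \<otimes>\<^bsub>stalk X F x\<^esub> (B \<otimes>\<^bsub>stalk X F x\<^esub> C)"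
    using a by (simp add: stalk_mult0 g.m_assoc)
next
  fix A assume "A \<in> carrier (stalk X F x)"
  then obtain U s where a: "openin X U" "x \<in> U" "s \<in> carrier (sections F U)" "A = germ X F x U s"
    by (auto simp: stalk_carrier)
  interpret g: comm_group "sections F U" using comm_group_sections a by blast
  show "\<one>\<^bsub>stalk X F x\<^esub> \<otimes>\<^bsub>stalk X F x\<^esub> A = A" using a by (simp add: stalk_one stalk_mult0)
  show "\<exists>y\<in>carrier (stalk X F x). y \<otimes>\<^bsub>stalk X F x\<^esub> A = \<one>\<^bsub>stalk X F x\<^esub>"
    by (rule bexI[of _ "germ X F x U (inv\<^bsub>sections F U\<^esub> s)"])
      (use a in \<open>auto simp: stalk_one[OF a(1,2)] stalk_mult0 germ_in_stalk\<close>)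
qed

lemma topX: "openin X U \<Longrightarrow> x \<in> U \<Longrightarrow> x \<in> topspace X" using openin_subset by blast

lemma comm_group_product: "\<lbrakk>\<And>i. i \<in> I \<Longrightarrow> comm_group (G i)\<rbrakk> \<Longrightarrow> comm_group (product_group I G)"
  by (intro group.group_comm_groupI product_group) (auto simp: comm_group_def PiE_iff fun_eq_iff restrict_def intro!: comm_monoid.m_comm)

lemma godement_presheaf: "ab_presheaf X (godement X F)"
proof (rule ab_presheaf.intro)
  fix U assume "openin X U"
  then show "comm_group (sections (godement X F) U)"
    unfolding godement_def presheaf.simps by (intro comm_group_product comm_group_stalk topX)
next
  fix U V assume "openin X U" "openin X V" "V \<subseteq> U"
  then show "restr (godement X F) U V \<in> hom (sections (godement X F) U) (sections (godement X F) V)"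
    by (auto simp: godement_def hom_def product_group_def fun_eq_iff PiE_iff)
qed (auto simp: godement_def PiE_iff extensional_restrict Int_absorb1 Int_absorb2)

lemma godement_unit_hom: 
  assumes "openin X U" shows "godement_unit X F U \<in> hom (sections F U) (sections (godement X F) U)"
  using assms by (auto simp: hom_def godement_unit_def godement_def product_group_def germ_in_stalk stalk_mult0 fun_eq_iff)

lemma godement_unit_restr:
  assumes "openin X U" "openin X V" "V \<subseteq> U" "s \<in> carrier (sections F U)"
  shows "godement_unit X F V (restr F U V s) = restr (godement X F) U V (godement_unit X F U s)"
  using assms germ_restr by (auto simp: godement_unit_def godement_def fun_eq_iff)

lemma subgroup_image: "openin X U \<Longrightarrow> subgroup (godement_image X F U) (sections (godement X F) U)"
  unfolding godement_image_def
  using group_hom.img_is_subgroup[of "sections F U" "sections (godement X F) U" "godement_unit X F U"]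
    godement_unit_hom grp ab_presheaf.grp[OF godement_presheaf]
  by (simp add: group_hom_def group_hom_axioms_def)


lemma normal_image: "openin X U \<Longrightarrow> godement_image X F U \<lhd> sections (godement X F) U"
  using subgroup_image ab_presheaf.comm_group_sections[OF godement_presheaf]
  by (metis comm_group.subgroup_imp_normal)

lemma restr_image:
  assumes "openin X U" "openin X V" "V \<subseteq> U" "n \<in> godement_image X F U" shows "restr (godement X F) U V n \<in> godement_image X F V"
proof -
  obtain s where s: "s \<in> carrier (sections F U)" "n = godement_unit X F U s" using assms(4) unfolding godement_image_def by blast
  show ?thesis unfolding godement_image_def s(2) godement_unit_restr[OF assms(1-3) s(1), symmetric]
    by (intro imageI restr_closed assms s)
qed

lemma coker_restr:
  assumes "openin X U" "openin X V" "V \<subseteq> U" "f \<in> carrier (sections (godement X F) U)"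
  shows "restr (godement_coker X F) U V (godement_image X F U #>\<^bsub>sections (godement X F) U\<^esub> f) = godement_image X F V #>\<^bsub>sections (godement X F) V\<^esub> restr (godement X F) U V f"
proof -
  interpret G: ab_presheaf X "godement X F" by (rule godement_presheaf)
  interpret n: normal "godement_image X F V" "sections (godement X F) V" using normal_image assms by blast
  interpret nU: normal "godement_image X F U" "sections (godement X F) U" using normal_image assms by blast
  have "godement_image X F V #>\<^bsub>sections (godement X F) V\<^esub> restr (godement X F) U V g = godement_image X F V #>\<^bsub>sections (godement X F) V\<^esub> restr (godement X F) U V f" 
    if g: "g \<in> godement_image X F U #>\<^bsub>sections (godement X F) U\<^esub> f" for g
  proof -
    obtain m where m: "m \<in> godement_image X F U" "g = m \<otimes>\<^bsub>sections (godement X F) U\<^esub> f" using g by (auto simp: r_coset_def)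
    then have "restr (godement X F) U V g = restr (godement X F) U V m \<otimes>\<^bsub>sections (godement X F) V\<^esub> restr (godement X F) U V f"
      using hom_mult[OF G.restr_hom] assms nU.subset by blast
    then show ?thesis
      using n.coset_mult_assoc[OF n.subset, of "restr (godement X F) U V m" "restr (godement X F) U V f"] n.rcos_const[of "restr (godement X F) U V m"] 
        restr_image[OF assms(1-3) m(1)] assms n.subset G.restr_closed[OF assms]
      by (simp add: subset_iff)
  qed
  moreover have "f \<in> godement_image X F U #>\<^bsub>sections (godement X F) U\<^esub> f" using assms nU.rcos_self nU.subgroup_axioms by blast
  ultimately show ?thesis unfolding godement_coker_def presheaf.simps by blast
qed

lemma coker_carrier: "carrier (sections (godement_coker X F) U) = (\<lambda>f. godement_image X F U #>\<^bsub>sections (godement X F) U\<^esub> f) ` carrier (sections (godement X F) U)"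
  by (simp add: godement_coker_def carrier_FactGroup)

lemma coker_one: "\<one>\<^bsub>sections (godement_coker X F) U\<^esub> = godement_image X F U"
  by (simp add: godement_coker_def)

lemma coker_mult: "openin X U \<Longrightarrow> f \<in> carrier (sections (godement X F) U) \<Longrightarrow> g \<in> carrier (sections (godement X F) U) \<Longrightarrow>
  (godement_image X F U #>\<^bsub>sections (godement X F) U\<^esub> f) \<otimes>\<^bsub>sections (godement_coker X F) U\<^esub> (godement_image X F U #>\<^bsub>sections (godement X F) U\<^esub> g) 
   = godement_image X F U #>\<^bsub>sections (godement X F) U\<^esub> (f \<otimes>\<^bsub>sections (godement X F) U\<^esub> g)"
  using normal.rcos_sum[OF normal_image] by (simp add: godement_coker_def)

lemma coker_presheaf: "ab_presheaf X (godement_coker X F)"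
proof -
  interpret G: ab_presheaf X "godement X F" by (rule godement_presheaf)
  show ?thesis
  proof (rule ab_presheaf.intro)
    fix U assume "openin X U"
    then show "comm_group (sections (godement_coker X F) U)"
      using comm_group.abelian_FactGroup[OF G.comm_group_sections subgroup_image] by (simp add: godement_coker_def)
  next
    fix U V assume a: "openin X U" "openin X V" "V \<subseteq> U"
    show "restr (godement_coker X F) U V \<in> hom (sections (godement_coker X F) U) (sections (godement_coker X F) V)"
    proof (rule homI)
      fix c assume "c \<in> carrier (sections (godement_coker X F) U)"
      then show "restr (godement_coker X F) U V c \<in> carrier (sections (godement_coker X F) V)"
        using a G.restr_closed by (auto simp: coker_carrier coker_restr)
    next
      fix c d assume "c \<in> carrier (sections (godement_coker X F) U)" "d \<in> carrier (sections (godement_coker X F) U)"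
      then obtain f g where fg: "f \<in> carrier (sections (godement X F) U)" "g \<in> carrier (sections (godement X F) U)"
        "c = godement_image X F U #>\<^bsub>sections (godement X F) U\<^esub> f" "d = godement_image X F U #>\<^bsub>sections (godement X F) U\<^esub> g" by (auto simp: coker_carrier)
      interpret g: group "sections (godement X F) U" using a G.grp by blast
      show "restr (godement_coker X F) U V (c \<otimes>\<^bsub>sections (godement_coker X F) U\<^esub> d) = 
         restr (godement_coker X F) U V c \<otimes>\<^bsub>sections (godement_coker X F) V\<^esub> restr (godement_coker X F) U V d"
        using a fg by (simp add: coker_mult coker_restr G.restr_closed hom_mult[OF G.restr_hom])
    qed
  next
    fix U c assume "openin X U" "c \<in> carrier (sections (godement_coker X F) U)"
    then show "restr (godement_coker X F) U U c = c" using G.restr_id by (auto simp: coker_carrier coker_restr)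
  next
    fix U V W c assume "openin X U" "openin X V" "openin X W" "W \<subseteq> V" "V \<subseteq> U" "c \<in> carrier (sections (godement_coker X F) U)"
    moreover have "W \<subseteq> U" using calculation by blast
    ultimately show "restr (godement_coker X F) V W (restr (godement_coker X F) U V c) = restr (godement_coker X F) U W c"
      using G.restr_restr by (auto simp: coker_carrier coker_restr G.restr_closed)
  qed
qed

lemma relabel_carrier: "carrier (sections (relabel e F) U) = e ` carrier (sections F U)"
  by (simp add: relabel_def)

lemma relabel_mult: "inj_on e (carrier (sections F U)) \<Longrightarrow> a \<in> carrier (sections F U) \<Longrightarrow> b \<in> carrier (sections F U)
  \<Longrightarrow> e a \<otimes>\<^bsub>sections (relabel e F) U\<^esub> e b = e (a \<otimes>\<^bsub>sections F U\<^esub> b)"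
  by (simp add: relabel_def inv_into_f_f)

lemma relabel_one: "\<one>\<^bsub>sections (relabel e F) U\<^esub> = e \<one>\<^bsub>sections F U\<^esub>"
  by (simp add: relabel_def)

lemma relabel_restr: "inj_on e (carrier (sections F U)) \<Longrightarrow> a \<in> carrier (sections F U) 
  \<Longrightarrow> restr (relabel e F) U V (e a) = e (restr F U V a)"
  by (simp add: relabel_def inv_into_f_f)

lemma relabel_presheaf:
  assumes inj: "\<And>U. openin X U \<Longrightarrow> inj_on e (carrier (sections F U))"
  shows "ab_presheaf X (relabel e F)"
proof (rule ab_presheaf.intro)
  fix U assume a: "openin X U"
  interpret g: comm_group "sections F U" using comm_group_sections a by blast
  show "comm_group (sections (relabel e F) U)"
    by (rule comm_groupI) (auto simp: relabel_carrier relabel_mult[OF inj[OF a]] relabel_one g.m_ac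
      intro!: bexI[of _ "inv\<^bsub>sections F U\<^esub> _"])
qed (auto simp: relabel_carrier relabel_mult[OF inj] relabel_restr[OF inj] restr_closed restr_id restr_restr hom_def
   hom_mult[OF restr_hom] group.is_monoid[OF grp] monoid.m_closed)

end

lemma inj_on_encode:
  fixes F' :: "('x, ('x, 'c) tree) presheaf"
  assumes "ab_presheaf X F'" "openin X U"
  shows "inj_on encode (carrier (sections (godement_coker X F') U))"
proof -
  interpret F': ab_presheaf X F' by (rule assms(1))
  let ?C = "godement X F'" let ?N = "godement_image X F'"
  interpret n: normal "?N U" "sections ?C U" using F'.normal_image assms by blast
  have pick: "(SOME f. f \<in> c) \<in> c \<and> (SOME f. f \<in> c) \<in> carrier (sections ?C U) 
      \<and> c = ?N U #>\<^bsub>sections ?C U\<^esub> (SOME f. f \<in> c)" if c: "c \<in> carrier (sections (godement_coker X F') U)" for c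
  proof -
    obtain f where f: "f \<in> carrier (sections ?C U)" "c = ?N U #>\<^bsub>sections ?C U\<^esub> f" 
      using c by (auto simp: F'.coker_carrier)
    then have "f \<in> c" using n.rcos_self n.subgroup_axioms by blast
    then have 1: "(SOME f. f \<in> c) \<in> c" by (rule someI[where P="\<lambda>f. f \<in> c"])
    then show ?thesis using f n.repr_independence[OF _ _ n.subgroup_axioms] n.r_coset_subset_G[OF n.subset]
      by blast
  qed
  show ?thesis
  proof (rule inj_onI)
    fix c d assume cd: "c \<in> carrier (sections (godement_coker X F') U)" "d \<in> carrier (sections (godement_coker X F') U)"
      "encode c = encode d"
    define f where "f = (SOME f. f \<in> c)"
    define g where "g = (SOME f. f \<in> d)"
    have eq: "(SOME p. p \<in> f x) = (SOME p. p \<in> g x)" for x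
      using cd(3) unfolding encode_def f_def g_def by (auto dest: fun_cong)
    have fg: "f \<in> carrier (sections ?C U)" "g \<in> carrier (sections ?C U)" using pick cd f_def g_def by auto
    have "f = g"
    proof
      fix x show "f x = g x"
      proof (cases "x \<in> U")
        case False then show ?thesis using fg by (auto simp: godement_def PiE_iff extensional_def)
      next
        case True
        then have st: "f x \<in> carrier (stalk X F' x)" "g x \<in> carrier (stalk X F' x)" using fg by (auto simp: godement_def PiE_iff)
        then obtain V s t where v: "openin X V" "x \<in> V" "s \<in> carrier (sections F' V)" "t \<in> carrier (sections F' V)"
           "f x = germ X F' x V s" "g x = germ X F' x V t" using F'.stalk_common2 by metis
        have "(SOME p. p \<in> f x) \<in> f x" "(SOME p. p \<in> g x) \<in> g x" 
          unfolding v using F'.germ_self[OF v(1,2)] v(3,4) by (metis someI_ex)+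
        then obtain W r where "(W,r) \<in> germ X F' x V s" "(W,r) \<in> germ X F' x V t" using v eq by (metis surj_pair)
        then show ?thesis using v F'.germ_memD(4) by metis
      qed
    qed
    then show "c = d" using pick cd f_def g_def by metis
  qed
qed

context ab_presheaf
begin

lemma syzygy_presheaf: "ab_presheaf X (syzygy X F n)"
proof (induction n)
  case 0 show ?case by (auto intro!: relabel_presheaf simp: inj_on_def)
next
  case (Suc n)
  then show ?case
    unfolding syzygy.simps
    by (intro ab_presheaf.relabel_presheaf[OF ab_presheaf.coker_presheaf[OF Suc]] inj_on_encode[OF Suc])
qed

lemma differential_hom: assumes o: "openin X U"
  shows "differential X F n U \<in> hom (sections (canonical_resolution X F n) U) (sections (canonical_resolution X F (Suc n)) U)"
proof -
  let ?Z = "syzygy X F n" let ?C = "godement X ?Z" let ?N = "godement_image X ?Z U"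
  interpret Z: ab_presheaf X ?Z by (rule syzygy_presheaf)
  interpret Z': ab_presheaf X "syzygy X F (Suc n)" by (rule syzygy_presheaf)
  interpret K: ab_presheaf X "godement_coker X ?Z" by (rule Z.coker_presheaf)
  interpret n: normal ?N "sections ?C U" using Z.normal_image o by blast
  note i = inj_on_encode[OF syzygy_presheaf o]
  have q: "(\<lambda>f. encode (?N #>\<^bsub>sections ?C U\<^esub> f)) \<in> hom (sections ?C U) (sections (syzygy X F (Suc n)) U)"
    by (rule homI) (auto simp: K.relabel_carrier Z.coker_carrier K.relabel_mult[OF i] Z.coker_mult[OF o])
  show ?thesis using hom_compose[OF q Z'.godement_unit_hom[OF o]]
    unfolding differential_def canonical_resolution_def comp_def by simp
qed

lemma differential_differential: assumes o: "openin X U" and f: "f \<in> carrier (sections (canonical_resolution X F n) U)"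
  shows "differential X F (Suc n) U (differential X F n U f) = \<one>\<^bsub>sections (canonical_resolution X F (Suc (Suc n))) U\<^esub>"
proof -
  let ?Z = "syzygy X F n" let ?Z' = "syzygy X F (Suc n)"  let ?Z'' = "syzygy X F (Suc (Suc n))"
  interpret Z: ab_presheaf X ?Z by (rule syzygy_presheaf)
  interpret Z': ab_presheaf X ?Z' by (rule syzygy_presheaf)
  interpret Z'': ab_presheaf X ?Z'' by (rule syzygy_presheaf)
  interpret K: ab_presheaf X "godement_coker X ?Z" by (rule Z.coker_presheaf)
  interpret K': ab_presheaf X "godement_coker X ?Z'" by (rule Z'.coker_presheaf)
  interpret G: ab_presheaf X "godement X ?Z''" by (rule Z''.godement_presheaf)
  interpret n: normal "godement_image X ?Z' U" "sections (godement X ?Z') U" using Z'.normal_image o by blast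
  have "differential X F n U f \<in> godement_image X ?Z' U"
    using f unfolding differential_def godement_image_def[of _ "?Z'"] canonical_resolution_def
    by (auto simp: K.relabel_carrier Z.coker_carrier)
  then have "godement_image X ?Z' U #>\<^bsub>sections (godement X ?Z') U\<^esub> differential X F n U f = godement_image X ?Z' U"
    using n.rcos_const by blast
  also have "encode \<dots> = \<one>\<^bsub>sections ?Z'' U\<^esub>"
    unfolding syzygy.simps(2)[of _ _ "Suc n"] K'.relabel_one Z'.coker_one ..
  finally show ?thesis
    using hom_one[OF Z''.godement_unit_hom[OF o] Z''.grp[OF o] G.grp[OF o]]
    unfolding differential_def[of _ _ "Suc n"] canonical_resolution_def by simp
qed

lemma cohomology_comm_group: "comm_group (sheaf_cohomology n X F)"
proof -
  let ?U = "topspace X"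
  let ?C = "\<lambda>n. sections (canonical_resolution X F n) ?U"
  have cg: "comm_group (?C n)" for n 
    unfolding canonical_resolution_def
    using ab_presheaf.comm_group_sections[OF ab_presheaf.godement_presheaf[OF syzygy_presheaf]] by simp
  have gh: "group_hom (?C n) (?C (Suc n)) (differential X F n ?U)" for n
    using cg differential_hom by (simp add: group_hom_def group_hom_axioms_def comm_group_def)
  have Z: "subgroup (cocycles X F n) (?C n)" unfolding cocycles_def using group_hom.subgroup_kernel[OF gh] .
  have B: "subgroup (coboundaries X F n) (?C n)"
    by (cases n) (use group_hom.img_is_subgroup[OF gh] group.triv_subgroup[OF comm_group.axioms(2)[OF cg]] in auto)
  have BZ: "coboundaries X F n \<subseteq> cocycles X F n"
  proof (cases n)
    case 0 then show ?thesis using group_hom.hom_one[OF gh] Z subgroup.one_closed by force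
  next
    case (Suc m) then show ?thesis
      using group_hom.hom_closed[OF gh] differential_differential[of ?U] by (auto simp: cocycles_def kernel_def)
  qed
  have CG: "comm_group ((?C n)\<lparr>carrier := cocycles X F n\<rparr>)"
    by (intro group.group_comm_groupI subgroup.subgroup_is_group[OF Z] comm_group.axioms(2)[OF cg])
       (use subgroup.mem_carrier[OF Z] comm_monoid.m_comm[OF comm_group.axioms(1)[OF cg]] in auto)
  show ?thesis unfolding sheaf_cohomology_def
    using comm_group.abelian_FactGroup[OF CG group.subgroup_incl[OF comm_group.axioms(2)[OF cg] B Z BZ]] .
qed

end

locale prime_localization = primeideal P R for P and R (structure)
begin

lemma one_S: "\<one> \<in> carrier R - P" using I_notcarr one_imp_carrier by auto
lemma mult_S: "s \<in> carrier R - P \<Longrightarrow> t \<in> carrier R - P \<Longrightarrow> s \<otimes> t \<in> carrier R - P"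
  using I_prime by auto

lemma frac_mem: "(b,t) \<in> fraction R P a s \<longleftrightarrow> b \<in> carrier R \<and> t \<in> carrier R - P \<and>
   (\<exists>u\<in>carrier R - P. u \<otimes> (t \<otimes> a \<ominus> s \<otimes> b) = \<zero>)"
  by (auto simp: fraction_def)

lemma frac_self: assumes "a \<in> carrier R" "s \<in> carrier R - P" shows "(a,s) \<in> fraction R P a s"
proof -
  have "\<one> \<otimes> (s \<otimes> a \<ominus> s \<otimes> a) = \<zero>" using assms by (auto simp: a_minus_def r_neg)
  then show ?thesis unfolding frac_mem using assms one_S by blast
qed

lemma frac_sub:
  assumes "a \<in> carrier R" "s \<in> carrier R - P" "b \<in> carrier R" "t \<in> carrier R - P"
   and u: "u \<in> carrier R - P" "u \<otimes> (t \<otimes> a \<ominus> s \<otimes> b) = \<zero>"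
  shows "fraction R P b t \<subseteq> fraction R P a s"
proof (intro subsetI)
  fix x assume "x \<in> fraction R P b t"
  then obtain c r v where x: "x = (c,r)" "c \<in> carrier R" "r \<in> carrier R - P" "v \<in> carrier R - P" 
     "v \<otimes> (r \<otimes> b \<ominus> t \<otimes> c) = \<zero>" by (cases x) (auto simp: frac_mem)
  have cs: "a \<in> carrier R" "s \<in> carrier R" "b \<in> carrier R" "t \<in> carrier R" "c \<in> carrier R" "r \<in> carrier R"
    "u \<in> carrier R" "v \<in> carrier R" using assms x by auto
  have "(u \<otimes> v \<otimes> t) \<otimes> (r \<otimes> a \<ominus> s \<otimes> c) = 
      v \<otimes> r \<otimes> (u \<otimes> (t \<otimes> a \<ominus> s \<otimes> b)) \<oplus> u \<otimes> s \<otimes> (v \<otimes> (r \<otimes> b \<ominus> t \<otimes> c))"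
    using cs by algebra
  also have "\<dots> = \<zero>" unfolding u(2) x(5) using cs by simp
  finally show "x \<in> fraction R P a s" unfolding x(1) frac_mem using x(2,3) mult_S[OF mult_S[OF u(1) x(4)] assms(4)] by blast
qed

lemma frac_eq_iff:
  assumes "a \<in> carrier R" "s \<in> carrier R - P" "b \<in> carrier R" "t \<in> carrier R - P"
  shows "fraction R P a s = fraction R P b t \<longleftrightarrow> (\<exists>u\<in>carrier R - P. u \<otimes> (t \<otimes> a \<ominus> s \<otimes> b) = \<zero>)"
proof
  assume "fraction R P a s = fraction R P b t"
  then have "(b,t) \<in> fraction R P a s" using frac_self assms by blast
  then show "\<exists>u\<in>carrier R - P. u \<otimes> (t \<otimes> a \<ominus> s \<otimes> b) = \<zero>" unfolding frac_mem by blast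
next
  assume "\<exists>u\<in>carrier R - P. u \<otimes> (t \<otimes> a \<ominus> s \<otimes> b) = \<zero>"
  then obtain u where u: "u\<in>carrier R - P" "u \<otimes> (t \<otimes> a \<ominus> s \<otimes> b) = \<zero>" by blast
  have cs: "a \<in> carrier R" "s \<in> carrier R" "b \<in> carrier R" "t \<in> carrier R" "u \<in> carrier R" using assms u by auto
  have "u \<otimes> (s \<otimes> b \<ominus> t \<otimes> a) = \<ominus> (u \<otimes> (t \<otimes> a \<ominus> s \<otimes> b))" using cs by algebra
  also have "\<dots> = \<zero>" unfolding u by simp
  finally have u': "u \<otimes> (s \<otimes> b \<ominus> t \<otimes> a) = \<zero>" .
  show "fraction R P a s = fraction R P b t" using frac_sub[OF assms u] frac_sub[OF assms(3,4,1,2) u(1) u'] by (rule subset_antisym[rotated])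
qed

lemma frac_eqI:
  assumes "a \<in> carrier R" "s \<in> carrier R - P" "b \<in> carrier R" "t \<in> carrier R - P" "t \<otimes> a = s \<otimes> b"
  shows "fraction R P a s = fraction R P b t"
proof -
  have "\<one> \<otimes> (t \<otimes> a \<ominus> s \<otimes> b) = \<zero>" using assms by (auto simp: a_minus_def r_neg)
  then show ?thesis using frac_eq_iff assms one_S by blast
qed

lemma frac_memD: 
  assumes "a \<in> carrier R" "s \<in> carrier R - P" "(b,t) \<in> fraction R P a s"
  shows "b \<in> carrier R" "t \<in> carrier R - P" "fraction R P b t = fraction R P a s"
proof -
  show 1: "b \<in> carrier R" "t \<in> carrier R - P" using assms unfolding frac_mem by blast+
  show "fraction R P b t = fraction R P a s" using frac_eq_iff[OF assms(1,2) 1] assms(3) unfolding frac_mem by blast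
qed

lemma loc_mult:
  assumes a: "a \<in> carrier R" "s \<in> carrier R - P" "b \<in> carrier R" "t \<in> carrier R - P"
  shows "fraction R P a s \<otimes>\<^bsub>localization R P\<^esub> fraction R P b t = fraction R P (a \<otimes> b) (s \<otimes> t)"
proof -
  have k: "fraction R P (a' \<otimes> b') (s' \<otimes> t') = fraction R P (a \<otimes> b) (s \<otimes> t)" 
    if m: "(a',s') \<in> fraction R P a s" "(b',t') \<in> fraction R P b t" for a' s' b' t'
  proof -
    note c1 = frac_memD(1,2)[OF a(1,2) m(1)] note c2 = frac_memD(1,2)[OF a(3,4) m(2)]
    obtain u v where u: "u \<in> carrier R - P" "u \<otimes> (s' \<otimes> a \<ominus> s \<otimes> a') = \<zero>"
      and v: "v \<in> carrier R - P" "v \<otimes> (t' \<otimes> b \<ominus> t \<otimes> b') = \<zero>" using m unfolding frac_mem by blast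
    have cs: "a \<in> carrier R" "s \<in> carrier R" "b \<in> carrier R" "t \<in> carrier R" 
      "a' \<in> carrier R" "s' \<in> carrier R" "b' \<in> carrier R" "t' \<in> carrier R"  "u \<in> carrier R" "v \<in> carrier R" 
      using a c1 c2 u v by auto
    have "(u \<otimes> v) \<otimes> ((s' \<otimes> t') \<otimes> (a \<otimes> b) \<ominus> (s \<otimes> t) \<otimes> (a' \<otimes> b')) = 
       v \<otimes> t' \<otimes> b \<otimes> (u \<otimes> (s' \<otimes> a \<ominus> s \<otimes> a')) \<oplus> u \<otimes> s \<otimes> a' \<otimes> (v \<otimes> (t' \<otimes> b \<ominus> t \<otimes> b'))"
      using cs by algebra
    also have "\<dots> = \<zero>" unfolding u(2) v(2) using cs by simp
    finally have "fraction R P (a \<otimes> b) (s \<otimes> t) = fraction R P (a' \<otimes> b') (s' \<otimes> t')"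
      using frac_eq_iff[of "a \<otimes> b" "s \<otimes> t" "a' \<otimes> b'" "s' \<otimes> t'"] mult_S u v cs a c1 c2 by blast
    then show ?thesis ..
  qed
  have "fraction R P a s \<otimes>\<^bsub>localization R P\<^esub> fraction R P b t = (\<Union>(a', s')\<in>fraction R P a s. \<Union>(b', t')\<in>fraction R P b t. fraction R P (a \<otimes> b) (s \<otimes> t))"
    unfolding localization_def monoid.simps partial_object.simps ring.simps by (intro SUP_cong refl) (auto simp: k split: prod.splits)
  also have "\<dots> = fraction R P (a \<otimes> b) (s \<otimes> t)" using frac_self[OF a(1,2)] frac_self[OF a(3,4)] by auto
  finally show ?thesis .
qed

lemma loc_add:
  assumes a: "a \<in> carrier R" "s \<in> carrier R - P" "b \<in> carrier R" "t \<in> carrier R - P"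
  shows "fraction R P a s \<oplus>\<^bsub>localization R P\<^esub> fraction R P b t = fraction R P (t \<otimes> a \<oplus> s \<otimes> b) (s \<otimes> t)"
proof -
  have k: "fraction R P (t' \<otimes> a' \<oplus> s' \<otimes> b') (s' \<otimes> t') = fraction R P (t \<otimes> a \<oplus> s \<otimes> b) (s \<otimes> t)" 
    if m: "(a',s') \<in> fraction R P a s" "(b',t') \<in> fraction R P b t" for a' s' b' t'
  proof -
    note c1 = frac_memD(1,2)[OF a(1,2) m(1)] note c2 = frac_memD(1,2)[OF a(3,4) m(2)]
    obtain u v where u: "u \<in> carrier R - P" "u \<otimes> (s' \<otimes> a \<ominus> s \<otimes> a') = \<zero>"
      and v: "v \<in> carrier R - P" "v \<otimes> (t' \<otimes> b \<ominus> t \<otimes> b') = \<zero>" using m unfolding frac_mem by blast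
    have cs: "a \<in> carrier R" "s \<in> carrier R" "b \<in> carrier R" "t \<in> carrier R" 
      "a' \<in> carrier R" "s' \<in> carrier R" "b' \<in> carrier R" "t' \<in> carrier R"  "u \<in> carrier R" "v \<in> carrier R" 
      using a c1 c2 u v by auto
    have "(u \<otimes> v) \<otimes> ((s' \<otimes> t') \<otimes> (t \<otimes> a \<oplus> s \<otimes> b) \<ominus> (s \<otimes> t) \<otimes> (t' \<otimes> a' \<oplus> s' \<otimes> b')) = 
       v \<otimes> t' \<otimes> t \<otimes> (u \<otimes> (s' \<otimes> a \<ominus> s \<otimes> a')) \<oplus> u \<otimes> s \<otimes> s' \<otimes> (v \<otimes> (t' \<otimes> b \<ominus> t \<otimes> b'))"
      using cs by algebra
    also have "\<dots> = \<zero>" unfolding u(2) v(2) using cs by simp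
    finally have "fraction R P (t \<otimes> a \<oplus> s \<otimes> b) (s \<otimes> t) = fraction R P (t' \<otimes> a' \<oplus> s' \<otimes> b') (s' \<otimes> t')"
      using frac_eq_iff[of "t \<otimes> a \<oplus> s \<otimes> b" "s \<otimes> t" "t' \<otimes> a' \<oplus> s' \<otimes> b'" "s' \<otimes> t'"] mult_S[OF u(1) v(1)] 
        mult_S[OF a(2,4)] mult_S[OF c1(2) c2(2)] cs by blast
    then show ?thesis ..
  qed
  have "fraction R P a s \<oplus>\<^bsub>localization R P\<^esub> fraction R P b t = (\<Union>(a', s')\<in>fraction R P a s. \<Union>(b', t')\<in>fraction R P b t. fraction R P (t \<otimes> a \<oplus> s \<otimes> b) (s \<otimes> t))"
    unfolding localization_def monoid.simps partial_object.simps ring.simps by (intro SUP_cong refl) (auto simp: k split: prod.splits)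
  also have "\<dots> = fraction R P (t \<otimes> a \<oplus> s \<otimes> b) (s \<otimes> t)" using frac_self[OF a(1,2)] frac_self[OF a(3,4)] by auto
  finally show ?thesis .
qed

lemma loc_carrier: "carrier (localization R P) = {fraction R P a s | a s. a \<in> carrier R \<and> s \<in> carrier R - P}"
  by (simp add: localization_def)
lemma loc_one: "\<one>\<^bsub>localization R P\<^esub> = fraction R P \<one> \<one>" by (simp add: localization_def)
lemma loc_zero: "\<zero>\<^bsub>localization R P\<^esub> = fraction R P \<zero> \<one>" by (simp add: localization_def)

lemma loc_cring: "cring (localization R P)"
proof (rule cringI)
  have S: "\<And>s. s \<in> carrier R - P \<Longrightarrow> s \<in> carrier R" by auto
  note simps = loc_mult loc_add loc_one loc_zero
  show "abelian_group (localization R P)"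
  proof (rule abelian_groupI)
    fix x y assume "x \<in> carrier (localization R P)" "y \<in> carrier (localization R P)"
    then obtain a s b t where x: "x = fraction R P a s" "a \<in> carrier R" "s \<in> carrier R - P"
      "y = fraction R P b t" "b \<in> carrier R" "t \<in> carrier R - P" unfolding loc_carrier by blast
    note c = x(2) S[OF x(3)] x(5) S[OF x(6)]
    show "x \<oplus>\<^bsub>localization R P\<^esub> y \<in> carrier (localization R P)" unfolding x(1,4) loc_add[OF x(2,3,5,6)] loc_carrier
      using c mult_S[OF x(3,6)] by blast
    show "x \<oplus>\<^bsub>localization R P\<^esub> y = y \<oplus>\<^bsub>localization R P\<^esub> x" unfolding x(1,4) loc_add[OF x(2,3,5,6)] loc_add[OF x(5,6,2,3)]
      using c by (simp add: m_comm a_comm)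
    fix z assume "z \<in> carrier (localization R P)"
    then obtain d r where z: "z = fraction R P d r" "d \<in> carrier R" "r \<in> carrier R - P" unfolding loc_carrier by blast
    note c' = c z(2) S[OF z(3)]
    have e1: "(r \<otimes> (t \<otimes> a \<oplus> s \<otimes> b) \<oplus> s \<otimes> t \<otimes> d) = ((t \<otimes> r) \<otimes> a \<oplus> s \<otimes> (r \<otimes> b \<oplus> t \<otimes> d))" using c' by algebra
    have e2: "s \<otimes> t \<otimes> r = s \<otimes> (t \<otimes> r)" using c' by algebra
    show "x \<oplus>\<^bsub>localization R P\<^esub> y \<oplus>\<^bsub>localization R P\<^esub> z = x \<oplus>\<^bsub>localization R P\<^esub> (y \<oplus>\<^bsub>localization R P\<^esub> z)"
      unfolding x(1,4) z(1) loc_add[OF x(2,3,5,6)] loc_add[OF x(5,6) z(2,3)]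
      using c' loc_add[OF _ mult_S[OF x(3,6)] z(2,3), of "t \<otimes> a \<oplus> s \<otimes> b"] 
        loc_add[OF x(2,3) _ mult_S[OF x(6) z(3)], of "r \<otimes> b \<oplus> t \<otimes> d"] e1 e2 by simp
  next
    show "\<zero>\<^bsub>localization R P\<^esub> \<in> carrier (localization R P)" unfolding loc_zero loc_carrier using one_S by blast
  next
    fix x assume "x \<in> carrier (localization R P)"
    then obtain a s where x: "x = fraction R P a s" "a \<in> carrier R" "s \<in> carrier R - P" unfolding loc_carrier by blast
    have 1: "s \<otimes> \<zero> \<oplus> \<one> \<otimes> a = a" "\<one> \<otimes> s = s" "s \<otimes> (\<ominus> a) \<oplus> s \<otimes> a = \<zero>" using x S[OF x(3)] by (auto simp: r_minus l_neg)
    show "\<zero>\<^bsub>localization R P\<^esub> \<oplus>\<^bsub>localization R P\<^esub> x = x" unfolding loc_zero x(1) loc_add[OF zero_closed one_S x(2,3)] 1 ..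
    have m: "\<ominus> a \<in> carrier R" using x by simp
    have "fraction R P (\<ominus> a) s \<oplus>\<^bsub>localization R P\<^esub> x = \<zero>\<^bsub>localization R P\<^esub>" unfolding x(1) loc_zero loc_add[OF m x(3) x(2,3)] 1
      by (rule frac_eqI) (use x one_S mult_S in auto)
    then show "\<exists>y\<in>carrier (localization R P). y \<oplus>\<^bsub>localization R P\<^esub> x = \<zero>\<^bsub>localization R P\<^esub>" unfolding loc_carrier using m x by blast
  qed
  show "comm_monoid (localization R P)"
  proof (rule comm_monoidI)
    fix x y assume "x \<in> carrier (localization R P)" "y \<in> carrier (localization R P)"
    then obtain a s b t where x: "x = fraction R P a s" "a \<in> carrier R" "s \<in> carrier R - P"
      "y = fraction R P b t" "b \<in> carrier R" "t \<in> carrier R - P" unfolding loc_carrier by blast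
    note c = x(2) S[OF x(3)] x(5) S[OF x(6)]
    show "x \<otimes>\<^bsub>localization R P\<^esub> y \<in> carrier (localization R P)" unfolding x(1,4) loc_mult[OF x(2,3,5,6)] loc_carrier
      using c mult_S[OF x(3,6)] by blast
    show "x \<otimes>\<^bsub>localization R P\<^esub> y = y \<otimes>\<^bsub>localization R P\<^esub> x" unfolding x(1,4) loc_mult[OF x(2,3,5,6)] loc_mult[OF x(5,6,2,3)]
      using c by (simp add: m_comm)
    fix z assume "z \<in> carrier (localization R P)"
    then obtain d r where z: "z = fraction R P d r" "d \<in> carrier R" "r \<in> carrier R - P" unfolding loc_carrier by blast
    show "x \<otimes>\<^bsub>localization R P\<^esub> y \<otimes>\<^bsub>localization R P\<^esub> z = x \<otimes>\<^bsub>localization R P\<^esub> (y \<otimes>\<^bsub>localization R P\<^esub> z)"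
      unfolding x(1,4) z(1) loc_mult[OF x(2,3,5,6)] loc_mult[OF x(5,6) z(2,3)]
      using c z S[OF z(3)] loc_mult[OF _ mult_S[OF x(3,6)] z(2,3), of "a \<otimes> b"] 
        loc_mult[OF x(2,3) _ mult_S[OF x(6) z(3)], of "b \<otimes> d"] by (simp add: m_assoc)
  next
    show "\<one>\<^bsub>localization R P\<^esub> \<in> carrier (localization R P)" unfolding loc_one loc_carrier using one_S by blast
  next
    fix x assume "x \<in> carrier (localization R P)"
    then obtain a s where x: "x = fraction R P a s" "a \<in> carrier R" "s \<in> carrier R - P" unfolding loc_carrier by blast
    show "\<one>\<^bsub>localization R P\<^esub> \<otimes>\<^bsub>localization R P\<^esub> x = x" unfolding loc_one x(1) loc_mult[OF one_closed one_S x(2,3)] using x S[OF x(3)] by simp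
  qed
  fix x y z assume "x \<in> carrier (localization R P)" "y \<in> carrier (localization R P)" "z \<in> carrier (localization R P)"
  then obtain a s b t d r where x: "x = fraction R P a s" "a \<in> carrier R" "s \<in> carrier R - P"
      "y = fraction R P b t" "b \<in> carrier R" "t \<in> carrier R - P" "z = fraction R P d r" "d \<in> carrier R" "r \<in> carrier R - P" unfolding loc_carrier by blast
  note c = x(2) S[OF x(3)] x(5) S[OF x(6)] x(8) S[OF x(9)]
  have w: "t \<otimes> a \<oplus> s \<otimes> b \<in> carrier R" "a \<otimes> d \<in> carrier R" "b \<otimes> d \<in> carrier R" using c by auto
  note M = mult_S[OF x(3,6)] mult_S[OF x(3,9)] mult_S[OF x(6,9)]
  show "(x \<oplus>\<^bsub>localization R P\<^esub> y) \<otimes>\<^bsub>localization R P\<^esub> z = x \<otimes>\<^bsub>localization R P\<^esub> z \<oplus>\<^bsub>localization R P\<^esub> y \<otimes>\<^bsub>localization R P\<^esub> z"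
    unfolding x(1,4,7) loc_add[OF x(2,3,5,6)] loc_mult[OF w(1) M(1) x(8,9)] loc_mult[OF x(2,3,8,9)] loc_mult[OF x(5,6,8,9)]
      loc_add[OF w(2) M(2) w(3) M(3)]
  proof (rule frac_eqI)
    show "s \<otimes> t \<otimes> r \<in> carrier R - P" "s \<otimes> r \<otimes> (t \<otimes> r) \<in> carrier R - P" using mult_S[OF M(1) x(9)] mult_S[OF M(2,3)] by auto
    show "s \<otimes> r \<otimes> (t \<otimes> r) \<otimes> ((t \<otimes> a \<oplus> s \<otimes> b) \<otimes> d) = s \<otimes> t \<otimes> r \<otimes> (t \<otimes> r \<otimes> (a \<otimes> d) \<oplus> s \<otimes> r \<otimes> (b \<otimes> d))"
      using c by algebra
  qed (use c in auto)
qed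

end

lemma openin_zariski: "openin (zariski_topology R) U \<longleftrightarrow> zariski_open R U"
  unfolding zariski_topology_def using istopology_zariski_open topology_inverse' by metis

lemma open_sub_Spec: "openin (zariski_topology R) U \<Longrightarrow> P \<in> U \<Longrightarrow> primeideal P R"
  by (auto simp: openin_zariski zariski_open_def Spec_def)

context cring begin

lemma sec_carrier: "f \<in> carrier (structure_sections R U) \<longleftrightarrow> f \<in> (\<Pi>\<^sub>E P\<in>U. carrier (localization R P)) \<and>
           (\<forall>P\<in>U. \<exists>W. openin (zariski_topology R) W \<and> P \<in> W \<and> W \<subseteq> U \<and>
             (\<exists>a\<in>carrier R. \<exists>s\<in>carrier R. \<forall>Q\<in>W. s \<notin> Q \<and> f Q = fraction R Q a s))"
  by (simp add: structure_sections_def)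

lemma sec2:
  assumes "f \<in> carrier (structure_sections R U)" "g \<in> carrier (structure_sections R U)" "P \<in> U" 
  obtains W a s b t where "openin (zariski_topology R) W" "P \<in> W" "W \<subseteq> U" "a\<in>carrier R" "s\<in>carrier R" "b\<in>carrier R" "t\<in>carrier R"
    "\<And>Q. Q \<in> W \<Longrightarrow> s \<notin> Q \<and> t \<notin> Q \<and> f Q = fraction R Q a s \<and> g Q = fraction R Q b t"
proof -
  obtain W a s where 1: "openin (zariski_topology R) W" "P \<in> W" "W \<subseteq> U" "a\<in>carrier R" "s\<in>carrier R"
    "\<forall>Q\<in>W. s \<notin> Q \<and> f Q = fraction R Q a s" using assms(1)[unfolded sec_carrier, THEN conjunct2, rule_format, OF assms(3)] by (elim exE conjE bexE)
  obtain W' b t where 2: "openin (zariski_topology R) W'" "P \<in> W'" "W' \<subseteq> U" "b\<in>carrier R" "t\<in>carrier R"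
    "\<forall>Q\<in>W'. t \<notin> Q \<and> g Q = fraction R Q b t" using assms(2)[unfolded sec_carrier, THEN conjunct2, rule_format, OF assms(3)] by (elim exE conjE bexE)
  show ?thesis by (rule that[of "W \<inter> W'" a s b t]) (use 1 2 in \<open>auto intro: openin_Int\<close>)
qed

lemma sec_comm_monoid:
  assumes U: "openin (zariski_topology R) U"
  shows "comm_monoid (structure_sections R U)" 
proof (rule comm_monoidI)
  note pr = open_sub_Spec[OF U]
  have lc: "P \<in> U \<Longrightarrow> cring (localization R P)" for P using prime_localization.loc_cring[unfolded prime_localization_def, OF pr] .
  have m: "f \<otimes>\<^bsub>structure_sections R U\<^esub> g = (\<lambda>P\<in>U. f P \<otimes>\<^bsub>localization R P\<^esub> g P)" for f g by (simp add: structure_sections_def)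
  have o: "\<one>\<^bsub>structure_sections R U\<^esub> = (\<lambda>P\<in>U. \<one>\<^bsub>localization R P\<^esub>)" by (simp add: structure_sections_def)
  have pt: "f \<in> carrier (structure_sections R U) \<Longrightarrow> P \<in> U \<Longrightarrow> f P \<in> carrier (localization R P)" for f P by (auto simp: sec_carrier)
  note cm = cring.cring_simprules[OF lc] monoid.r_one[OF ring.is_monoid[OF cring.axioms(1)[OF lc]]]
  fix f g assume fg: "f \<in> carrier (structure_sections R U)" "g \<in> carrier (structure_sections R U)"
  show "f \<otimes>\<^bsub>structure_sections R U\<^esub> g \<in> carrier (structure_sections R U)"
    unfolding sec_carrier
  proof (intro conjI ballI)
    show "f \<otimes>\<^bsub>structure_sections R U\<^esub> g \<in> (\<Pi>\<^sub>E P\<in>U. carrier (localization R P))" unfolding m using pt fg cm by auto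
    fix P assume P: "P \<in> U"
    obtain W a s b t where w: "openin (zariski_topology R) W" "P \<in> W" "W \<subseteq> U" "a\<in>carrier R" "s\<in>carrier R" "b\<in>carrier R" "t\<in>carrier R"
      "\<And>Q. Q \<in> W \<Longrightarrow> s \<notin> Q \<and> t \<notin> Q \<and> f Q = fraction R Q a s \<and> g Q = fraction R Q b t" using sec2[OF fg P] by metis
    have "s \<otimes> t \<notin> Q \<and> (f \<otimes>\<^bsub>structure_sections R U\<^esub> g) Q = fraction R Q (a \<otimes> b) (s \<otimes> t)" if Q: "Q \<in> W" for Q
    proof -
      interpret prime_localization Q R using pr w(3) Q by (auto simp: prime_localization_def)
      have QU: "Q \<in> U" using w Q by blast
      show ?thesis unfolding m using w(8)[OF Q] QU loc_mult[of a s b t] w mult_S[of s t] by simp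
    qed
    then show "\<exists>W. openin (zariski_topology R) W \<and> P \<in> W \<and> W \<subseteq> U \<and>
             (\<exists>a\<in>carrier R. \<exists>s\<in>carrier R. \<forall>Q\<in>W. s \<notin> Q \<and> (f \<otimes>\<^bsub>structure_sections R U\<^esub> g) Q = fraction R Q a s)"
      using w(1-7) m_closed by blast
  qed
  show "f \<otimes>\<^bsub>structure_sections R U\<^esub> g = g \<otimes>\<^bsub>structure_sections R U\<^esub> f" unfolding m using pt fg cm(14) by (auto simp: fun_eq_iff cm)
  show "\<one>\<^bsub>structure_sections R U\<^esub> \<otimes>\<^bsub>structure_sections R U\<^esub> f = f" using pt[OF fg(1)] fg(1) unfolding m o 
    by (auto simp: fun_eq_iff cm sec_carrier PiE_iff extensional_def)
  fix h assume h: "h \<in> carrier (structure_sections R U)"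
  show "f \<otimes>\<^bsub>structure_sections R U\<^esub> g \<otimes>\<^bsub>structure_sections R U\<^esub> h = f \<otimes>\<^bsub>structure_sections R U\<^esub> (g \<otimes>\<^bsub>structure_sections R U\<^esub> h)"
    unfolding m using pt fg h by (auto simp: fun_eq_iff cm)
next
  note pr = open_sub_Spec[OF U]
  show "\<one>\<^bsub>structure_sections R U\<^esub> \<in> carrier (structure_sections R U)"
    unfolding sec_carrier
  proof (intro conjI ballI)
    show "\<one>\<^bsub>structure_sections R U\<^esub> \<in> (\<Pi>\<^sub>E P\<in>U. carrier (localization R P))" 
      using cring.cring_simprules(6)[OF prime_localization.loc_cring[unfolded prime_localization_def, OF pr]] by (auto simp: structure_sections_def)
    fix P assume P: "P \<in> U"
    have "\<one> \<notin> Q \<and> \<one>\<^bsub>structure_sections R U\<^esub> Q = fraction R Q \<one> \<one>" if "Q \<in> U" for Q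
      using prime_localization.one_S[unfolded prime_localization_def, OF pr[OF that]] that by (auto simp: structure_sections_def localization_def)
    then show "\<exists>W. openin (zariski_topology R) W \<and> P \<in> W \<and> W \<subseteq> U \<and>
             (\<exists>a\<in>carrier R. \<exists>s\<in>carrier R. \<forall>Q\<in>W. s \<notin> Q \<and> \<one>\<^bsub>structure_sections R U\<^esub> Q = fraction R Q a s)"
      using U P by blast
  qed
qed

lemma sec_restrict: 
  assumes "openin (zariski_topology R) V" "V \<subseteq> U" "f \<in> carrier (structure_sections R U)"
  shows "restrict f V \<in> carrier (structure_sections R V)"
  unfolding sec_carrier
proof (intro conjI ballI)
  show "restrict f V \<in> (\<Pi>\<^sub>E P\<in>V. carrier (localization R P))" using assms unfolding sec_carrier by auto
  fix P assume P: "P \<in> V"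
  obtain W a s where 1: "openin (zariski_topology R) W" "P \<in> W" "W \<subseteq> U" "a\<in>carrier R" "s\<in>carrier R"
    "\<forall>Q\<in>W. s \<notin> Q \<and> f Q = fraction R Q a s" using assms(3)[unfolded sec_carrier, THEN conjunct2, rule_format, OF subsetD[OF assms(2) P]] by (elim exE conjE bexE)
  show "\<exists>W. openin (zariski_topology R) W \<and> P \<in> W \<and> W \<subseteq> V \<and>
             (\<exists>a\<in>carrier R. \<exists>s\<in>carrier R. \<forall>Q\<in>W. s \<notin> Q \<and> restrict f V Q = fraction R Q a s)"
    by (rule exI[of _ "W \<inter> V"]) (use 1 P assms in \<open>auto intro: openin_Int\<close>)
qed

lemma units_presheaf: "ab_presheaf (zariski_topology R) (units_sheaf R)"
proof (rule ab_presheaf.intro)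
  fix U assume "openin (zariski_topology R) U"
  then interpret comm_monoid "structure_sections R U" by (rule sec_comm_monoid)
  show "comm_group (sections (units_sheaf R) U)" using units_comm_group by (simp add: units_sheaf_def)
next
  fix U V assume a: "openin (zariski_topology R) U" "openin (zariski_topology R) V" "V \<subseteq> U"
  have r1: "restrict (f \<otimes>\<^bsub>structure_sections R U\<^esub> g) V = restrict f V \<otimes>\<^bsub>structure_sections R V\<^esub> restrict g V" for f g
    using a by (auto simp: structure_sections_def fun_eq_iff)
  have r2: "restrict \<one>\<^bsub>structure_sections R U\<^esub> V = \<one>\<^bsub>structure_sections R V\<^esub>" using a by (auto simp: structure_sections_def fun_eq_iff)
  have r3: "restrict f V \<in> Units (structure_sections R V)" if "f \<in> Units (structure_sections R U)" for f
  proof -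
    obtain g where g: "g \<in> carrier (structure_sections R U)" "f \<in> carrier (structure_sections R U)" "g \<otimes>\<^bsub>structure_sections R U\<^esub> f = \<one>\<^bsub>structure_sections R U\<^esub>" "f \<otimes>\<^bsub>structure_sections R U\<^esub> g = \<one>\<^bsub>structure_sections R U\<^esub>"
      using \<open>f \<in> _\<close> unfolding Units_def by blast
    show ?thesis unfolding Units_def
      using g(3,4)[THEN arg_cong[of _ _ "\<lambda>f. restrict f V"]] sec_restrict[OF a(2,3) g(1)] sec_restrict[OF a(2,3) g(2)] unfolding r1 r2 by blast
  qed
  show "restr (units_sheaf R) U V \<in> hom (sections (units_sheaf R) U) (sections (units_sheaf R) V)"
    by (auto simp: hom_def units_sheaf_def units_of_def r3 r1)
next
  fix U s assume "openin (zariski_topology R) U" "s \<in> carrier (sections (units_sheaf R) U)"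
  then have "s \<in> carrier (structure_sections R U)" by (auto simp: units_sheaf_def units_of_def Units_def)
  then show "restr (units_sheaf R) U U s = s" by (auto simp: units_sheaf_def sec_carrier PiE_iff extensional_restrict)
next
  fix U V W :: "'a set set" and s assume "W \<subseteq> V"
  then show "restr (units_sheaf R) V W (restr (units_sheaf R) U V s) = restr (units_sheaf R) U W s"
    by (auto simp: units_sheaf_def fun_eq_iff)
qed

end

lemma mpoly_cring: "cring (mpolynomial_ring V :: ('v,'k::comm_ring_1) mpolynomial ring)"
proof (rule cringI)
  let ?M = "mpolynomial_ring V :: ('v,'k) mpolynomial ring"
  have add: "p + q \<in> carrier ?M" if "p \<in> carrier ?M" "q \<in> carrier ?M" for p q
    using that Poly_Mapping.keys_add[of p q] by (auto simp: mpolynomial_ring_def)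
  have mult: "p * q \<in> carrier ?M" if "p \<in> carrier ?M" "q \<in> carrier ?M" for p q
  proof -
    have "Poly_Mapping.keys m \<subseteq> V" if m: "m \<in> Poly_Mapping.keys (p * q)" for m
    proof -
      obtain a b where "m = a + b" "a \<in> Poly_Mapping.keys p" "b \<in> Poly_Mapping.keys q" 
        using m Poly_Mapping.keys_mult[of p q] by blast
      then show ?thesis using that Poly_Mapping.keys_add[of a b] \<open>p \<in> _\<close> \<open>q \<in> _\<close> by (auto simp: mpolynomial_ring_def)
    qed
    then show ?thesis by (auto simp: mpolynomial_ring_def)
  qed
  have e: "monoid.mult ?M = (*)" "ring.add ?M = (+)" "one ?M = 1" "ring.zero ?M = 0" by (auto simp: mpolynomial_ring_def)
  have z: "0 \<in> carrier ?M" "1 \<in> carrier ?M" by (auto simp: mpolynomial_ring_def)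
  have u: "- p \<in> carrier ?M" if "p \<in> carrier ?M" for p using that by (auto simp: mpolynomial_ring_def)
  show "abelian_group ?M" by (rule abelian_groupI) (auto simp: e add z ac_simps intro!: bexI[OF _ u])
  show "comm_monoid ?M" by (rule comm_monoidI) (auto simp: e mult z ac_simps)
  show "(x \<oplus>\<^bsub>?M\<^esub> y) \<otimes>\<^bsub>?M\<^esub> z = x \<otimes>\<^bsub>?M\<^esub> z \<oplus>\<^bsub>?M\<^esub> y \<otimes>\<^bsub>?M\<^esub> z" for x y z by (simp add: e distrib_right)
qed

lemma variable_in: "v \<in> V \<Longrightarrow> variable v \<in> carrier (mpolynomial_ring V)" by (auto simp: variable_def mpolynomial_ring_def)

lemma prod_in: "F \<subseteq> V \<Longrightarrow> (\<Prod>v\<in>F. variable v :: ('v,'k::comm_ring_1) mpolynomial) \<in> carrier (mpolynomial_ring V)"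
proof (induction F rule: infinite_finite_induct)
  case (insert x F)
  interpret cring "mpolynomial_ring V :: ('v,'k) mpolynomial ring" by (rule mpoly_cring)
  have "variable x * (\<Prod>v\<in>F. variable v :: ('v,'k) mpolynomial) \<in> carrier (mpolynomial_ring V)"
    using m_closed[OF variable_in[of x V]] insert by (simp add: mpolynomial_ring_def)
  then show ?case using insert by simp
qed (auto simp: mpolynomial_ring_def)

lemma SR_cring: "cring (stanley_reisner_ring V D :: ('v,'k::comm_ring_1) mpolynomial set ring)"
proof -
  interpret cring "mpolynomial_ring V :: ('v,'k) mpolynomial ring" by (rule mpoly_cring)
  have "ideal (stanley_reisner_ideal V D) (mpolynomial_ring V :: ('v,'k) mpolynomial ring)"
    unfolding stanley_reisner_ideal_def by (rule genideal_ideal) (auto intro: prod_in)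
  then show ?thesis unfolding stanley_reisner_ring_def using ideal.quotient_is_cring is_cring by blast
qed

end

theory Submission
  imports Defs "HOL-Computational_Algebra.Polynomial" "HOL-Computational_Algebra.Fraction_Field"
begin

text \<open>A unit near a prime \<open>P\<close> is determined by the fractions it induces on the faces \<open>F\<close> whose coordinate
  subspace passes through \<open>P\<close>, which identifies \<open>\<O>\<^sup>*\<close> with a sheaf attached to the whole complex; such a
  sheaf exists for every subcomplex \<open>\<Gamma>\<close>. Adding a face \<open>F\<close> with boundary in \<open>\<Gamma>\<close> gives a Mayer--Vietoris
  sequence from \<open>\<Gamma> \<union> {F}\<close> to the simplex on \<open>F\<close> and \<open>\<Gamma>\<close>, and on to the boundary of \<open>F\<close>. Global units on
  that boundary are constants, so they lift to the simplex, and acyclicity passes from the simplex and the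
  two smaller complexes to \<open>\<Gamma> \<union> {F}\<close>. For a simplex the ring is a factorial polynomial ring, and
  \<open>\<O>\<^sup>*\<close> is the kernel of the surjection from the constant sheaf of nonzero rational functions onto the
  sheaf of divisors, both of them flasque; again global sections lift, because every divisor is
  principal. Cohomology is computed through the syzygies of the Godement resolution: acyclicity means
  that global sections lift at each syzygy, and one step of the resolution preserves flasqueness and
  Mayer--Vietoris sequences whose global sections lift.\<close>

section \<open>Sheaves as families of stalks\<close>

text \<open>Global sections of a Godement sheaf are arbitrary families of stalk elements, so they
  lift along every stalkwise surjection by mere choice. Hence no connecting maps or long exact
  sequences occur: for an exact sequence with last term K the one condition that matters is that
  global sections of K lift to the middle term. It is proved by hand only for the original sheaves;
  after one step of the resolution it follows from the acyclicity of K. The syzygies take values in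
  trees, a type unrelated to the concrete sheaves, so a sheaf is accessed only through its stalks
  and a local predicate, and one notion of step covers both worlds. All subcomplexes are treated on
  the single space Spec K[\<Delta>], with value one at points off their support, so that no inverse
  image of a sheaf and no change of base space is ever formed. The algebraic input is reducedness
  (an element that vanishes on every face is zero), the extension of an element on one face to the
  whole ring, and unique factorization on each face.\<close>

text \<open>A sheaf is encoded by its stalks \<open>S x\<close> and the predicate \<open>L x f\<close>: near \<open>x\<close> the family
  of stalk elements \<open>f\<close> comes from a section. This includes \<open>x \<in> topspace X\<close>.\<close>

locale etale =
  fixes X :: "'x topology" and S :: "'x \<Rightarrow> 's monoid" and L :: "'x \<Rightarrow> ('x \<Rightarrow> 's) \<Rightarrow> bool"
  assumes comm_group_stalk: "x \<in> topspace X \<Longrightarrow> comm_group (S x)"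
    and L_closed: "L x f \<Longrightarrow> x \<in> topspace X \<and> f x \<in> carrier (S x)"
    and L_cong: "\<lbrakk>L x f; openin X W; x \<in> W; \<And>y. y \<in> W \<Longrightarrow> g y = f y\<rbrakk> \<Longrightarrow> L x g"
    and L_open: "L x f \<Longrightarrow> \<exists>W. openin X W \<and> x \<in> W \<and> (\<forall>y\<in>W. L y f)"
    and L_one: "x \<in> topspace X \<Longrightarrow> L x (\<lambda>y. \<one>\<^bsub>S y\<^esub>)"
    and L_div: "\<lbrakk>L x f; L x g\<rbrakk> \<Longrightarrow> L x (\<lambda>y. f y \<otimes>\<^bsub>S y\<^esub> inv\<^bsub>S y\<^esub> g y)"
    and L_surj: "\<lbrakk>x \<in> topspace X; s \<in> carrier (S x)\<rbrakk> \<Longrightarrow> \<exists>f. L x f \<and> f x = s"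
    and L_eq: "\<lbrakk>L x f; L x g; f x = g x\<rbrakk> \<Longrightarrow> \<exists>W. openin X W \<and> x \<in> W \<and> (\<forall>y\<in>W. f y = g y)"

text \<open>Global sections of Godement's sheaf, except that values off \<open>topspace X\<close>
  are arbitrary; pointwise operations then stay inside without restricting.\<close>

abbreviation families :: "'x topology \<Rightarrow> ('x \<Rightarrow> 's monoid) \<Rightarrow> ('x \<Rightarrow> 's) set" where
  "families X S \<equiv> (\<Pi> x\<in>topspace X. carrier (S x))"

context etale
begin

lemma group_stalk: "x \<in> topspace X \<Longrightarrow> group (S x)"
  using comm_group_stalk comm_group.axioms(2) by blast

lemma inv_cl: "\<lbrakk>x \<in> topspace X; a \<in> carrier (S x)\<rbrakk> \<Longrightarrow> inv\<^bsub>S x\<^esub> a \<in> carrier (S x)"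
  by (simp add: group_stalk)

lemma mult_cl: "\<lbrakk>x \<in> topspace X; a \<in> carrier (S x); b \<in> carrier (S x)\<rbrakk> \<Longrightarrow> a \<otimes>\<^bsub>S x\<^esub> b \<in> carrier (S x)"
  by (simp add: group_stalk group.is_monoid monoid.m_closed)

lemma one_cl: "x \<in> topspace X \<Longrightarrow> \<one>\<^bsub>S x\<^esub> \<in> carrier (S x)"
  by (simp add: group_stalk group.is_monoid)

lemma div_mult: "\<lbrakk>x \<in> topspace X; a \<in> carrier (S x); b \<in> carrier (S x)\<rbrakk> \<Longrightarrow> a \<otimes>\<^bsub>S x\<^esub> inv\<^bsub>S x\<^esub> b \<otimes>\<^bsub>S x\<^esub> b = a"
  by (metis group.inv_closed group.l_inv group.is_monoid group_stalk monoid.m_assoc monoid.r_one)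

lemma div_one_iff: "\<lbrakk>x \<in> topspace X; a \<in> carrier (S x); b \<in> carrier (S x)\<rbrakk> \<Longrightarrow> a \<otimes>\<^bsub>S x\<^esub> inv\<^bsub>S x\<^esub> b = \<one>\<^bsub>S x\<^esub> \<longleftrightarrow> a = b"
  by (metis div_mult group.is_monoid group.r_inv group_stalk monoid.l_one)

lemma div_div: "\<lbrakk>x \<in> topspace X; a \<in> carrier (S x); b \<in> carrier (S x)\<rbrakk> \<Longrightarrow> a \<otimes>\<^bsub>S x\<^esub> inv\<^bsub>S x\<^esub> (a \<otimes>\<^bsub>S x\<^esub> inv\<^bsub>S x\<^esub> b) = b"
proof -
  assume a: "x \<in> topspace X" "a \<in> carrier (S x)" "b \<in> carrier (S x)"
  interpret comm_group "S x" by (rule comm_group_stalk) fact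
  show ?thesis using a by (simp add: inv_mult m_assoc[symmetric])
qed

lemma div_one: "\<lbrakk>x \<in> topspace X; a \<in> carrier (S x)\<rbrakk> \<Longrightarrow> a \<otimes>\<^bsub>S x\<^esub> inv\<^bsub>S x\<^esub> \<one>\<^bsub>S x\<^esub> = a"
  by (metis group.is_monoid group_stalk monoid.inv_one monoid.r_one)

lemma one_div: "\<lbrakk>x \<in> topspace X; a \<in> carrier (S x)\<rbrakk> \<Longrightarrow> \<one>\<^bsub>S x\<^esub> \<otimes>\<^bsub>S x\<^esub> inv\<^bsub>S x\<^esub> a = inv\<^bsub>S x\<^esub> a"
  by (meson group.is_monoid group_stalk inv_cl monoid.l_one)

lemma L_inv: "L x f \<Longrightarrow> L x (\<lambda>y. inv\<^bsub>S y\<^esub> f y)"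
proof -
  assume a: "L x f"
  obtain W where W: "openin X W" "x \<in> W" "\<forall>y\<in>W. L y f" using L_open[OF a] by blast
  have "L x (\<lambda>y. \<one>\<^bsub>S y\<^esub> \<otimes>\<^bsub>S y\<^esub> inv\<^bsub>S y\<^esub> f y)" by (rule L_div[OF L_one a]) (use L_closed a in blast)
  then show ?thesis by (rule L_cong[OF _ W(1,2)]) (use W(3) L_closed one_div in metis)
qed

lemma L_mult: "\<lbrakk>L x f; L x g\<rbrakk> \<Longrightarrow> L x (\<lambda>y. f y \<otimes>\<^bsub>S y\<^esub> g y)"
proof -
  assume a: "L x f" "L x g"
  obtain W where W: "openin X W" "x \<in> W" "\<forall>y\<in>W. L y g" using L_open[OF a(2)] by blast
  have "L x (\<lambda>y. f y \<otimes>\<^bsub>S y\<^esub> inv\<^bsub>S y\<^esub> (inv\<^bsub>S y\<^esub> g y))" by (rule L_div[OF a(1) L_inv[OF a(2)]])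
  then show ?thesis by (rule L_cong[OF _ W(1,2)]) (metis W(3) L_closed group_stalk group.inv_inv)
qed

text \<open>A local family becomes a member of \<open>families\<close> by setting it to one off the
  open set.\<close>

lemma L_surj_families:
  assumes "x \<in> topspace X" "s \<in> carrier (S x)"
  shows "\<exists>f\<in>families X S. L x f \<and> f x = s"
proof -
  obtain f where f: "L x f" "f x = s" using L_surj[OF assms] by blast
  obtain W where W: "openin X W" "x \<in> W" "\<forall>y\<in>W. L y f" using L_open[OF f(1)] by blast
  let ?g = "\<lambda>y. if y \<in> W then f y else \<one>\<^bsub>S y\<^esub>"
  have "?g \<in> families X S" using W(3) L_closed one_cl by auto
  moreover have "L x ?g" by (rule L_cong[OF f(1) W(1,2)]) simp
  ultimately show ?thesis using f W by (intro bexI[of _ ?g]) auto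
qed

lemma L_global_families: "(\<And>x. x \<in> topspace X \<Longrightarrow> L x f) \<Longrightarrow> f \<in> families X S"
  using L_closed by auto

lemma families_div: "\<lbrakk>f \<in> families X S; g \<in> families X S\<rbrakk> \<Longrightarrow> (\<lambda>y. f y \<otimes>\<^bsub>S y\<^esub> inv\<^bsub>S y\<^esub> g y) \<in> families X S"
  using mult_cl inv_cl by (auto simp: Pi_iff)

lemma families_mult: "\<lbrakk>f \<in> families X S; g \<in> families X S\<rbrakk> \<Longrightarrow> (\<lambda>y. f y \<otimes>\<^bsub>S y\<^esub> g y) \<in> families X S"
  using mult_cl by (auto simp: Pi_iff)

lemma families_one: "(\<lambda>y. \<one>\<^bsub>S y\<^esub>) \<in> families X S"
  using one_cl by auto

end

text \<open>One step of the canonical resolution: \<open>S' x\<close> is the group of all families modulo those that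
  are sections near \<open>x\<close>.\<close>

locale etale_step = etale X S L
  for X :: "'x topology" and S :: "'x \<Rightarrow> 's monoid" and L +
  fixes S' :: "'x \<Rightarrow> 't monoid" and L' and \<kappa> :: "'x \<Rightarrow> ('x \<Rightarrow> 's) \<Rightarrow> 't"
  assumes comm_group_S': "x \<in> topspace X \<Longrightarrow> comm_group (S' x)"
    and \<kappa>_topspace: "\<lbrakk>f \<in> families X S; g \<in> families X S; x \<in> topspace X; \<And>y. y \<in> topspace X \<Longrightarrow> f y = g y\<rbrakk> \<Longrightarrow> \<kappa> x f = \<kappa> x g"
    and \<kappa>_mult: "\<lbrakk>x \<in> topspace X; f \<in> families X S; g \<in> families X S\<rbrakk> \<Longrightarrow>
        \<kappa> x (\<lambda>y. f y \<otimes>\<^bsub>S y\<^esub> g y) = \<kappa> x f \<otimes>\<^bsub>S' x\<^esub> \<kappa> x g"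
    and \<kappa>_image: "x \<in> topspace X \<Longrightarrow> \<kappa> x ` families X S = carrier (S' x)"
    and \<kappa>_one_iff: "\<lbrakk>x \<in> topspace X; f \<in> families X S\<rbrakk> \<Longrightarrow> \<kappa> x f = \<one>\<^bsub>S' x\<^esub> \<longleftrightarrow> L x f"
    and L'_iff: "L' x z \<longleftrightarrow> (\<exists>W. openin X W \<and> x \<in> W \<and> (\<exists>f\<in>families X S. \<forall>y\<in>W. z y = \<kappa> y f))"
begin

lemma group_S': "x \<in> topspace X \<Longrightarrow> group (S' x)"
  using comm_group_S' comm_group.axioms(2) by blast

lemma \<kappa>_closed: "\<lbrakk>x \<in> topspace X; f \<in> families X S\<rbrakk> \<Longrightarrow> \<kappa> x f \<in> carrier (S' x)"
  using \<kappa>_image by blast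

lemma \<kappa>_surj: "\<lbrakk>x \<in> topspace X; s \<in> carrier (S' x)\<rbrakk> \<Longrightarrow> \<exists>f\<in>families X S. s = \<kappa> x f"
  unfolding \<kappa>_image[symmetric] by (erule imageE) blast

lemma \<kappa>_div:
  assumes x: "x \<in> topspace X" and f: "f \<in> families X S" and g: "g \<in> families X S"
  shows "\<kappa> x (\<lambda>y. f y \<otimes>\<^bsub>S y\<^esub> inv\<^bsub>S y\<^esub> g y) = \<kappa> x f \<otimes>\<^bsub>S' x\<^esub> inv\<^bsub>S' x\<^esub> \<kappa> x g"
proof -
  interpret g: group "S' x" by (rule group_S'[OF x])
  let ?d = "\<lambda>y. f y \<otimes>\<^bsub>S y\<^esub> inv\<^bsub>S y\<^esub> g y"
  have d: "?d \<in> families X S" using families_div f g .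
  have "\<kappa> x ?d \<otimes>\<^bsub>S' x\<^esub> \<kappa> x g = \<kappa> x (\<lambda>y. ?d y \<otimes>\<^bsub>S y\<^esub> g y)" using \<kappa>_mult[OF x d g] by simp
  also have "\<dots> = \<kappa> x f" by (rule \<kappa>_topspace[OF families_mult[OF d g] f x]) (use f g in \<open>simp add: Pi_iff div_mult\<close>)
  finally show ?thesis using \<kappa>_closed[OF x] d f g by (metis g.inv_solve_right')
qed

lemma \<kappa>_eq_iff:
  assumes x: "x \<in> topspace X" and f: "f \<in> families X S" and g: "g \<in> families X S"
  shows "\<kappa> x f = \<kappa> x g \<longleftrightarrow> L x (\<lambda>y. f y \<otimes>\<^bsub>S y\<^esub> inv\<^bsub>S y\<^esub> g y)"
proof -
  interpret g: group "S' x" by (rule group_S'[OF x])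
  have "\<kappa> x f = \<kappa> x g \<longleftrightarrow> \<kappa> x f \<otimes>\<^bsub>S' x\<^esub> inv\<^bsub>S' x\<^esub> \<kappa> x g = \<one>\<^bsub>S' x\<^esub>"
    using \<kappa>_closed[OF x] f g by (metis g.inv_closed g.inv_equality g.inv_inv g.r_inv)
  then show ?thesis using \<kappa>_div[OF assms] \<kappa>_one_iff[OF x families_div[OF f g]] by simp
qed

text \<open>The quotient of the two families is one on \<open>W\<close>, hence a section there. So
  \<kappa> depends only on the germ of a family.\<close>

lemma \<kappa>_cong:
  assumes W: "openin X W" "x \<in> W" and f: "f \<in> families X S" and g: "g \<in> families X S"
    and eq: "\<And>y. y \<in> W \<Longrightarrow> f y = g y"
  shows "\<kappa> x f = \<kappa> x g"
proof -
  have WX: "W \<subseteq> topspace X" using W openin_subset by blast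
  have "L x (\<lambda>y. f y \<otimes>\<^bsub>S y\<^esub> inv\<^bsub>S y\<^esub> g y)"
  proof (rule L_cong[OF L_one W])
    show "x \<in> topspace X" using WX W by blast
    fix y assume "y \<in> W"
    then show "f y \<otimes>\<^bsub>S y\<^esub> inv\<^bsub>S y\<^esub> g y = \<one>\<^bsub>S y\<^esub>"
      using WX eq g div_one_iff[of y "f y" "g y"] by (auto simp: Pi_iff)
  qed
  then show ?thesis using \<kappa>_eq_iff f g WX W by blast
qed

lemma L'_closed: "L' x z \<Longrightarrow> x \<in> topspace X \<and> z x \<in> carrier (S' x)"
  unfolding L'_iff using \<kappa>_closed openin_subset by fastforce

text \<open>The one axiom with content is the last: classes that agree at \<open>x\<close> have
  representatives whose quotient is a section at \<open>x\<close>, hence by \<open>L_open\<close> at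
  all nearby points.\<close>

lemma etale_next: "etale X S' L'"
proof (rule etale.intro)
  show "x \<in> topspace X \<Longrightarrow> comm_group (S' x)" for x by (rule comm_group_S')
  show "L' x f \<Longrightarrow> x \<in> topspace X \<and> f x \<in> carrier (S' x)" for x f by (rule L'_closed)
  show "L' x g" if "L' x f" "openin X W" "x \<in> W" "\<And>y. y \<in> W \<Longrightarrow> g y = f y" for x f W g
  proof -
    obtain V h where "openin X V" "x \<in> V" "h \<in> families X S" "\<forall>y\<in>V. f y = \<kappa> y h"
      using \<open>L' x f\<close> unfolding L'_iff by blast
    then show ?thesis unfolding L'_iff using that
      by (intro exI[of _ "V \<inter> W"]) (auto intro!: bexI[of _ h])
  qed
  show "\<exists>W. openin X W \<and> x \<in> W \<and> (\<forall>y\<in>W. L' y f)" if "L' x f" for x f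
    using that unfolding L'_iff by blast
  show "L' x (\<lambda>y. \<one>\<^bsub>S' y\<^esub>)" if "x \<in> topspace X" for x
  proof -
    have "\<forall>y\<in>topspace X. \<one>\<^bsub>S' y\<^esub> = \<kappa> y (\<lambda>y. \<one>\<^bsub>S y\<^esub>)" using families_one \<kappa>_one_iff L_one by metis
    then show ?thesis unfolding L'_iff using that families_one openin_topspace by blast
  qed
  show "L' x (\<lambda>y. f y \<otimes>\<^bsub>S' y\<^esub> inv\<^bsub>S' y\<^esub> g y)" if "L' x f" "L' x g" for x f g
  proof -
    obtain V h where 1: "openin X V" "x \<in> V" "h \<in> families X S" "\<forall>y\<in>V. f y = \<kappa> y h"
      using \<open>L' x f\<close> unfolding L'_iff by blast
    obtain V' h' where 2: "openin X V'" "x \<in> V'" "h' \<in> families X S" "\<forall>y\<in>V'. g y = \<kappa> y h'"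
      using \<open>L' x g\<close> unfolding L'_iff by blast
    have "V \<subseteq> topspace X" using 1 openin_subset by blast
    then have "\<forall>y\<in>V \<inter> V'. f y \<otimes>\<^bsub>S' y\<^esub> inv\<^bsub>S' y\<^esub> g y = \<kappa> y (\<lambda>y. h y \<otimes>\<^bsub>S y\<^esub> inv\<^bsub>S y\<^esub> h' y)"
      using 1 2 \<kappa>_div by auto
    then show ?thesis unfolding L'_iff using 1 2 families_div[OF 1(3) 2(3)] by (meson IntI openin_Int)
  qed
  show "\<exists>f. L' x f \<and> f x = s" if x: "x \<in> topspace X" "s \<in> carrier (S' x)" for x s
  proof -
    obtain h where "h \<in> families X S" "s = \<kappa> x h" using \<kappa>_surj[OF x] by blast
    moreover from this have "L' x (\<lambda>y. \<kappa> y h)" unfolding L'_iff using x(1) openin_topspace by blast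
    ultimately show ?thesis by (intro exI[of _ "\<lambda>y. \<kappa> y h"]) simp
  qed
  show "\<exists>W. openin X W \<and> x \<in> W \<and> (\<forall>y\<in>W. f y = g y)" if "L' x f" "L' x g" "f x = g x" for x f g
  proof -
    obtain V h where 1: "openin X V" "x \<in> V" "h \<in> families X S" "\<forall>y\<in>V. f y = \<kappa> y h"
      using \<open>L' x f\<close> unfolding L'_iff by blast
    obtain V' h' where 2: "openin X V'" "x \<in> V'" "h' \<in> families X S" "\<forall>y\<in>V'. g y = \<kappa> y h'"
      using \<open>L' x g\<close> unfolding L'_iff by blast
    have x: "x \<in> topspace X" and sub: "V \<subseteq> topspace X" using 1 openin_subset by blast+
    have "\<kappa> x h = \<kappa> x h'" using that(3) 1 2 by simp
    then have "L x (\<lambda>y. h y \<otimes>\<^bsub>S y\<^esub> inv\<^bsub>S y\<^esub> h' y)" using \<kappa>_eq_iff[OF x 1(3) 2(3)] by simp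
    then obtain W where W: "openin X W" "x \<in> W" "\<forall>y\<in>W. L y (\<lambda>y. h y \<otimes>\<^bsub>S y\<^esub> inv\<^bsub>S y\<^esub> h' y)" using L_open by blast
    have "\<forall>y\<in>V \<inter> V' \<inter> W. f y = g y" using W(3) \<kappa>_eq_iff[OF _ 1(3) 2(3)] 1 2 sub by auto
    then show ?thesis using W 1 2 by (intro exI[of _ "V \<inter> V' \<inter> W"]) (auto intro!: openin_Int)
  qed
qed

end

text \<open>For a step of the resolution this is the vanishing of the first cohomology of the
  resolved sheaf: global sections of the cokernel come from the Godement sheaf.\<close>

definition glob_lift :: "'x topology \<Rightarrow> ('x \<Rightarrow> 's monoid) \<Rightarrow> ('x \<Rightarrow> ('x \<Rightarrow> 't) \<Rightarrow> bool) \<Rightarrow> ('x \<Rightarrow> ('x \<Rightarrow> 's) \<Rightarrow> 't) \<Rightarrow> bool" where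
  "glob_lift X S L' \<kappa> \<longleftrightarrow>
     (\<forall>z. (\<forall>x\<in>topspace X. L' x z) \<longrightarrow> (\<exists>f\<in>families X S. \<forall>x\<in>topspace X. z x = \<kappa> x f))"

subsection \<open>Flasque sheaves\<close>

definition flasque :: "'x topology \<Rightarrow> ('x \<Rightarrow> ('x \<Rightarrow> 's) \<Rightarrow> bool) \<Rightarrow> bool" where
  "flasque X L \<longleftrightarrow> (\<forall>U f. openin X U \<longrightarrow> (\<forall>x\<in>U. L x f) \<longrightarrow>
     (\<exists>g. (\<forall>x\<in>topspace X. L x g) \<and> (\<forall>x\<in>U. g x = f x)))"

context etale_step
begin

text \<open>Zorn's lemma on partial lifts. Over a small overlap two lifts differ by a section of
  \<open>L\<close>; flasqueness extends this section to the whole space, where it corrects the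
  second lift without changing its class, so that the two glue.\<close>

lemma flasque_lift:
  assumes fl: "flasque X L" and U: "openin X U" and z: "\<And>x. x \<in> U \<Longrightarrow> L' x z"
  shows "\<exists>f\<in>families X S. \<forall>x\<in>U. z x = \<kappa> x f"
proof -
  define good where "good W f \<longleftrightarrow> openin X W \<and> W \<subseteq> U \<and> f \<in> families X S \<and> (\<forall>x\<in>W. z x = \<kappa> x f)" for W f
  \<comment> \<open>Partial lifts are ordered by inclusion of graphs, since the values of
    \<open>f\<close> off \<open>W\<close> carry no information.\<close>
  define gr where "gr W f = (\<lambda>x. (x, f x)) ` W" for W and f :: "'x \<Rightarrow> 's"
  define A where "A = {gr W f | W f. good W f}"
  have gr_mem: "(x, s) \<in> gr W f \<longleftrightarrow> x \<in> W \<and> s = f x" for x s W f unfolding gr_def by auto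
  have "\<exists>M\<in>A. \<forall>N\<in>A. M \<subseteq> N \<longrightarrow> N = M"
  proof (rule subset_Zorn)
    fix C assume C: "subset.chain A C"
    then have CA: "C \<subseteq> A" and lin: "\<And>M N. M \<in> C \<Longrightarrow> N \<in> C \<Longrightarrow> M \<subseteq> N \<or> N \<subseteq> M"
      unfolding subset.chain_def by auto
    define W where "W = \<Union>{V. \<exists>f. good V f \<and> gr V f \<in> C}"
    \<comment> \<open>Graphs in a chain are comparable, so the value chosen by \<open>SOME\<close>
      is unique; off the union the default is one.\<close>
    define h where "h x = (if x \<in> W then SOME s. (x, s) \<in> \<Union>C else \<one>\<^bsub>S x\<^esub>)" for x
    have h: "h x = f x" if v: "good V f" "gr V f \<in> C" "x \<in> V" for V f x
    proof -
      have "x \<in> W" using v W_def by blast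
      have c: "(x, f x) \<in> \<Union>C" using v(2,3) gr_mem[of x "f x" V f] by (intro UnionI) simp_all
      have "s = f x" if "(x, s) \<in> \<Union>C" for s
      proof -
        obtain N where N: "N \<in> C" "(x, s) \<in> N" using \<open>(x, s) \<in> \<Union>C\<close> by blast
        then obtain V' f' where N': "N = gr V' f'" using CA A_def by blast
        have "(x, s) \<in> gr V f \<or> (x, f x) \<in> gr V' f'"
          using lin[OF N(1) v(2)] N(2) v(3) unfolding N' gr_def by blast
        then show ?thesis using N(2) unfolding N' gr_mem by auto
      qed
      then have "(SOME s. (x, s) \<in> \<Union>C) = f x" using c by (rule some_equality[rotated])
      then show ?thesis using \<open>x \<in> W\<close> unfolding h_def by simp
    qed
    have Wop: "openin X W" unfolding W_def by (rule openin_Union) (auto simp: good_def)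
    have WU: "W \<subseteq> U" unfolding W_def good_def by blast
    have hf: "h \<in> families X S"
    proof (rule Pi_I)
      fix x assume x: "x \<in> topspace X"
      show "h x \<in> carrier (S x)"
      proof (cases "x \<in> W")
        case True
        then obtain V f where v: "good V f" "gr V f \<in> C" "x \<in> V" unfolding W_def by blast
        then show ?thesis using h[OF v] x unfolding good_def by auto
      qed (simp add: h_def one_cl x)
    qed
    have "z x = \<kappa> x h" if "x \<in> W" for x
    proof -
      obtain V f where v: "good V f" "gr V f \<in> C" "x \<in> V" using \<open>x \<in> W\<close> unfolding W_def by blast
      have "\<kappa> x f = \<kappa> x h" by (rule \<kappa>_cong[of V]) (use v h[OF v(1,2)] hf in \<open>auto simp: good_def\<close>)
      then show ?thesis using v unfolding good_def by auto
    qed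
    then have "good W h" unfolding good_def using Wop WU hf by blast
    then have "gr W h \<in> A" unfolding A_def by blast
    moreover have "M \<subseteq> gr W h" if "M \<in> C" for M
    proof -
      obtain V f where v: "good V f" "M = gr V f" using CA \<open>M \<in> C\<close> A_def by blast
      then have "V \<subseteq> W" using \<open>M \<in> C\<close> W_def by blast
      then show ?thesis using h[OF v(1)] \<open>M \<in> C\<close> v(2) by (auto simp: gr_def)
    qed
    ultimately show "\<exists>M\<in>A. \<forall>N\<in>C. N \<subseteq> M" by blast
  qed
  then obtain M where M: "M \<in> A" "\<And>N. N \<in> A \<Longrightarrow> M \<subseteq> N \<Longrightarrow> N = M" by meson
  then obtain W f where Wf: "good W f" "M = gr W f" unfolding A_def by auto
  have max: "gr V g = gr W f" if "good V g" "gr W f \<subseteq> gr V g" for V g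
    using M(2)[of "gr V g"] that Wf(2) unfolding A_def by auto
  have w: "openin X W" "W \<subseteq> U" "f \<in> families X S" "\<And>x. x \<in> W \<Longrightarrow> z x = \<kappa> x f"
    using Wf(1) unfolding good_def by simp_all
  have "U \<subseteq> W"
  proof
    fix x assume x: "x \<in> U"
    obtain V k where V: "openin X V" "x \<in> V" "k \<in> families X S" "\<forall>y\<in>V. z y = \<kappa> y k"
      using z[OF x] unfolding L'_iff by blast
    have sub: "W \<subseteq> topspace X" "V \<subseteq> topspace X" using w(1) V(1) openin_subset by auto
    \<comment> \<open>Both \<open>f\<close> and \<open>k\<close> lift \<open>z\<close> on
      \<open>W \<inter> V\<close>, so their quotient is a section of \<open>L\<close> there.\<close>
    let ?d = "\<lambda>y. f y \<otimes>\<^bsub>S y\<^esub> inv\<^bsub>S y\<^esub> k y"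
    have "\<forall>y\<in>W \<inter> V. L y ?d" 
      using w(4) V(4) \<kappa>_eq_iff[OF _ w(3) V(3)] sub by (metis IntE subsetD)
    moreover have "openin X (W \<inter> V)" using w(1) V(1) by (rule openin_Int)
    ultimately obtain g where g: "\<forall>y\<in>topspace X. L y g" "\<forall>y\<in>W \<inter> V. g y = ?d y" using fl unfolding flasque_def by blast
    have gT: "g \<in> families X S" using g(1) L_global_families by blast
    \<comment> \<open>The global section \<open>g\<close> has trivial class, so \<open>k'\<close>
      still lifts \<open>z\<close> on \<open>V\<close>, and now it agrees with \<open>f\<close> on
      the overlap.\<close>
    define k' where "k' = (\<lambda>y. g y \<otimes>\<^bsub>S y\<^esub> k y)"
    have k'T: "k' \<in> families X S" unfolding k'_def using families_mult gT V(3) .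
    have k'f: "k' y = f y" if "y \<in> W \<inter> V" for y using that g(2) w(3) V(3) sub div_mult[of y "f y" "k y"] unfolding k'_def by (auto simp: Pi_iff)
    have \<kappa>k': "\<kappa> y k' = \<kappa> y k" if "y \<in> topspace X" for y
    proof -
      have gy: "\<kappa> y g = \<one>\<^bsub>S' y\<^esub>" using g(1) gT \<kappa>_one_iff that by blast
      show ?thesis using \<kappa>_mult[OF that gT V(3)] gy \<kappa>_closed[OF that V(3)] group_S'[OF that]
        by (simp add: k'_def group.is_monoid monoid.l_one)
    qed
    define h where "h y = (if y \<in> W then f y else k' y)" for y
    have hT: "h \<in> families X S" using w(3) k'T by (auto simp: h_def)
    have hV: "h y = k' y" if "y \<in> V" for y using that k'f by (auto simp: h_def)
    \<comment> \<open>\<open>V\<close> comes from the local description of \<open>z\<close> and may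
      leave \<open>U\<close>, hence the intersection.\<close>
    have "z y = \<kappa> y h" if "y \<in> W \<union> V \<inter> U" for y
    proof (cases "y \<in> W")
      case True
      then have "\<kappa> y h = \<kappa> y f" using \<kappa>_cong[OF w(1) _ hT w(3)] by (simp add: h_def)
      then show ?thesis using w(4) True by simp
    next
      case False
      then have y: "y \<in> V" using that by auto
      then have "\<kappa> y h = \<kappa> y k'" using \<kappa>_cong[OF V(1) _ hT k'T] hV by simp
      then show ?thesis using V(4) \<kappa>k'[of y] y sub by (simp add: subset_iff)
    qed
    then have "good (W \<union> V \<inter> U) h" unfolding good_def using w(1,2) V(1) U hT by (simp add: openin_Un openin_Int)
    moreover have "gr W f \<subseteq> gr (W \<union> V \<inter> U) h" by (auto simp: gr_def h_def)
    ultimately have "gr (W \<union> V \<inter> U) h = gr W f" using max by blast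
    then have "(x, h x) \<in> gr W f" using V(2) x gr_mem by blast
    then show "x \<in> W" using gr_mem by blast
  qed
  then show ?thesis using w(3,4) by (intro bexI[of _ f]) auto
qed

lemma flasque_glob_lift: "flasque X L \<Longrightarrow> glob_lift X S L' \<kappa>"
  unfolding glob_lift_def using flasque_lift[of "topspace X"] by auto

text \<open>A lift over \<open>U\<close> is already a family on the whole space, and its classes
  form a global section extending the given one.\<close>

lemma flasque_next: "flasque X L \<Longrightarrow> flasque X L'"
  unfolding flasque_def[of X L']
proof (intro allI impI)
  fix U z assume a: "flasque X L" "openin X U" "\<forall>x\<in>U. L' x z"
  then obtain f where "f \<in> families X S" "\<forall>x\<in>U. z x = \<kappa> x f" using flasque_lift by blast
  then have "(\<forall>x\<in>topspace X. L' x (\<lambda>x. \<kappa> x f)) \<and> (\<forall>x\<in>U. \<kappa> x f = z x)"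
    unfolding L'_iff using openin_topspace by (intro conjI ballI) (blast, simp)
  then show "\<exists>g. (\<forall>x\<in>topspace X. L' x g) \<and> (\<forall>x\<in>U. g x = z x)" by (rule exI[of _ "\<lambda>x. \<kappa> x f"])
qed

end

section \<open>Morphisms of sheaves and Mayer--Vietoris squares\<close>

definition etale_hom ::
    "'x topology \<Rightarrow> ('x \<Rightarrow> 's monoid) \<Rightarrow> ('x \<Rightarrow> ('x \<Rightarrow> 's) \<Rightarrow> bool) \<Rightarrow>
     ('x \<Rightarrow> 't monoid) \<Rightarrow> ('x \<Rightarrow> ('x \<Rightarrow> 't) \<Rightarrow> bool) \<Rightarrow> ('x \<Rightarrow> 's \<Rightarrow> 't) \<Rightarrow> bool" where
  "etale_hom X S L T M p \<longleftrightarrow>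
     (\<forall>x\<in>topspace X. p x \<in> hom (S x) (T x)) \<and> (\<forall>x f. L x f \<longrightarrow> M x (\<lambda>y. p y (f y)))"

lemma etale_hom_closed: "\<lbrakk>etale_hom X S L T M p; x \<in> topspace X; s \<in> carrier (S x)\<rbrakk> \<Longrightarrow> p x s \<in> carrier (T x)"
  unfolding etale_hom_def using hom_in_carrier by metis

lemma etale_hom_families: "\<lbrakk>etale_hom X S L T M p; f \<in> families X S\<rbrakk> \<Longrightarrow> (\<lambda>y. p y (f y)) \<in> families X T"
  using etale_hom_closed by (fastforce simp: Pi_iff)

lemma etale_hom_div:
  assumes "etale_hom X S L T M p" "etale X S L" "etale X T M" "x \<in> topspace X" "a \<in> carrier (S x)" "b \<in> carrier (S x)"
  shows "p x (a \<otimes>\<^bsub>S x\<^esub> inv\<^bsub>S x\<^esub> b) = p x a \<otimes>\<^bsub>T x\<^esub> inv\<^bsub>T x\<^esub> p x b"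
proof -
  have "group_hom (S x) (T x) (p x)"
    using assms(1,4) etale.group_stalk[OF assms(2,4)] etale.group_stalk[OF assms(3,4)]
    unfolding etale_hom_def group_hom_def group_hom_axioms_def by simp
  then interpret group_hom "S x" "T x" "p x" .
  show ?thesis using assms by simp
qed

text \<open>Functoriality of the step. The map acts on a chosen representative; the choice is
  immaterial because \<open>p\<close> sends sections to sections, so representatives of one class
  have images with the same class.\<close>

lemma step_hom:
  assumes s: "etale_step X S L S' L' \<kappa>" and t: "etale_step X T M T' M' \<mu>" and p: "etale_hom X S L T M p"
  shows "\<exists>p'. etale_hom X S' L' T' M' p' \<and>
     (\<forall>x\<in>topspace X. \<forall>f\<in>families X S. p' x (\<kappa> x f) = \<mu> x (\<lambda>y. p y (f y)))"
proof -
  interpret s: etale_step X S L S' L' \<kappa> by fact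
  interpret t: etale_step X T M T' M' \<mu> by fact
  define p' where "p' x a = \<mu> x (\<lambda>y. p y ((SOME f. f \<in> families X S \<and> \<kappa> x f = a) y))" for x a
  have key: "p' x (\<kappa> x f) = \<mu> x (\<lambda>y. p y (f y))" if x: "x \<in> topspace X" and f: "f \<in> families X S" for x f
  proof -
    define g where "g = (SOME g. g \<in> families X S \<and> \<kappa> x g = \<kappa> x f)"
    have g: "g \<in> families X S" "\<kappa> x g = \<kappa> x f"
      unfolding g_def using someI_ex[of "\<lambda>g. g \<in> families X S \<and> \<kappa> x g = \<kappa> x f"] f by blast+
    have "L x (\<lambda>y. g y \<otimes>\<^bsub>S y\<^esub> inv\<^bsub>S y\<^esub> f y)" using s.\<kappa>_eq_iff[OF x g(1) f] g(2) by simp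
    then have "M x (\<lambda>y. p y (g y \<otimes>\<^bsub>S y\<^esub> inv\<^bsub>S y\<^esub> f y))" using p unfolding etale_hom_def by blast
    then have "M x (\<lambda>y. p y (g y) \<otimes>\<^bsub>T y\<^esub> inv\<^bsub>T y\<^esub> p y (f y))"
      by (rule t.L_cong[of _ _ "topspace X"])
        (use x f g etale_hom_div[OF p s.etale_axioms t.etale_axioms] in \<open>auto simp: Pi_iff\<close>)
    then show ?thesis unfolding p'_def g_def[symmetric]
      using t.\<kappa>_eq_iff[OF x etale_hom_families[OF p g(1)] etale_hom_families[OF p f]] by simp
  qed
  have "etale_hom X S' L' T' M' p'"
    unfolding etale_hom_def
  proof (intro conjI ballI allI impI)
    fix x assume x: "x \<in> topspace X"
    show "p' x \<in> hom (S' x) (T' x)"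
    proof (rule homI)
      fix a assume "a \<in> carrier (S' x)"
      then obtain f where "f \<in> families X S" "a = \<kappa> x f" using s.\<kappa>_surj[OF x] by blast
      then show "p' x a \<in> carrier (T' x)" using key x t.\<kappa>_closed etale_hom_families[OF p] by simp
    next
      fix a b assume "a \<in> carrier (S' x)" "b \<in> carrier (S' x)"
      then obtain f g where f: "f \<in> families X S" "a = \<kappa> x f" and g: "g \<in> families X S" "b = \<kappa> x g"
        using s.\<kappa>_surj[OF x] by metis
      have fg: "(\<lambda>y. f y \<otimes>\<^bsub>S y\<^esub> g y) \<in> families X S" using s.families_mult f g by blast
      have "p' x (a \<otimes>\<^bsub>S' x\<^esub> b) = p' x (\<kappa> x (\<lambda>y. f y \<otimes>\<^bsub>S y\<^esub> g y))" using s.\<kappa>_mult[OF x f(1) g(1)] f g by simp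
      also have "\<dots> = \<mu> x (\<lambda>y. p y (f y \<otimes>\<^bsub>S y\<^esub> g y))" by (rule key[OF x fg])
      also have "\<dots> = \<mu> x (\<lambda>y. p y (f y) \<otimes>\<^bsub>T y\<^esub> p y (g y))"
      proof (rule t.\<kappa>_topspace[OF etale_hom_families[OF p fg] t.families_mult[OF etale_hom_families[OF p f(1)] etale_hom_families[OF p g(1)]] x])
        fix y assume y: "y \<in> topspace X"
        then show "p y (f y \<otimes>\<^bsub>S y\<^esub> g y) = p y (f y) \<otimes>\<^bsub>T y\<^esub> p y (g y)"
          using p f g hom_mult[of "p y" "S y" "T y"] unfolding etale_hom_def by (simp add: Pi_iff)
      qed
      also have "\<dots> = p' x a \<otimes>\<^bsub>T' x\<^esub> p' x b"
        using t.\<kappa>_mult[OF x etale_hom_families[OF p f(1)] etale_hom_families[OF p g(1)]] key x f g by simp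
      finally show "p' x (a \<otimes>\<^bsub>S' x\<^esub> b) = p' x a \<otimes>\<^bsub>T' x\<^esub> p' x b" .
    qed
  next
    fix x z assume "L' x z"
    then obtain W f where W: "openin X W" "x \<in> W" "f \<in> families X S" "\<forall>y\<in>W. z y = \<kappa> y f" unfolding s.L'_iff by blast
    have "W \<subseteq> topspace X" using W openin_subset by blast
    then have "\<forall>y\<in>W. p' y (z y) = \<mu> y (\<lambda>y. p y (f y))" using W key by auto
    then show "M' x (\<lambda>y. p' y (z y))" unfolding t.L'_iff using W etale_hom_families[OF p W(3)] by blast
  qed
  then show ?thesis using key by blast
qed

text \<open>A stalkwise exact Mayer--Vietoris sequence \<open>1 \<rightarrow> F \<rightarrow> G \<times> H \<rightarrow> K \<rightarrow> 1\<close> in which already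
  \<open>G \<rightarrow> K\<close> is surjective on stalks and on global sections.\<close>

locale mv_square =
  F: etale X SF LF + G: etale X SG LG + H: etale X SH LH + K: etale X SK LK
  for X :: "'x topology" and SF :: "'x \<Rightarrow> 'f monoid" and LF and SG :: "'x \<Rightarrow> 'g monoid" and LG
    and SH :: "'x \<Rightarrow> 'h monoid" and LH and SK :: "'x \<Rightarrow> 'k monoid" and LK +
  fixes p :: "'x \<Rightarrow> 'f \<Rightarrow> 'g" and q :: "'x \<Rightarrow> 'f \<Rightarrow> 'h" and a :: "'x \<Rightarrow> 'g \<Rightarrow> 'k" and b :: "'x \<Rightarrow> 'h \<Rightarrow> 'k"
  assumes hom_p: "etale_hom X SF LF SG LG p" and hom_q: "etale_hom X SF LF SH LH q"
    and hom_a: "etale_hom X SG LG SK LK a" and hom_b: "etale_hom X SH LH SK LK b"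
    and comm: "\<And>x s. \<lbrakk>x \<in> topspace X; s \<in> carrier (SF x)\<rbrakk> \<Longrightarrow> a x (p x s) = b x (q x s)"
    and inj: "\<And>x s. \<lbrakk>x \<in> topspace X; s \<in> carrier (SF x); p x s = \<one>\<^bsub>SG x\<^esub>; q x s = \<one>\<^bsub>SH x\<^esub>\<rbrakk> \<Longrightarrow> s = \<one>\<^bsub>SF x\<^esub>"
    and lift: "\<And>x s t. \<lbrakk>x \<in> topspace X; s \<in> carrier (SG x); t \<in> carrier (SH x); a x s = b x t\<rbrakk> \<Longrightarrow>
          \<exists>r\<in>carrier (SF x). p x r = s \<and> q x r = t"
    and surj: "\<And>x k. \<lbrakk>x \<in> topspace X; k \<in> carrier (SK x)\<rbrakk> \<Longrightarrow> \<exists>s\<in>carrier (SG x). a x s = k"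
    and glob: "\<And>h. (\<And>x. x \<in> topspace X \<Longrightarrow> LK x h) \<Longrightarrow> \<exists>g. \<forall>x\<in>topspace X. LG x g \<and> a x (g x) = h x"
begin

lemma inj': "\<lbrakk>x \<in> topspace X; s \<in> carrier (SF x); t \<in> carrier (SF x); p x s = p x t; q x s = q x t\<rbrakk> \<Longrightarrow> s = t"
proof -
  assume x: "x \<in> topspace X" and st: "s \<in> carrier (SF x)" "t \<in> carrier (SF x)" and e: "p x s = p x t" "q x s = q x t"
  let ?d = "s \<otimes>\<^bsub>SF x\<^esub> inv\<^bsub>SF x\<^esub> t"
  have "p x ?d = \<one>\<^bsub>SG x\<^esub>"
    using etale_hom_div[OF hom_p F.etale_axioms G.etale_axioms x st] e etale_hom_closed[OF hom_p x st(2)] G.div_one_iff[OF x] by simp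
  moreover have "q x ?d = \<one>\<^bsub>SH x\<^esub>"
    using etale_hom_div[OF hom_q F.etale_axioms H.etale_axioms x st] e etale_hom_closed[OF hom_q x st(2)] H.div_one_iff[OF x] by simp
  ultimately have "?d = \<one>\<^bsub>SF x\<^esub>" using inj[OF x] F.mult_cl F.inv_cl x st by blast
  then show ?thesis using F.div_one_iff x st by blast
qed

text \<open>Families need no continuity, so stalkwise lifts are chosen independently at each point
  of \<open>W\<close> and set to one elsewhere.\<close>

lemma family_lift:
  assumes "W \<subseteq> topspace X" "g \<in> families X SG" "h \<in> families X SH" "\<And>y. y \<in> W \<Longrightarrow> a y (g y) = b y (h y)"
  obtains f where "f \<in> families X SF" "\<And>y. y \<in> W \<Longrightarrow> p y (f y) = g y" "\<And>y. y \<in> W \<Longrightarrow> q y (f y) = h y"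
proof -
  have "\<forall>y. \<exists>r. y \<in> W \<longrightarrow> r \<in> carrier (SF y) \<and> p y r = g y \<and> q y r = h y"
    using lift[OF subsetD[OF assms(1)] Pi_mem[OF assms(2) subsetD[OF assms(1)]] Pi_mem[OF assms(3) subsetD[OF assms(1)]] assms(4)] by meson
  then obtain f where f: "\<And>y. y \<in> W \<Longrightarrow> f y \<in> carrier (SF y) \<and> p y (f y) = g y \<and> q y (f y) = h y" by metis
  show ?thesis
    by (rule that[of "\<lambda>y. if y \<in> W then f y else \<one>\<^bsub>SF y\<^esub>"]) (use f F.one_cl in auto)
qed

text \<open>The inductive engine. Exactness passes to the next stalks by a chase on families modulo
  sections. \<open>liftG\<close>, \<open>liftH\<close> and \<open>glob\<close> together give the
  global lift for \<open>F\<close>, while \<open>liftK\<close> produces the condition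
  \<open>glob\<close> of the next square.\<close>

theorem mv_step:
  fixes SF' :: "'x \<Rightarrow> 'f2 monoid" and SG' :: "'x \<Rightarrow> 'g2 monoid" and SH' :: "'x \<Rightarrow> 'h2 monoid" and SK' :: "'x \<Rightarrow> 'k2 monoid"
  assumes F': "etale_step X SF LF SF' LF' \<phi>" and G': "etale_step X SG LG SG' LG' \<gamma>"
    and H': "etale_step X SH LH SH' LH' \<eta>" and K': "etale_step X SK LK SK' LK' \<kappa>"
    and liftG: "glob_lift X SG LG' \<gamma>" and liftH: "glob_lift X SH LH' \<eta>" and liftK: "glob_lift X SK LK' \<kappa>"
  shows "glob_lift X SF LF' \<phi> \<and> (\<exists>p' q' a' b'. mv_square X SF' LF' SG' LG' SH' LH' SK' LK' p' q' a' b')"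
proof -
  interpret F': etale_step X SF LF SF' LF' \<phi> by fact
  interpret G': etale_step X SG LG SG' LG' \<gamma> by fact
  interpret H': etale_step X SH LH SH' LH' \<eta> by fact
  interpret K': etale_step X SK LK SK' LK' \<kappa> by fact
  obtain p' where p': "etale_hom X SF' LF' SG' LG' p'"
      "\<And>x f. x \<in> topspace X \<Longrightarrow> f \<in> families X SF \<Longrightarrow> p' x (\<phi> x f) = \<gamma> x (\<lambda>y. p y (f y))"
    using step_hom[OF F' G' hom_p] by blast
  obtain q' where q': "etale_hom X SF' LF' SH' LH' q'"
      "\<And>x f. x \<in> topspace X \<Longrightarrow> f \<in> families X SF \<Longrightarrow> q' x (\<phi> x f) = \<eta> x (\<lambda>y. q y (f y))"
    using step_hom[OF F' H' hom_q] by blast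
  obtain a' where a': "etale_hom X SG' LG' SK' LK' a'"
      "\<And>x f. x \<in> topspace X \<Longrightarrow> f \<in> families X SG \<Longrightarrow> a' x (\<gamma> x f) = \<kappa> x (\<lambda>y. a y (f y))"
    using step_hom[OF G' K' hom_a] by blast
  obtain b' where b': "etale_hom X SH' LH' SK' LK' b'"
      "\<And>x f. x \<in> topspace X \<Longrightarrow> f \<in> families X SH \<Longrightarrow> b' x (\<eta> x f) = \<kappa> x (\<lambda>y. b y (f y))"
    using step_hom[OF H' K' hom_b] by blast
  note fam = etale_hom_families[OF hom_p] etale_hom_families[OF hom_q] etale_hom_families[OF hom_a] etale_hom_families[OF hom_b]
  have comm': "a' x (p' x s) = b' x (q' x s)" if x: "x \<in> topspace X" and s: "s \<in> carrier (SF' x)" for x s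
  proof -
    obtain f where f: "f \<in> families X SF" "s = \<phi> x f" using F'.\<kappa>_surj[OF x s] by blast
    have "a' x (p' x s) = \<kappa> x (\<lambda>y. a y (p y (f y)))" using f(2) p'(2)[OF x f(1)] a'(2)[OF x fam(1)[OF f(1)]] by simp
    also have "\<dots> = \<kappa> x (\<lambda>y. b y (q y (f y)))"
      by (rule K'.\<kappa>_topspace[OF fam(3)[OF fam(1)[OF f(1)]] fam(4)[OF fam(2)[OF f(1)]] x]) (use f(1) comm in \<open>simp add: Pi_iff\<close>)
    also have "\<dots> = b' x (q' x s)" using f(2) q'(2)[OF x f(1)] b'(2)[OF x fam(2)[OF f(1)]] by simp
    finally show ?thesis .
  qed
  have inj2: "s = \<one>\<^bsub>SF' x\<^esub>" if x: "x \<in> topspace X" and s: "s \<in> carrier (SF' x)"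
    and e: "p' x s = \<one>\<^bsub>SG' x\<^esub>" "q' x s = \<one>\<^bsub>SH' x\<^esub>" for x s
  proof -
    obtain f where f: "f \<in> families X SF" "s = \<phi> x f" using F'.\<kappa>_surj[OF x s] by blast
    have LG: "LG x (\<lambda>y. p y (f y))" using e(1) f(2) p'(2)[OF x f(1)] G'.\<kappa>_one_iff[OF x fam(1)[OF f(1)]] by simp
    have LH: "LH x (\<lambda>y. q y (f y))" using e(2) f(2) q'(2)[OF x f(1)] H'.\<kappa>_one_iff[OF x fam(2)[OF f(1)]] by simp
    \<comment> \<open>A section \<open>t\<close> of \<open>F\<close> through \<open>f x\<close>: its
      images agree with those of \<open>f\<close> at \<open>x\<close>, hence near \<open>x\<close>
      by \<open>L_eq\<close>, and joint injectivity makes \<open>f\<close> equal to \<open>t\<close>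
      there.\<close>
    obtain t where t: "LF x t" "t x = f x" using F.L_surj[OF x Pi_mem[OF f(1) x]] by (elim exE conjE)
    have pt: "LG x (\<lambda>y. p y (t y))" and qt: "LH x (\<lambda>y. q y (t y))"
      using t(1) hom_p hom_q unfolding etale_hom_def by simp_all
    obtain W where W: "openin X W" "x \<in> W" "\<forall>y\<in>W. p y (t y) = p y (f y)"
      using G.L_eq[OF pt LG] t(2) by auto
    obtain W' where W': "openin X W'" "x \<in> W'" "\<forall>y\<in>W'. q y (t y) = q y (f y)"
      using H.L_eq[OF qt LH] t(2) by auto
    obtain V where V: "openin X V" "x \<in> V" "\<forall>y\<in>V. LF y t" using F.L_open[OF t(1)] by blast
    have "LF x f"
    proof (rule F.L_cong[OF t(1)])
      show "openin X (W \<inter> W' \<inter> V)" "x \<in> W \<inter> W' \<inter> V" using W(1,2) W'(1,2) V(1,2) by (simp_all add: openin_Int)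
      fix y assume y: "y \<in> W \<inter> W' \<inter> V"
      then have "y \<in> topspace X" "t y \<in> carrier (SF y)" using V(3) F.L_closed by auto
      then show "f y = t y" using inj'[of y "f y" "t y"] f(1) W(3) W'(3) y by (simp add: Pi_iff)
    qed
    then show ?thesis using f(2) F'.\<kappa>_one_iff[OF x f(1)] by simp
  qed
  have lift': "\<exists>r\<in>carrier (SF' x). p' x r = s \<and> q' x r = t"
    if x: "x \<in> topspace X" and s: "s \<in> carrier (SG' x)" and t: "t \<in> carrier (SH' x)" and e: "a' x s = b' x t" for x s t
  proof -
    obtain g where g: "g \<in> families X SG" "s = \<gamma> x g" using G'.\<kappa>_surj[OF x s] by blast
    obtain h where h: "h \<in> families X SH" "t = \<eta> x h" using H'.\<kappa>_surj[OF x t] by blast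
    \<comment> \<open>Equality of the classes says only that \<open>a(g)\<close> and
      \<open>b(h)\<close> differ by a section of \<open>K\<close> near \<open>x\<close>. A section
      \<open>r\<close> of \<open>G\<close> lifting this difference turns \<open>g\<close> into an
      exact partner of \<open>h\<close>.\<close>
    let ?d = "\<lambda>y. a y (g y) \<otimes>\<^bsub>SK y\<^esub> inv\<^bsub>SK y\<^esub> b y (h y)"
    have d: "LK x ?d" using e g(2) h(2) a'(2)[OF x g(1)] b'(2)[OF x h(1)] K'.\<kappa>_eq_iff[OF x fam(3)[OF g(1)] fam(4)[OF h(1)]] by simp
    then obtain u where u: "u \<in> carrier (SG x)" "a x u = ?d x" using surj[OF x] K.L_closed by blast
    obtain r where r: "r \<in> families X SG" "LG x r" "r x = u" using G.L_surj_families[OF x u(1)] by blast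
    have ar: "LK x (\<lambda>y. a y (r y))" using r(2) hom_a unfolding etale_hom_def by simp
    then obtain W where W: "openin X W" "x \<in> W" "\<forall>y\<in>W. a y (r y) = ?d y" using K.L_eq[OF ar d] r(3) u(2) by auto
    have sub: "W \<subseteq> topspace X" using W(1) by (rule openin_subset)
    define g' where "g' = (\<lambda>y. g y \<otimes>\<^bsub>SG y\<^esub> inv\<^bsub>SG y\<^esub> r y)"
    have g': "g' \<in> families X SG" unfolding g'_def by (rule G.families_div[OF g(1) r(1)])
    have "a y (g' y) = b y (h y)" if "y \<in> W" for y
    proof -
      have y: "y \<in> topspace X" using sub that by blast
      have "a y (g' y) = a y (g y) \<otimes>\<^bsub>SK y\<^esub> inv\<^bsub>SK y\<^esub> (?d y)"
        unfolding g'_def using etale_hom_div[OF hom_a G.etale_axioms K.etale_axioms y] g(1) r(1) W(3) that y by (simp add: Pi_iff)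
      also have "\<dots> = b y (h y)" by (rule K.div_div[OF y Pi_mem[OF fam(3)[OF g(1)] y] Pi_mem[OF fam(4)[OF h(1)] y]])
      finally show ?thesis .
    qed
    then obtain f where f: "f \<in> families X SF" "\<And>y. y \<in> W \<Longrightarrow> p y (f y) = g' y" "\<And>y. y \<in> W \<Longrightarrow> q y (f y) = h y"
      using family_lift[OF sub g' h(1)] by blast
    have "p' x (\<phi> x f) = \<gamma> x g'" unfolding p'(2)[OF x f(1)] by (rule G'.\<kappa>_cong[OF W(1,2) fam(1)[OF f(1)] g']) (rule f(2))
    also have "\<dots> = s \<otimes>\<^bsub>SG' x\<^esub> inv\<^bsub>SG' x\<^esub> \<gamma> x r" unfolding g'_def g(2) by (rule G'.\<kappa>_div[OF x g(1) r(1)])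
    also have "\<gamma> x r = \<one>\<^bsub>SG' x\<^esub>" using r(2) G'.\<kappa>_one_iff[OF x r(1)] by simp
    also have "s \<otimes>\<^bsub>SG' x\<^esub> inv\<^bsub>SG' x\<^esub> \<one>\<^bsub>SG' x\<^esub> = s" by (rule etale.div_one[OF G'.etale_next x s])
    finally have "p' x (\<phi> x f) = s" .
    moreover have "q' x (\<phi> x f) = t" unfolding q'(2)[OF x f(1)] h(2) by (rule H'.\<kappa>_cong[OF W(1,2) fam(2)[OF f(1)] h(1)]) (rule f(3))
    ultimately show ?thesis using F'.\<kappa>_closed[OF x f(1)] by blast
  qed
  \<comment> \<open>Surjectivity on families is surjectivity on stalks plus choice.\<close>
  have famlift: "\<exists>g\<in>families X SG. \<forall>y\<in>topspace X. a y (g y) = k y" if k: "k \<in> families X SK" for k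
  proof -
    have "\<forall>y\<in>topspace X. \<exists>s. s \<in> carrier (SG y) \<and> a y s = k y" using surj[OF _ Pi_mem[OF k]] by meson
    from bchoice[OF this] show ?thesis by auto
  qed
  have surj': "\<exists>s\<in>carrier (SG' x). a' x s = k" if x: "x \<in> topspace X" and k: "k \<in> carrier (SK' x)" for x k
  proof -
    obtain f where f: "f \<in> families X SK" "k = \<kappa> x f" using K'.\<kappa>_surj[OF x k] by blast
    obtain g where g: "g \<in> families X SG" "\<forall>y\<in>topspace X. a y (g y) = f y" using famlift[OF f(1)] by blast
    have "a' x (\<gamma> x g) = k" unfolding a'(2)[OF x g(1)] f(2) by (rule K'.\<kappa>_topspace[OF fam(3)[OF g(1)] f(1) x]) (use g(2) in simp)
    then show ?thesis using G'.\<kappa>_closed[OF x g(1)] by blast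
  qed
  \<comment> \<open>Acyclicity of \<open>K\<close> enters here: a global section of its next syzygy
    is the class of one family, and families lift to \<open>G\<close>.\<close>
  have glob': "\<exists>g. \<forall>x\<in>topspace X. LG' x g \<and> a' x (g x) = h x" if h: "\<And>x. x \<in> topspace X \<Longrightarrow> LK' x h" for h
  proof -
    obtain f where f: "f \<in> families X SK" "\<forall>x\<in>topspace X. h x = \<kappa> x f" using liftK[unfolded glob_lift_def, rule_format, of h] h by auto
    obtain g where g: "g \<in> families X SG" "\<forall>y\<in>topspace X. a y (g y) = f y" using famlift[OF f(1)] by blast
    have "LG' x (\<lambda>x. \<gamma> x g) \<and> a' x (\<gamma> x g) = h x" if x: "x \<in> topspace X" for x
    proof
      show "LG' x (\<lambda>x. \<gamma> x g)" unfolding G'.L'_iff using x g(1) by (intro exI[of _ "topspace X"]) auto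
      show "a' x (\<gamma> x g) = h x" unfolding a'(2)[OF x g(1)] f(2)[rule_format, OF x] by (rule K'.\<kappa>_topspace[OF fam(3)[OF g(1)] f(1) x]) (use g(2) in simp)
    qed
    then show ?thesis by (intro exI[of _ "\<lambda>x. \<gamma> x g"]) simp
  qed
  have sq: "mv_square X SF' LF' SG' LG' SH' LH' SK' LK' p' q' a' b'"
    by (intro mv_square.intro mv_square_axioms.intro F'.etale_next G'.etale_next H'.etale_next K'.etale_next p'(1) q'(1) a'(1) b'(1))
      (fact comm' inj2 lift' surj' glob')+
  have "glob_lift X SF LF' \<phi>" unfolding glob_lift_def
  proof (intro allI impI)
    fix z assume z: "\<forall>x\<in>topspace X. LF' x z"
    have pz: "\<forall>x\<in>topspace X. LG' x (\<lambda>y. p' y (z y))" and qz: "\<forall>x\<in>topspace X. LH' x (\<lambda>y. q' y (z y))"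
      using z p'(1) q'(1) unfolding etale_hom_def by simp_all
    obtain g where g: "g \<in> families X SG" "\<forall>x\<in>topspace X. p' x (z x) = \<gamma> x g" using liftG[unfolded glob_lift_def, rule_format, of "\<lambda>y. p' y (z y)"] pz by auto
    obtain h where h: "h \<in> families X SH" "\<forall>x\<in>topspace X. q' x (z x) = \<eta> x h" using liftH[unfolded glob_lift_def, rule_format, of "\<lambda>y. q' y (z y)"] qz by auto
    \<comment> \<open>The lifts \<open>g\<close> and \<open>h\<close> were chosen independently.
      Their discrepancy is now a section of \<open>K\<close> at every point, so \<open>glob\<close>
      gives a global \<open>r\<close> over it, and dividing \<open>g\<close> by \<open>r\<close>
      keeps all its classes.\<close>
    let ?d = "\<lambda>y. a y (g y) \<otimes>\<^bsub>SK y\<^esub> inv\<^bsub>SK y\<^esub> b y (h y)"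
    have "LK x ?d" if x: "x \<in> topspace X" for x
    proof -
      have "\<kappa> x (\<lambda>y. a y (g y)) = a' x (p' x (z x))" using g(2) x a'(2)[OF x g(1)] by simp
      also have "\<dots> = b' x (q' x (z x))" using comm'[OF x] F'.L'_closed z x by simp
      also have "\<dots> = \<kappa> x (\<lambda>y. b y (h y))" using h(2) x b'(2)[OF x h(1)] by simp
      finally show ?thesis using K'.\<kappa>_eq_iff[OF x fam(3)[OF g(1)] fam(4)[OF h(1)]] by simp
    qed
    then obtain r where r: "\<forall>x\<in>topspace X. LG x r \<and> a x (r x) = ?d x" using glob[of ?d] by blast
    then have rT: "r \<in> families X SG" using G.L_global_families by blast
    define g' where "g' = (\<lambda>y. g y \<otimes>\<^bsub>SG y\<^esub> inv\<^bsub>SG y\<^esub> r y)"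
    have g': "g' \<in> families X SG" unfolding g'_def by (rule G.families_div[OF g(1) rT])
    have "a y (g' y) = b y (h y)" if y: "y \<in> topspace X" for y
    proof -
      have "a y (g' y) = a y (g y) \<otimes>\<^bsub>SK y\<^esub> inv\<^bsub>SK y\<^esub> (?d y)"
        unfolding g'_def using etale_hom_div[OF hom_a G.etale_axioms K.etale_axioms y] g(1) rT r y by (simp add: Pi_iff)
      also have "\<dots> = b y (h y)" by (rule K.div_div[OF y Pi_mem[OF fam(3)[OF g(1)] y] Pi_mem[OF fam(4)[OF h(1)] y]])
      finally show ?thesis .
    qed
    then obtain f where f: "f \<in> families X SF" "\<And>y. y \<in> topspace X \<Longrightarrow> p y (f y) = g' y" "\<And>y. y \<in> topspace X \<Longrightarrow> q y (f y) = h y"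
      using family_lift[OF subset_refl g' h(1)] by blast
    interpret sq: mv_square X SF' LF' SG' LG' SH' LH' SK' LK' p' q' a' b' by (rule sq)
    have "z x = \<phi> x f" if x: "x \<in> topspace X" for x
    proof (rule sq.inj'[OF x])
      show "z x \<in> carrier (SF' x)" using F'.L'_closed z x by simp
      show "\<phi> x f \<in> carrier (SF' x)" using F'.\<kappa>_closed[OF x f(1)] .
      have "p' x (\<phi> x f) = \<gamma> x g'" unfolding p'(2)[OF x f(1)] by (rule G'.\<kappa>_topspace[OF fam(1)[OF f(1)] g' x]) (rule f(2))
      also have "\<dots> = \<gamma> x g \<otimes>\<^bsub>SG' x\<^esub> inv\<^bsub>SG' x\<^esub> \<gamma> x r" unfolding g'_def by (rule G'.\<kappa>_div[OF x g(1) rT])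
      also have "\<gamma> x r = \<one>\<^bsub>SG' x\<^esub>" using r x G'.\<kappa>_one_iff[OF x rT] by simp
      also have "\<gamma> x g \<otimes>\<^bsub>SG' x\<^esub> inv\<^bsub>SG' x\<^esub> \<one>\<^bsub>SG' x\<^esub> = \<gamma> x g"
        by (rule etale.div_one[OF G'.etale_next x G'.\<kappa>_closed[OF x g(1)]])
      also have "\<dots> = p' x (z x)" using g(2) x by simp
      finally show "p' x (z x) = p' x (\<phi> x f)" ..
      have "q' x (\<phi> x f) = \<eta> x h" unfolding q'(2)[OF x f(1)] by (rule H'.\<kappa>_topspace[OF fam(2)[OF f(1)] h(1) x]) (rule f(3))
      then show "q' x (z x) = q' x (\<phi> x f)" using h(2) x by simp
    qed
    then show "\<exists>f\<in>families X SF. \<forall>x\<in>topspace X. z x = \<phi> x f" using f(1) by (intro bexI[of _ f]) auto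
  qed
  then show ?thesis using sq by blast
qed

end

section \<open>Stalks and global lifts in the Godement resolution\<close>

definition local_section :: "'x topology \<Rightarrow> ('x, 'a) presheaf \<Rightarrow> 'x \<Rightarrow> ('x \<Rightarrow> ('x set \<times> 'a) set) \<Rightarrow> bool" where
  "local_section X F x f \<longleftrightarrow>
     (\<exists>W. openin X W \<and> x \<in> W \<and> (\<exists>s\<in>carrier (sections F W). \<forall>y\<in>W. f y = germ X F y W s))"

context ab_presheaf
begin

lemma germ_hom: "\<lbrakk>openin X U; x \<in> U\<rbrakk> \<Longrightarrow> group_hom (sections F U) (stalk X F x) (germ X F x U)"
  using grp comm_group_stalk[OF topX] germ_in_stalk stalk_mult0
  by (auto simp: group_hom_def group_hom_axioms_def hom_def comm_group_def)

text \<open>A presheaf enters through its germs alone, so this is the stalk description of its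
  sheafification; the cokernel presheaves of the resolution fit although they need not be
  sheaves.\<close>

lemma etale_stalk: "etale X (stalk X F) (local_section X F)"
proof (rule etale.intro)
  show "x \<in> topspace X \<Longrightarrow> comm_group (stalk X F x)" for x by (rule comm_group_stalk)
  show "x \<in> topspace X \<and> f x \<in> carrier (stalk X F x)" if "local_section X F x f" for x f
    using that germ_in_stalk openin_subset unfolding local_section_def by fastforce
  show "local_section X F x g" if "local_section X F x f" "openin X W" "x \<in> W" "\<And>y. y \<in> W \<Longrightarrow> g y = f y" for x f W g
  proof -
    obtain V s where V: "openin X V" "x \<in> V" "s \<in> carrier (sections F V)" "\<forall>y\<in>V. f y = germ X F y V s"
      using \<open>local_section X F x f\<close> unfolding local_section_def by blast
    have o: "openin X (V \<inter> W)" using V that by blast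
    have "g y = germ X F y (V \<inter> W) (restr F V (V \<inter> W) s)" if "y \<in> V \<inter> W" for y
      using germ_restr[OF V(1) o _ that V(3)] V(4) \<open>\<And>y. y \<in> W \<Longrightarrow> g y = f y\<close> that by simp
    moreover have "restr F V (V \<inter> W) s \<in> carrier (sections F (V \<inter> W))" by (rule restr_closed[OF V(1) o _ V(3)]) simp
    ultimately show ?thesis unfolding local_section_def using o V(2) that(3) by blast
  qed
  show "\<exists>W. openin X W \<and> x \<in> W \<and> (\<forall>y\<in>W. local_section X F y f)" if "local_section X F x f" for x f
    using that unfolding local_section_def by blast
  show "local_section X F x (\<lambda>y. \<one>\<^bsub>stalk X F y\<^esub>)" if "x \<in> topspace X" for x
  proof -
    have "\<forall>y\<in>topspace X. \<one>\<^bsub>stalk X F y\<^esub> = germ X F y (topspace X) \<one>\<^bsub>sections F (topspace X)\<^esub>"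
      using stalk_one by simp
    moreover have "\<one>\<^bsub>sections F (topspace X)\<^esub> \<in> carrier (sections F (topspace X))"
      using grp by (simp add: group.is_monoid)
    ultimately show ?thesis unfolding local_section_def using that openin_topspace by blast
  qed
  show "local_section X F x (\<lambda>y. f y \<otimes>\<^bsub>stalk X F y\<^esub> inv\<^bsub>stalk X F y\<^esub> g y)"
    if fg: "local_section X F x f" "local_section X F x g" for x f g
  proof -
    obtain V s where V: "openin X V" "x \<in> V" "s \<in> carrier (sections F V)" "\<forall>y\<in>V. f y = germ X F y V s"
      using fg(1) unfolding local_section_def by blast
    obtain W t where W: "openin X W" "x \<in> W" "t \<in> carrier (sections F W)" "\<forall>y\<in>W. g y = germ X F y W t"
      using fg(2) unfolding local_section_def by blast
    let ?U = "V \<inter> W"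
    have o: "openin X ?U" using V W by blast
    have st: "restr F V ?U s \<in> carrier (sections F ?U)" "restr F W ?U t \<in> carrier (sections F ?U)"
      using restr_closed[OF V(1) o _ V(3)] restr_closed[OF W(1) o _ W(3)] by simp_all
    let ?r = "restr F V ?U s \<otimes>\<^bsub>sections F ?U\<^esub> inv\<^bsub>sections F ?U\<^esub> restr F W ?U t"
    interpret U: group "sections F ?U" by (rule grp[OF o])
    have "f y \<otimes>\<^bsub>stalk X F y\<^esub> inv\<^bsub>stalk X F y\<^esub> g y = germ X F y ?U ?r" if y: "y \<in> ?U" for y
    proof -
      interpret h: group_hom "sections F ?U" "stalk X F y" "germ X F y ?U" by (rule germ_hom[OF o y])
      have "germ X F y ?U ?r = germ X F y ?U (restr F V ?U s) \<otimes>\<^bsub>stalk X F y\<^esub> inv\<^bsub>stalk X F y\<^esub> germ X F y ?U (restr F W ?U t)"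
        using st by simp
      then show ?thesis using germ_restr[OF V(1) o _ y V(3)] germ_restr[OF W(1) o _ y W(3)] V(4) W(4) y by simp
    qed
    moreover have "?r \<in> carrier (sections F ?U)" using st by simp
    ultimately show ?thesis unfolding local_section_def using o V(2) W(2) by blast
  qed
  show "\<exists>f. local_section X F x f \<and> f x = s" if x: "x \<in> topspace X" "s \<in> carrier (stalk X F x)" for x s
  proof -
    obtain U t where U: "s = germ X F x U t" "openin X U" "x \<in> U" "t \<in> carrier (sections F U)"
      using x(2) unfolding stalk_carrier by blast
    then have "local_section X F x (\<lambda>y. germ X F y U t)" unfolding local_section_def by blast
    then show ?thesis using U(1) by blast
  qed
  show "\<exists>W. openin X W \<and> x \<in> W \<and> (\<forall>y\<in>W. f y = g y)"
    if fg: "local_section X F x f" "local_section X F x g" "f x = g x" for x f g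
  proof -
    obtain V s where V: "openin X V" "x \<in> V" "s \<in> carrier (sections F V)" "\<forall>y\<in>V. f y = germ X F y V s"
      using fg(1) unfolding local_section_def by blast
    obtain W t where W: "openin X W" "x \<in> W" "t \<in> carrier (sections F W)" "\<forall>y\<in>W. g y = germ X F y W t"
      using fg(2) unfolding local_section_def by blast
    have "germ X F x V s = germ X F x W t" using fg(3) V W by simp
    then obtain U where U: "openin X U" "x \<in> U" "U \<subseteq> V \<inter> W" "restr F V U s = restr F W U t"
      using germ_eq_iff[OF V(1-3) W(1-3)] by blast
    have "f y = g y" if y: "y \<in> U" for y
    proof -
      have "germ X F y U (restr F V U s) = germ X F y V s" "germ X F y U (restr F W U t) = germ X F y W t"
        using germ_restr[OF V(1) U(1) _ y V(3)] germ_restr[OF W(1) U(1) _ y W(3)] U(3) by simp_all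
      then show ?thesis using V(4) W(4) U(3,4) y by (metis IntE subsetD)
    qed
    then show ?thesis using U by blast
  qed
qed

lemma godement_carrier: "carrier (sections (godement X F) U) = (\<Pi>\<^sub>E x\<in>U. carrier (stalk X F x))"
  by (simp add: godement_def)

lemma image_iff: "g \<in> godement_image X F U \<longleftrightarrow> (\<exists>s\<in>carrier (sections F U). g = (\<lambda>x\<in>U. germ X F x U s))"
  by (auto simp: godement_image_def godement_unit_def)

end

text \<open>The tree that names the class of the discontinuous section \<open>g\<close> in the next
  syzygy.\<close>

definition coset_code :: "'x topology \<Rightarrow> ('x, ('x, 'a) tree) presheaf \<Rightarrow> 'x set \<Rightarrow> ('x \<Rightarrow> ('x set \<times> ('x, 'a) tree) set) \<Rightarrow> ('x, 'a) tree" where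
  "coset_code X Z U g = encode (godement_image X Z U #>\<^bsub>sections (godement X Z) U\<^esub> g)"

text \<open>The map \<kappa> of \<open>etale_step\<close> for the Godement resolution. A family is
  defined on the whole space, so its class can be formed there before taking the germ; the
  restriction makes it extensional, as sections of \<open>godement\<close> are.\<close>

definition coker_germ ::
    "'x topology \<Rightarrow> ('x, ('x, 'a) tree) presheaf \<Rightarrow> 'x \<Rightarrow> ('x \<Rightarrow> ('x set \<times> ('x, 'a) tree) set) \<Rightarrow> ('x set \<times> ('x, 'a) tree) set" where
  "coker_germ X Z x f =
     germ X (relabel encode (godement_coker X Z)) x (topspace X) (coset_code X Z (topspace X) (restrict f (topspace X)))"

locale tree_presheaf = Z: ab_presheaf X Z for X and Z :: "('x, ('x, 'a) tree) presheaf"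
begin

abbreviation "Z' \<equiv> relabel encode (godement_coker X Z)"

sublocale K: ab_presheaf X "godement_coker X Z" by (rule Z.coker_presheaf)

lemma next_presheaf: "ab_presheaf X Z'"
  by (rule K.relabel_presheaf) (rule inj_on_encode[OF Z.ab_presheaf_axioms])

sublocale Z': ab_presheaf X Z' by (rule next_presheaf)

lemma code_carrier: "carrier (sections Z' U) = coset_code X Z U ` carrier (sections (godement X Z) U)"
  by (simp add: K.relabel_carrier Z.coker_carrier image_image coset_code_def)

lemma code_closed: "g \<in> carrier (sections (godement X Z) U) \<Longrightarrow> coset_code X Z U g \<in> carrier (sections Z' U)"
  by (simp add: code_carrier)

lemma code_restr:
  assumes "openin X U" "openin X V" "V \<subseteq> U" "g \<in> carrier (sections (godement X Z) U)"
  shows "restr Z' U V (coset_code X Z U g) = coset_code X Z V (restrict g V)"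
proof -
  have "godement_image X Z U #>\<^bsub>sections (godement X Z) U\<^esub> g \<in> carrier (sections (godement_coker X Z) U)"
    using assms(4) by (simp add: Z.coker_carrier)
  then have "restr Z' U V (coset_code X Z U g) = encode (restr (godement_coker X Z) U V (godement_image X Z U #>\<^bsub>sections (godement X Z) U\<^esub> g))"
    unfolding coset_code_def by (rule K.relabel_restr[OF inj_on_encode[OF Z.ab_presheaf_axioms assms(1)]])
  then show ?thesis unfolding Z.coker_restr[OF assms] by (simp add: coset_code_def godement_def)
qed

lemma code_mult:
  assumes "openin X U" "g \<in> carrier (sections (godement X Z) U)" "h \<in> carrier (sections (godement X Z) U)"
  shows "coset_code X Z U g \<otimes>\<^bsub>sections Z' U\<^esub> coset_code X Z U h = coset_code X Z U (g \<otimes>\<^bsub>sections (godement X Z) U\<^esub> h)"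
  using K.relabel_mult[OF inj_on_encode[OF Z.ab_presheaf_axioms assms(1)]] assms Z.coker_mult[OF assms]
  by (simp add: coset_code_def Z.coker_carrier)

lemma code_one_iff:
  assumes "openin X U" "g \<in> carrier (sections (godement X Z) U)"
  shows "coset_code X Z U g = \<one>\<^bsub>sections Z' U\<^esub> \<longleftrightarrow> g \<in> godement_image X Z U"
proof -
  interpret n: normal "godement_image X Z U" "sections (godement X Z) U" by (rule Z.normal_image[OF assms(1)])
  have "coset_code X Z U g = \<one>\<^bsub>sections Z' U\<^esub> \<longleftrightarrow> godement_image X Z U #>\<^bsub>sections (godement X Z) U\<^esub> g = \<one>\<^bsub>sections (godement_coker X Z) U\<^esub>"
    unfolding coset_code_def K.relabel_one
    by (rule inj_on_eq_iff[OF inj_on_encode[OF Z.ab_presheaf_axioms assms(1)]])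
      (use assms(2) monoid.one_closed[OF group.is_monoid[OF K.grp[OF assms(1)]]] in \<open>simp_all add: Z.coker_carrier\<close>)
  also have "\<dots> \<longleftrightarrow> g \<in> godement_image X Z U"
    unfolding Z.coker_one using n.rcos_const n.rcos_self[OF assms(2) n.subgroup_axioms] by auto
  finally show ?thesis .
qed

lemma families_restrict: "\<lbrakk>f \<in> families X (stalk X Z); openin X U\<rbrakk> \<Longrightarrow> restrict f U \<in> carrier (sections (godement X Z) U)"
  using Z.topX by (auto simp: Z.godement_carrier Pi_iff)

text \<open>Forming classes commutes with restriction, so the germ may be computed over any
  neighbourhood.\<close>

lemma coker_germ_eq:
  assumes "f \<in> families X (stalk X Z)" "openin X U" "x \<in> U"
  shows "coker_germ X Z x f = germ X Z' x U (coset_code X Z U (restrict f U))"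
proof -
  have U: "U \<subseteq> topspace X" using assms(2) by (rule openin_subset)
  have c: "restrict f (topspace X) \<in> carrier (sections (godement X Z) (topspace X))"
    using families_restrict[OF assms(1)] by simp
  have "germ X Z' x U (restr Z' (topspace X) U (coset_code X Z (topspace X) (restrict f (topspace X)))) = coker_germ X Z x f"
    unfolding coker_germ_def using Z'.germ_restr[OF openin_topspace assms(2) U assms(3) code_closed[OF c]] .
  then show ?thesis using code_restr[OF openin_topspace assms(2) U c] U by (simp add: restrict_restrict Int_absorb1)
qed

text \<open>The Godement sheaf is flasque: a discontinuous section extends by one.\<close>

lemma family_of_section:
  assumes U: "openin X U" and g: "g \<in> carrier (sections (godement X Z) U)"
  obtains f where "f \<in> families X (stalk X Z)" "restrict f U = g"
proof
  let ?f = "\<lambda>y. if y \<in> U then g y else \<one>\<^bsub>stalk X Z y\<^esub>"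
  show "?f \<in> families X (stalk X Z)"
    using g etale.one_cl[OF Z.etale_stalk] by (auto simp: Z.godement_carrier PiE_iff)
  show "restrict ?f U = g"
    using g by (auto simp: Z.godement_carrier PiE_iff extensional_def fun_eq_iff)
qed

text \<open>Since discontinuous sections extend to the whole space, every germ of the cokernel comes
  from a global family, and a family dies in the stalk exactly when it is a section of
  \<open>Z\<close> near the point.\<close>

lemma step: "etale_step X (stalk X Z) (local_section X Z) (stalk X Z') (local_section X Z') (coker_germ X Z)"
proof (intro etale_step.intro etale_step_axioms.intro Z.etale_stalk)
  interpret E: etale X "stalk X Z" "local_section X Z" by (rule Z.etale_stalk)
  have top: "openin X (topspace X)" by simp
  show "x \<in> topspace X \<Longrightarrow> comm_group (stalk X Z' x)" for x by (rule Z'.comm_group_stalk)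
  show "coker_germ X Z x f = coker_germ X Z x g" if "\<And>y. y \<in> topspace X \<Longrightarrow> f y = g y" for f g x
  proof -
    have "restrict f (topspace X) = restrict g (topspace X)" using that by (auto simp: fun_eq_iff)
    then show ?thesis by (simp add: coker_germ_def)
  qed
  show "coker_germ X Z x (\<lambda>y. f y \<otimes>\<^bsub>stalk X Z y\<^esub> g y) = coker_germ X Z x f \<otimes>\<^bsub>stalk X Z' x\<^esub> coker_germ X Z x g"
    if x: "x \<in> topspace X" and f: "f \<in> families X (stalk X Z)" and g: "g \<in> families X (stalk X Z)" for x f g
  proof -
    have c: "restrict f (topspace X) \<in> carrier (sections (godement X Z) (topspace X))"
      "restrict g (topspace X) \<in> carrier (sections (godement X Z) (topspace X))"
      using families_restrict[OF f top] families_restrict[OF g top] by simp_all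
    have "restrict (\<lambda>y. f y \<otimes>\<^bsub>stalk X Z y\<^esub> g y) (topspace X)
       = restrict f (topspace X) \<otimes>\<^bsub>sections (godement X Z) (topspace X)\<^esub> restrict g (topspace X)"
      by (auto simp: godement_def product_group_def fun_eq_iff)
    then show ?thesis unfolding coker_germ_def
      using Z'.stalk_mult0[OF top x code_closed[OF c(1)] code_closed[OF c(2)]] code_mult[OF top c] by simp
  qed
  show "coker_germ X Z x ` families X (stalk X Z) = carrier (stalk X Z' x)" if x: "x \<in> topspace X" for x
  proof (intro equalityI subsetI)
    fix s assume "s \<in> coker_germ X Z x ` families X (stalk X Z)"
    then obtain f where f: "f \<in> families X (stalk X Z)" "s = coker_germ X Z x f" by (rule imageE)
    show "s \<in> carrier (stalk X Z' x)" unfolding f(2) coker_germ_def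
      by (rule Z'.germ_in_stalk[OF top x code_closed[OF families_restrict[OF f(1) top]]])
  next
    fix s assume "s \<in> carrier (stalk X Z' x)"
    then obtain U t where U: "s = germ X Z' x U t" "openin X U" "x \<in> U" "t \<in> carrier (sections Z' U)"
      unfolding Z'.stalk_carrier by blast
    obtain g where g: "g \<in> carrier (sections (godement X Z) U)" "t = coset_code X Z U g"
      using U(4) unfolding code_carrier by (rule imageE)
    obtain f where f: "f \<in> families X (stalk X Z)" "restrict f U = g" using family_of_section[OF U(2) g(1)] .
    have "s = coker_germ X Z x f" using coker_germ_eq[OF f(1) U(2,3)] U(1) g(2) f(2) by simp
    then show "s \<in> coker_germ X Z x ` families X (stalk X Z)" using f(1) by (rule image_eqI)
  qed
  show "coker_germ X Z x f = \<one>\<^bsub>stalk X Z' x\<^esub> \<longleftrightarrow> local_section X Z x f"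
    if x: "x \<in> topspace X" and f: "f \<in> families X (stalk X Z)" for x f
  proof -
    have c: "restrict f (topspace X) \<in> carrier (sections (godement X Z) (topspace X))"
      using families_restrict[OF f top] .
    have o: "\<one>\<^bsub>sections Z' (topspace X)\<^esub> \<in> carrier (sections Z' (topspace X))" using Z'.grp[OF top] by (simp add: group.is_monoid)
    have r1: "restr Z' (topspace X) W \<one>\<^bsub>sections Z' (topspace X)\<^esub> = \<one>\<^bsub>sections Z' W\<^esub>" if "openin X W" for W
      using hom_one[OF Z'.restr_hom[OF top that openin_subset[OF that]] Z'.grp[OF top] Z'.grp[OF that]] .
    have rf: "restr Z' (topspace X) W (coset_code X Z (topspace X) (restrict f (topspace X))) = coset_code X Z W (restrict f W)"
      if "openin X W" for W
      using code_restr[OF top that openin_subset[OF that] c] openin_subset[OF that] by (simp add: restrict_restrict Int_absorb1)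
    \<comment> \<open>Triviality of the germ means triviality of the class over some neighbourhood,
      that is, membership in the image of the sections of \<open>Z\<close>.\<close>
    have "coker_germ X Z x f = \<one>\<^bsub>stalk X Z' x\<^esub> \<longleftrightarrow> (\<exists>W. openin X W \<and> x \<in> W \<and> W \<subseteq> topspace X \<inter> topspace X \<and>
        restr Z' (topspace X) W (coset_code X Z (topspace X) (restrict f (topspace X))) = restr Z' (topspace X) W \<one>\<^bsub>sections Z' (topspace X)\<^esub>)"
      unfolding coker_germ_def Z'.stalk_one[OF top x]
      by (rule Z'.germ_eq_iff[OF top x code_closed[OF c] top x o])
    also have "\<dots> \<longleftrightarrow> (\<exists>W. openin X W \<and> x \<in> W \<and> restrict f W \<in> godement_image X Z W)"
      using rf r1 code_one_iff families_restrict[OF f] openin_subset by (metis Int_absorb)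
    also have "\<dots> \<longleftrightarrow> local_section X Z x f"
      unfolding Z.image_iff local_section_def
      by (intro ex_cong1 conj_cong bex_cong refl) (auto simp: fun_eq_iff restrict_def)
    finally show ?thesis .
  qed
  show "local_section X Z' x z \<longleftrightarrow> (\<exists>W. openin X W \<and> x \<in> W \<and> (\<exists>f\<in>families X (stalk X Z). \<forall>y\<in>W. z y = coker_germ X Z y f))" for x z
    unfolding local_section_def
  proof (intro ex_cong1 conj_cong refl iffI)
    fix W assume W: "openin X W"
    { assume "\<exists>s\<in>carrier (sections Z' W). \<forall>y\<in>W. z y = germ X Z' y W s"
      then obtain s where s: "s \<in> carrier (sections Z' W)" "\<forall>y\<in>W. z y = germ X Z' y W s" by (rule bexE)
      obtain g where g: "g \<in> carrier (sections (godement X Z) W)" "s = coset_code X Z W g"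
        using s(1) unfolding code_carrier by (rule imageE)
      obtain f where f: "f \<in> families X (stalk X Z)" "restrict f W = g" using family_of_section[OF W g(1)] .
      have "\<forall>y\<in>W. z y = coker_germ X Z y f" using coker_germ_eq[OF f(1) W] s(2) g(2) f(2) by simp
      then show "\<exists>f\<in>families X (stalk X Z). \<forall>y\<in>W. z y = coker_germ X Z y f" using f(1) by (rule bexI) }
    { assume "\<exists>f\<in>families X (stalk X Z). \<forall>y\<in>W. z y = coker_germ X Z y f"
      then obtain f where f: "f \<in> families X (stalk X Z)" "\<forall>y\<in>W. z y = coker_germ X Z y f" by (rule bexE)
      have "\<forall>y\<in>W. z y = germ X Z' y W (coset_code X Z W (restrict f W))" using coker_germ_eq[OF f(1) W] f(2) by simp
      then show "\<exists>s\<in>carrier (sections Z' W). \<forall>y\<in>W. z y = germ X Z' y W s"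
        using code_closed[OF families_restrict[OF f(1) W]] by (rule bexI) }
  qed
qed

end

text \<open>By dimension shifting, the condition at \<open>n\<close> is the vanishing of the
  cohomology of \<open>F\<close> in degree \<open>n + 1\<close>.\<close>

definition acyclic_presheaf :: "'x topology \<Rightarrow> ('x, 'a) presheaf \<Rightarrow> bool" where
  "acyclic_presheaf X F \<longleftrightarrow>
     (\<forall>n. glob_lift X (stalk X (syzygy X F n)) (local_section X (syzygy X F (Suc n))) (coker_germ X (syzygy X F n)))"

lemma (in ab_presheaf) syzygy_step:
  "etale_step X (stalk X (syzygy X F n)) (local_section X (syzygy X F n))
     (stalk X (syzygy X F (Suc n))) (local_section X (syzygy X F (Suc n))) (coker_germ X (syzygy X F n))"
  using tree_presheaf.step[of X "syzygy X F n"] syzygy_presheaf[of n] by (simp add: tree_presheaf_def)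

text \<open>A cocycle in degree \<open>Suc n\<close> has trivial class at every point, so it is a
  global section of the syzygy \<open>Suc n\<close>; acyclicity at \<open>n\<close> writes it as the
  class of a family, which is a coboundary.\<close>

lemma (in ab_presheaf) acyclic_cohomology:
  assumes ac: "acyclic_presheaf X F"
  shows "trivial_group (sheaf_cohomology (Suc n) X F)"
proof -
  let ?Z = "syzygy X F" and ?T = "topspace X" and ?C = "canonical_resolution X F"
  have Z: "ab_presheaf X (?Z m)" for m by (rule syzygy_presheaf)
  have Cg: "group (sections (?C m) ?T)" for m
    unfolding canonical_resolution_def
    by (rule ab_presheaf.grp[OF ab_presheaf.godement_presheaf[OF Z] openin_topspace])
  have carr: "carrier (sections (?C m) ?T) = (\<Pi>\<^sub>E x\<in>?T. carrier (stalk X (?Z m) x))" for m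
    unfolding canonical_resolution_def by (rule ab_presheaf.godement_carrier[OF Z])
  \<comment> \<open>In this form the differential is the map \<kappa> taken at every point, without
    cosets and codes.\<close>
  have diff: "differential X F m ?T f = (\<lambda>x\<in>?T. coker_germ X (?Z m) x f)" if "f \<in> carrier (sections (?C m) ?T)" for m f
  proof -
    have "restrict f ?T = f" using that unfolding carr PiE_def by (intro extensional_restrict) (rule IntD2)
    then show ?thesis
      unfolding differential_def godement_unit_def coker_germ_def coset_code_def canonical_resolution_def by simp
  qed
  have sub: "cocycles X F (Suc n) \<subseteq> coboundaries X F (Suc n)"
  proof
    fix f assume f: "f \<in> cocycles X F (Suc n)"
    have "f \<in> carrier (sections (?C (Suc n)) ?T) \<and> differential X F (Suc n) ?T f = \<one>\<^bsub>sections (?C (Suc (Suc n))) ?T\<^esub>"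
      using f unfolding cocycles_def kernel_def by (rule CollectD)
    then have fc: "f \<in> carrier (sections (?C (Suc n)) ?T)"
      and d: "differential X F (Suc n) ?T f = \<one>\<^bsub>sections (?C (Suc (Suc n))) ?T\<^esub>" by (rule conjunct1, rule conjunct2)
    have fam: "f \<in> families X (stalk X (?Z (Suc n)))" using fc unfolding carr by (auto simp: PiE_iff)
    interpret s: etale_step X "stalk X (?Z (Suc n))" "local_section X (?Z (Suc n))"
      "stalk X (?Z (Suc (Suc n)))" "local_section X (?Z (Suc (Suc n)))" "coker_germ X (?Z (Suc n))"
      by (rule syzygy_step)
    \<comment> \<open>The kernel of the differential, read pointwise through
      \<open>\<kappa>_one_iff\<close>.\<close>
    have loc: "local_section X (?Z (Suc n)) x f" if x: "x \<in> ?T" for x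
    proof -
      have "coker_germ X (?Z (Suc n)) x f = differential X F (Suc n) ?T f x" unfolding diff[OF fc] using x by simp
      also have "\<dots> = \<one>\<^bsub>stalk X (?Z (Suc (Suc n))) x\<^esub>"
        unfolding d using x by (simp add: canonical_resolution_def godement_def del: syzygy.simps)
      finally have "coker_germ X (?Z (Suc n)) x f = \<one>\<^bsub>stalk X (?Z (Suc (Suc n))) x\<^esub>" .
      then show ?thesis unfolding s.\<kappa>_one_iff[OF x fam] .
    qed
    have "\<exists>h\<in>families X (stalk X (?Z n)). \<forall>x\<in>?T. f x = coker_germ X (?Z n) x h"
      by (rule ac[unfolded acyclic_presheaf_def glob_lift_def, rule_format]) (rule loc)
    then obtain h where h: "h \<in> families X (stalk X (?Z n))" "\<forall>x\<in>?T. f x = coker_germ X (?Z n) x h" by (rule bexE)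
    let ?h = "restrict h ?T"
    have hc: "?h \<in> carrier (sections (?C n) ?T)" unfolding carr using h(1) by auto
    have "differential X F n ?T ?h = f"
    proof
      fix x show "differential X F n ?T ?h x = f x"
        unfolding diff[OF hc] using h(2) fc unfolding carr by (auto simp: coker_germ_def PiE_iff extensional_def)
    qed
    then show "f \<in> coboundaries X F (Suc n)" unfolding coboundaries.simps using hc by (rule image_eqI[OF sym])
  qed
  let ?H = "sheaf_cohomology (Suc n) X F"
  have g: "group ?H" using cohomology_comm_group comm_group.axioms(2) by blast
  have one: "\<one>\<^bsub>?H\<^esub> = coboundaries X F (Suc n)" by (simp only: sheaf_cohomology_def one_FactGroup)
  interpret C: group "sections (?C (Suc n)) ?T"
    by (rule Cg)
  have hom: "group_hom (sections (?C n) ?T) (sections (?C (Suc n)) ?T) (differential X F n ?T)"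
    by (intro group_hom.intro group_hom_axioms.intro Cg differential_hom openin_topspace)
  have B: "subgroup (coboundaries X F (Suc n)) (sections (?C (Suc n)) ?T)"
    unfolding coboundaries.simps by (rule group_hom.img_is_subgroup[OF hom])
  have sing: "c = coboundaries X F (Suc n)" if "c \<in> carrier ?H" for c
  proof -
    have rc: "N #>\<^bsub>G\<lparr>carrier := H\<rparr>\<^esub> f = N #>\<^bsub>G\<^esub> f" for N H f and G :: "('x \<Rightarrow> ('x set \<times> ('x, 'a) tree) set) monoid"
      by (simp add: r_coset_def)
    have cc: "carrier (G\<lparr>carrier := H\<rparr>) = H" for H and G :: "('x \<Rightarrow> ('x set \<times> ('x, 'a) tree) set) monoid"
      by simp
    from that obtain f where "c = coboundaries X F (Suc n) #>\<^bsub>sections (?C (Suc n)) ?T\<lparr>carrier := cocycles X F (Suc n)\<rparr>\<^esub> f"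
      "f \<in> carrier (sections (?C (Suc n)) ?T\<lparr>carrier := cocycles X F (Suc n)\<rparr>)"
      unfolding sheaf_cohomology_def carrier_FactGroup by (rule imageE)
    then have f: "f \<in> cocycles X F (Suc n)" "c = coboundaries X F (Suc n) #>\<^bsub>sections (?C (Suc n)) ?T\<^esub> f"
      unfolding rc cc by (simp_all only:)
    have fB: "f \<in> coboundaries X F (Suc n)" using sub f(1) by (rule subsetD)
    show ?thesis unfolding f(2) by (rule C.coset_join2[OF subgroup.mem_carrier[OF B fB] B fB])
  qed
  have "carrier ?H = {\<one>\<^bsub>?H\<^esub>}"
  proof (rule equalityI; rule subsetI)
    fix c assume "c \<in> carrier ?H"
    then have "c = \<one>\<^bsub>?H\<^esub>" unfolding one by (rule sing)
    then show "c \<in> {\<one>\<^bsub>?H\<^esub>}" by (simp only: singleton_iff)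
  next
    fix c assume "c \<in> {\<one>\<^bsub>?H\<^esub>}"
    then have "c = \<one>\<^bsub>?H\<^esub>" by (rule singletonD)
    then show "c \<in> carrier ?H" using monoid.one_closed[OF group.is_monoid[OF g]] by (rule ssubst)
  qed
  with g show ?thesis unfolding trivial_group_def by (rule conjI)
qed

section \<open>Concrete sheaves at the start of the resolution\<close>

lemma etale_step_iso:
  assumes A: "etale X A M" and S: "etale_step X S L S' L' \<kappa>"
    and iso: "\<And>x. x \<in> topspace X \<Longrightarrow> \<psi> x \<in> iso (A x) (S x)"
    and LM: "\<And>x f. \<lbrakk>x \<in> topspace X; f \<in> families X A\<rbrakk> \<Longrightarrow> M x f \<longleftrightarrow> L x (\<lambda>y. \<psi> y (f y))"
  shows "etale_step X A M S' L' (\<lambda>x f. \<kappa> x (\<lambda>y. \<psi> y (f y)))" (is ?step)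
    and "glob_lift X S L' \<kappa> \<longleftrightarrow> glob_lift X A L' (\<lambda>x f. \<kappa> x (\<lambda>y. \<psi> y (f y)))" (is ?lift)
proof -
  interpret A: etale X A M by (rule A)
  interpret S: etale_step X S L S' L' \<kappa> by (rule S)
  have fam: "(\<lambda>y. \<psi> y (f y)) \<in> families X S" if "f \<in> families X A" for f
    using that iso by (auto simp: iso_def hom_def Pi_iff)
  \<comment> \<open>Families transport back along the isomorphisms of stalks pointwise; every clause
    below is reduced to this.\<close>
  have ex: "\<exists>f\<in>families X A. \<forall>y\<in>topspace X. \<psi> y (f y) = g y" if g: "g \<in> families X S" for g
  proof -
    have "\<forall>y\<in>topspace X. \<exists>a. a \<in> carrier (A y) \<and> \<psi> y a = g y"
    proof
      fix y assume y: "y \<in> topspace X"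
      have "g y \<in> \<psi> y ` carrier (A y)" using iso[OF y] Pi_mem[OF g y] by (simp add: iso_def bij_betw_def)
      then show "\<exists>a. a \<in> carrier (A y) \<and> \<psi> y a = g y" by auto
    qed
    from bchoice[OF this] show ?thesis by auto
  qed
  have \<kappa>ex: "\<exists>f\<in>families X A. \<forall>y\<in>topspace X. \<kappa> y g = \<kappa> y (\<lambda>y. \<psi> y (f y))" if g: "g \<in> families X S" for g
  proof -
    obtain f where f: "f \<in> families X A" "\<forall>y\<in>topspace X. \<psi> y (f y) = g y" using ex[OF g] by (rule bexE)
    have "\<kappa> y g = \<kappa> y (\<lambda>y. \<psi> y (f y))" if "y \<in> topspace X" for y
      by (rule S.\<kappa>_topspace[OF g fam[OF f(1)] that]) (use f(2) in simp)
    then show ?thesis using f(1) by (intro bexI[of _ f]) auto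
  qed
  show ?step
  proof (intro etale_step.intro etale_step_axioms.intro A)
    show "x \<in> topspace X \<Longrightarrow> comm_group (S' x)" for x by (rule S.comm_group_S')
    show "\<kappa> x (\<lambda>y. \<psi> y (f y)) = \<kappa> x (\<lambda>y. \<psi> y (g y))"
      if "f \<in> families X A" "g \<in> families X A" "x \<in> topspace X" "\<And>y. y \<in> topspace X \<Longrightarrow> f y = g y" for x f g
      by (rule S.\<kappa>_topspace[OF fam[OF that(1)] fam[OF that(2)] that(3)]) (use that(4) in simp)
    show "\<kappa> x (\<lambda>y. \<psi> y (f y \<otimes>\<^bsub>A y\<^esub> g y)) = \<kappa> x (\<lambda>y. \<psi> y (f y)) \<otimes>\<^bsub>S' x\<^esub> \<kappa> x (\<lambda>y. \<psi> y (g y))"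
      if x: "x \<in> topspace X" and fg: "f \<in> families X A" "g \<in> families X A" for x f g
    proof -
      have "\<kappa> x (\<lambda>y. \<psi> y (f y \<otimes>\<^bsub>A y\<^esub> g y)) = \<kappa> x (\<lambda>y. \<psi> y (f y) \<otimes>\<^bsub>S y\<^esub> \<psi> y (g y))"
        by (rule S.\<kappa>_topspace[OF fam[OF A.families_mult[OF fg]] S.families_mult[OF fam[OF fg(1)] fam[OF fg(2)]] x])
          (use iso fg in \<open>auto simp: iso_def hom_def Pi_iff\<close>)
      then show ?thesis using S.\<kappa>_mult[OF x fam[OF fg(1)] fam[OF fg(2)]] by simp
    qed
    show "(\<lambda>f. \<kappa> x (\<lambda>y. \<psi> y (f y))) ` families X A = carrier (S' x)" if x: "x \<in> topspace X" for x
    proof (intro equalityI subsetI)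
      fix s assume "s \<in> (\<lambda>f. \<kappa> x (\<lambda>y. \<psi> y (f y))) ` families X A"
      then obtain f where "s = \<kappa> x (\<lambda>y. \<psi> y (f y))" "f \<in> families X A" by (rule imageE)
      then show "s \<in> carrier (S' x)" using S.\<kappa>_closed[OF x fam] by simp
    next
      fix s assume "s \<in> carrier (S' x)"
      then obtain g where g: "g \<in> families X S" "s = \<kappa> x g" using S.\<kappa>_surj[OF x] by blast
      obtain f where f: "f \<in> families X A" "\<forall>y\<in>topspace X. \<kappa> y g = \<kappa> y (\<lambda>y. \<psi> y (f y))" using \<kappa>ex[OF g(1)] by (rule bexE)
      show "s \<in> (\<lambda>f. \<kappa> x (\<lambda>y. \<psi> y (f y))) ` families X A" using f x g(2) by (intro image_eqI[of _ _ f]) auto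
    qed
    show "\<kappa> x (\<lambda>y. \<psi> y (f y)) = \<one>\<^bsub>S' x\<^esub> \<longleftrightarrow> M x f" if "x \<in> topspace X" "f \<in> families X A" for x f
      using S.\<kappa>_one_iff[OF that(1) fam[OF that(2)]] LM[OF that] by simp
    show "L' x z \<longleftrightarrow> (\<exists>W. openin X W \<and> x \<in> W \<and> (\<exists>f\<in>families X A. \<forall>y\<in>W. z y = \<kappa> y (\<lambda>y. \<psi> y (f y))))" for x z
      unfolding S.L'_iff
    proof (intro ex_cong1 conj_cong refl iffI)
      fix W assume W: "openin X W"
      { assume "\<exists>g\<in>families X S. \<forall>y\<in>W. z y = \<kappa> y g"
        then obtain g where g: "g \<in> families X S" "\<forall>y\<in>W. z y = \<kappa> y g" by (rule bexE)
        obtain f where f: "f \<in> families X A" "\<forall>y\<in>topspace X. \<kappa> y g = \<kappa> y (\<lambda>y. \<psi> y (f y))" using \<kappa>ex[OF g(1)] by (rule bexE)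
        have "\<forall>y\<in>W. z y = \<kappa> y (\<lambda>y. \<psi> y (f y))" using g(2) f(2) openin_subset[OF W] by auto
        then show "\<exists>f\<in>families X A. \<forall>y\<in>W. z y = \<kappa> y (\<lambda>y. \<psi> y (f y))" using f(1) by (rule bexI) }
      { assume "\<exists>f\<in>families X A. \<forall>y\<in>W. z y = \<kappa> y (\<lambda>y. \<psi> y (f y))"
        then obtain f where f: "f \<in> families X A" "\<forall>y\<in>W. z y = \<kappa> y (\<lambda>y. \<psi> y (f y))" by (rule bexE)
        show "\<exists>g\<in>families X S. \<forall>y\<in>W. z y = \<kappa> y g" using f(2) fam[OF f(1)] by (intro bexI[of _ "\<lambda>y. \<psi> y (f y)"]) }
    qed
  qed
  show ?lift
    unfolding glob_lift_def
  proof (intro all_cong1 imp_cong refl iffI)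
    fix z
    { assume "\<exists>g\<in>families X S. \<forall>y\<in>topspace X. z y = \<kappa> y g"
      then obtain g where g: "g \<in> families X S" "\<forall>y\<in>topspace X. z y = \<kappa> y g" by (rule bexE)
      obtain f where f: "f \<in> families X A" "\<forall>y\<in>topspace X. \<kappa> y g = \<kappa> y (\<lambda>y. \<psi> y (f y))" using \<kappa>ex[OF g(1)] by (rule bexE)
      have "\<forall>y\<in>topspace X. z y = \<kappa> y (\<lambda>y. \<psi> y (f y))" using g(2) f(2) by auto
      then show "\<exists>f\<in>families X A. \<forall>y\<in>topspace X. z y = \<kappa> y (\<lambda>y. \<psi> y (f y))" using f(1) by (rule bexI) }
    { assume "\<exists>f\<in>families X A. \<forall>y\<in>topspace X. z y = \<kappa> y (\<lambda>y. \<psi> y (f y))"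
      then obtain f where f: "f \<in> families X A" "\<forall>y\<in>topspace X. z y = \<kappa> y (\<lambda>y. \<psi> y (f y))" by (rule bexE)
      show "\<exists>g\<in>families X S. \<forall>y\<in>topspace X. z y = \<kappa> y g" using f(2) fam[OF f(1)] by (intro bexI[of _ "\<lambda>y. \<psi> y (f y)"]) }
  qed
qed

text \<open>Ties a presheaf of functions to a stalk description. It covers both the sheaf of units
  as defined by local fractions and the presheaf of all sections of arbitrary stalk data.\<close>

locale etale_presheaf = E: etale X A L + F: ab_presheaf X F
  for X :: "'x topology" and A :: "'x \<Rightarrow> 's monoid" and L and F :: "('x, 'x \<Rightarrow> 's) presheaf" +
  assumes sec_carrier: "openin X U \<Longrightarrow> carrier (sections F U) = {s \<in> extensional U. \<forall>x\<in>U. L x s}"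
    and sec_mult: "\<lbrakk>openin X U; s \<in> carrier (sections F U); t \<in> carrier (sections F U)\<rbrakk> \<Longrightarrow>
          s \<otimes>\<^bsub>sections F U\<^esub> t = (\<lambda>x\<in>U. s x \<otimes>\<^bsub>A x\<^esub> t x)"
    and sec_restr: "\<lbrakk>openin X U; openin X V; V \<subseteq> U; s \<in> carrier (sections F U)\<rbrakk> \<Longrightarrow> restr F U V s = restrict s V"
begin

abbreviation "Z0 \<equiv> (relabel Leaf F :: ('x, ('x, 'x \<Rightarrow> 's) tree) presheaf)"

lemma Z0: "ab_presheaf X Z0"
  by (rule F.relabel_presheaf) (simp add: inj_on_def)

sublocale Z0: ab_presheaf X Z0 by (rule Z0)

lemma L_restrict: "\<lbrakk>openin X W; x \<in> W; L x f\<rbrakk> \<Longrightarrow> L x (restrict f W)"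
  by (rule E.L_cong[of _ f W]) auto

lemma leaf_carrier: "s \<in> carrier (sections F U) \<Longrightarrow> Leaf s \<in> carrier (sections Z0 U)"
  by (simp add: F.relabel_carrier)

lemma leaf_restr: "s \<in> carrier (sections F U) \<Longrightarrow> restr Z0 U V (Leaf s) = Leaf (restr F U V s)"
  by (rule F.relabel_restr) (simp_all add: inj_on_def)

lemma leaf_mult: "\<lbrakk>s \<in> carrier (sections F U); t \<in> carrier (sections F U)\<rbrakk> \<Longrightarrow>
    Leaf s \<otimes>\<^bsub>sections Z0 U\<^esub> Leaf t = Leaf (s \<otimes>\<^bsub>sections F U\<^esub> t)"
  by (rule F.relabel_mult) (simp_all add: inj_on_def)

text \<open>By \<open>L_eq\<close> sections with equal value at \<open>x\<close> agree near
  \<open>x\<close>, so a germ carries no more than its value.\<close>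

lemma germ_eq_value:
  assumes U: "openin X U" "x \<in> U" "s \<in> carrier (sections F U)"
    and V: "openin X V" "x \<in> V" "t \<in> carrier (sections F V)"
  shows "germ X Z0 x U (Leaf s) = germ X Z0 x V (Leaf t) \<longleftrightarrow> s x = t x"
proof -
  have "germ X Z0 x U (Leaf s) = germ X Z0 x V (Leaf t) \<longleftrightarrow>
     (\<exists>W. openin X W \<and> x \<in> W \<and> W \<subseteq> U \<inter> V \<and> restr Z0 U W (Leaf s) = restr Z0 V W (Leaf t))"
    by (rule Z0.germ_eq_iff[OF U(1,2) leaf_carrier[OF U(3)] V(1,2) leaf_carrier[OF V(3)]])
  also have "\<dots> \<longleftrightarrow> (\<exists>W. openin X W \<and> x \<in> W \<and> W \<subseteq> U \<inter> V \<and> restrict s W = restrict t W)"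
    using leaf_restr[OF U(3)] leaf_restr[OF V(3)] sec_restr[OF U(1) _ _ U(3)] sec_restr[OF V(1) _ _ V(3)]
    by (intro ex_cong1 conj_cong refl) auto
  also have "\<dots> \<longleftrightarrow> s x = t x"
  proof
    assume "\<exists>W. openin X W \<and> x \<in> W \<and> W \<subseteq> U \<inter> V \<and> restrict s W = restrict t W"
    then show "s x = t x" by (metis restrict_apply')
  next
    assume eq: "s x = t x"
    have "L x s" "L x t" using U V sec_carrier by auto
    from E.L_eq[OF this eq] obtain W where W: "openin X W" "x \<in> W" "\<forall>y\<in>W. s y = t y" by (elim exE conjE)
    have "restrict s (W \<inter> U \<inter> V) = restrict t (W \<inter> U \<inter> V)" using W(3) by (auto simp: fun_eq_iff)
    then show "\<exists>W. openin X W \<and> x \<in> W \<and> W \<subseteq> U \<inter> V \<and> restrict s W = restrict t W"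
      using W(1,2) U(1,2) V(1,2) by (intro exI[of _ "W \<inter> U \<inter> V"]) (auto intro: openin_Int)
  qed
  finally show ?thesis .
qed

text \<open>The inverse of evaluation at \<open>x\<close>: a value is sent to the germ of any
  section that takes it.\<close>

definition stalk_iso :: "'x \<Rightarrow> 's \<Rightarrow> ('x set \<times> ('x, 'x \<Rightarrow> 's) tree) set" where
  "stalk_iso x a = (SOME g. \<exists>U s. openin X U \<and> x \<in> U \<and> s \<in> carrier (sections F U) \<and> s x = a \<and> g = germ X Z0 x U (Leaf s))"

lemma stalk_iso_eq:
  assumes U: "openin X U" "x \<in> U" "s \<in> carrier (sections F U)"
  shows "stalk_iso x (s x) = germ X Z0 x U (Leaf s)"
  unfolding stalk_iso_def
proof (rule some_equality)
  show "\<exists>V t. openin X V \<and> x \<in> V \<and> t \<in> carrier (sections F V) \<and> t x = s x \<and> germ X Z0 x U (Leaf s) = germ X Z0 x V (Leaf t)"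
    using U by auto
  fix g assume "\<exists>V t. openin X V \<and> x \<in> V \<and> t \<in> carrier (sections F V) \<and> t x = s x \<and> g = germ X Z0 x V (Leaf t)"
  then show "g = germ X Z0 x U (Leaf s)" using germ_eq_value[OF _ _ _ U] by auto
qed

lemma section_through:
  assumes "L x f"
  obtains U where "openin X U" "x \<in> U" "restrict f U \<in> carrier (sections F U)"
proof -
  obtain W where W: "openin X W" "x \<in> W" "\<forall>y\<in>W. L y f" using E.L_open[OF assms] by (elim exE conjE)
  have "restrict f W \<in> carrier (sections F W)" using W L_restrict by (simp add: sec_carrier)
  then show ?thesis using that W by blast
qed

lemma value_section:
  assumes "x \<in> topspace X" "a \<in> carrier (A x)"
  obtains U s where "openin X U" "x \<in> U" "s \<in> carrier (sections F U)" "s x = a"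
proof -
  obtain f where f: "L x f" "f x = a" using E.L_surj[OF assms] by (elim exE conjE)
  obtain U where U: "openin X U" "x \<in> U" "restrict f U \<in> carrier (sections F U)" using section_through[OF f(1)] .
  show ?thesis by (rule that[OF U]) (use f U in simp)
qed

lemma stalk_iso:
  assumes x: "x \<in> topspace X"
  shows "stalk_iso x \<in> iso (A x) (stalk X Z0 x)"
proof (rule isoI)
  show "stalk_iso x \<in> hom (A x) (stalk X Z0 x)"
  proof (rule homI)
    fix a assume a: "a \<in> carrier (A x)"
    obtain U s where U: "openin X U" "x \<in> U" "s \<in> carrier (sections F U)" "s x = a" using value_section[OF x a] .
    show "stalk_iso x a \<in> carrier (stalk X Z0 x)"
      using stalk_iso_eq[OF U(1-3)] U(4) Z0.germ_in_stalk[OF U(1,2) leaf_carrier[OF U(3)]] by simp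
  next
    fix a b assume a: "a \<in> carrier (A x)" and b: "b \<in> carrier (A x)"
    obtain U s where U: "openin X U" "x \<in> U" "s \<in> carrier (sections F U)" "s x = a" using value_section[OF x a] .
    obtain V t where V: "openin X V" "x \<in> V" "t \<in> carrier (sections F V)" "t x = b" using value_section[OF x b] .
    let ?W = "U \<inter> V"
    have o: "openin X ?W" "x \<in> ?W" using U V by auto
    have st: "restrict s ?W \<in> carrier (sections F ?W)" "restrict t ?W \<in> carrier (sections F ?W)"
      using F.restr_closed[OF U(1) o(1) _ U(3)] sec_restr[OF U(1) o(1) _ U(3)]
        F.restr_closed[OF V(1) o(1) _ V(3)] sec_restr[OF V(1) o(1) _ V(3)] by simp_all
    let ?r = "restrict s ?W \<otimes>\<^bsub>sections F ?W\<^esub> restrict t ?W"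
    have r: "?r \<in> carrier (sections F ?W)" using st F.grp[OF o(1)] by (simp add: group.is_monoid monoid.m_closed)
    have "?r x = a \<otimes>\<^bsub>A x\<^esub> b" using sec_mult[OF o(1) st] o(2) U(4) V(4) by simp
    then have "stalk_iso x (a \<otimes>\<^bsub>A x\<^esub> b) = germ X Z0 x ?W (Leaf ?r)" using stalk_iso_eq[OF o r] by simp
    also have "\<dots> = germ X Z0 x ?W (Leaf (restrict s ?W)) \<otimes>\<^bsub>stalk X Z0 x\<^esub> germ X Z0 x ?W (Leaf (restrict t ?W))"
      using Z0.stalk_mult0[OF o leaf_carrier[OF st(1)] leaf_carrier[OF st(2)]] leaf_mult[OF st] by simp
    also have "\<dots> = stalk_iso x a \<otimes>\<^bsub>stalk X Z0 x\<^esub> stalk_iso x b"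
      using stalk_iso_eq[OF o st(1)] stalk_iso_eq[OF o st(2)] o(2) U(4) V(4) by simp
    finally show "stalk_iso x (a \<otimes>\<^bsub>A x\<^esub> b) = stalk_iso x a \<otimes>\<^bsub>stalk X Z0 x\<^esub> stalk_iso x b" .
  qed
  show "bij_betw (stalk_iso x) (carrier (A x)) (carrier (stalk X Z0 x))"
  proof (rule bij_betw_imageI)
    show "inj_on (stalk_iso x) (carrier (A x))"
    proof (rule inj_onI)
      fix a b assume a: "a \<in> carrier (A x)" and b: "b \<in> carrier (A x)" and eq: "stalk_iso x a = stalk_iso x b"
      obtain U s where U: "openin X U" "x \<in> U" "s \<in> carrier (sections F U)" "s x = a" using value_section[OF x a] .
      obtain V t where V: "openin X V" "x \<in> V" "t \<in> carrier (sections F V)" "t x = b" using value_section[OF x b] .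
      show "a = b" using eq stalk_iso_eq[OF U(1-3)] stalk_iso_eq[OF V(1-3)] germ_eq_value[OF U(1-3) V(1-3)] U(4) V(4) by simp
    qed
    show "stalk_iso x ` carrier (A x) = carrier (stalk X Z0 x)"
    proof (intro equalityI subsetI)
      fix g assume "g \<in> stalk_iso x ` carrier (A x)"
      then show "g \<in> carrier (stalk X Z0 x)" using \<open>stalk_iso x \<in> hom (A x) (stalk X Z0 x)\<close> by (auto simp: hom_def)
    next
      fix g assume "g \<in> carrier (stalk X Z0 x)"
      then obtain U s' where U: "g = germ X Z0 x U s'" "openin X U" "x \<in> U" "s' \<in> carrier (sections Z0 U)"
        unfolding Z0.stalk_carrier by blast
      obtain s where s: "s' = Leaf s" "s \<in> carrier (sections F U)" using U(4) unfolding F.relabel_carrier by (rule imageE)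
      have "s x \<in> carrier (A x)" using s(2) U(2,3) E.L_closed by (auto simp: sec_carrier)
      moreover have "g = stalk_iso x (s x)" using stalk_iso_eq[OF U(2,3) s(2)] U(1) s(1) by simp
      ultimately show "g \<in> stalk_iso x ` carrier (A x)" by (rule image_eqI[rotated])
    qed
  qed
qed

lemma local_section_iff:
  assumes x: "x \<in> topspace X" and f: "f \<in> families X A"
  shows "L x f \<longleftrightarrow> local_section X Z0 x (\<lambda>y. stalk_iso y (f y))"
proof
  assume "L x f"
  then obtain U where U: "openin X U" "x \<in> U" "restrict f U \<in> carrier (sections F U)" by (rule section_through)
  have "\<forall>y\<in>U. stalk_iso y (f y) = germ X Z0 y U (Leaf (restrict f U))"
    using stalk_iso_eq[OF U(1) _ U(3)] by fastforce
  then show "local_section X Z0 x (\<lambda>y. stalk_iso y (f y))"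
    unfolding local_section_def using U(1,2) leaf_carrier[OF U(3)] by blast
next
  assume "local_section X Z0 x (\<lambda>y. stalk_iso y (f y))"
  then obtain U s' where U: "openin X U" "x \<in> U" "s' \<in> carrier (sections Z0 U)" "\<forall>y\<in>U. stalk_iso y (f y) = germ X Z0 y U s'"
    unfolding local_section_def by (elim exE conjE bexE)
  obtain s where s: "s' = Leaf s" "s \<in> carrier (sections F U)" using U(3) unfolding F.relabel_carrier by (rule imageE)
  have Ls: "\<forall>y\<in>U. L y s" using s(2) U(1) by (simp add: sec_carrier)
  show "L x f"
  proof (rule E.L_cong[OF Ls[rule_format, OF U(2)] U(1,2)])
    fix y assume y: "y \<in> U"
    have yX: "y \<in> topspace X" using y openin_subset[OF U(1)] by blast
    have "stalk_iso y (f y) = stalk_iso y (s y)" using U(4) y s(1) stalk_iso_eq[OF U(1) y s(2)] by simp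
    moreover have "f y \<in> carrier (A y)" "s y \<in> carrier (A y)" using Pi_mem[OF f yX] Ls y E.L_closed by auto
    ultimately show "f y = s y" using stalk_iso[OF yX] by (auto simp: iso_def bij_betw_def inj_on_def)
  qed
qed

lemma first_step:
  shows "etale_step X A L (stalk X (syzygy X F 1)) (local_section X (syzygy X F 1))
      (\<lambda>x f. coker_germ X Z0 x (\<lambda>y. stalk_iso y (f y)))" (is ?step)
    and "glob_lift X (stalk X Z0) (local_section X (syzygy X F 1)) (coker_germ X Z0) \<longleftrightarrow>
      glob_lift X A (local_section X (syzygy X F 1)) (\<lambda>x f. coker_germ X Z0 x (\<lambda>y. stalk_iso y (f y)))" (is ?lift)
proof -
  have s: "etale_step X (stalk X Z0) (local_section X Z0) (stalk X (syzygy X F 1)) (local_section X (syzygy X F 1)) (coker_germ X Z0)"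
    using F.syzygy_step[of 0] unfolding One_nat_def syzygy.simps(1) .
  show ?step by (rule etale_step_iso(1)[OF E.etale_axioms s stalk_iso local_section_iff])
  show ?lift by (rule etale_step_iso(2)[OF E.etale_axioms s stalk_iso local_section_iff])
qed

text \<open>Isolates the first step, where the concrete stalks appear, from the later ones, which
  all live on trees; inductions over the resolution start at the former and continue with the
  latter.\<close>

lemma acyclic_iff:
  "acyclic_presheaf X F \<longleftrightarrow>
     glob_lift X A (local_section X (syzygy X F 1)) (\<lambda>x f. coker_germ X Z0 x (\<lambda>y. stalk_iso y (f y))) \<and>
     (\<forall>n. glob_lift X (stalk X (syzygy X F (Suc n))) (local_section X (syzygy X F (Suc (Suc n)))) (coker_germ X (syzygy X F (Suc n))))"
  (is "_ \<longleftrightarrow> ?A \<and> (\<forall>n. ?B (Suc n))")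
proof -
  have "acyclic_presheaf X F \<longleftrightarrow> ?B 0 \<and> (\<forall>n. ?B (Suc n))"
    unfolding acyclic_presheaf_def by (metis not0_implies_Suc)
  also have "?B 0 \<longleftrightarrow> ?A" using first_step(2) unfolding One_nat_def syzygy.simps(1) .
  finally show ?thesis .
qed

text \<open>Flasqueness is inherited by each syzygy and gives the global lift at each.\<close>

lemma flasque_acyclic:
  assumes "flasque X L"
  shows "acyclic_presheaf X F"
proof -
  have 1: "flasque X (local_section X (syzygy X F (Suc n)))" for n
  proof (induction n)
    case 0 show ?case using etale_step.flasque_next[OF first_step(1) assms] unfolding One_nat_def .
  next
    case (Suc n) then show ?case by (rule etale_step.flasque_next[OF F.syzygy_step])
  qed
  show ?thesis unfolding acyclic_iff
    by (intro conjI allI etale_step.flasque_glob_lift[OF first_step(1) assms] etale_step.flasque_glob_lift[OF F.syzygy_step 1])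
qed

end

text \<open>Each application of \<open>mv_step\<close> yields the lift for \<open>F\<close> at one
  level together with the square for the next.\<close>

theorem mayer_vietoris:
  assumes sq: "mv_square X SF LF SG LG SH LH SK LK p q a b"
    and F: "etale_presheaf X SF LF F" and G: "etale_presheaf X SG LG G"
    and H: "etale_presheaf X SH LH H" and K: "etale_presheaf X SK LK K"
    and ac: "acyclic_presheaf X G" "acyclic_presheaf X H" "acyclic_presheaf X K"
  shows "acyclic_presheaf X F"
proof -
  interpret F: etale_presheaf X SF LF F by (rule F)
  interpret G: etale_presheaf X SG LG G by (rule G)
  interpret H: etale_presheaf X SH LH H by (rule H)
  interpret K: etale_presheaf X SK LK K by (rule K)
  note acG = ac(1)[unfolded G.acyclic_iff] and acH = ac(2)[unfolded H.acyclic_iff] and acK = ac(3)[unfolded K.acyclic_iff]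
  let ?sq = "\<lambda>n. \<exists>p q a b. mv_square X (stalk X (syzygy X F n)) (local_section X (syzygy X F n))
     (stalk X (syzygy X G n)) (local_section X (syzygy X G n)) (stalk X (syzygy X H n)) (local_section X (syzygy X H n))
     (stalk X (syzygy X K n)) (local_section X (syzygy X K n)) p q a b"
  \<comment> \<open>The step out of the concrete sheaves is done separately because it changes the
    types of the stalks; from here on all four sheaves are syzygies.\<close>
  note base = mv_square.mv_step[OF sq F.first_step(1) G.first_step(1) H.first_step(1) K.first_step(1)
      acG[THEN conjunct1] acH[THEN conjunct1] acK[THEN conjunct1]]
  have step: "glob_lift X (stalk X (syzygy X F (Suc n))) (local_section X (syzygy X F (Suc (Suc n)))) (coker_germ X (syzygy X F (Suc n)))
      \<and> ?sq (Suc (Suc n))" if "?sq (Suc n)" for n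
  proof -
    obtain p q a b where "mv_square X (stalk X (syzygy X F (Suc n))) (local_section X (syzygy X F (Suc n)))
     (stalk X (syzygy X G (Suc n))) (local_section X (syzygy X G (Suc n))) (stalk X (syzygy X H (Suc n))) (local_section X (syzygy X H (Suc n)))
     (stalk X (syzygy X K (Suc n))) (local_section X (syzygy X K (Suc n))) p q a b" using \<open>?sq (Suc n)\<close> by (elim exE)
    then show ?thesis
      by (rule mv_square.mv_step[OF _ F.F.syzygy_step G.F.syzygy_step H.F.syzygy_step K.F.syzygy_step
            acG[THEN conjunct2, rule_format] acH[THEN conjunct2, rule_format] acK[THEN conjunct2, rule_format]])
  qed
  have sqn: "?sq (Suc n)" for n
  proof (induction n)
    case 0 show ?case using base[THEN conjunct2] unfolding One_nat_def .
  next
    case (Suc n) show ?case by (rule step[OF Suc, THEN conjunct2])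
  qed
  show ?thesis unfolding F.acyclic_iff
    by (intro conjI allI base[THEN conjunct1] step[OF sqn, THEN conjunct1])
qed

text \<open>Gives a cohomology to stalk data that come without a presheaf, such as rational
  functions and divisors.\<close>

definition section_presheaf :: "('x \<Rightarrow> 's monoid) \<Rightarrow> ('x \<Rightarrow> ('x \<Rightarrow> 's) \<Rightarrow> bool) \<Rightarrow> ('x, 'x \<Rightarrow> 's) presheaf" where
  "section_presheaf A L =
     \<lparr>sections = (\<lambda>U. \<lparr>carrier = {s \<in> extensional U. \<forall>x\<in>U. L x s},
        monoid.mult = (\<lambda>s t. \<lambda>x\<in>U. s x \<otimes>\<^bsub>A x\<^esub> t x), one = (\<lambda>x\<in>U. \<one>\<^bsub>A x\<^esub>)\<rparr>),
      restr = (\<lambda>U V s. restrict s V)\<rparr>"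

lemma (in etale) etale_section_presheaf: "etale_presheaf X S L (section_presheaf S L)"
proof (intro etale_presheaf.intro etale_presheaf_axioms.intro etale_axioms ab_presheaf.intro)
  fix U assume U: "openin X U"
  have top: "x \<in> topspace X" if "x \<in> U" for x using that openin_subset[OF U] by blast
  have res: "L x (restrict f U)" if "L x f" "x \<in> U" for f x by (rule L_cong[OF that(1) U that(2)]) simp
  show "comm_group (sections (section_presheaf S L) U)"
  proof (rule comm_groupI)
    let ?G = "sections (section_presheaf S L) U"
    have c: "s \<in> carrier ?G \<longleftrightarrow> s \<in> extensional U \<and> (\<forall>x\<in>U. L x s)" for s by (simp add: section_presheaf_def)
    have m: "s \<otimes>\<^bsub>?G\<^esub> t = (\<lambda>x\<in>U. s x \<otimes>\<^bsub>S x\<^esub> t x)" for s t by (simp add: section_presheaf_def)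
    have o: "\<one>\<^bsub>?G\<^esub> = (\<lambda>x\<in>U. \<one>\<^bsub>S x\<^esub>)" by (simp add: section_presheaf_def)
    have v: "s x \<in> carrier (S x)" if "s \<in> carrier ?G" "x \<in> U" for s x using that c L_closed by blast
    note cg = comm_group_stalk[OF top]
    note mon = group.is_monoid[OF group_stalk[OF top]]
    fix s t assume s: "s \<in> carrier ?G" and t: "t \<in> carrier ?G"
    show "s \<otimes>\<^bsub>?G\<^esub> t \<in> carrier ?G" using s t L_mult res by (simp add: c m)
    show "s \<otimes>\<^bsub>?G\<^esub> t = t \<otimes>\<^bsub>?G\<^esub> s"
      unfolding m by (rule restrict_ext) (use v[OF s] v[OF t] comm_monoid.m_comm[OF comm_group.axioms(1)[OF cg]] in blast)
    fix r assume r: "r \<in> carrier ?G"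
    show "s \<otimes>\<^bsub>?G\<^esub> t \<otimes>\<^bsub>?G\<^esub> r = s \<otimes>\<^bsub>?G\<^esub> (t \<otimes>\<^bsub>?G\<^esub> r)"
      unfolding m by (rule restrict_ext) (use v[OF s] v[OF t] v[OF r] monoid.m_assoc[OF mon] in simp)
  next
    let ?G = "sections (section_presheaf S L) U"
    have c: "s \<in> carrier ?G \<longleftrightarrow> s \<in> extensional U \<and> (\<forall>x\<in>U. L x s)" for s by (simp add: section_presheaf_def)
    have m: "s \<otimes>\<^bsub>?G\<^esub> t = (\<lambda>x\<in>U. s x \<otimes>\<^bsub>S x\<^esub> t x)" for s t by (simp add: section_presheaf_def)
    have o: "\<one>\<^bsub>?G\<^esub> = (\<lambda>x\<in>U. \<one>\<^bsub>S x\<^esub>)" by (simp add: section_presheaf_def)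
    show "\<one>\<^bsub>?G\<^esub> \<in> carrier ?G" unfolding c o using res L_one top by simp
    fix s assume s: "s \<in> carrier ?G"
    have v: "s x \<in> carrier (S x)" if "x \<in> U" for x using s that c L_closed by blast
    show "\<one>\<^bsub>?G\<^esub> \<otimes>\<^bsub>?G\<^esub> s = s"
    proof
      fix x show "(\<one>\<^bsub>?G\<^esub> \<otimes>\<^bsub>?G\<^esub> s) x = s x"
        using s v monoid.l_one[OF group.is_monoid[OF group_stalk[OF top]]] unfolding m o c
        by (cases "x \<in> U") (auto simp: extensional_def)
    qed
    have "(\<lambda>x\<in>U. inv\<^bsub>S x\<^esub> s x) \<in> carrier ?G" using s L_inv res unfolding c by simp
    moreover have "(\<lambda>x\<in>U. inv\<^bsub>S x\<^esub> s x) \<otimes>\<^bsub>?G\<^esub> s = \<one>\<^bsub>?G\<^esub>"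
      unfolding m o by (rule restrict_ext) (use v group.l_inv[OF group_stalk[OF top]] in simp)
    ultimately show "\<exists>t\<in>carrier ?G. t \<otimes>\<^bsub>?G\<^esub> s = \<one>\<^bsub>?G\<^esub>" by (intro bexI)
  qed
next
  fix U V assume a: "openin X U" "openin X V" "V \<subseteq> U"
  have res: "L x (restrict f V)" if "L x f" "x \<in> V" for f x by (rule L_cong[OF that(1) a(2) that(2)]) simp
  show "restr (section_presheaf S L) U V \<in> hom (sections (section_presheaf S L) U) (sections (section_presheaf S L) V)"
    using a(3) res by (auto simp: hom_def section_presheaf_def fun_eq_iff subset_iff)
qed (auto simp: section_presheaf_def extensional_restrict Int_absorb1 Int_absorb2)

definition acyclic_etale :: "'x topology \<Rightarrow> ('x \<Rightarrow> 's monoid) \<Rightarrow> ('x \<Rightarrow> ('x \<Rightarrow> 's) \<Rightarrow> bool) \<Rightarrow> bool" where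
  "acyclic_etale X S L \<longleftrightarrow> acyclic_presheaf X (section_presheaf S L)"

lemma (in etale) flasque_acyclic: "flasque X L \<Longrightarrow> acyclic_etale X S L"
  unfolding acyclic_etale_def by (rule etale_presheaf.flasque_acyclic[OF etale_section_presheaf])

lemma (in mv_square) acyclic:
  assumes "acyclic_etale X SG LG" "acyclic_etale X SH LH" "acyclic_etale X SK LK"
    and "etale_presheaf X SF LF P"
  shows "acyclic_presheaf X P"
  using mayer_vietoris[OF mv_square_axioms assms(4) G.etale_section_presheaf H.etale_section_presheaf K.etale_section_presheaf]
    assms(1-3) unfolding acyclic_etale_def by blast

section \<open>Factorial subrings of a domain\<close>

text \<open>Rings are subsets of a type because the polynomial rings in varying sets of variables,
  and the images of all face maps, must live in one type.\<close>

definition subdom :: "'a::idom set \<Rightarrow> bool" where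
  "subdom A \<longleftrightarrow> 0 \<in> A \<and> 1 \<in> A \<and> (\<forall>a\<in>A. \<forall>b\<in>A. a + b \<in> A \<and> a * b \<in> A) \<and> (\<forall>a\<in>A. - a \<in> A)"

lemma subdomD:
  assumes "subdom A"
  shows "0 \<in> A" "1 \<in> A" "a \<in> A \<Longrightarrow> b \<in> A \<Longrightarrow> a + b \<in> A" "a \<in> A \<Longrightarrow> b \<in> A \<Longrightarrow> a * b \<in> A" "a \<in> A \<Longrightarrow> - a \<in> A"
  using assms by (auto simp: subdom_def)

lemma subdom_diff: "subdom A \<Longrightarrow> a \<in> A \<Longrightarrow> b \<in> A \<Longrightarrow> a - b \<in> A"
  using subdomD(3,5)[of A] by (metis diff_conv_add_uminus)

definition dvd_in :: "'a::idom set \<Rightarrow> 'a \<Rightarrow> 'a \<Rightarrow> bool" where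
  "dvd_in A a b \<longleftrightarrow> (\<exists>c\<in>A. b = a * c)"

definition unit_in :: "'a::idom set \<Rightarrow> 'a \<Rightarrow> bool" where
  "unit_in A u \<longleftrightarrow> u \<in> A \<and> (\<exists>v\<in>A. u * v = 1)"

definition prime_in :: "'a::idom set \<Rightarrow> 'a \<Rightarrow> bool" where
  "prime_in A p \<longleftrightarrow> p \<in> A \<and> p \<noteq> 0 \<and> \<not> unit_in A p \<and>
     (\<forall>a\<in>A. \<forall>b\<in>A. dvd_in A p (a * b) \<longrightarrow> dvd_in A p a \<or> dvd_in A p b)"

text \<open>A unit times \<open>n\<close> primes. The counter serves as an induction measure in
  place of a degree or a norm.\<close>

inductive fac :: "'a::idom set \<Rightarrow> nat \<Rightarrow> 'a \<Rightarrow> bool" for A where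
  unit: "unit_in A u \<Longrightarrow> fac A 0 u"
| prime: "\<lbrakk>prime_in A p; fac A n a\<rbrakk> \<Longrightarrow> fac A (Suc n) (p * a)"

text \<open>Asking for prime factors instead of irreducible ones makes uniqueness of the
  factorization automatic.\<close>

definition factorial_in :: "'a::idom set \<Rightarrow> bool" where
  "factorial_in A \<longleftrightarrow> subdom A \<and> (\<forall>a\<in>A. a \<noteq> 0 \<longrightarrow> (\<exists>n. fac A n a))"

lemma unit_in_mult: "subdom A \<Longrightarrow> unit_in A u \<Longrightarrow> unit_in A v \<Longrightarrow> unit_in A (u * v)"
  unfolding unit_in_def
proof (elim conjE bexE, intro conjI)
  fix u' v' assume a: "subdom A" "u \<in> A" "v \<in> A" "u' \<in> A" "u * u' = 1" "v' \<in> A" "v * v' = 1"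
  show "u * v \<in> A" using a subdomD(4) by blast
  have "u * v * (u' * v') = (u * u') * (v * v')" by (simp add: ac_simps)
  then show "\<exists>w\<in>A. u * v * w = 1" using a subdomD(4)[OF a(1) a(4,6)] by (intro bexI[of _ "u' * v'"]) simp_all
qed

lemma dvd_in_mult: "subdom A \<Longrightarrow> dvd_in A a b \<Longrightarrow> c \<in> A \<Longrightarrow> dvd_in A a (b * c)"
  unfolding dvd_in_def using subdomD(4) by (metis mult.assoc)

lemma dvd_in_mult2: "subdom A \<Longrightarrow> dvd_in A a b \<Longrightarrow> c \<in> A \<Longrightarrow> dvd_in A a (c * b)"
  using dvd_in_mult[of A a b c] by (simp add: mult.commute)

lemma dvd_in_add: "subdom A \<Longrightarrow> dvd_in A a b \<Longrightarrow> dvd_in A a c \<Longrightarrow> dvd_in A a (b + c)"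
  unfolding dvd_in_def using subdomD(3) by (metis distrib_left)

lemma dvd_in_diff: "subdom A \<Longrightarrow> dvd_in A a b \<Longrightarrow> dvd_in A a c \<Longrightarrow> dvd_in A a (b - c)"
  unfolding dvd_in_def using subdom_diff by (metis right_diff_distrib)

lemma dvd_in_sum: "subdom A \<Longrightarrow> (\<And>i. i \<in> I \<Longrightarrow> dvd_in A a (f i)) \<Longrightarrow> dvd_in A a (\<Sum>i\<in>I. f i)"
proof (induction I rule: infinite_finite_induct)
  case (insert x F) then show ?case by (simp add: dvd_in_add)
qed (auto simp: dvd_in_def subdomD intro!: bexI[of _ 0])

lemma unit_dvd: "subdom A \<Longrightarrow> unit_in A u \<Longrightarrow> dvd_in A a u \<Longrightarrow> a \<in> A \<Longrightarrow> unit_in A a"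
  unfolding unit_in_def dvd_in_def using subdomD(4) by (metis mult.assoc)

lemma fac_in: assumes A: "subdom A" and "fac A n a" shows "a \<in> A \<and> a \<noteq> 0"
  using assms(2) by (induction rule: fac.induct) (auto simp: unit_in_def prime_in_def subdomD(4)[OF A])

lemma fac_unit_mult:
  assumes A: "subdom A" and "fac A n a" and u: "unit_in A u" shows "fac A n (u * a)"
  using assms(2)
proof (induction rule: fac.induct)
  case (unit v) then show ?case using fac.unit unit_in_mult[OF A u] by blast
next
  case (prime p n a)
  then have "fac A (Suc n) (p * (u * a))" using fac.prime by blast
  then show ?case by (simp add: ac_simps)
qed

lemma fac_mult:
  assumes A: "subdom A" and "fac A n a" and b: "fac A m b" shows "fac A (n + m) (a * b)"
  using assms(2)
proof (induction rule: fac.induct)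
  case (unit v) then show ?case using fac_unit_mult[OF A b] by simp
next
  case (prime p n a)
  then have "fac A (Suc (n + m)) (p * (a * b))" using fac.prime by blast
  then show ?case by (simp add: ac_simps)
qed

text \<open>A prime that divides a product of primes is associate to one of them; cancelling it
  lowers the count by one.\<close>

lemma fac_prime_dvd:
  assumes A: "subdom A" and "fac A n a" "prime_in A p" "dvd_in A p a"
  shows "\<exists>k b. n = Suc k \<and> fac A k b \<and> a = p * b"
  using assms(2-)
proof (induction rule: fac.induct)
  case (unit u)
  then show ?case using unit_dvd[OF A] unfolding prime_in_def by blast
next
  case (prime q n a)
  have q: "q \<in> A" "q \<noteq> 0" and a: "a \<in> A" using prime fac_in[OF A] unfolding prime_in_def by blast+
  have p: "p \<in> A" "p \<noteq> 0" using prime unfolding prime_in_def by blast+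
  show ?case
  proof (cases "dvd_in A p a")
    case True
    then obtain k b where k: "n = Suc k" "fac A k b" "a = p * b" using prime by blast
    have "fac A (Suc k) (q * b)" using fac.prime[OF prime(1) k(2)] .
    then show ?thesis using k by (intro exI[of _ n] exI[of _ "q * b"]) (simp add: ac_simps)
  next
    case False
    then have "dvd_in A p q" using prime q a unfolding prime_in_def by blast
    then obtain w where w: "w \<in> A" "q = p * w" unfolding dvd_in_def by blast
    \<comment> \<open>From \<open>q = p * w\<close>, the prime \<open>q\<close> divides
      \<open>p\<close> or \<open>w\<close>. The first fails when \<open>w\<close> is no unit, the
      second would make \<open>p\<close> a unit; so \<open>w\<close> is a unit.\<close>
    have "\<not> dvd_in A q p"
      if "\<not> unit_in A w"
    proof
      assume "dvd_in A q p"
      then obtain v where v: "v \<in> A" "p = q * v" unfolding dvd_in_def by blast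
      have "p * 1 = p * (w * v)" using v w by (simp add: ac_simps)
      then have "w * v = 1" using p by (metis mult_left_cancel)
      then show False using that v w unfolding unit_in_def by blast
    qed
    moreover have "dvd_in A q (p * w)" using w subdomD(2)[OF A] unfolding dvd_in_def by (metis mult.right_neutral)
    then have "dvd_in A q p \<or> dvd_in A q w" using prime(1) p w unfolding prime_in_def by blast
    moreover have "\<not> dvd_in A q w"
    proof
      assume "dvd_in A q w"
      then obtain v where v: "v \<in> A" "w = q * v" unfolding dvd_in_def by blast
      have "q * 1 = q * (p * v)" using w(2)[unfolded v(2)] by (simp only: mult.left_commute[of q p v] mult_1_right)
      then have "1 = p * v" using mult_left_cancel[OF q(2)] by blast
      then have "p * v = 1" ..
      then show False using prime(4) v p unfolding unit_in_def prime_in_def by blast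
    qed
    ultimately have "unit_in A w" by blast
    then have "fac A n (w * a)" using fac_unit_mult[OF A prime(2)] by blast
    then show ?thesis using w by (intro exI[of _ n] exI[of _ "w * a"]) (simp add: ac_simps)
  qed
qed

subsection \<open>Gauss's lemma\<close>

definition polys :: "'a::idom set \<Rightarrow> 'a poly set" where
  "polys A = {f. \<forall>i. coeff f i \<in> A}"

lemma sum_in: "subdom A \<Longrightarrow> (\<And>i. i \<in> I \<Longrightarrow> f i \<in> A) \<Longrightarrow> (\<Sum>i\<in>I. f i) \<in> A"
  by (induction I rule: infinite_finite_induct) (auto simp: subdomD)

lemma subdom_polys: assumes "subdom A" shows "subdom (polys A)"
  using assms unfolding subdom_def[of "polys A"] unfolding polys_def
  by (auto simp: subdomD coeff_mult coeff_pCons one_pCons split: nat.splits intro!: sum_in)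

lemma const_polys: "subdom A \<Longrightarrow> [:a:] \<in> polys A \<longleftrightarrow> a \<in> A"
  by (auto simp: polys_def coeff_pCons subdomD split: nat.splits)

lemma dvd_const: "dvd_in (polys A) [:a:] f \<longleftrightarrow> (\<forall>i. dvd_in A a (coeff f i))" if "subdom A"
proof
  assume "dvd_in (polys A) [:a:] f"
  then obtain g where "g \<in> polys A" "f = [:a:] * g" unfolding dvd_in_def by blast
  then show "\<forall>i. dvd_in A a (coeff f i)" unfolding dvd_in_def polys_def by (auto simp: coeff_smult)
next
  assume "\<forall>i. dvd_in A a (coeff f i)"
  then obtain c where c: "\<And>i. c i \<in> A" "\<And>i. coeff f i = a * c i" unfolding dvd_in_def by metis
  define g where "g = (\<Sum>i\<le>degree f. monom (c i) i)"
  have cg: "coeff g i = (if i \<le> degree f then c i else 0)" for i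
    unfolding g_def by (simp add: coeff_sum coeff_monom)
  have "f = [:a:] * g"
  proof (rule poly_eqI)
    fix i show "coeff f i = coeff ([:a:] * g) i"
      by (cases "i \<le> degree f") (simp_all add: cg c(2)[symmetric] coeff_eq_0)
  qed
  moreover have "g \<in> polys A" unfolding polys_def using c(1) subdomD(1)[OF that] by (simp add: cg)
  ultimately show "dvd_in (polys A) [:a:] f" unfolding dvd_in_def by blast
qed

lemma unit_const: "unit_in A u \<Longrightarrow> subdom A \<Longrightarrow> unit_in (polys A) [:u:]"
  unfolding unit_in_def by (auto simp: const_polys one_pCons intro!: bexI[of _ "[:_:]"])

lemma unit_polys: assumes "subdom A" "unit_in (polys A) f" shows "\<exists>u. unit_in A u \<and> f = [:u:]"
proof -
  obtain g where g: "f \<in> polys A" "g \<in> polys A" "f * g = 1" using assms(2) unfolding unit_in_def by blast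
  then have nz: "f \<noteq> 0" "g \<noteq> 0" by auto
  have "degree f + degree g = 0" using degree_mult_eq[OF nz] g(3) by simp
  then obtain u v where uv: "f = [:u:]" "g = [:v:]" by (metis add_is_0 degree_eq_zeroE)
  then have "u \<in> A" "v \<in> A" "u * v = 1" using g const_polys[OF assms(1)] by (auto simp: one_pCons mult.commute)
  then show ?thesis using uv unfolding unit_in_def by blast
qed

text \<open>Gauss's argument: for the least indices \<open>i\<close> and \<open>j\<close> at which
  \<open>p\<close> fails to divide the coefficients of \<open>f\<close> and \<open>g\<close>, the
  coefficient of \<open>f * g\<close> at \<open>i + j\<close> is the product of these two plus
  multiples of \<open>p\<close>.\<close>

lemma prime_const:
  assumes A: "subdom A" and p: "prime_in A p"
  shows "prime_in (polys A) [:p:]"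
  unfolding prime_in_def
proof (intro conjI ballI impI)
  have pA: "p \<in> A" "p \<noteq> 0" "\<not> unit_in A p" using p unfolding prime_in_def by blast+
  show "[:p:] \<in> polys A" "[:p:] \<noteq> 0" using pA const_polys[OF A] by auto
  show "\<not> unit_in (polys A) [:p:]" using unit_polys[OF A] pA by force
  fix f g assume fg: "f \<in> polys A" "g \<in> polys A" "dvd_in (polys A) [:p:] (f * g)"
  show "dvd_in (polys A) [:p:] f \<or> dvd_in (polys A) [:p:] g"
  proof (rule ccontr)
    assume "\<not> ?thesis"
    then have ex: "\<exists>i. \<not> dvd_in A p (coeff f i)" "\<exists>j. \<not> dvd_in A p (coeff g j)" unfolding dvd_const[OF A] by blast+
    define i where "i = (LEAST i. \<not> dvd_in A p (coeff f i))"
    define j where "j = (LEAST j. \<not> dvd_in A p (coeff g j))"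
    have i: "\<not> dvd_in A p (coeff f i)" "\<And>k. k < i \<Longrightarrow> dvd_in A p (coeff f k)"
      unfolding i_def using LeastI_ex[OF ex(1)] not_less_Least by blast+
    have j: "\<not> dvd_in A p (coeff g j)" "\<And>k. k < j \<Longrightarrow> dvd_in A p (coeff g k)"
      unfolding j_def using LeastI_ex[OF ex(2)] not_less_Least by blast+
    have cA: "coeff f k \<in> A" "coeff g k \<in> A" for k using fg unfolding polys_def by auto
    let ?t = "\<lambda>k. coeff f k * coeff g (i + j - k)"
    have "dvd_in A p (coeff (f * g) (i + j))" using fg(3) unfolding dvd_const[OF A] by blast
    moreover have "coeff (f * g) (i + j) = ?t i + (\<Sum>k\<in>{..i+j} - {i}. ?t k)"
      unfolding coeff_mult by (rule sum.remove) auto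
    moreover have "dvd_in A p (\<Sum>k\<in>{..i+j} - {i}. ?t k)"
    proof (rule dvd_in_sum[OF A])
      fix k assume "k \<in> {..i+j} - {i}"
      then consider "k < i" | "i + j - k < j" by force
      then show "dvd_in A p (?t k)"
        by cases (use i(2) j(2) cA dvd_in_mult[OF A] dvd_in_mult2[OF A] in blast)+
    qed
    ultimately have "dvd_in A p (coeff f i * coeff g j)" using dvd_in_diff[OF A] by fastforce
    then show False using p i(1) j(1) cA unfolding prime_in_def by blast
  qed
qed

context
  fixes A :: "'a::idom set"
  assumes fA: "factorial_in A"
begin

lemma factorial_subdom: "subdom A" using fA unfolding factorial_in_def by blast

lemma factorial_subdom_polys: "subdom (polys A)" by (rule subdom_polys[OF factorial_subdom])

text \<open>Primitivity is phrased through primes of \<open>A\<close>, so that no content has to be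
  defined.\<close>

definition primitive :: "'a poly \<Rightarrow> bool" where
  "primitive f \<longleftrightarrow> f \<in> polys A \<and> f \<noteq> 0 \<and> (\<forall>p. prime_in A p \<longrightarrow> \<not> dvd_in (polys A) [:p:] f)"

text \<open>Prime factors of \<open>c\<close> are removed one at a time: such a prime divides
  \<open>f * k\<close> but not the primitive \<open>f\<close>, hence it divides the cofactor
  \<open>k\<close>.\<close>

lemma const_cancel:
  assumes "fac A n c" "primitive f" "m \<in> polys A" "dvd_in (polys A) f ([:c:] * m)"
  shows "dvd_in (polys A) f m"
  using assms
proof (induction arbitrary: rule: fac.induct)
  case (unit u)
  then obtain v where v: "v \<in> A" "u * v = 1" unfolding unit_in_def by blast
  obtain k where k: "k \<in> polys A" "[:u:] * m = f * k" using unit unfolding dvd_in_def by blast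
  have "f * ([:v:] * k) = [:v:] * ([:u:] * m)" unfolding k(2) by (simp only: ac_simps)
  also have "\<dots> = m" using v by (simp add: mult.commute)
  finally have "m = f * ([:v:] * k)" ..
  moreover have "[:v:] * k \<in> polys A" using v k const_polys[OF factorial_subdom] subdomD(4)[OF factorial_subdom_polys] by blast
  ultimately show ?case unfolding dvd_in_def by blast
next
  case (prime p n c)
  obtain k where k: "k \<in> polys A" "[:p * c:] * m = f * k" using prime(6) unfolding dvd_in_def by blast
  have cA: "c \<in> A" using fac_in[OF factorial_subdom prime(2)] by blast
  have eq: "f * k = [:p:] * ([:c:] * m)" using k(2) by (simp add: mult.commute)
  have "[:c:] * m \<in> polys A" using cA const_polys[OF factorial_subdom] subdomD(4)[OF factorial_subdom_polys] prime by blast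
  then have "dvd_in (polys A) [:p:] (f * k)" unfolding dvd_in_def eq by blast
  moreover have "\<not> dvd_in (polys A) [:p:] f" "f \<in> polys A" using prime unfolding primitive_def by blast+
  ultimately have "dvd_in (polys A) [:p:] k" using prime_const[OF factorial_subdom prime(1)] k(1) unfolding prime_in_def by blast
  then obtain k' where k': "k' \<in> polys A" "k = [:p:] * k'" unfolding dvd_in_def by blast
  have "[:p:] * ([:c:] * m) = [:p:] * (f * k')" using eq unfolding k'(2) by (simp only: ac_simps)
  moreover have "[:p:] \<noteq> 0" using prime(1) unfolding prime_in_def by simp
  ultimately have "[:c:] * m = f * k'" by (metis mult_left_cancel)
  then show ?case using prime k' unfolding dvd_in_def by blast
qed

text \<open>Induction on the number of prime factors of the leading coefficient: a prime constant
  dividing \<open>f\<close> also divides that coefficient, so pulling it out lowers the count. At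
  count zero \<open>f\<close> is already primitive.\<close>

lemma primitive_part:
  assumes "f \<in> polys A" "f \<noteq> 0"
  shows "\<exists>c n g. fac A n c \<and> primitive g \<and> f = [:c:] * g"
proof -
  have "\<exists>c k g. fac A k c \<and> primitive g \<and> f = [:c:] * g"
    if "fac A n (lead_coeff f)" "f \<in> polys A" "f \<noteq> 0" for n f
    using that
  proof (induction n arbitrary: f)
    have prim: "\<exists>c k g. fac A k c \<and> primitive g \<and> f = [:c:] * g" if "primitive f" for f
    proof -
      have "fac A 0 1" by (rule fac.unit) (use factorial_subdom in \<open>auto simp: unit_in_def subdomD\<close>)
      then show ?thesis using that by (intro exI[of _ 1] exI[of _ 0] exI[of _ f]) simp
    qed
    {
      case 0
      show ?case
      proof (rule prim, unfold primitive_def, intro conjI allI impI notI)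
        fix p assume p: "prime_in A p" "dvd_in (polys A) [:p:] f"
        then have "dvd_in A p (lead_coeff f)" unfolding dvd_const[OF factorial_subdom] by blast
        then show False using fac_prime_dvd[OF factorial_subdom 0(1) p(1)] by blast
      qed (use 0 in auto)
    next
      case (Suc n)
      show ?case
      proof (cases "primitive f")
        case True then show ?thesis by (rule prim)
      next
        case False
        then obtain p where p: "prime_in A p" "dvd_in (polys A) [:p:] f" using Suc unfolding primitive_def by blast
        then obtain f' where f': "f' \<in> polys A" "f = [:p:] * f'" unfolding dvd_in_def by blast
        have "dvd_in A p (lead_coeff f)" using p(2) unfolding dvd_const[OF factorial_subdom] by blast
        then obtain b where b: "fac A n b" "lead_coeff f = p * b" using fac_prime_dvd[OF factorial_subdom Suc(2) p(1)] by blast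
        have "lead_coeff f = p * lead_coeff f'" unfolding f'(2) by (simp add: lead_coeff_mult del: mult_pCons_left)
        then have "lead_coeff f' = b" using b(2) p(1) unfolding prime_in_def by simp
        moreover have "f' \<noteq> 0" using Suc f' by auto
        ultimately obtain c k g where c: "fac A k c" "primitive g" "f' = [:c:] * g" using Suc(1) f'(1) b(1) by blast
        have "f = [:p * c:] * g" unfolding f'(2) c(3) by (simp add: mult.commute)
        then show ?thesis using fac.prime[OF p(1) c(1)] c(2) by blast
      qed
    }
  qed
  moreover have "lead_coeff f \<in> A" using assms unfolding polys_def by blast
  ultimately show ?thesis using assms fA unfolding factorial_in_def by (metis leading_coeff_0_iff)
qed

text \<open>Stands in for division over the field of fractions. Each cancellation of a leading term
  costs a factor \<open>lead_coeff m\<close>, and these factors are collected in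
  \<open>c\<close>.\<close>

lemma pseudo_division:
  assumes m: "m \<in> polys A" "m \<noteq> 0" and s: "s \<in> polys A"
  shows "\<exists>c q r. c \<in> A \<and> c \<noteq> 0 \<and> q \<in> polys A \<and> r \<in> polys A \<and> [:c:] * s = q * m + r \<and> (r = 0 \<or> degree r < degree m)"
  using s
proof (induction "degree s" arbitrary: s rule: less_induct)
  case less
  show ?case
  proof (cases "s = 0 \<or> degree s < degree m")
    case True
    then show ?thesis using less subdomD[OF factorial_subdom] subdomD[OF factorial_subdom_polys] by (intro exI[of _ 1] exI[of _ 0] exI[of _ s]) auto
  next
    case False
    let ?l = "lead_coeff m" and ?t = "monom (lead_coeff s) (degree s - degree m)"
    define s' where "s' = [:?l:] * s - ?t * m"
    have lA: "?l \<in> A" "?l \<noteq> 0" and tP: "?t \<in> polys A" and lP: "[:?l:] \<in> polys A"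
      using m less(2) subdomD(1)[OF factorial_subdom] const_polys[OF factorial_subdom] unfolding polys_def by (auto simp: coeff_monom)
    have s'P: "s' \<in> polys A" unfolding s'_def using lP tP m less(2) subdomD(4)[OF factorial_subdom_polys] subdom_diff[OF factorial_subdom_polys] by blast
    have "degree s' \<le> degree s" unfolding s'_def
    proof (rule degree_diff_le)
      show "degree ([:?l:] * s) \<le> degree s" by (simp add: degree_smult_le)
      show "degree (?t * m) \<le> degree s"
        using degree_mult_le[of ?t m] degree_monom_le[of "lead_coeff s" "degree s - degree m"] False by linarith
    qed
    moreover have "coeff s' (degree s) = 0"
    proof -
      have "coeff (?t * m) (degree s) = lead_coeff s * ?l"
        using False by (simp add: coeff_monom_mult)
      then show ?thesis unfolding s'_def by (simp add: mult.commute)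
    qed
    ultimately have s'0: "s' = 0 \<or> degree s' < degree s" by (rule eq_zero_or_degree_less)
    have "\<exists>c q r. c \<in> A \<and> c \<noteq> 0 \<and> q \<in> polys A \<and> r \<in> polys A \<and> [:c:] * s' = q * m + r \<and> (r = 0 \<or> degree r < degree m)"
    proof (cases "s' = 0")
      case True then show ?thesis using subdomD[OF factorial_subdom] subdomD[OF factorial_subdom_polys] by (intro exI[of _ 1] exI[of _ 0]) auto
    next
      case False then show ?thesis using less(1) s'P s'0 by blast
    qed
    then obtain c q r where c: "c \<in> A" "c \<noteq> 0" "q \<in> polys A" "r \<in> polys A" "[:c:] * s' = q * m + r" "r = 0 \<or> degree r < degree m" by blast
    have "[:c * ?l:] * s = [:c:] * ([:?l:] * s)" by (simp add: mult.commute)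
    also have "\<dots> = [:c:] * (s' + ?t * m)" unfolding s'_def by simp
    also have "\<dots> = [:c:] * s' + [:c:] * ?t * m" by (simp only: distrib_left mult.assoc)
    also have "\<dots> = (q + [:c:] * ?t) * m + r" unfolding c(5) by (simp only: distrib_right add.assoc add.commute add.left_commute)
    finally have "[:c * ?l:] * s = (q + [:c:] * ?t) * m + r" .
    moreover have "q + [:c:] * ?t \<in> polys A" using c tP const_polys[OF factorial_subdom] subdomD[OF factorial_subdom_polys] by blast
    moreover have "c * ?l \<in> A" "c * ?l \<noteq> 0" using c lA subdomD(4)[OF factorial_subdom] by auto
    ultimately show ?thesis using c by blast
  qed
qed

text \<open>An element \<open>m\<close> of least degree in the ideal of \<open>f\<close> and
  \<open>g\<close> divides, up to constants, everything in that ideal. If \<open>m\<close> is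
  constant, \<open>m * h\<close> is a multiple of \<open>f\<close>, and so is \<open>h\<close>.
  Otherwise the primitive part of \<open>m\<close> divides both \<open>f\<close> and
  \<open>g\<close>, and irreducibility makes it associate to \<open>f\<close>.\<close>

lemma primitive_irreducible_prime:
  assumes f: "primitive f" "degree f > 0"
    and irr: "\<And>g h. \<lbrakk>g \<in> polys A; h \<in> polys A; f = g * h\<rbrakk> \<Longrightarrow> degree g = 0 \<or> degree h = 0"
  shows "prime_in (polys A) f"
  unfolding prime_in_def
proof (intro conjI ballI impI)
  show fP: "f \<in> polys A" "f \<noteq> 0" using f unfolding primitive_def by blast+
  show "\<not> unit_in (polys A) f" using unit_polys[OF factorial_subdom] f(2) by force
  fix g h assume g: "g \<in> polys A" and h: "h \<in> polys A" and fgh: "dvd_in (polys A) f (g * h)"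
  define J where "J = {a * f + b * g | a b. a \<in> polys A \<and> b \<in> polys A}"
  have JP: "J \<subseteq> polys A" unfolding J_def using fP g subdomD(3,4)[OF factorial_subdom_polys] by blast
  have "f = 1 * f + 0 * g" "g = 0 * f + 1 * g" by simp_all
  then have fJ: "f \<in> J" and gJ: "g \<in> J" unfolding J_def using subdomD(1,2)[OF factorial_subdom_polys] by blast+
  have Jlin: "u * s - v * t \<in> J" if st: "s \<in> J" "t \<in> J" and uv: "u \<in> polys A" "v \<in> polys A" for s t u v
  proof -
    obtain a b a' b' where ab: "a \<in> polys A" "b \<in> polys A" "s = a * f + b * g" "a' \<in> polys A" "b' \<in> polys A" "t = a' * f + b' * g"
      using st unfolding J_def by blast
    have "u * s - v * t = (u * a - v * a') * f + (u * b - v * b') * g" unfolding ab(3,6) by (simp add: algebra_simps)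
    moreover have "u * a - v * a' \<in> polys A" "u * b - v * b' \<in> polys A"
      using ab uv subdomD(4)[OF factorial_subdom_polys] subdom_diff[OF factorial_subdom_polys] by blast+
    ultimately show ?thesis unfolding J_def by blast
  qed
  define n where "n = (LEAST n. \<exists>m\<in>J. m \<noteq> 0 \<and> degree m = n)"
  have ex: "\<exists>n. \<exists>m\<in>J. m \<noteq> 0 \<and> degree m = n" using fJ fP(2) by blast
  obtain m where m: "m \<in> J" "m \<noteq> 0" "degree m = n" using LeastI_ex[OF ex] unfolding n_def by blast
  have min: "r = 0" if "r \<in> J" "r = 0 \<or> degree r < degree m" for r
  proof (rule ccontr)
    assume "r \<noteq> 0"
    then have "degree r < n" using that(2) m(3) by simp
    then show False using not_less_Least[of "degree r" "\<lambda>n. \<exists>m\<in>J. m \<noteq> 0 \<and> degree m = n"] \<open>r \<noteq> 0\<close> that(1)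
      unfolding n_def by blast
  qed
  have mP: "m \<in> polys A" using m JP by blast
  have quot: "\<exists>c q. c \<in> A \<and> c \<noteq> 0 \<and> q \<in> polys A \<and> [:c:] * s = q * m" if s: "s \<in> J" for s
  proof -
    obtain c q r where c: "c \<in> A" "c \<noteq> 0" "q \<in> polys A" "[:c:] * s = q * m + r" "r = 0 \<or> degree r < degree m"
      using pseudo_division[OF mP m(2)] s JP by blast
    have "r = [:c:] * s - q * m" using c(4) by simp
    then have "r \<in> J" using Jlin[OF s m(1)] c const_polys[OF factorial_subdom] by blast
    \<comment> \<open>The remainder lies in the ideal and has smaller degree than \<open>m\<close>,
      so it vanishes.\<close>
    then show ?thesis using min c by fastforce
  qed
  have fac: "\<exists>k. fac A k c" if "c \<in> A" "c \<noteq> 0" for c using fA that unfolding factorial_in_def by blast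
  show "dvd_in (polys A) f g \<or> dvd_in (polys A) f h"
  proof (cases "degree m = 0")
    case True
    then obtain \<mu> where \<mu>: "m = [:\<mu>:]" by (rule degree_eq_zeroE)
    then have \<mu>A: "\<mu> \<in> A" "\<mu> \<noteq> 0" using mP m(2) const_polys[OF factorial_subdom] by auto
    obtain a b where ab: "a \<in> polys A" "b \<in> polys A" "m = a * f + b * g" using m(1) unfolding J_def by blast
    \<comment> \<open>The Bezout relation times \<open>h\<close>: both summands are multiples of
      \<open>f\<close>, the second by assumption on \<open>g * h\<close>.\<close>
    have "m * h = f * (a * h) + (g * h) * b" unfolding ab(3) by (simp add: algebra_simps)
    moreover have "dvd_in (polys A) f (f * (a * h))" using ab h subdomD(4)[OF factorial_subdom_polys] unfolding dvd_in_def by blast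
    ultimately have "dvd_in (polys A) f ([:\<mu>:] * h)"
      using dvd_in_add[OF factorial_subdom_polys] dvd_in_mult[OF factorial_subdom_polys fgh ab(2)] \<mu> by simp
    then show ?thesis using const_cancel f(1) h fac[OF \<mu>A] by blast
  next
    case False
    obtain d k m0 where m0: "fac A k d" "primitive m0" "m = [:d:] * m0" using primitive_part[OF mP m(2)] by blast
    have m0P: "m0 \<in> polys A" using m0 unfolding primitive_def by blast
    have dP: "[:d:] \<in> polys A" and d0: "d \<noteq> 0" using fac_in[OF factorial_subdom m0(1)] const_polys[OF factorial_subdom] by auto
    have dvd0: "dvd_in (polys A) m0 s" if s: "s \<in> J" for s
    proof -
      obtain c q where c: "c \<in> A" "c \<noteq> 0" "q \<in> polys A" "[:c:] * s = q * m" using quot[OF s] by blast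
      have "[:c:] * s = m0 * (q * [:d:])" unfolding c(4) m0(3) by (simp only: ac_simps)
      then have "dvd_in (polys A) m0 ([:c:] * s)" unfolding dvd_in_def using c(3) dP subdomD(4)[OF factorial_subdom_polys] by blast
      then show ?thesis using const_cancel m0(2) s JP fac[OF c(1,2)] by blast
    qed
    obtain k where k: "k \<in> polys A" "f = m0 * k" using dvd0[OF fJ] unfolding dvd_in_def by blast
    have "degree m0 = degree m" unfolding m0(3) using d0 by simp
    then have "degree k = 0" using irr[OF m0P k] False by simp
    then obtain \<kappa> where \<kappa>: "k = [:\<kappa>:]" by (rule degree_eq_zeroE)
    have \<kappa>A: "\<kappa> \<in> A" "\<kappa> \<noteq> 0" using \<kappa> k fP(2) const_polys[OF factorial_subdom] by auto
    obtain l where l: "fac A l \<kappa>" using fac[OF \<kappa>A] by blast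
    \<comment> \<open>A prime factor of \<kappa> would divide \<open>f\<close>, against
      primitivity.\<close>
    have "unit_in A \<kappa>" using l
    proof cases
      case (prime p n a)
      have "f = [:p:] * (m0 * [:a:])" unfolding k(2) \<kappa> prime(2) by (simp add: ac_simps)
      moreover have "m0 * [:a:] \<in> polys A" using m0P fac_in[OF factorial_subdom prime(4)] const_polys[OF factorial_subdom] subdomD(4)[OF factorial_subdom_polys] by blast
      ultimately have "dvd_in (polys A) [:p:] f" unfolding dvd_in_def by blast
      then show ?thesis using f(1) prime(3) unfolding primitive_def by blast
    qed simp
    then obtain v where v: "v \<in> A" "\<kappa> * v = 1" unfolding unit_in_def by blast
    obtain w where w: "w \<in> polys A" "g = m0 * w" using dvd0[OF gJ] unfolding dvd_in_def by blast
    have "f * ([:v:] * w) = ([:\<kappa>:] * [:v:]) * (m0 * w)" unfolding k(2) \<kappa> by (simp only: ac_simps)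
    also have "\<dots> = g" using v w by (simp add: mult.commute[of v \<kappa>])
    finally have "g = f * ([:v:] * w)" ..
    moreover have "[:v:] * w \<in> polys A" using v w const_polys[OF factorial_subdom] subdomD(4)[OF factorial_subdom_polys] by blast
    ultimately show ?thesis unfolding dvd_in_def by blast
  qed
qed

lemma fac_const: "fac A n c \<Longrightarrow> fac (polys A) n [:c:]"
proof (induction rule: fac.induct)
  case (unit u) then show ?case using unit_const[OF _ factorial_subdom] fac.unit by blast
next
  case (prime p n a)
  then have "fac (polys A) (Suc n) ([:p:] * [:a:])" using fac.prime prime_const[OF factorial_subdom] by blast
  then show ?case by (simp add: mult.commute)
qed

text \<open>Factors of a primitive polynomial are primitive, so splitting into factors of positive
  degree ends, by degree, in polynomials to which the irreducibility criterion applies.\<close>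

lemma primitive_fac: "primitive f \<Longrightarrow> \<exists>n. fac (polys A) n f"
proof (induction "degree f" arbitrary: f rule: less_induct)
  case less
  then have fP: "f \<in> polys A" "f \<noteq> 0" unfolding primitive_def by blast+
  show ?case
  proof (cases "degree f = 0")
    case True
    then obtain a where a: "f = [:a:]" by (rule degree_eq_zeroE)
    then have "a \<in> A" "a \<noteq> 0" using fP const_polys[OF factorial_subdom] by auto
    then show ?thesis using fA fac_const unfolding a factorial_in_def by blast
  next
    case False
    show ?thesis
    proof (cases "\<exists>g h. g \<in> polys A \<and> h \<in> polys A \<and> f = g * h \<and> degree g \<noteq> 0 \<and> degree h \<noteq> 0")
      case True
      then obtain g h where gh: "g \<in> polys A" "h \<in> polys A" "f = g * h" "degree g \<noteq> 0" "degree h \<noteq> 0" by blast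
      then have nz: "g \<noteq> 0" "h \<noteq> 0" by auto
      have deg: "degree f = degree g + degree h" unfolding gh(3) using degree_mult_eq[OF nz] .
      have "primitive g" using less(2) gh nz dvd_in_mult[OF factorial_subdom_polys] unfolding primitive_def by blast
      moreover have "primitive h" using less(2) gh nz dvd_in_mult2[OF factorial_subdom_polys] unfolding primitive_def by blast
      ultimately obtain n m where "fac (polys A) n g" "fac (polys A) m h" using less(1) deg gh(4,5) by (metis add_cancel_left_right add_cancel_right_right less_add_same_cancel1 less_add_same_cancel2 neq0_conv)
      then show ?thesis unfolding gh(3) using fac_mult[OF factorial_subdom_polys] by blast
    next
      case no: False
      have "prime_in (polys A) f" by (rule primitive_irreducible_prime) (use less(2) False no in auto)
      moreover have "fac (polys A) 0 1" by (rule fac.unit) (use factorial_subdom_polys in \<open>auto simp: unit_in_def subdomD\<close>)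
      ultimately have "fac (polys A) (Suc 0) (f * 1)" by (rule fac.prime)
      then show ?thesis by auto
    qed
  qed
qed

theorem factorial_polys: "factorial_in (polys A)"
  unfolding factorial_in_def
proof (intro conjI ballI impI factorial_subdom_polys)
  fix f assume "f \<in> polys A" "f \<noteq> 0"
  then obtain c n g where c: "fac A n c" "primitive g" "f = [:c:] * g" using primitive_part by blast
  then show "\<exists>n. fac (polys A) n f" using fac_mult[OF factorial_subdom_polys fac_const] primitive_fac by blast
qed

end

text \<open>Divisibility, units and primes are reflected by a homomorphism injective on
  \<open>C\<close>. This moves Gauss's theorem from univariate polynomials over
  \<open>mpolys J\<close> to polynomials with one more variable.\<close>

lemma factorial_transport:
  fixes h :: "'a::idom \<Rightarrow> 'b::idom"
  assumes C: "factorial_in C"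
    and h: "\<And>a b. a \<in> C \<Longrightarrow> b \<in> C \<Longrightarrow> h (a + b) = h a + h b \<and> h (a * b) = h a * h b"
    and h1: "h 1 = 1" and inj: "\<And>a. a \<in> C \<Longrightarrow> h a = 0 \<Longrightarrow> a = 0"
  shows "factorial_in (h ` C)" and "\<And>x. unit_in (h ` C) x \<Longrightarrow> \<exists>v. unit_in C v \<and> x = h v"
proof -
  have S: "subdom C" using C unfolding factorial_in_def by blast
  have "h (0 + 0) = h 0 + h 0" using h subdomD(1)[OF S] by blast
  then have h0: "h 0 = 0" by (simp only: add_0_right) (metis add_cancel_right_right)
  have hm: "h (- a) = - h a" if "a \<in> C" for a
    using h[OF that subdomD(5)[OF S that]] h0 by (simp add: eq_neg_iff_add_eq_0 add.commute)
  have inj': "a = b" if "a \<in> C" "b \<in> C" "h a = h b" for a b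
  proof -
    have "h (a + - b) = 0" using h[OF that(1) subdomD(5)[OF S that(2)]] hm[OF that(2)] that(3) by simp
    then have "a + - b = 0" using inj subdomD(3,5)[OF S] that by blast
    then show ?thesis by simp
  qed
  have S': "subdom (h ` C)" unfolding subdom_def
  proof (intro conjI ballI)
    show "0 \<in> h ` C" "1 \<in> h ` C" using h0 h1 subdomD(1,2)[OF S] by (metis image_eqI)+
    fix x y assume "x \<in> h ` C" "y \<in> h ` C"
    then obtain a b where ab: "a \<in> C" "b \<in> C" "x = h a" "y = h b" by blast
    show "x + y \<in> h ` C" "x * y \<in> h ` C" using h[OF ab(1,2)] ab subdomD(3,4)[OF S ab(1,2)] by (metis image_eqI)+
  next
    fix x assume "x \<in> h ` C"
    then obtain a where a: "a \<in> C" "x = h a" by blast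
    then show "- x \<in> h ` C" using hm subdomD(5)[OF S] by (metis image_eqI)
  qed
  have d: "dvd_in (h ` C) (h a) (h b) \<longleftrightarrow> dvd_in C a b" if "a \<in> C" "b \<in> C" for a b
  proof
    assume "dvd_in (h ` C) (h a) (h b)"
    then obtain c where c: "c \<in> C" "h b = h a * h c" unfolding dvd_in_def by blast
    then have "h b = h (a * c)" using h that by simp
    then show "dvd_in C a b" unfolding dvd_in_def using inj'[OF that(2) subdomD(4)[OF S that(1) c(1)]] c(1) by blast
  next
    assume "dvd_in C a b"
    then show "dvd_in (h ` C) (h a) (h b)" unfolding dvd_in_def using h that by blast
  qed
  have u: "unit_in (h ` C) (h a) \<longleftrightarrow> unit_in C a" if "a \<in> C" for a
  proof -
    have "unit_in (h ` C) (h a) \<longleftrightarrow> dvd_in (h ` C) (h a) (h 1)" unfolding unit_in_def dvd_in_def h1 using that by auto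
    also have "\<dots> \<longleftrightarrow> unit_in C a" unfolding d[OF that subdomD(2)[OF S]] unfolding unit_in_def dvd_in_def using that by auto
    finally show ?thesis .
  qed
  have p: "prime_in (h ` C) (h a)" if "prime_in C a" for a
  proof -
    have a: "a \<in> C" "a \<noteq> 0" "\<not> unit_in C a" using that unfolding prime_in_def by blast+
    have "dvd_in (h ` C) (h a) (h b) \<or> dvd_in (h ` C) (h a) (h c)"
      if "b \<in> C" "c \<in> C" "dvd_in (h ` C) (h a) (h b * h c)" for b c
    proof -
      have "dvd_in C a (b * c)" using that h[OF that(1,2)] d[OF a(1) subdomD(4)[OF S that(1,2)]] by simp
      then show ?thesis using \<open>prime_in C a\<close> that d[OF a(1)] unfolding prime_in_def by blast
    qed
    then show ?thesis unfolding prime_in_def using a u[OF a(1)] inj by blast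
  qed
  have f: "fac C n a \<Longrightarrow> fac (h ` C) n (h a)" for n a
  proof (induction rule: fac.induct)
    case (unit v) then show ?case using u fac.unit unfolding unit_in_def by metis
  next
    case (prime q n a)
    have "q \<in> C" "a \<in> C" using prime fac_in[OF S] unfolding prime_in_def by blast+
    then show ?case using fac.prime[OF p[OF prime(1)] prime(3)] h by simp
  qed
  have "\<exists>n. fac (h ` C) n x" if x: "x \<in> h ` C" "x \<noteq> 0" for x
  proof -
    obtain a where a: "a \<in> C" "x = h a" using x(1) by blast
    then have "a \<noteq> 0" using x(2) h0 by auto
    then obtain n where "fac C n a" using C a(1) unfolding factorial_in_def by blast
    then show ?thesis using f a(2) by auto
  qed
  then show "factorial_in (h ` C)" unfolding factorial_in_def using S' by simp
  show "\<exists>v. unit_in C v \<and> x = h v" if x: "unit_in (h ` C) x" for x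
  proof -
    obtain a where a: "a \<in> C" "x = h a" using x unfolding unit_in_def by blast
    then show ?thesis using u[OF a(1)] x by auto
  qed
qed

section \<open>Polynomial rings\<close>

abbreviation mpolys :: "'v set \<Rightarrow> ('v, 'k::comm_ring_1) mpolynomial set" where
  "mpolys V \<equiv> carrier (mpolynomial_ring V)"

lemma mpolys_iff: "p \<in> mpolys V \<longleftrightarrow> (\<forall>m\<in>Poly_Mapping.keys p. Poly_Mapping.keys m \<subseteq> V)"
  by (simp add: mpolynomial_ring_def)

lemma mpolynomial_ring_simps:
  "monoid.mult (mpolynomial_ring V) = (*)" "ring.add (mpolynomial_ring V) = (+)"
  "one (mpolynomial_ring V) = 1" "ring.zero (mpolynomial_ring V) = 0"
  by (simp_all add: mpolynomial_ring_def)

lemma mpolys_closed: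
  fixes p q :: "('v, 'k::comm_ring_1) mpolynomial"
  shows "0 \<in> mpolys V" "1 \<in> mpolys V" "p \<in> mpolys V \<Longrightarrow> q \<in> mpolys V \<Longrightarrow> p + q \<in> mpolys V"
    "p \<in> mpolys V \<Longrightarrow> q \<in> mpolys V \<Longrightarrow> p * q \<in> mpolys V" "p \<in> mpolys V \<Longrightarrow> - p \<in> mpolys V"
proof -
  interpret cring "mpolynomial_ring V :: ('v,'k) mpolynomial ring" by (rule mpoly_cring)
  show "p \<in> mpolys V \<Longrightarrow> q \<in> mpolys V \<Longrightarrow> p + q \<in> mpolys V" "p \<in> mpolys V \<Longrightarrow> q \<in> mpolys V \<Longrightarrow> p * q \<in> mpolys V"
    using a_closed[of p q] m_closed[of p q] by (simp_all add: mpolynomial_ring_simps)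
qed (simp_all add: mpolys_iff)

lemma mpolys_sum: "(\<And>i. i \<in> I \<Longrightarrow> f i \<in> mpolys V) \<Longrightarrow> (\<Sum>i\<in>I. f i) \<in> mpolys V"
  by (induction I rule: infinite_finite_induct) (auto simp: mpolys_closed)

lemma mpolys_single: "Poly_Mapping.keys m \<subseteq> V \<Longrightarrow> Poly_Mapping.single m c \<in> mpolys V"
  by (simp add: mpolys_iff)

lemma monomials: "p = (\<Sum>m\<in>Poly_Mapping.keys p. Poly_Mapping.single m (Poly_Mapping.lookup p m))"
proof (rule poly_mapping_eqI)
  fix n
  have "Poly_Mapping.lookup (\<Sum>m\<in>Poly_Mapping.keys p. Poly_Mapping.single m (Poly_Mapping.lookup p m)) n
      = (\<Sum>m\<in>Poly_Mapping.keys p. if m = n then Poly_Mapping.lookup p m else 0)"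
    by (simp add: lookup_sum lookup_single when_def)
  then show "Poly_Mapping.lookup p n = Poly_Mapping.lookup (\<Sum>m\<in>Poly_Mapping.keys p. Poly_Mapping.single m (Poly_Mapping.lookup p m)) n"
    by (simp add: sum.delta in_keys_iff)
qed

lemma subdom_mpolys:
  "subdom (mpolys J :: (('i::linorder \<Rightarrow>\<^sub>0 nat) \<Rightarrow>\<^sub>0 'k::field) set)"
  unfolding subdom_def using mpolys_closed by blast

lemma keys_add_nat: "Poly_Mapping.keys (m + n) = Poly_Mapping.keys m \<union> Poly_Mapping.keys (n :: 'v \<Rightarrow>\<^sub>0 nat)"
  by (auto simp: in_keys_iff lookup_add)

lemma lookup_times_single:
  fixes c :: "('v, 'k::comm_ring_1) mpolynomial"
  shows "Poly_Mapping.lookup (c * Poly_Mapping.single s 1) n = (\<Sum>m\<in>Poly_Mapping.keys c. Poly_Mapping.lookup c m when m + s = n)"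
proof -
  have "c * Poly_Mapping.single s 1 = (\<Sum>m\<in>Poly_Mapping.keys c. Poly_Mapping.single (m + s) (Poly_Mapping.lookup c m))"
    by (subst (1) monomials[of c]) (simp add: sum_distrib_right mult_single)
  then show ?thesis by (simp add: lookup_sum lookup_single)
qed

lemma single_power: "Poly_Mapping.single (Poly_Mapping.single j (1::nat)) (1::'k::comm_ring_1) ^ i = Poly_Mapping.single (Poly_Mapping.single j i) 1"
  by (induction i) (simp_all add: mult_single single_add[symmetric])

text \<open>Evaluation at the new variable \<open>x\<close> identifies univariate polynomials over
  \<open>mpolys J\<close> with \<open>mpolys (insert j J)\<close>: splitting off the power of
  \<open>j\<close> in a monomial is unique.\<close>

lemma mpolys_insert:
  fixes J :: "'i::linorder set"
  assumes j: "j \<notin> J"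
  defines "x \<equiv> Poly_Mapping.single (Poly_Mapping.single j 1) 1 :: ('i, 'k::field) mpolynomial"
  shows "mpolys (insert j J) = (\<lambda>f. poly f x) ` polys (mpolys J)"
    and "\<And>f. f \<in> polys (mpolys J) \<Longrightarrow> poly f x = 0 \<Longrightarrow> f = 0"
proof -
  have xp: "x ^ i = Poly_Mapping.single (Poly_Mapping.single j i) 1" for i unfolding x_def by (rule single_power)
  note S = subdom_mpolys[of J, where 'k='k] and S' = subdom_mpolys[of "insert j J", where 'k='k]
  note P = subdom_polys[OF S]
  \<comment> \<open>Reads off coefficients: exponents of the form \<open>m0\<close> plus a multiple
    of \<open>j\<close>, with \<open>m0\<close> supported in \<open>J\<close>, determine both parts
    because \<open>j\<close> is not in \<open>J\<close>.\<close>
  have coef: "Poly_Mapping.lookup (c * x ^ i) (m0 + Poly_Mapping.single j i') = (if i = i' then Poly_Mapping.lookup c m0 else 0)"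
    if c: "c \<in> mpolys J" and m0: "Poly_Mapping.keys m0 \<subseteq> J" for c :: "('i, 'k) mpolynomial" and i i' m0
  proof -
    have eq: "m + Poly_Mapping.single j i = m0 + Poly_Mapping.single j i' \<longleftrightarrow> m = m0 \<and> i = i'" if m: "m \<in> Poly_Mapping.keys c" for m
    proof
      assume e: "m + Poly_Mapping.single j i = m0 + Poly_Mapping.single j i'"
      have "Poly_Mapping.lookup m j = 0" "Poly_Mapping.lookup m0 j = 0"
        using c m m0 j unfolding mpolys_iff by (auto simp: in_keys_iff subset_iff)
      then have "i = i'" using arg_cong[OF e, of "\<lambda>m. Poly_Mapping.lookup m j"] by (simp add: lookup_add)
      then show "m = m0 \<and> i = i'" using e by simp
    qed simp
    have "Poly_Mapping.lookup (c * x ^ i) (m0 + Poly_Mapping.single j i') =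
       (\<Sum>m\<in>Poly_Mapping.keys c. Poly_Mapping.lookup c m when m = m0 \<and> i = i')"
      unfolding xp lookup_times_single by (rule sum.cong) (simp_all add: eq)
    also have "\<dots> = (if i = i' then Poly_Mapping.lookup c m0 else 0)"
    proof (cases "i = i' \<and> m0 \<in> Poly_Mapping.keys c")
      case True
      then have "(\<Sum>m\<in>Poly_Mapping.keys c. Poly_Mapping.lookup c m when m = m0 \<and> i = i') = (\<Sum>m\<in>{m0}. Poly_Mapping.lookup c m when m = m0 \<and> i = i')"
        by (intro sum.mono_neutral_right) auto
      then show ?thesis using True by simp
    next
      case False
      then have "(\<Sum>m\<in>Poly_Mapping.keys c. Poly_Mapping.lookup c m when m = m0 \<and> i = i') = 0" by (intro sum.neutral) (auto simp: when_def)
      then show ?thesis using False by (simp add: in_keys_iff)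
    qed
    finally show ?thesis .
  qed
  show "f = 0" if f: "f \<in> polys (mpolys J)" "poly f x = 0" for f
  proof (rule poly_eqI)
    fix i
    have cf: "coeff f i \<in> mpolys J" for i using f(1) unfolding polys_def by blast
    have "Poly_Mapping.lookup (coeff f i) m = 0" for m
    proof (cases "Poly_Mapping.keys m \<subseteq> J \<and> i \<le> degree f")
      case True
      have "0 = Poly_Mapping.lookup (poly f x) (m + Poly_Mapping.single j i)" using f(2) by simp
      also have "\<dots> = (\<Sum>k\<le>degree f. if k = i then Poly_Mapping.lookup (coeff f k) m else 0)"
        unfolding poly_altdef lookup_sum by (rule sum.cong) (use True coef[OF cf] in auto)
      also have "\<dots> = Poly_Mapping.lookup (coeff f i) m" using True by (simp add: sum.delta)
      finally show ?thesis ..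
    next
      case False
      then show ?thesis using cf[of i] unfolding mpolys_iff by (auto simp: in_keys_iff coeff_eq_0)
    qed
    then show "coeff f i = coeff 0 i" by (intro poly_mapping_eqI) simp
  qed
  show "mpolys (insert j J) = (\<lambda>f. poly f x) ` polys (mpolys J)"
  proof (intro equalityI subsetI)
    fix p :: "('i, 'k) mpolynomial" assume p: "p \<in> mpolys (insert j J)"
    have "\<exists>f\<in>polys (mpolys J). Poly_Mapping.single m (Poly_Mapping.lookup p m) = poly f x" if m: "m \<in> Poly_Mapping.keys p" for m
    proof -
      \<comment> \<open>The exponent with its \<open>j\<close> part removed.\<close>
      define m' where "m' = m - Poly_Mapping.single j (Poly_Mapping.lookup m j)"
      have mm': "m = m' + Poly_Mapping.single j (Poly_Mapping.lookup m j)"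
        unfolding m'_def by (rule poly_mapping_eqI) (simp add: lookup_add lookup_minus lookup_single when_def)
      have "Poly_Mapping.keys m' \<subseteq> J"
      proof
        fix i assume i: "i \<in> Poly_Mapping.keys m'"
        then have "i \<noteq> j" "i \<in> Poly_Mapping.keys m" unfolding m'_def by (auto simp: in_keys_iff lookup_minus lookup_single when_def split: if_splits)
        then show "i \<in> J" using p m unfolding mpolys_iff by blast
      qed
      then have c: "Poly_Mapping.single m' (Poly_Mapping.lookup p m) \<in> mpolys J" by (rule mpolys_single)
      let ?f = "monom (Poly_Mapping.single m' (Poly_Mapping.lookup p m)) (Poly_Mapping.lookup m j)"
      have "?f \<in> polys (mpolys J)" using c mpolys_closed(1) unfolding polys_def by (auto simp: coeff_monom)
      moreover have "poly ?f x = Poly_Mapping.single m (Poly_Mapping.lookup p m)"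
        unfolding poly_monom xp by (simp add: mult_single mm'[symmetric])
      ultimately show ?thesis by metis
    qed
    then obtain f where f: "\<And>m. m \<in> Poly_Mapping.keys p \<Longrightarrow> f m \<in> polys (mpolys J) \<and> Poly_Mapping.single m (Poly_Mapping.lookup p m) = poly (f m) x" by metis
    have "p = (\<Sum>m\<in>Poly_Mapping.keys p. poly (f m) x)" by (subst (1) monomials[of p]) (rule sum.cong, use f in auto)
    also have "\<dots> = poly (\<Sum>m\<in>Poly_Mapping.keys p. f m) x" by (simp add: poly_sum)
    finally have e: "p = poly (\<Sum>m\<in>Poly_Mapping.keys p. f m) x" .
    have "(\<Sum>m\<in>Poly_Mapping.keys p. f m) \<in> polys (mpolys J)" by (rule sum_in[OF P]) (simp add: f)
    from imageI[OF this, of "\<lambda>f. poly f x"] show "p \<in> (\<lambda>f. poly f x) ` polys (mpolys J)" unfolding e[symmetric] .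
  next
    fix p assume "p \<in> (\<lambda>f. poly f x) ` polys (mpolys J)"
    then obtain f where f: "p = poly f x" "f \<in> polys (mpolys J)" by (rule imageE)
    have "coeff f i * x ^ i \<in> mpolys (insert j J)" for i
      by (rule mpolys_closed(4)) (use f(2) xp in \<open>auto simp: polys_def mpolys_iff\<close>)
    then show "p \<in> mpolys (insert j J)" unfolding f(1) poly_altdef by (rule mpolys_sum)
  qed
qed

text \<open>One variable at a time, from the field in the empty case. The claim on units travels
  along since units of a polynomial ring over a domain are units of the coefficient ring.\<close>

theorem factorial_mpolys:
  fixes J :: "'i::linorder set"
  assumes "finite J"
  shows "factorial_in (mpolys J :: ('i, 'k::field) mpolynomial set) \<and>
    (\<forall>u::('i, 'k) mpolynomial. unit_in (mpolys J) u \<longrightarrow> (\<exists>c. u = Poly_Mapping.single 0 c))"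
  using assms
proof (induction J)
  case empty
  have const: "\<exists>c. p = Poly_Mapping.single 0 c" if "p \<in> mpolys {}" for p :: "('i, 'k) mpolynomial"
  proof
    have "Poly_Mapping.keys p \<subseteq> {0}" using that unfolding mpolys_iff by auto
    then show "p = Poly_Mapping.single 0 (Poly_Mapping.lookup p 0)"
      by (intro poly_mapping_eqI) (auto simp: lookup_single when_def in_keys_iff subset_iff)
  qed
  have "\<exists>n. fac (mpolys {}) n p" if p: "p \<in> mpolys {}" "p \<noteq> 0" for p :: "('i, 'k) mpolynomial"
  proof -
    obtain c where c: "p = Poly_Mapping.single 0 c" using const p(1) by blast
    then have "c \<noteq> 0" using p(2) by auto
    then have "p * Poly_Mapping.single 0 (inverse c) = 1" unfolding c by (simp add: mult_single)
    moreover have "Poly_Mapping.single 0 (inverse c) \<in> mpolys {}" by (rule mpolys_single) simp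
    ultimately have "unit_in (mpolys {}) p" using p(1) unfolding unit_in_def by blast
    then show ?thesis using fac.unit by blast
  qed
  then show ?case unfolding factorial_in_def using subdom_mpolys const unfolding unit_in_def by blast
next
  case (insert j J)
  define x where "x = (Poly_Mapping.single (Poly_Mapping.single j 1) 1 :: ('i, 'k) mpolynomial)"
  note ins = mpolys_insert[OF insert(2), where 'k='k, folded x_def]
  have f: "factorial_in (mpolys J :: ('i, 'k) mpolynomial set)" using insert by blast
  note tr = factorial_transport[OF factorial_polys[OF f], of "\<lambda>f. poly f x"]
  have "factorial_in ((\<lambda>f. poly f x) ` polys (mpolys J))" by (rule tr(1)) (use ins(2) in auto)
  moreover have "\<exists>c. u = Poly_Mapping.single 0 c" if u: "unit_in (mpolys (insert j J)) u" for u :: "('i, 'k) mpolynomial"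
  proof -
    have "\<exists>v. unit_in (polys (mpolys J)) v \<and> u = poly v x" by (rule tr(2)) (use ins u in auto)
    then obtain v where v: "unit_in (polys (mpolys J)) v" "u = poly v x" by blast
    obtain w where w: "unit_in (mpolys J) w" "v = [:w:]" using unit_polys[OF subdom_mpolys v(1)] by blast
    then show ?thesis using v(2) insert.IH by auto
  qed
  ultimately show ?case unfolding ins(1) by blast
qed

section \<open>Rings with face maps\<close>

text \<open>\<open>\<pi> F\<close> plays the role of the projection from the face ring onto the polynomial ring of a face.\<close>

locale face_ring = cring R for R (structure) +
  fixes \<Delta> :: "'v set set" and \<pi> :: "'v set \<Rightarrow> 'a \<Rightarrow> 't::idom"
  assumes finite_faces: "finite \<Delta>"
    and down: "\<lbrakk>F \<in> \<Delta>; G \<subseteq> F\<rbrakk> \<Longrightarrow> G \<in> \<Delta>"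
    and \<pi>_add: "\<lbrakk>F \<in> \<Delta>; a \<in> carrier R; b \<in> carrier R\<rbrakk> \<Longrightarrow> \<pi> F (a \<oplus> b) = \<pi> F a + \<pi> F b"
    and \<pi>_mult: "\<lbrakk>F \<in> \<Delta>; a \<in> carrier R; b \<in> carrier R\<rbrakk> \<Longrightarrow> \<pi> F (a \<otimes> b) = \<pi> F a * \<pi> F b"
    and \<pi>_one: "F \<in> \<Delta> \<Longrightarrow> \<pi> F \<one> = 1"
    and \<pi>_inj: "\<lbrakk>a \<in> carrier R; \<And>F. F \<in> \<Delta> \<Longrightarrow> \<pi> F a = 0\<rbrakk> \<Longrightarrow> a = \<zero>"
    and \<pi>_lift: "\<lbrakk>F \<in> \<Delta>; a \<in> carrier R\<rbrakk> \<Longrightarrow> \<exists>b\<in>carrier R. \<forall>G\<in>\<Delta>. \<pi> G b = \<pi> (G \<inter> F) a"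
    and \<pi>_mono: "\<lbrakk>G \<in> \<Delta>; F \<subseteq> G; a \<in> carrier R; \<pi> G a = 0\<rbrakk> \<Longrightarrow> \<pi> F a = 0"
    and \<pi>_factorial: "F \<in> \<Delta> \<Longrightarrow> factorial_in (\<pi> F ` carrier R)"
    and \<pi>_unit: "\<lbrakk>F \<in> \<Delta>; a \<in> carrier R; unit_in (\<pi> F ` carrier R) (\<pi> F a)\<rbrakk> \<Longrightarrow> \<pi> F a = \<pi> {} a"

text \<open>The variables are renamed to natural numbers because the type class \<open>idom\<close> is available for
  polynomials only when the variables are linearly ordered.\<close>

locale sr_vars =
  fixes V :: "'v set" and \<Delta> :: "'v set set" and \<iota> :: "'v \<Rightarrow> nat" and k :: "'k::field itself"
  assumes finite_V: "finite V" and complex: "abstract_simplicial_complex V \<Delta>" and inj_\<iota>: "inj_on \<iota> V"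
begin

definition ren :: "('v \<Rightarrow>\<^sub>0 nat) \<Rightarrow> (nat \<Rightarrow>\<^sub>0 nat)" where
  "ren m = (\<Sum>v\<in>V. Poly_Mapping.single (\<iota> v) (Poly_Mapping.lookup m v))"

text \<open>For \<open>F \<subseteq> V\<close> this is restriction to the coordinate subspace of
  \<open>F\<close>: variables outside \<open>F\<close> become zero, the others are renamed by
  \<iota>.\<close>

definition ev :: "'v set \<Rightarrow> ('v, 'k) mpolynomial \<Rightarrow> (nat, 'k) mpolynomial" where
  "ev F p = (\<Sum>m\<in>Poly_Mapping.keys p. if Poly_Mapping.keys m \<subseteq> F then Poly_Mapping.single (ren m) (Poly_Mapping.lookup p m) else 0)"

text \<open>The same restriction kept inside the original ring; it supplies the witness for
  \<open>\<pi>_lift\<close>.\<close>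

definition filt :: "'v set \<Rightarrow> ('v, 'k) mpolynomial \<Rightarrow> ('v, 'k) mpolynomial" where
  "filt F p = (\<Sum>m\<in>Poly_Mapping.keys p. if Poly_Mapping.keys m \<subseteq> F then Poly_Mapping.single m (Poly_Mapping.lookup p m) else 0)"

lemma ren_add: "ren (m + n) = ren m + ren n"
  by (simp add: ren_def lookup_add single_add sum.distrib)

lemma ren_zero: "ren 0 = 0" by (simp add: ren_def)

lemma lookup_ren: "v \<in> V \<Longrightarrow> Poly_Mapping.lookup (ren m) (\<iota> v) = Poly_Mapping.lookup m v"
proof -
  assume v: "v \<in> V"
  have "Poly_Mapping.lookup (ren m) (\<iota> v) = (\<Sum>w\<in>V. if w = v then Poly_Mapping.lookup m w else 0)"
    unfolding ren_def lookup_sum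
    by (rule sum.cong) (use v inj_\<iota> in \<open>auto simp: lookup_single when_def inj_on_def\<close>)
  then show ?thesis using v finite_V by (simp add: sum.delta)
qed

lemma ren_inj: "\<lbrakk>Poly_Mapping.keys m \<subseteq> V; Poly_Mapping.keys n \<subseteq> V; ren m = ren n\<rbrakk> \<Longrightarrow> m = n"
proof (rule poly_mapping_eqI)
  fix v assume a: "Poly_Mapping.keys m \<subseteq> V" "Poly_Mapping.keys n \<subseteq> V" "ren m = ren n"
  show "Poly_Mapping.lookup m v = Poly_Mapping.lookup n v"
  proof (cases "v \<in> V")
    case True then show ?thesis using lookup_ren[of v m] lookup_ren[of v n] a(3) by simp
  next
    case False then show ?thesis using a by (metis in_keys_iff subsetD)
  qed
qed

lemma keys_ren: "Poly_Mapping.keys (ren m) \<subseteq> \<iota> ` Poly_Mapping.keys m"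
proof
  fix i assume "i \<in> Poly_Mapping.keys (ren m)"
  then have "(\<Sum>v\<in>V. Poly_Mapping.lookup (Poly_Mapping.single (\<iota> v) (Poly_Mapping.lookup m v)) i) \<noteq> 0"
    by (simp add: in_keys_iff ren_def lookup_sum)
  then obtain v where "v \<in> V" "Poly_Mapping.lookup (Poly_Mapping.single (\<iota> v) (Poly_Mapping.lookup m v)) i \<noteq> 0"
    by (rule sum.not_neutral_contains_not_neutral)
  then show "i \<in> \<iota> ` Poly_Mapping.keys m" by (auto simp: in_keys_iff lookup_single when_def split: if_splits)
qed

lemma ev_superset: "finite M \<Longrightarrow> Poly_Mapping.keys p \<subseteq> M \<Longrightarrow>
    ev F p = (\<Sum>m\<in>M. if Poly_Mapping.keys m \<subseteq> F then Poly_Mapping.single (ren m) (Poly_Mapping.lookup p m) else 0)"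
  unfolding ev_def by (rule sum.mono_neutral_left) (auto simp: in_keys_iff)

lemma ev_add: "ev F (p + q) = ev F p + ev F q"
proof -
  let ?M = "Poly_Mapping.keys p \<union> Poly_Mapping.keys q"
  have "Poly_Mapping.keys (p + q) \<subseteq> ?M" by (rule Poly_Mapping.keys_add)
  then show ?thesis
    using ev_superset[of ?M "p + q" F] ev_superset[of ?M p F] ev_superset[of ?M q F]
    by (simp add: sum.distrib[symmetric] lookup_add single_add if_distrib cong: if_cong)
qed

lemma ev_zero: "ev F 0 = 0" by (simp add: ev_def)

lemma ev_sum: "ev F (\<Sum>i\<in>I. f i) = (\<Sum>i\<in>I. ev F (f i))"
  by (induction I rule: infinite_finite_induct) (auto simp: ev_add ev_zero)

lemma ev_single: "ev F (Poly_Mapping.single m c) = (if Poly_Mapping.keys m \<subseteq> F then Poly_Mapping.single (ren m) c else 0)"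
  by (cases "c = 0") (simp_all add: ev_def)

text \<open>The support of a product of monomials is the union of the supports, so it lies in
  \<open>F\<close> exactly when both do.\<close>

lemma ev_mult: "ev F (p * q) = ev F p * ev F q"
proof -
  have s: "ev F (Poly_Mapping.single m c * Poly_Mapping.single n d) = ev F (Poly_Mapping.single m c) * ev F (Poly_Mapping.single n d)" for m c n d
    by (auto simp: mult_single ev_single keys_add_nat ren_add)
  have s2: "ev F (p * Poly_Mapping.single n d) = ev F p * ev F (Poly_Mapping.single n d)" for p n d
  proof -
    have "ev F (p * Poly_Mapping.single n d) = (\<Sum>m\<in>Poly_Mapping.keys p. ev F (Poly_Mapping.single m (Poly_Mapping.lookup p m) * Poly_Mapping.single n d))"
      by (subst (1) monomials[of p]) (simp only: sum_distrib_right ev_sum)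
    also have "\<dots> = ev F (\<Sum>m\<in>Poly_Mapping.keys p. Poly_Mapping.single m (Poly_Mapping.lookup p m)) * ev F (Poly_Mapping.single n d)"
      by (simp only: s sum_distrib_right ev_sum)
    finally show ?thesis using monomials[of p] by simp
  qed
  have "ev F (p * q) = (\<Sum>n\<in>Poly_Mapping.keys q. ev F (p * Poly_Mapping.single n (Poly_Mapping.lookup q n)))"
    by (subst (1) monomials[of q]) (simp only: sum_distrib_left ev_sum)
  also have "\<dots> = ev F p * ev F (\<Sum>n\<in>Poly_Mapping.keys q. Poly_Mapping.single n (Poly_Mapping.lookup q n))"
    by (simp only: s2 sum_distrib_left ev_sum)
  finally show ?thesis using monomials[of q] by simp
qed

lemma ev_one: "ev F 1 = 1"
  using ev_single[of F 0 1] by (simp add: ren_zero)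

lemma ev_in: "ev F p \<in> mpolys (\<iota> ` F)"
  unfolding ev_def
proof (rule mpolys_sum)
  fix m show "(if Poly_Mapping.keys m \<subseteq> F then Poly_Mapping.single (ren m) (Poly_Mapping.lookup p m) else 0) \<in> mpolys (\<iota> ` F)"
    using order_trans[OF keys_ren[of m] image_mono[of "Poly_Mapping.keys m" F \<iota>]]
    by (auto intro!: mpolys_single mpolys_closed(1))
qed

lemma lookup_ev:
  assumes p: "p \<in> mpolys V" and m: "Poly_Mapping.keys m \<subseteq> F" "Poly_Mapping.keys m \<subseteq> V"
  shows "Poly_Mapping.lookup (ev F p) (ren m) = Poly_Mapping.lookup p m"
proof -
  have "Poly_Mapping.lookup (ev F p) (ren m) = (\<Sum>n\<in>Poly_Mapping.keys p. if n = m then Poly_Mapping.lookup p n else 0)"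
    unfolding ev_def lookup_sum
  proof (rule sum.cong)
    fix n assume n: "n \<in> Poly_Mapping.keys p"
    with p have "Poly_Mapping.keys n \<subseteq> V" by (simp add: mpolys_iff)
    then have "ren n = ren m \<longleftrightarrow> n = m" using ren_inj[OF _ m(2)] by auto
    then show "Poly_Mapping.lookup (if Poly_Mapping.keys n \<subseteq> F then Poly_Mapping.single (ren n) (Poly_Mapping.lookup p n) else 0) (ren m)
       = (if n = m then Poly_Mapping.lookup p n else 0)" using m(1) by (simp add: lookup_single when_def)
  qed simp
  then show ?thesis by (simp add: sum.delta in_keys_iff)
qed

lemma ev_zero_iff:
  assumes p: "p \<in> mpolys V"
  shows "ev F p = 0 \<longleftrightarrow> (\<forall>m\<in>Poly_Mapping.keys p. \<not> Poly_Mapping.keys m \<subseteq> F)"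
proof
  assume 0: "ev F p = 0"
  show "\<forall>m\<in>Poly_Mapping.keys p. \<not> Poly_Mapping.keys m \<subseteq> F"
  proof (intro ballI notI)
    fix m assume m: "m \<in> Poly_Mapping.keys p" "Poly_Mapping.keys m \<subseteq> F"
    have "Poly_Mapping.keys m \<subseteq> V" using p m(1) by (simp add: mpolys_iff)
    then have "Poly_Mapping.lookup p m = 0" using lookup_ev[OF p m(2)] 0 by simp
    then show False using m(1) by (simp add: in_keys_iff)
  qed
qed (simp add: ev_def)

lemma ev_surj:
  assumes F: "F \<subseteq> V"
  shows "ev F ` mpolys V = mpolys (\<iota> ` F)"
proof (intro equalityI subsetI)
  fix t assume "t \<in> ev F ` mpolys V" then show "t \<in> mpolys (\<iota> ` F)" using ev_in by blast
next
  fix t :: "(nat, 'k) mpolynomial" assume t: "t \<in> mpolys (\<iota> ` F)"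
  define g where "g n = (\<Sum>v\<in>F. Poly_Mapping.single v (Poly_Mapping.lookup n (\<iota> v)))" for n :: "nat \<Rightarrow>\<^sub>0 nat"
  have finF: "finite F" using F finite_V finite_subset by blast
  have lg: "Poly_Mapping.lookup (g n) v = (if v \<in> F then Poly_Mapping.lookup n (\<iota> v) else 0)" for n v
    unfolding g_def lookup_sum lookup_single when_def using finF by (simp add: sum.delta')
  have kg: "Poly_Mapping.keys (g n) \<subseteq> F" for n by (auto simp: in_keys_iff lg split: if_splits)
  have rg: "ren (g n) = n" if n: "Poly_Mapping.keys n \<subseteq> \<iota> ` F" for n
  proof (rule poly_mapping_eqI)
    fix i
    show "Poly_Mapping.lookup (ren (g n)) i = Poly_Mapping.lookup n i"
    proof (cases "i \<in> \<iota> ` F")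
      case True then show ?thesis using lookup_ren[of _ "g n"] lg F by auto
    next
      case False
      then have "i \<notin> Poly_Mapping.keys (ren (g n))" "i \<notin> Poly_Mapping.keys n" using keys_ren[of "g n"] kg[of n] n by blast+
      then show ?thesis by (simp add: in_keys_iff)
    qed
  qed
  let ?p = "\<Sum>n\<in>Poly_Mapping.keys t. Poly_Mapping.single (g n) (Poly_Mapping.lookup t n)"
  have pV: "?p \<in> mpolys V" using kg F by (intro mpolys_sum mpolys_single) blast
  have evp: "ev F ?p = t"
  proof -
    have "ev F ?p = (\<Sum>n\<in>Poly_Mapping.keys t. Poly_Mapping.single n (Poly_Mapping.lookup t n))"
      unfolding ev_sum ev_single by (rule sum.cong) (use rg kg t in \<open>auto simp: mpolys_iff\<close>)
    then show ?thesis using monomials[of t] by simp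
  qed
  show "t \<in> ev F ` mpolys V" using imageI[OF pV, of "ev F"] unfolding evp .
qed

lemma filt_in: "p \<in> mpolys V \<Longrightarrow> filt F p \<in> mpolys V"
  unfolding filt_def by (rule mpolys_sum) (auto simp: mpolys_iff)

lemma ev_filt: "ev G (filt F p) = ev (G \<inter> F) p"
  unfolding filt_def ev_sum ev_def[of "G \<inter> F"]
  by (rule sum.cong) (auto simp: ev_single ev_zero)

abbreviation "SI \<equiv> stanley_reisner_ideal V \<Delta> :: ('v, 'k) mpolynomial set"
abbreviation "SR \<equiv> stanley_reisner_ring V \<Delta> :: ('v, 'k) mpolynomial set ring"

sublocale P: cring "mpolynomial_ring V :: ('v, 'k) mpolynomial ring" by (rule mpoly_cring)

lemma SI_ideal: "ideal SI (mpolynomial_ring V)"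
  unfolding stanley_reisner_ideal_def by (rule P.genideal_ideal) (auto intro: prod_in)

lemma prod_variable: "finite F \<Longrightarrow> (\<Prod>v\<in>F. variable v) = Poly_Mapping.single (\<Sum>v\<in>F. Poly_Mapping.single v 1) (1 :: 'k)"
  by (induction F rule: finite_induct) (simp_all add: variable_def mult_single)

lemma lookup_support: "finite F \<Longrightarrow> Poly_Mapping.lookup (\<Sum>v\<in>F. Poly_Mapping.single v (1::nat)) w = (if w \<in> F then 1 else 0)"
  by (simp add: lookup_sum lookup_single when_def sum.delta')

lemma keys_support: "finite F \<Longrightarrow> Poly_Mapping.keys (\<Sum>v\<in>F. Poly_Mapping.single v (1::nat)) = F"
  by (auto simp: in_keys_iff lookup_support simp del: One_nat_def split: if_splits)

text \<open>The kernel of \<open>ev F\<close> is an ideal, and it contains each generator because a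
  nonface is never inside the face \<open>F\<close>.\<close>

lemma ev_ideal:
  assumes F: "F \<in> \<Delta>" and p: "p \<in> SI"
  shows "ev F p = 0"
proof -
  let ?I = "{p \<in> mpolys V. ev F p = 0} :: ('v, 'k) mpolynomial set"
  have uminus: "\<ominus>\<^bsub>mpolynomial_ring V\<^esub> p = - p" if "p \<in> mpolys V" for p :: "('v, 'k) mpolynomial"
    by (rule P.minus_equality) (use that mpolys_closed(5) in \<open>simp_all add: mpolynomial_ring_simps\<close>)
  have evm: "ev F (- p) = - ev F p" for p using ev_add[of F p "- p"] ev_zero by (simp add: eq_neg_iff_add_eq_0 add.commute)
  have "ideal ?I (mpolynomial_ring V)"
  proof (rule idealI)
    show "ring (mpolynomial_ring V :: ('v, 'k) mpolynomial ring)" by (rule P.ring_axioms)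
    show "subgroup ?I (add_monoid (mpolynomial_ring V))"
    proof (rule group.subgroupI)
      show "Group.group (add_monoid (mpolynomial_ring V :: ('v, 'k) mpolynomial ring))" by (rule P.add.is_group)
      show "?I \<noteq> {}" using mpolys_closed(1) ev_zero by blast
      show "inv\<^bsub>add_monoid (mpolynomial_ring V)\<^esub> p \<in> ?I" if "p \<in> ?I" for p
        unfolding a_inv_def[symmetric] using that uminus evm mpolys_closed(5) by auto
      show "p \<otimes>\<^bsub>add_monoid (mpolynomial_ring V)\<^esub> q \<in> ?I" if "p \<in> ?I" "q \<in> ?I" for p q
        using that mpolys_closed(3)[of p V q] by (simp add: ev_add mpolynomial_ring_simps)
    qed auto
  qed (auto simp: mpolynomial_ring_simps mpolys_closed(4) ev_mult)
  moreover have "{\<Prod>v\<in>G. variable v | G. G \<subseteq> V \<and> G \<notin> \<Delta>} \<subseteq> ?I"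
  proof clarify
    fix G assume G: "G \<subseteq> V" "G \<notin> \<Delta>"
    have fin: "finite G" using G finite_V finite_subset by blast
    have "\<not> G \<subseteq> F" using G(2) F complex unfolding abstract_simplicial_complex_def by blast
    then have "ev F (\<Prod>v\<in>G. variable v) = 0" unfolding prod_variable[OF fin] ev_single keys_support[OF fin] by simp
    then show "(\<Prod>v\<in>G. variable v :: ('v, 'k) mpolynomial) \<in> mpolys V \<and> ev F (\<Prod>v\<in>G. variable v) = 0"
      using prod_in[OF G(1)] by simp
  qed
  ultimately have "SI \<subseteq> ?I" unfolding stanley_reisner_ideal_def by (rule P.genideal_minimal)
  then show ?thesis using p by blast
qed

text \<open>Each monomial of \<open>p\<close> must have a nonface as support, so it is a multiple of
  the squarefree generator of that support. Together with \<open>ev_ideal\<close> this makes the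
  ideal an intersection of kernels to domains, hence radical.\<close>

lemma in_SI:
  assumes p: "p \<in> mpolys V" and 0: "\<And>F. F \<in> \<Delta> \<Longrightarrow> ev F p = 0"
  shows "p \<in> SI"
proof -
  interpret I: ideal SI "mpolynomial_ring V" by (rule SI_ideal)
  have single: "Poly_Mapping.single m c \<in> SI" if m: "m \<in> Poly_Mapping.keys p" for m c
  proof -
    let ?S = "Poly_Mapping.keys m" and ?e = "\<Sum>v\<in>Poly_Mapping.keys m. Poly_Mapping.single v (1::nat)"
    have S: "?S \<subseteq> V" using p m unfolding mpolys_iff by blast
    have "?S \<notin> \<Delta>" using 0 ev_zero_iff[OF p] m by blast
    then have "(\<Prod>v\<in>?S. variable v) \<in> SI"
      unfolding stanley_reisner_ideal_def using S
      by (intro subsetD[OF P.genideal_self]) (auto intro: prod_in)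
    then have g: "Poly_Mapping.single ?e 1 \<in> SI" by (simp add: prod_variable)
    \<comment> \<open>The truncated subtraction is exact: every variable in the support of
      \<open>m\<close> has exponent at least one.\<close>
    have "(m - ?e) + ?e = m"
      by (rule poly_mapping_eqI) (auto simp: lookup_add lookup_minus lookup_support in_keys_iff simp del: One_nat_def)
    then have "Poly_Mapping.single m c = Poly_Mapping.single (m - ?e) c * Poly_Mapping.single ?e 1" by (simp add: mult_single)
    moreover have "Poly_Mapping.keys (m - ?e) \<subseteq> V" using S by (auto simp: in_keys_iff lookup_minus subset_iff)
    then have "Poly_Mapping.single (m - ?e) c \<in> mpolys V" by (rule mpolys_single)
    ultimately show ?thesis using I.I_l_closed[OF g] by (simp add: mpolynomial_ring_simps)
  qed
  have sum: "(\<Sum>i\<in>M. f i) \<in> SI" if "\<And>i. i \<in> M \<Longrightarrow> f i \<in> SI" for M and f :: "('v \<Rightarrow>\<^sub>0 nat) \<Rightarrow> ('v, 'k) mpolynomial"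
    using that
  proof (induction M rule: infinite_finite_induct)
    case (insert x M)
    then have "f x \<oplus>\<^bsub>mpolynomial_ring V\<^esub> (\<Sum>i\<in>M. f i) \<in> SI" by (intro I.a_closed) auto
    then show ?case using insert by (simp add: mpolynomial_ring_simps)
  qed (use I.zero_closed in \<open>simp_all add: mpolynomial_ring_simps\<close>)
  have "(\<Sum>m\<in>Poly_Mapping.keys p. Poly_Mapping.single m (Poly_Mapping.lookup p m)) \<in> SI" by (rule sum) (rule single)
  then show ?thesis unfolding monomials[of p, symmetric] .
qed

definition face_map :: "'v set \<Rightarrow> ('v, 'k) mpolynomial set \<Rightarrow> (nat, 'k) mpolynomial" where
  "face_map F c = ev F (SOME p. p \<in> mpolys V \<and> c = SI +>\<^bsub>mpolynomial_ring V\<^esub> p)"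

lemma face_map_coset:
  assumes F: "F \<in> \<Delta>" and p: "p \<in> mpolys V"
  shows "face_map F (SI +>\<^bsub>mpolynomial_ring V\<^esub> p) = ev F p"
proof -
  interpret I: ideal SI "mpolynomial_ring V" by (rule SI_ideal)
  define q where "q = (SOME q. q \<in> mpolys V \<and> SI +>\<^bsub>mpolynomial_ring V\<^esub> p = SI +>\<^bsub>mpolynomial_ring V\<^esub> q)"
  have q: "q \<in> mpolys V \<and> SI +>\<^bsub>mpolynomial_ring V\<^esub> p = SI +>\<^bsub>mpolynomial_ring V\<^esub> q"
    unfolding q_def by (rule someI[of _ p]) (use p in simp)
  have "q \<in> SI +>\<^bsub>mpolynomial_ring V\<^esub> p" using q I.a_rcos_self[of q] by simp
  then obtain i where i: "i \<in> SI" "q = i + p" unfolding a_r_coset_def' by (auto simp: mpolynomial_ring_simps)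
  then have "ev F q = ev F p" using ev_add ev_ideal[OF F i(1)] by simp
  then show ?thesis unfolding face_map_def q_def .
qed

lemma SR_coset: "c \<in> carrier SR \<Longrightarrow> \<exists>p\<in>mpolys V. c = SI +>\<^bsub>mpolynomial_ring V\<^esub> p"
  by (auto simp: stanley_reisner_ring_def FactRing_def A_RCOSETS_def')

lemma coset_SR: "p \<in> mpolys V \<Longrightarrow> SI +>\<^bsub>mpolynomial_ring V\<^esub> p \<in> carrier SR"
  by (auto simp: stanley_reisner_ring_def FactRing_def A_RCOSETS_def')

lemma face_map_image: "F \<in> \<Delta> \<Longrightarrow> face_map F ` carrier SR = mpolys (\<iota> ` F)"
proof -
  assume F: "F \<in> \<Delta>"
  then have FV: "F \<subseteq> V" using complex unfolding abstract_simplicial_complex_def by blast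
  have "face_map F ` carrier SR = ev F ` mpolys V"
  proof (intro equalityI subsetI)
    fix t assume "t \<in> face_map F ` carrier SR"
    then obtain c where "c \<in> carrier SR" "t = face_map F c" by blast
    then show "t \<in> ev F ` mpolys V" using SR_coset face_map_coset[OF F] by blast
  next
    fix t assume "t \<in> ev F ` mpolys V"
    then obtain p where "p \<in> mpolys V" "t = ev F p" by blast
    then show "t \<in> face_map F ` carrier SR" using coset_SR face_map_coset[OF F] by (metis image_eqI)
  qed
  then show ?thesis using ev_surj[OF FV] by simp
qed

text \<open>\<open>in_SI\<close> gives \<open>\<pi>_inj\<close>, dropping the monomials not
  supported in \<open>F\<close> gives \<open>\<pi>_lift\<close>, and units of a polynomial ring are
  constants, which survive restriction to the empty face.\<close>

lemma face_ring: "face_ring SR \<Delta> face_map"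
proof -
  interpret I: ideal SI "mpolynomial_ring V" by (rule SI_ideal)
  interpret h: ring_hom_ring "mpolynomial_ring V" "mpolynomial_ring V Quot SI" "(+>\<^bsub>mpolynomial_ring V\<^esub>) SI"
    by (rule I.rcos_ring_hom_ring)
  have SRq: "SR = mpolynomial_ring V Quot SI" by (simp add: stanley_reisner_ring_def)
  have dn: "G \<in> \<Delta>" if "F \<in> \<Delta>" "G \<subseteq> F" for F G using complex that unfolding abstract_simplicial_complex_def by blast
  have FV: "F \<subseteq> V" if "F \<in> \<Delta>" for F using complex that unfolding abstract_simplicial_complex_def by blast
  show ?thesis
  proof (intro face_ring.intro face_ring_axioms.intro)
    show "cring SR" by (rule SR_cring)
    show "finite \<Delta>" using finite_V complex unfolding abstract_simplicial_complex_def by (meson finite_Pow_iff finite_subset)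
    show "\<And>F G. F \<in> \<Delta> \<Longrightarrow> G \<subseteq> F \<Longrightarrow> G \<in> \<Delta>" by (rule dn)
    show "face_map F (a \<oplus>\<^bsub>SR\<^esub> b) = face_map F a + face_map F b" if F: "F \<in> \<Delta>" and a: "a \<in> carrier SR" and b: "b \<in> carrier SR" for F a b
    proof -
      obtain p q where pq: "p \<in> mpolys V" "a = SI +>\<^bsub>mpolynomial_ring V\<^esub> p" "q \<in> mpolys V" "b = SI +>\<^bsub>mpolynomial_ring V\<^esub> q"
        using SR_coset a b by meson
      have "a \<oplus>\<^bsub>SR\<^esub> b = SI +>\<^bsub>mpolynomial_ring V\<^esub> (p + q)"
        using h.hom_add[OF pq(1,3)] unfolding pq SRq by (simp add: mpolynomial_ring_simps)
      then show ?thesis using face_map_coset[OF F pq(1)] face_map_coset[OF F pq(3)] face_map_coset[OF F mpolys_closed(3)[OF pq(1,3)]] pq(2,4) ev_add by simp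
    qed
    show "face_map F (a \<otimes>\<^bsub>SR\<^esub> b) = face_map F a * face_map F b" if F: "F \<in> \<Delta>" and a: "a \<in> carrier SR" and b: "b \<in> carrier SR" for F a b
    proof -
      obtain p q where pq: "p \<in> mpolys V" "a = SI +>\<^bsub>mpolynomial_ring V\<^esub> p" "q \<in> mpolys V" "b = SI +>\<^bsub>mpolynomial_ring V\<^esub> q"
        using SR_coset a b by meson
      have "a \<otimes>\<^bsub>SR\<^esub> b = SI +>\<^bsub>mpolynomial_ring V\<^esub> (p * q)"
        using h.hom_mult[OF pq(1,3)] unfolding pq SRq by (simp add: mpolynomial_ring_simps)
      then show ?thesis using face_map_coset[OF F pq(1)] face_map_coset[OF F pq(3)] face_map_coset[OF F mpolys_closed(4)[OF pq(1,3)]] pq(2,4) ev_mult by simp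
    qed
    show "face_map F \<one>\<^bsub>SR\<^esub> = 1" if F: "F \<in> \<Delta>" for F
    proof -
      have "\<one>\<^bsub>SR\<^esub> = SI +>\<^bsub>mpolynomial_ring V\<^esub> 1" using h.hom_one unfolding SRq by (simp add: mpolynomial_ring_simps)
      then show ?thesis using face_map_coset[OF F mpolys_closed(2)] ev_one by simp
    qed
    show "a = \<zero>\<^bsub>SR\<^esub>" if a: "a \<in> carrier SR" and 0: "\<And>F. F \<in> \<Delta> \<Longrightarrow> face_map F a = 0" for a
    proof -
      obtain p where p: "p \<in> mpolys V" "a = SI +>\<^bsub>mpolynomial_ring V\<^esub> p" using SR_coset[OF a] by (elim bexE)
      have "ev F p = 0" if "F \<in> \<Delta>" for F using 0[OF that] face_map_coset[OF that p(1)] p(2) by simp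
      then have "SI +>\<^bsub>mpolynomial_ring V\<^esub> p = SI" by (intro I.a_rcos_const in_SI[OF p(1)])
      then show ?thesis unfolding p(2) SRq by (simp only: FactRing_def ring.simps)
    qed
    show "\<exists>b\<in>carrier SR. \<forall>G\<in>\<Delta>. face_map G b = face_map (G \<inter> F) a" if F: "F \<in> \<Delta>" and a: "a \<in> carrier SR" for F a
    proof -
      obtain p where p: "p \<in> mpolys V" "a = SI +>\<^bsub>mpolynomial_ring V\<^esub> p" using SR_coset[OF a] by (elim bexE)
      show ?thesis
      proof (intro bexI[OF _ coset_SR[OF filt_in[OF p(1)]]] ballI)
        fix G assume G: "G \<in> \<Delta>"
        show "face_map G (SI +>\<^bsub>mpolynomial_ring V\<^esub> filt F p) = face_map (G \<inter> F) a"
          unfolding p(2) face_map_coset[OF G filt_in[OF p(1)]] face_map_coset[OF dn[OF G Int_lower1] p(1)] ev_filt ..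
      qed
    qed
    show "face_map F a = 0" if G: "G \<in> \<Delta>" "F \<subseteq> G" and a: "a \<in> carrier SR" and 0: "face_map G a = 0" for F G a
    proof -
      obtain p where p: "p \<in> mpolys V" "a = SI +>\<^bsub>mpolynomial_ring V\<^esub> p" using SR_coset[OF a] by (elim bexE)
      have "ev G p = 0" using 0 face_map_coset[OF G(1) p(1)] p(2) by simp
      then have "ev F p = 0" using order_trans[OF _ G(2)] unfolding ev_zero_iff[OF p(1)] by blast
      then show ?thesis using face_map_coset[OF dn[OF G] p(1)] p(2) by simp
    qed
    have fin: "finite (\<iota> ` F)" if "F \<in> \<Delta>" for F by (rule finite_imageI[OF finite_subset[OF FV[OF that] finite_V]])
    show "factorial_in (face_map F ` carrier SR)" if F: "F \<in> \<Delta>" for F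
      unfolding face_map_image[OF F] by (rule factorial_mpolys[OF fin[OF F], THEN conjunct1])
    show "face_map F a = face_map {} a" if F: "F \<in> \<Delta>" and a: "a \<in> carrier SR"
      and u: "unit_in (face_map F ` carrier SR) (face_map F a)" for F a
    proof -
      obtain p where p: "p \<in> mpolys V" "a = SI +>\<^bsub>mpolynomial_ring V\<^esub> p" using SR_coset[OF a] by (elim bexE)
      have "unit_in (mpolys (\<iota> ` F)) (ev F p)" using u unfolding p(2) face_map_image[OF F] face_map_coset[OF F p(1)] .
      then obtain c where c: "ev F p = Poly_Mapping.single 0 c" using factorial_mpolys[OF fin[OF F], where 'k='k] by auto
      have "ev {} p \<in> mpolys (\<iota> ` {})" by (rule ev_in)
      then have "Poly_Mapping.keys (ev {} p) \<subseteq> {0}" unfolding mpolys_iff by auto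
      \<comment> \<open>All restrictions share the constant term of \<open>p\<close>, and on the
        empty face nothing else remains.\<close>
      moreover have "Poly_Mapping.lookup (ev {} p) 0 = c"
        using lookup_ev[OF p(1), of 0 F] lookup_ev[OF p(1), of 0 "{}"] c by (simp add: ren_zero)
      ultimately have "ev {} p = Poly_Mapping.single 0 c"
        by (intro poly_mapping_eqI) (auto simp: lookup_single when_def in_keys_iff subset_iff)
      then show ?thesis using c face_map_coset[OF F p(1)] face_map_coset[OF dn[OF F] p(1), of "{}"] p(2) by simp
    qed
  qed
qed

end

section \<open>Divisors on a factorial domain\<close>

text \<open>One prime for each class of associates. Associates define the same predicate under
  \<open>SOME\<close>, so they get the same representative.\<close>

definition prime_rep :: "'a::idom set \<Rightarrow> 'a \<Rightarrow> 'a" where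
  "prime_rep A p = (SOME q. prime_in A q \<and> dvd_in A p q)"

definition prime_reps :: "'a::idom set \<Rightarrow> 'a set" where
  "prime_reps A = prime_rep A ` {p. prime_in A p}"

definition ord_in :: "'a::idom set \<Rightarrow> 'a \<Rightarrow> 'a \<Rightarrow> nat" where
  "ord_in A p a = (THE n. \<exists>b\<in>A. a = p ^ n * b \<and> \<not> dvd_in A p b)"

lemma dvd_in_refl: "subdom A \<Longrightarrow> dvd_in A a a"
  unfolding dvd_in_def using subdomD(2) by (metis mult.right_neutral)

lemma dvd_in_trans: "subdom A \<Longrightarrow> dvd_in A a b \<Longrightarrow> dvd_in A b c \<Longrightarrow> dvd_in A a c"
  unfolding dvd_in_def using subdomD(4) by (metis mult.assoc)

lemma prime_inD:
  assumes "prime_in A p"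
  shows "p \<in> A" "p \<noteq> 0" "\<not> unit_in A p" "\<lbrakk>a \<in> A; b \<in> A; dvd_in A p (a * b)\<rbrakk> \<Longrightarrow> dvd_in A p a \<or> dvd_in A p b"
  using assms unfolding prime_in_def by blast+

lemma prime_not_dvd_unit: "subdom A \<Longrightarrow> prime_in A p \<Longrightarrow> unit_in A u \<Longrightarrow> \<not> dvd_in A p u"
  using unit_dvd prime_inD(1,3) by blast

text \<open>Writing \<open>q = p * w\<close>, the prime \<open>q\<close> divides \<open>p\<close> or
  \<open>w\<close>, and in the second case \<open>q\<close> cancels and \<open>p\<close> becomes a
  unit.\<close>

lemma prime_dvd_prime:
  assumes A: "subdom A" and p: "prime_in A p" and q: "prime_in A q" and dvd: "dvd_in A p q"
  shows "dvd_in A q p"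
proof -
  obtain w where w: "w \<in> A" "q = p * w" using dvd unfolding dvd_in_def by blast
  have "dvd_in A q (p * w)" using dvd_in_refl[OF A] w(2) by metis
  then have "dvd_in A q p \<or> dvd_in A q w" by (rule prime_inD(4)[OF q prime_inD(1)[OF p] w(1)])
  moreover have "\<not> dvd_in A q w"
  proof
    assume "dvd_in A q w"
    then obtain v where v: "v \<in> A" "w = q * v" unfolding dvd_in_def by blast
    have "q * 1 = q * (p * v)" using w(2)[unfolded v(2)] by (simp only: mult.left_commute[of q p v] mult_1_right)
    then have "1 = p * v" using mult_left_cancel[OF prime_inD(2)[OF q]] by blast
    then have "unit_in A p" unfolding unit_in_def using v(1) prime_inD(1)[OF p] by metis
    then show False using prime_inD(3)[OF p] by blast
  qed
  ultimately show ?thesis by blast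
qed

lemma prime_rep_eq:
  assumes "subdom A" "prime_in A p" "prime_in A q" "dvd_in A p q"
  shows "prime_rep A p = prime_rep A q"
proof -
  have "dvd_in A q p" using prime_dvd_prime assms by blast
  then have "(\<lambda>r. prime_in A r \<and> dvd_in A p r) = (\<lambda>r. prime_in A r \<and> dvd_in A q r)"
    using dvd_in_trans assms by blast
  then show ?thesis unfolding prime_rep_def by simp
qed

lemma prime_rep:
  assumes A: "subdom A" and p: "prime_in A p"
  shows "prime_in A (prime_rep A p)" "dvd_in A p (prime_rep A p)" "dvd_in A (prime_rep A p) p"
    "prime_rep A (prime_rep A p) = prime_rep A p"
proof -
  have "prime_in A (prime_rep A p) \<and> dvd_in A p (prime_rep A p)"
    unfolding prime_rep_def by (rule someI[of _ p]) (use p dvd_in_refl[OF A] in blast)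
  then show 1: "prime_in A (prime_rep A p)" "dvd_in A p (prime_rep A p)" by auto
  show "dvd_in A (prime_rep A p) p" by (rule prime_dvd_prime[OF A p 1])
  show "prime_rep A (prime_rep A p) = prime_rep A p" using prime_rep_eq[OF A p 1] by simp
qed

lemma prime_reps_prime: "subdom A \<Longrightarrow> p \<in> prime_reps A \<Longrightarrow> prime_in A p"
  using prime_rep(1) unfolding prime_reps_def by blast

lemma prime_reps_rep: "subdom A \<Longrightarrow> p \<in> prime_reps A \<Longrightarrow> prime_rep A p = p"
  using prime_rep(4) unfolding prime_reps_def by blast

lemma prime_rep_in: "prime_in A p \<Longrightarrow> prime_rep A p \<in> prime_reps A"
  unfolding prime_reps_def by blast

lemma prime_reps_dvd_prime: "subdom A \<Longrightarrow> q \<in> prime_reps A \<Longrightarrow> prime_in A p \<Longrightarrow> dvd_in A q p \<Longrightarrow> q = prime_rep A p"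
  using prime_rep_eq[OF _ prime_reps_prime] prime_reps_rep by metis

context
  fixes A :: "'a::idom set"
  assumes fA: "factorial_in A"
begin

text \<open>Induction on a factorization: a prime factor associate to \<open>p\<close> raises the
  exponent by one, any other is absorbed in the cofactor.\<close>

lemma ord_ex:
  assumes p: "prime_in A p" and a: "a \<in> A" "a \<noteq> 0"
  shows "\<exists>n. \<exists>b\<in>A. a = p ^ n * b \<and> \<not> dvd_in A p b"
proof -
  obtain m where "fac A m a" using fA a unfolding factorial_in_def by blast
  then show ?thesis
  proof (induction rule: fac.induct)
    case (unit u)
    then show ?case using prime_not_dvd_unit[OF factorial_subdom[OF fA] p] unfolding unit_in_def by (intro exI[of _ 0] bexI[of _ u]) auto
  next
    case (prime q m a)
    then obtain n b where b: "b \<in> A" "a = p ^ n * b" "\<not> dvd_in A p b" by blast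
    have q: "q \<in> A" using prime_inD(1)[OF prime(1)] .
    show ?case
    proof (cases "dvd_in A p q")
      case True
      then obtain w where w: "w \<in> A" "q = p * w" unfolding dvd_in_def by blast
      have "dvd_in A q p" by (rule prime_dvd_prime[OF factorial_subdom[OF fA] p prime(1) True])
      then obtain v where v: "v \<in> A" "p = q * v" unfolding dvd_in_def by blast
      have "q * 1 = q * (v * w)" using w(2)[unfolded v(2)] by (simp only: mult.assoc mult_1_right)
      then have "1 = v * w" using mult_left_cancel[OF prime_inD(2)[OF prime(1)]] by blast
      then have "unit_in A w" unfolding unit_in_def using v(1) w(1) by (metis mult.commute)
      then have "\<not> dvd_in A p w" using prime_not_dvd_unit[OF factorial_subdom[OF fA] p] by blast
      then have "\<not> dvd_in A p (w * b)" using prime_inD(4)[OF p w(1) b(1)] b(3) by blast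
      moreover have "q * a = p ^ Suc n * (w * b)" unfolding b(2) w(2) by (simp add: ac_simps)
      ultimately show ?thesis using subdomD(4)[OF factorial_subdom[OF fA] w(1) b(1)] by blast
    next
      case False
      then have "\<not> dvd_in A p (q * b)" using prime_inD(4)[OF p q b(1)] b(3) by blast
      moreover have "q * a = p ^ n * (q * b)" unfolding b(2) by (simp add: ac_simps)
      ultimately show ?thesis using subdomD(4)[OF factorial_subdom[OF fA] q b(1)] by blast
    qed
  qed
qed

lemma power_in: "p \<in> A \<Longrightarrow> p ^ n \<in> A"
  by (induction n) (auto intro: subdomD[OF factorial_subdom[OF fA]])

text \<open>Of two such representations the one with the smaller exponent would, after cancelling,
  have a cofactor divisible by \<open>p\<close>.\<close>

lemma ord_eq:
  assumes p: "prime_in A p" and b: "b \<in> A" "\<not> dvd_in A p b"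
  shows "ord_in A p (p ^ n * b) = n"
  unfolding ord_in_def
proof (rule the_equality)
  have nl: False if "n < m" "p ^ n * b = p ^ m * c" "b \<in> A" "c \<in> A" "\<not> dvd_in A p b" for n m b c
  proof -
    have "m = n + Suc (m - n - 1)" using that(1) by simp
    then obtain k where k: "m = n + Suc k" ..
    have "p ^ n * b = p ^ n * (p * (p ^ k * c))" using that(2) unfolding k by (simp add: power_add ac_simps)
    moreover have "p ^ n \<noteq> 0" using prime_inD(2)[OF p] by simp
    ultimately have "b = p * (p ^ k * c)" using mult_left_cancel by blast
    moreover have "p ^ k * c \<in> A" using subdomD(4)[OF factorial_subdom[OF fA] power_in[OF prime_inD(1)[OF p]] that(4)] .
    ultimately show False using that(5) unfolding dvd_in_def by blast
  qed
  show "\<exists>c\<in>A. p ^ n * b = p ^ n * c \<and> \<not> dvd_in A p c" using b by blast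
  fix m assume "\<exists>c\<in>A. p ^ n * b = p ^ m * c \<and> \<not> dvd_in A p c"
  then obtain c where c: "c \<in> A" "p ^ n * b = p ^ m * c" "\<not> dvd_in A p c" by blast
  show "m = n" using nl[OF _ c(2) b(1) c(1) b(2)] nl[OF _ c(2)[symmetric] c(1) b(1) c(3)] by (meson linorder_neqE_nat)
qed

lemma ord_mult:
  assumes p: "prime_in A p" and a: "a \<in> A" "a \<noteq> 0" and b: "b \<in> A" "b \<noteq> 0"
  shows "ord_in A p (a * b) = ord_in A p a + ord_in A p b"
proof -
  obtain n a' where a': "a' \<in> A" "a = p ^ n * a'" "\<not> dvd_in A p a'" using ord_ex[OF p a] by blast
  obtain m b' where b': "b' \<in> A" "b = p ^ m * b'" "\<not> dvd_in A p b'" using ord_ex[OF p b] by blast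
  have nd: "\<not> dvd_in A p (a' * b')" using prime_inD(4)[OF p a'(1) b'(1)] a'(3) b'(3) by blast
  have eq: "a * b = p ^ (n + m) * (a' * b')" unfolding a'(2) b'(2) by (simp add: power_add ac_simps)
  show ?thesis unfolding eq ord_eq[OF p subdomD(4)[OF factorial_subdom[OF fA] a'(1) b'(1)] nd]
    unfolding a'(2) b'(2) ord_eq[OF p a'(1,3)] ord_eq[OF p b'(1,3)] ..
qed

lemma ord_zero_iff:
  assumes p: "prime_in A p" and a: "a \<in> A" "a \<noteq> 0"
  shows "ord_in A p a = 0 \<longleftrightarrow> \<not> dvd_in A p a"
proof
  assume "\<not> dvd_in A p a"
  then show "ord_in A p a = 0" using ord_eq[OF p a(1), of 0] by simp
next
  assume 0: "ord_in A p a = 0"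
  obtain n b where b: "b \<in> A" "a = p ^ n * b" "\<not> dvd_in A p b" using ord_ex[OF p a] by blast
  have "n = 0" using 0 unfolding b(2) ord_eq[OF p b(1,3)] .
  then show "\<not> dvd_in A p a" using b by simp
qed

lemma ord_unit: "prime_in A p \<Longrightarrow> unit_in A u \<Longrightarrow> ord_in A p u = 0"
  using ord_zero_iff[of p u] prime_not_dvd_unit[OF factorial_subdom[OF fA]] unfolding unit_in_def by fastforce

lemma ord_self: "prime_in A p \<Longrightarrow> ord_in A p p = 1"
proof -
  assume p: "prime_in A p"
  have u: "unit_in A 1" unfolding unit_in_def using subdomD(2)[OF factorial_subdom[OF fA]] by auto
  show ?thesis using ord_eq[OF p subdomD(2)[OF factorial_subdom[OF fA]] prime_not_dvd_unit[OF factorial_subdom[OF fA] p u], of 1] by simp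
qed

lemma ord_rep_other:
  assumes q: "q \<in> prime_reps A" and p: "prime_in A p" and ne: "prime_rep A p \<noteq> q"
  shows "ord_in A q p = 0"
  using ord_zero_iff[OF prime_reps_prime[OF factorial_subdom[OF fA] q] prime_inD(1,2)[OF p]] prime_reps_dvd_prime[OF factorial_subdom[OF fA] q p] ne by blast

text \<open>Each step of a factorization contributes at most one representative.\<close>

lemma finite_prime_divisors:
  assumes "a \<in> A" "a \<noteq> 0"
  shows "finite {p \<in> prime_reps A. dvd_in A p a}"
proof -
  obtain m where "fac A m a" using fA assms unfolding factorial_in_def by blast
  then show ?thesis
  proof (induction rule: fac.induct)
    case (unit u)
    then have "{p \<in> prime_reps A. dvd_in A p u} = {}"
      using prime_not_dvd_unit[OF factorial_subdom[OF fA]] prime_reps_prime[OF factorial_subdom[OF fA]] by blast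
    then show ?case by (rule ssubst) simp
  next
    case (prime p m a)
    have "{q \<in> prime_reps A. dvd_in A q (p * a)} \<subseteq> insert (prime_rep A p) {q \<in> prime_reps A. dvd_in A q a}"
    proof
      fix q assume "q \<in> {q \<in> prime_reps A. dvd_in A q (p * a)}"
      then have q: "q \<in> prime_reps A" "dvd_in A q (p * a)" by auto
      have "dvd_in A q p \<or> dvd_in A q a"
        using prime_inD(4)[OF prime_reps_prime[OF factorial_subdom[OF fA] q(1)] prime_inD(1)[OF prime(1)] _ q(2)] fac_in[OF factorial_subdom[OF fA] prime(2)] by blast
      then show "q \<in> insert (prime_rep A p) {q \<in> prime_reps A. dvd_in A q a}"
        using prime_reps_dvd_prime[OF factorial_subdom[OF fA] q(1) prime(1)] q(1) by blast
    qed
    then show ?case using prime(3) finite_subset by blast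
  qed
qed

text \<open>The prime factors of \<open>a\<close> are stripped one by one: those represented in
  \<open>Q\<close> also divide \<open>s\<close> and cancel, the others are moved into
  \<open>b\<close>. What is left of the fraction involves no prime of \<open>Q\<close>; this will
  identify rational functions without divisor at a point with units there.\<close>

lemma equal_orders:
  assumes a: "a \<in> A" "a \<noteq> 0" and s: "s \<in> A" "s \<noteq> 0" and Q: "Q \<subseteq> prime_reps A"
    and eq: "\<And>p. p \<in> Q \<Longrightarrow> ord_in A p a = ord_in A p s"
  shows "\<exists>b\<in>A. \<exists>t\<in>A. b \<noteq> 0 \<and> t \<noteq> 0 \<and> a * t = b * s \<and> (\<forall>p\<in>Q. \<not> dvd_in A p b \<and> \<not> dvd_in A p t)"
proof -
  obtain m where "fac A m a" using fA a unfolding factorial_in_def by blast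
  then show ?thesis using s eq
  proof (induction arbitrary: s rule: fac.induct)
    case (unit u)
    have uA: "u \<in> A" "u \<noteq> 0" using unit(1) unfolding unit_in_def by auto
    have "\<not> dvd_in A p u \<and> \<not> dvd_in A p s" if p: "p \<in> Q" for p
    proof -
      have pp: "prime_in A p" using p Q prime_reps_prime[OF factorial_subdom[OF fA]] by blast
      have "ord_in A p s = 0" using unit(4)[OF p] ord_unit[OF pp unit(1)] by simp
      then show ?thesis using ord_zero_iff[OF pp unit(2,3)] prime_not_dvd_unit[OF factorial_subdom[OF fA] pp unit(1)] by blast
    qed
    then show ?case using uA unit(2,3) by blast
  next
    case (prime p m a)
    have aA: "a \<in> A" "a \<noteq> 0" using fac_in[OF factorial_subdom[OF fA] prime(2)] by auto
    have pA: "p \<in> A" "p \<noteq> 0" using prime_inD(1,2)[OF prime(1)] by auto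
    have Qp: "prime_in A q" if "q \<in> Q" for q using that Q prime_reps_prime[OF factorial_subdom[OF fA]] by blast
    show ?case
    proof (cases "prime_rep A p \<in> Q")
      case True
      let ?r = "prime_rep A p"
      note r = prime_rep[OF factorial_subdom[OF fA] prime(1)]
      have "dvd_in A ?r (p * a)" by (rule dvd_in_mult[OF factorial_subdom[OF fA] r(3) aA(1)])
      then have "ord_in A ?r s \<noteq> 0" using prime(6)[OF True] ord_zero_iff[OF r(1) subdomD(4)[OF factorial_subdom[OF fA] pA(1) aA(1)]] pA aA by simp
      then have "dvd_in A ?r s" using ord_zero_iff[OF r(1) prime(4,5)] by simp
      then have "dvd_in A p s" using dvd_in_trans[OF factorial_subdom[OF fA] r(2)] by blast
      then obtain s' where s': "s' \<in> A" "s = p * s'" unfolding dvd_in_def by blast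
      have s'0: "s' \<noteq> 0" using prime(5) s' by auto
      have "ord_in A q a = ord_in A q s'" if q: "q \<in> Q" for q
        using prime(6)[OF q] unfolding s'(2) ord_mult[OF Qp[OF q] pA aA] ord_mult[OF Qp[OF q] pA s'(1) s'0] by simp
      then obtain b t where bt: "b \<in> A" "t \<in> A" "b \<noteq> 0" "t \<noteq> 0" "a * t = b * s'" "\<forall>q\<in>Q. \<not> dvd_in A q b \<and> \<not> dvd_in A q t"
        using prime(3)[OF s'(1) s'0] by blast
      have "p * a * t = b * s" unfolding s'(2) using bt(5) by (simp add: ac_simps)
      then show ?thesis using bt by blast
    next
      case False
      have ne: "ord_in A q p = 0" if q: "q \<in> Q" for q
        by (rule ord_rep_other[OF _ prime(1)]) (use q Q False in auto)
      have "ord_in A q a = ord_in A q s" if q: "q \<in> Q" for q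
        using prime(6)[OF q] ne[OF q] unfolding ord_mult[OF Qp[OF q] pA aA] by simp
      then obtain b t where bt: "b \<in> A" "t \<in> A" "b \<noteq> 0" "t \<noteq> 0" "a * t = b * s" "\<forall>q\<in>Q. \<not> dvd_in A q b \<and> \<not> dvd_in A q t"
        using prime(3)[OF prime(4,5)] by blast
      have "p * a * t = (p * b) * s" using bt(5) by (simp add: ac_simps)
      moreover have "\<not> dvd_in A q (p * b)" if q: "q \<in> Q" for q
      proof -
        have "\<not> dvd_in A q p" using ord_zero_iff[OF Qp[OF q] pA] ne[OF q] by blast
        then show ?thesis using prime_inD(4)[OF Qp[OF q] pA(1) bt(1)] bt(6) q by blast
      qed
      moreover have "p * b \<in> A" "p * b \<noteq> 0" using subdomD(4)[OF factorial_subdom[OF fA] pA(1) bt(1)] pA bt(3) by auto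
      ultimately show ?thesis using bt(2,4,6) by blast
    qed
  qed
qed

lemma no_prime_unit:
  assumes a: "a \<in> A" "a \<noteq> 0" and nd: "\<And>p. p \<in> prime_reps A \<Longrightarrow> \<not> dvd_in A p a"
  shows "unit_in A a"
proof -
  obtain m where "fac A m a" using fA a unfolding factorial_in_def by blast
  then show ?thesis
  proof cases
    case (prime p n b)
    have "dvd_in A (prime_rep A p) a"
      unfolding prime(2) by (rule dvd_in_mult[OF factorial_subdom[OF fA] prime_rep(3)[OF factorial_subdom[OF fA] prime(3)]]) (use fac_in[OF factorial_subdom[OF fA] prime(4)] in blast)
    then show ?thesis using nd prime_rep_in[OF prime(3)] by blast
  qed simp
qed

end

text \<open>The multiplicative group of the field of fractions of \<open>A\<close>, realised inside
  the fractions of the ambient type.\<close>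

definition fractions :: "'a::idom set \<Rightarrow> 'a fract set" where
  "fractions A = {Fract a s | a s. a \<in> A \<and> s \<in> A \<and> a \<noteq> 0 \<and> s \<noteq> 0}"

definition val :: "'a::idom set \<Rightarrow> 'a \<Rightarrow> 'a fract \<Rightarrow> int" where
  "val A p g = (SOME z. \<exists>a\<in>A. \<exists>s\<in>A. a \<noteq> 0 \<and> s \<noteq> 0 \<and> g = Fract a s \<and> z = int (ord_in A p a) - int (ord_in A p s))"

context
  fixes A :: "'a::idom set"
  assumes fA: "factorial_in A"
begin

text \<open>Cross multiplication and additivity of orders make the difference independent of the
  chosen representative.\<close>

lemma val_Fract:
  assumes p: "prime_in A p" and a: "a \<in> A" "a \<noteq> 0" and s: "s \<in> A" "s \<noteq> 0"
  shows "val A p (Fract a s) = int (ord_in A p a) - int (ord_in A p s)"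
  unfolding val_def
proof (rule some_equality)
  show "\<exists>b\<in>A. \<exists>t\<in>A. b \<noteq> 0 \<and> t \<noteq> 0 \<and> Fract a s = Fract b t \<and>
      int (ord_in A p a) - int (ord_in A p s) = int (ord_in A p b) - int (ord_in A p t)" using a s by blast
  fix z assume "\<exists>b\<in>A. \<exists>t\<in>A. b \<noteq> 0 \<and> t \<noteq> 0 \<and> Fract a s = Fract b t \<and> z = int (ord_in A p b) - int (ord_in A p t)"
  then obtain b t where b: "b \<in> A" "t \<in> A" "b \<noteq> 0" "t \<noteq> 0" "Fract a s = Fract b t" "z = int (ord_in A p b) - int (ord_in A p t)" by blast
  have "a * t = b * s" using b(5) s(2) b(4) by (simp add: eq_fract)
  then have "ord_in A p a + ord_in A p t = ord_in A p b + ord_in A p s"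
    using ord_mult[OF fA p a b(2,4)] ord_mult[OF fA p b(1,3) s] by simp
  then show "z = int (ord_in A p a) - int (ord_in A p s)" using b(6) by simp
qed

lemma fractions_mult: "g \<in> fractions A \<Longrightarrow> h \<in> fractions A \<Longrightarrow> g * h \<in> fractions A"
  unfolding fractions_def using subdomD(4)[OF factorial_subdom[OF fA]] by (auto simp: mult_fract) (metis mult_eq_0_iff)

lemma val_mult:
  assumes p: "prime_in A p" and g: "g \<in> fractions A" and h: "h \<in> fractions A"
  shows "val A p (g * h) = val A p g + val A p h"
proof -
  obtain a s where a: "g = Fract a s" "a \<in> A" "s \<in> A" "a \<noteq> 0" "s \<noteq> 0" using g unfolding fractions_def by blast
  obtain b t where b: "h = Fract b t" "b \<in> A" "t \<in> A" "b \<noteq> 0" "t \<noteq> 0" using h unfolding fractions_def by blast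
  have ab: "a * b \<in> A" "a * b \<noteq> 0" "s * t \<in> A" "s * t \<noteq> 0" using a b subdomD(4)[OF factorial_subdom[OF fA]] by auto
  show ?thesis unfolding a(1) b(1) mult_fract val_Fract[OF p ab] val_Fract[OF p a(2,4,3,5)] val_Fract[OF p b(2,4,3,5)]
      ord_mult[OF fA p a(2,4) b(2,4)] ord_mult[OF fA p a(3,5) b(3,5)] by simp
qed

lemma finite_val:
  assumes g: "g \<in> fractions A"
  shows "finite {p \<in> prime_reps A. val A p g \<noteq> 0}"
proof -
  obtain a s where a: "g = Fract a s" "a \<in> A" "s \<in> A" "a \<noteq> 0" "s \<noteq> 0" using g unfolding fractions_def by blast
  have "{p \<in> prime_reps A. val A p g \<noteq> 0} \<subseteq> {p \<in> prime_reps A. dvd_in A p a} \<union> {p \<in> prime_reps A. dvd_in A p s}"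
  proof
    fix p assume "p \<in> {p \<in> prime_reps A. val A p g \<noteq> 0}"
    then have p: "p \<in> prime_reps A" "val A p g \<noteq> 0" by auto
    note pp = prime_reps_prime[OF factorial_subdom[OF fA] p(1)]
    have "ord_in A p a \<noteq> 0 \<or> ord_in A p s \<noteq> 0" using p(2) val_Fract[OF pp a(2,4,3,5)] unfolding a(1) by auto
    then show "p \<in> {p \<in> prime_reps A. dvd_in A p a} \<union> {p \<in> prime_reps A. dvd_in A p s}"
      using ord_zero_iff[OF fA pp a(2,4)] ord_zero_iff[OF fA pp a(3,5)] p(1) by auto
  qed
  then show ?thesis using finite_prime_divisors[OF fA] a by (meson finite_UnI finite_subset)
qed

text \<open>Every divisor is principal: the product of the powers \<open>q ^ d q\<close>, with
  negative multiplicities put into denominators.\<close>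

lemma val_surj:
  assumes "finite S" "S \<subseteq> prime_reps A"
  shows "\<exists>g\<in>fractions A. \<forall>p\<in>prime_reps A. val A p g = (if p \<in> S then d p else 0)"
  using assms
proof (induction S)
  case empty
  have u: "unit_in A 1" using subdomD(2)[OF factorial_subdom[OF fA]] unfolding unit_in_def by auto
  have "val A p (Fract 1 1) = 0" if "p \<in> prime_reps A" for p
    using val_Fract[OF prime_reps_prime[OF factorial_subdom[OF fA] that], of 1 1] subdomD(2)[OF factorial_subdom[OF fA]] by simp
  moreover have "Fract 1 1 \<in> fractions A" unfolding fractions_def using subdomD(2)[OF factorial_subdom[OF fA]] by (auto intro!: exI[of _ 1])
  ultimately show ?case by auto
next
  case (insert q S)
  then obtain g where g: "g \<in> fractions A" "\<forall>p\<in>prime_reps A. val A p g = (if p \<in> S then d p else 0)" by auto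
  have q: "q \<in> prime_reps A" "prime_in A q" using insert prime_reps_prime[OF factorial_subdom[OF fA]] by auto
  have one: "1 \<in> A" "(1::'a) \<noteq> 0" "unit_in A 1" using subdomD(2)[OF factorial_subdom[OF fA]] unfolding unit_in_def by auto
  have qn: "q ^ n \<in> A" "q ^ n \<noteq> 0" for n using power_in[OF fA] prime_inD(1,2)[OF q(2)] by auto
  have o: "ord_in A p (q ^ n) = (if p = q then n else 0)" if p: "p \<in> prime_reps A" for p n
  proof (induction n)
    case 0 show ?case using ord_unit[OF fA prime_reps_prime[OF factorial_subdom[OF fA] p] one(3)] by simp
  next
    case (Suc n)
    have "ord_in A p q = (if p = q then 1 else 0)"
      using ord_self[OF fA q(2)] ord_rep_other[OF fA p q(2)] prime_reps_rep[OF factorial_subdom[OF fA] q(1)] by auto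
    then show ?case
      using Suc ord_mult[OF fA prime_reps_prime[OF factorial_subdom[OF fA] p] prime_inD(1,2)[OF q(2)] qn] by simp
  qed
  have "\<exists>h\<in>fractions A. \<forall>p\<in>prime_reps A. val A p h = (if p = q then d q else 0)"
  proof (cases "d q \<ge> 0")
    case True
    have "Fract (q ^ nat (d q)) 1 \<in> fractions A" unfolding fractions_def using qn one by blast
    moreover have "val A p (Fract (q ^ nat (d q)) 1) = (if p = q then d q else 0)" if p: "p \<in> prime_reps A" for p
      using val_Fract[OF prime_reps_prime[OF factorial_subdom[OF fA] p] qn one(1,2)] o[OF p] True
        ord_unit[OF fA prime_reps_prime[OF factorial_subdom[OF fA] p] one(3)] by simp
    ultimately show ?thesis by blast
  next
    case False
    have "Fract 1 (q ^ nat (- d q)) \<in> fractions A" unfolding fractions_def using qn one by blast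
    moreover have "val A p (Fract 1 (q ^ nat (- d q))) = (if p = q then d q else 0)" if p: "p \<in> prime_reps A" for p
      using val_Fract[OF prime_reps_prime[OF factorial_subdom[OF fA] p] one(1,2) qn] o[OF p] False
        ord_unit[OF fA prime_reps_prime[OF factorial_subdom[OF fA] p] one(3)] by simp
    ultimately show ?thesis by blast
  qed
  then obtain h where h: "h \<in> fractions A" "\<forall>p\<in>prime_reps A. val A p h = (if p = q then d q else 0)" by blast
  have "val A p (g * h) = (if p \<in> insert q S then d p else 0)" if p: "p \<in> prime_reps A" for p
    using val_mult[OF prime_reps_prime[OF factorial_subdom[OF fA] p] g(1) h(1)] g(2) h(2) p insert(2) by auto
  then show ?case using fractions_mult[OF g(1) h(1)] by blast
qed

lemma val_zero:
  assumes g: "g \<in> fractions A" and Q: "Q \<subseteq> prime_reps A" and v: "\<And>p. p \<in> Q \<Longrightarrow> val A p g = 0"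
  shows "\<exists>b\<in>A. \<exists>t\<in>A. b \<noteq> 0 \<and> t \<noteq> 0 \<and> g = Fract b t \<and> (\<forall>p\<in>Q. \<not> dvd_in A p b \<and> \<not> dvd_in A p t)"
proof -
  obtain a s where a: "g = Fract a s" "a \<in> A" "s \<in> A" "a \<noteq> 0" "s \<noteq> 0" using g unfolding fractions_def by blast
  have "ord_in A p a = ord_in A p s" if p: "p \<in> Q" for p
  proof -
    have "prime_in A p" using p Q prime_reps_prime[OF factorial_subdom[OF fA]] by blast
    then show ?thesis using v[OF p] val_Fract[OF _ a(2,4,3,5)] unfolding a(1) by simp
  qed
  then obtain b t where bt: "b \<in> A" "t \<in> A" "b \<noteq> 0" "t \<noteq> 0" "a * t = b * s" "\<forall>p\<in>Q. \<not> dvd_in A p b \<and> \<not> dvd_in A p t"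
    using equal_orders[OF fA a(2,4,3,5) Q] by blast
  have "g = Fract b t" unfolding a(1) using bt(4,5) a(5) by (simp add: eq_fract)
  then show ?thesis using bt by blast
qed

end

section \<open>Sheaves of evaluations\<close>

text \<open>\<open>M y\<close> are the symbols usable at \<open>y\<close> and \<open>e y m\<close>
  is the value there; a section is given locally by a single symbol. Units, rational functions and
  divisors all arise in this way.\<close>

definition eval_section :: "'x topology \<Rightarrow> ('x \<Rightarrow> 'm set) \<Rightarrow> ('x \<Rightarrow> 'm \<Rightarrow> 's) \<Rightarrow> 'x \<Rightarrow> ('x \<Rightarrow> 's) \<Rightarrow> bool" where
  "eval_section X M e x f \<longleftrightarrow> (\<exists>W m. openin X W \<and> x \<in> W \<and> (\<forall>y\<in>W. m \<in> M y \<and> f y = e y m))"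

text \<open>Symbols form no group: \<open>d\<close> stands for division and \<open>u\<close> for the
  neutral element only after evaluation, as with numerator--denominator pairs.\<close>

locale eval_sheaf =
  fixes X :: "'x topology" and S :: "'x \<Rightarrow> 's monoid" and M :: "'x \<Rightarrow> 'm set" and e :: "'x \<Rightarrow> 'm \<Rightarrow> 's"
    and d :: "'m \<Rightarrow> 'm \<Rightarrow> 'm" and u :: 'm
  assumes cg: "x \<in> topspace X \<Longrightarrow> comm_group (S x)"
    and carr: "x \<in> topspace X \<Longrightarrow> carrier (S x) = e x ` M x"
    and M_open: "\<lbrakk>x \<in> topspace X; m \<in> M x\<rbrakk> \<Longrightarrow> \<exists>W. openin X W \<and> x \<in> W \<and> (\<forall>y\<in>W. m \<in> M y)"
    and M_one: "x \<in> topspace X \<Longrightarrow> u \<in> M x \<and> e x u = \<one>\<^bsub>S x\<^esub>"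
    and M_div: "\<lbrakk>x \<in> topspace X; m \<in> M x; n \<in> M x\<rbrakk> \<Longrightarrow> d m n \<in> M x \<and> e x (d m n) = e x m \<otimes>\<^bsub>S x\<^esub> inv\<^bsub>S x\<^esub> e x n"
    and e_eq: "\<lbrakk>x \<in> topspace X; m \<in> M x; n \<in> M x; e x m = e x n\<rbrakk> \<Longrightarrow>
        \<exists>W. openin X W \<and> x \<in> W \<and> (\<forall>y\<in>W. m \<in> M y \<longrightarrow> n \<in> M y \<longrightarrow> e y m = e y n)"
begin

lemma etale: "etale X S (eval_section X M e)"
proof (rule etale.intro)
  show "x \<in> topspace X \<Longrightarrow> comm_group (S x)" for x by (rule cg)
  show "x \<in> topspace X \<and> f x \<in> carrier (S x)" if a: "eval_section X M e x f" for x f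
  proof -
    obtain W m where W: "openin X W" "x \<in> W" "\<forall>y\<in>W. m \<in> M y \<and> f y = e y m"
      using a unfolding eval_section_def by (elim exE conjE)
    have "x \<in> topspace X" using openin_subset[OF W(1)] W(2) by blast
    then show ?thesis using carr W(2,3) by simp
  qed
  show "eval_section X M e x g" if a: "eval_section X M e x f" "openin X V" "x \<in> V" "\<And>y. y \<in> V \<Longrightarrow> g y = f y" for x f V g
  proof -
    obtain W m where W: "openin X W" "x \<in> W" "\<forall>y\<in>W. m \<in> M y \<and> f y = e y m"
      using a(1) unfolding eval_section_def by (elim exE conjE)
    then show ?thesis unfolding eval_section_def using a(2-4)
      by (intro exI[of _ "W \<inter> V"] exI[of _ m]) (simp add: openin_Int)
  qed
  show "\<exists>W. openin X W \<and> x \<in> W \<and> (\<forall>y\<in>W. eval_section X M e y f)" if "eval_section X M e x f" for x f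
    using that unfolding eval_section_def by blast
  show "eval_section X M e x (\<lambda>y. \<one>\<^bsub>S y\<^esub>)" if "x \<in> topspace X" for x
    unfolding eval_section_def using that M_one by (intro exI[of _ "topspace X"] exI[of _ u]) simp
  show "eval_section X M e x (\<lambda>y. f y \<otimes>\<^bsub>S y\<^esub> inv\<^bsub>S y\<^esub> g y)"
    if a: "eval_section X M e x f" "eval_section X M e x g" for x f g
  proof -
    obtain W m where W: "openin X W" "x \<in> W" "\<forall>y\<in>W. m \<in> M y \<and> f y = e y m"
      using a(1) unfolding eval_section_def by (elim exE conjE)
    obtain V n where V: "openin X V" "x \<in> V" "\<forall>y\<in>V. n \<in> M y \<and> g y = e y n"
      using a(2) unfolding eval_section_def by (elim exE conjE)
    have "\<forall>y\<in>W \<inter> V. d m n \<in> M y \<and> f y \<otimes>\<^bsub>S y\<^esub> inv\<^bsub>S y\<^esub> g y = e y (d m n)"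
      using W(3) V(3) M_div[of _ m n] openin_subset[OF W(1)] by auto
    then show ?thesis unfolding eval_section_def using W(1,2) V(1,2)
      by (intro exI[of _ "W \<inter> V"] exI[of _ "d m n"]) (simp add: openin_Int)
  qed
  show "\<exists>f. eval_section X M e x f \<and> f x = s" if x: "x \<in> topspace X" "s \<in> carrier (S x)" for x s
  proof -
    obtain m where m: "s = e x m" "m \<in> M x" using x(2) unfolding carr[OF x(1)] by (rule imageE)
    obtain W where W: "openin X W" "x \<in> W" "\<forall>y\<in>W. m \<in> M y" using M_open[OF x(1) m(2)] by (elim exE conjE)
    have "eval_section X M e x (\<lambda>y. e y m)" unfolding eval_section_def
      using W by (intro exI[of _ W] exI[of _ m]) simp
    then show ?thesis using m(1) by (intro exI[of _ "\<lambda>y. e y m"]) simp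
  qed
  show "\<exists>W. openin X W \<and> x \<in> W \<and> (\<forall>y\<in>W. f y = g y)"
    if a: "eval_section X M e x f" "eval_section X M e x g" "f x = g x" for x f g
  proof -
    obtain W m where W: "openin X W" "x \<in> W" "\<forall>y\<in>W. m \<in> M y \<and> f y = e y m"
      using a(1) unfolding eval_section_def by (elim exE conjE)
    obtain V n where V: "openin X V" "x \<in> V" "\<forall>y\<in>V. n \<in> M y \<and> g y = e y n"
      using a(2) unfolding eval_section_def by (elim exE conjE)
    have x: "x \<in> topspace X" using openin_subset[OF W(1)] W(2) by blast
    have "e x m = e x n" "m \<in> M x" "n \<in> M x" using a(3) W(2,3) V(2,3) by auto
    then obtain U where U: "openin X U" "x \<in> U" "\<forall>y\<in>U. m \<in> M y \<longrightarrow> n \<in> M y \<longrightarrow> e y m = e y n"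
      using e_eq[OF x, of m n] by auto
    show ?thesis using U W V by (intro exI[of _ "U \<inter> (W \<inter> V)"]) (simp add: openin_Int)
  qed
qed

end

lemma eval_hom:
  assumes "\<And>x. x \<in> topspace X \<Longrightarrow> p x \<in> hom (S x) (S' x)"
    and "\<And>x m. \<lbrakk>x \<in> topspace X; m \<in> M x\<rbrakk> \<Longrightarrow>
        \<exists>W n. openin X W \<and> x \<in> W \<and> (\<forall>y\<in>W. m \<in> M y \<longrightarrow> n \<in> M' y \<and> p y (e y m) = e' y n)"
  shows "etale_hom X S (eval_section X M e) S' (eval_section X M' e') p"
  unfolding etale_hom_def
proof (intro conjI ballI allI impI assms(1))
  fix x f assume "eval_section X M e x f"
  then obtain W m where W: "openin X W" "x \<in> W" "\<forall>y\<in>W. m \<in> M y \<and> f y = e y m"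
    unfolding eval_section_def by (elim exE conjE)
  have x: "x \<in> topspace X" using openin_subset[OF W(1)] W(2) by blast
  obtain V n where V: "openin X V" "x \<in> V" "\<forall>y\<in>V. m \<in> M y \<longrightarrow> n \<in> M' y \<and> p y (e y m) = e' y n"
    using assms(2)[OF x, of m] W(2,3) by auto
  then show "eval_section X M' e' x (\<lambda>y. p y (f y))" unfolding eval_section_def using W
    by (intro exI[of _ "W \<inter> V"] exI[of _ n]) (simp add: openin_Int)
qed

section \<open>Kernels and isomorphisms as degenerate squares\<close>

abbreviation trivial_stalk :: "'x \<Rightarrow> unit monoid" where
  "trivial_stalk \<equiv> (\<lambda>_. \<lparr>carrier = UNIV, monoid.mult = (\<lambda>_ _. ()), one = ()\<rparr>)"

lemma etale_trivial: "etale X trivial_stalk (\<lambda>x _. x \<in> topspace X)"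
proof (rule etale.intro)
  show "comm_group (trivial_stalk x)" for x by (rule comm_groupI) auto
qed (use openin_topspace in auto)

lemma acyclic_trivial: "acyclic_etale X trivial_stalk (\<lambda>x _. x \<in> topspace X)"
  by (rule etale.flasque_acyclic[OF etale_trivial]) (auto simp: flasque_def)

lemma etale_hom_trivial:
  assumes "etale X S L" shows "etale_hom X S L trivial_stalk (\<lambda>x _. x \<in> topspace X) (\<lambda>_ _. ())"
  using etale.L_closed[OF assms] by (auto simp: etale_hom_def hom_def)

text \<open>The Mayer--Vietoris square with a trivial sheaf as second factor: \<open>F\<close> is
  then the kernel of the map \<open>a\<close>.\<close>

lemma kernel_acyclic:
  assumes F: "etale_presheaf X SF LF P" and G: "etale X SG LG" and K: "etale X SK LK"
    and p: "etale_hom X SF LF SG LG p" and a: "etale_hom X SG LG SK LK a"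
    and comm: "\<And>x s. \<lbrakk>x \<in> topspace X; s \<in> carrier (SF x)\<rbrakk> \<Longrightarrow> a x (p x s) = \<one>\<^bsub>SK x\<^esub>"
    and inj: "\<And>x s. \<lbrakk>x \<in> topspace X; s \<in> carrier (SF x); p x s = \<one>\<^bsub>SG x\<^esub>\<rbrakk> \<Longrightarrow> s = \<one>\<^bsub>SF x\<^esub>"
    and lift: "\<And>x s. \<lbrakk>x \<in> topspace X; s \<in> carrier (SG x); a x s = \<one>\<^bsub>SK x\<^esub>\<rbrakk> \<Longrightarrow> \<exists>r\<in>carrier (SF x). p x r = s"
    and surj: "\<And>x k. \<lbrakk>x \<in> topspace X; k \<in> carrier (SK x)\<rbrakk> \<Longrightarrow> \<exists>s\<in>carrier (SG x). a x s = k"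
    and glob: "\<And>h. (\<And>x. x \<in> topspace X \<Longrightarrow> LK x h) \<Longrightarrow> \<exists>g. \<forall>x\<in>topspace X. LG x g \<and> a x (g x) = h x"
    and ac: "acyclic_etale X SG LG" "acyclic_etale X SK LK"
  shows "acyclic_presheaf X P"
proof -
  interpret F: etale_presheaf X SF LF P by (rule F)
  interpret K: etale X SK LK by (rule K)
  have b: "etale_hom X trivial_stalk (\<lambda>x _. x \<in> topspace X) SK LK (\<lambda>x _. \<one>\<^bsub>SK x\<^esub>)"
    using K.group_stalk K.L_one by (auto simp: etale_hom_def hom_def group.is_monoid)
  have "mv_square X SF LF SG LG trivial_stalk (\<lambda>x _. x \<in> topspace X) SK LK p (\<lambda>_ _. ()) a (\<lambda>x _. \<one>\<^bsub>SK x\<^esub>)"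
  proof (intro mv_square.intro mv_square_axioms.intro F.E.etale_axioms G K etale_trivial p a b etale_hom_trivial)
    show "\<exists>r\<in>carrier (SF x). p x r = s \<and> () = t"
      if "x \<in> topspace X" "s \<in> carrier (SG x)" "a x s = \<one>\<^bsub>SK x\<^esub>" for x s and t :: unit
      using lift[OF that] by auto
  qed (use comm inj surj glob in auto)
  then show ?thesis by (rule mv_square.acyclic[OF _ ac(1) acyclic_trivial ac(2) F])
qed

text \<open>An isomorphism is the case of a kernel with trivial target.\<close>

lemma iso_acyclic:
  assumes F: "etale_presheaf X SF LF P" and G: "etale X SG LG" and p: "etale_hom X SF LF SG LG p"
    and inj: "\<And>x s. \<lbrakk>x \<in> topspace X; s \<in> carrier (SF x); p x s = \<one>\<^bsub>SG x\<^esub>\<rbrakk> \<Longrightarrow> s = \<one>\<^bsub>SF x\<^esub>"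
    and surj: "\<And>x s. \<lbrakk>x \<in> topspace X; s \<in> carrier (SG x)\<rbrakk> \<Longrightarrow> \<exists>r\<in>carrier (SF x). p x r = s"
    and ac: "acyclic_etale X SG LG"
  shows "acyclic_presheaf X P"
proof (rule kernel_acyclic[OF F G etale_trivial p etale_hom_trivial[OF G] _ inj surj _ _ ac acyclic_trivial])
  fix x and k :: unit assume x: "x \<in> topspace X"
  show "\<exists>s\<in>carrier (SG x). () = k" using etale.one_cl[OF G x] by (intro bexI) auto
next
  fix h :: "'a \<Rightarrow> unit"
  show "\<exists>g. \<forall>x\<in>topspace X. LG x g \<and> () = h x" using etale.L_one[OF G] by auto
qed auto

section \<open>The prime spectrum\<close>

context cring
begin

lemma topspace_zariski: "topspace (zariski_topology R) = Spec R"
proof -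
  have "openin (zariski_topology R) (Spec R)" unfolding openin_zariski zariski_open_def
  proof (intro exI[of _ "{\<one>}"] conjI)
    have "\<one> \<notin> P" if "P \<in> Spec R" for P
    proof -
      interpret primeideal P R using that by (simp add: Spec_def)
      show ?thesis using one_imp_carrier I_notcarr by blast
    qed
    then show "Spec R = Spec R - {P \<in> Spec R. {\<one>} \<subseteq> P}" by blast
  qed simp
  moreover have "openin (zariski_topology R) U \<Longrightarrow> U \<subseteq> Spec R" for U
    unfolding openin_zariski zariski_open_def by blast
  ultimately show ?thesis by (meson openin_subset openin_topspace subset_antisym)
qed

lemma open_nonvanishing: "a \<in> carrier R \<Longrightarrow> openin (zariski_topology R) {P \<in> Spec R. a \<notin> P}"
  unfolding openin_zariski zariski_open_def by (rule exI[of _ "{a}"]) auto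

lemma open_generization: "\<lbrakk>openin (zariski_topology R) U; P \<in> U; Q \<in> Spec R; Q \<subseteq> P\<rbrakk> \<Longrightarrow> Q \<in> U"
  unfolding openin_zariski zariski_open_def by blast

lemma open_contains_nonvanishing:
  "\<lbrakk>openin (zariski_topology R) U; P \<in> U\<rbrakk> \<Longrightarrow> \<exists>a\<in>carrier R. a \<notin> P \<and> (\<forall>Q\<in>Spec R. a \<notin> Q \<longrightarrow> Q \<in> U)"
  unfolding openin_zariski zariski_open_def by blast

text \<open>Multiply elements outside \<open>P\<close>, one from each ideal; the product stays
  outside \<open>P\<close> by primality.\<close>

lemma prime_avoid:
  assumes P: "P \<in> Spec R" and "finite I" "\<And>J. J \<in> I \<Longrightarrow> ideal J R \<and> \<not> J \<subseteq> P"
  shows "\<exists>w\<in>carrier R - P. \<forall>J\<in>I. w \<in> J"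
  using assms(2,3)
proof (induction I)
  interpret P: primeideal P R using P by (simp add: Spec_def)
  {
    case empty
    have "\<one> \<in> carrier R - P" using P.one_imp_carrier P.I_notcarr by blast
    then show ?case by blast
  next
    case (insert J I)
    then obtain w where w: "w \<in> carrier R - P" "\<forall>J\<in>I. w \<in> J" by auto
    interpret J: ideal J R using insert by blast
    obtain v where v: "v \<in> J" "v \<notin> P" using insert by blast
    have vR: "v \<in> carrier R" using v(1) J.a_subset by blast
    have "v \<otimes> w \<in> carrier R - P" using P.I_prime[OF vR] v w vR by blast
    moreover have "v \<otimes> w \<in> J" using J.I_r_closed[OF v(1)] w by blast
    moreover have "v \<otimes> w \<in> K" if "K \<in> I" for K
      using ideal.I_l_closed[of K R w v] insert(4)[of K] w that vR by blast
    ultimately show ?case by blast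
  }
qed

lemma avoid_nbhd:
  assumes P: "P \<in> Spec R" and "finite I" "\<And>J. J \<in> I \<Longrightarrow> ideal J R \<and> \<not> J \<subseteq> P"
  shows "\<exists>W. openin (zariski_topology R) W \<and> P \<in> W \<and> (\<forall>Q\<in>W. \<forall>J\<in>I. \<not> J \<subseteq> Q)"
proof -
  obtain w where w: "w \<in> carrier R - P" "\<forall>J\<in>I. w \<in> J" using prime_avoid[OF assms] by blast
  show ?thesis using open_nonvanishing[of w] w P by (intro exI[of _ "{P \<in> Spec R. w \<notin> P}"]) auto
qed

text \<open>Pairs \<open>(a, s)\<close> for which \<open>a/s\<close> is a unit in the local ring at
  \<open>P\<close>.\<close>

definition nonvan :: "'a set \<Rightarrow> ('a \<times> 'a) set" where
  "nonvan P = (carrier R - P) \<times> (carrier R - P)"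

lemma nonvan_open:
  assumes "P \<in> Spec R" "m \<in> nonvan P"
  shows "\<exists>W. openin (zariski_topology R) W \<and> P \<in> W \<and> (\<forall>Q\<in>W. m \<in> nonvan Q)"
proof -
  obtain a s where m: "m = (a, s)" "a \<in> carrier R - P" "s \<in> carrier R - P" using assms(2) unfolding nonvan_def by blast
  let ?W = "{P \<in> Spec R. a \<notin> P} \<inter> {P \<in> Spec R. s \<notin> P}"
  have "openin (zariski_topology R) ?W" using m by (intro openin_Int open_nonvanishing) auto
  moreover have "P \<in> ?W" "\<forall>Q\<in>?W. m \<in> nonvan Q" using m assms(1) unfolding nonvan_def by auto
  ultimately show ?thesis by blast
qed

lemma not_in_prime_mult: "\<lbrakk>P \<in> Spec R; a \<in> carrier R - P; b \<in> carrier R - P\<rbrakk> \<Longrightarrow> a \<otimes> b \<in> carrier R - P"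
  using primeideal.I_prime[of P R a b] by (auto simp: Spec_def)

lemma one_not_in_prime: "P \<in> Spec R \<Longrightarrow> \<one> \<in> carrier R - P"
proof -
  assume "P \<in> Spec R"
  then interpret P: primeideal P R by (simp add: Spec_def)
  show ?thesis using P.one_imp_carrier P.I_notcarr by blast
qed

end

section \<open>The sheaves of units on subcomplexes\<close>

context face_ring
begin

abbreviation "X \<equiv> zariski_topology R"
abbreviation "A F \<equiv> \<pi> F ` carrier R"

text \<open>The preimage in \<open>R\<close> of the principal ideal of \<open>p\<close> on the face
  \<open>F\<close>. For \<open>p = 0\<close> it is the generic point of the coordinate subspace of
  \<open>F\<close>, and for a prime \<open>p\<close> the generic point of the hypersurface of
  \<open>p\<close> in that subspace.\<close>

definition pull :: "'v set \<Rightarrow> 't \<Rightarrow> 'a set" where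
  "pull F p = {a \<in> carrier R. dvd_in (A F) p (\<pi> F a)}"

abbreviation gen :: "'v set \<Rightarrow> 'a set" where "gen F \<equiv> pull F 0"

lemma subdom_A: "F \<in> \<Delta> \<Longrightarrow> subdom (A F)"
  using \<pi>_factorial unfolding factorial_in_def by blast

lemma \<pi>_zero: "F \<in> \<Delta> \<Longrightarrow> \<pi> F \<zero> = 0"
proof -
  assume "F \<in> \<Delta>"
  then have "\<pi> F \<zero> + \<pi> F \<zero> = \<pi> F \<zero> + 0" using \<pi>_add[of F \<zero> \<zero>] l_zero[OF zero_closed] zero_closed by (simp only: add_0_right)
  then show ?thesis by (rule add_left_imp_eq)
qed

lemma \<pi>_minus: "F \<in> \<Delta> \<Longrightarrow> a \<in> carrier R \<Longrightarrow> \<pi> F (\<ominus> a) = - \<pi> F a"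
  using \<pi>_add[of F "\<ominus> a" a] \<pi>_zero[of F] by (simp add: l_neg eq_neg_iff_add_eq_0)

lemma \<pi>_diff: "F \<in> \<Delta> \<Longrightarrow> a \<in> carrier R \<Longrightarrow> b \<in> carrier R \<Longrightarrow> \<pi> F (a \<ominus> b) = \<pi> F a - \<pi> F b"
  by (simp add: a_minus_def \<pi>_add \<pi>_minus)

lemma gen_iff: "a \<in> gen F \<longleftrightarrow> a \<in> carrier R \<and> \<pi> F a = 0" if "F \<in> \<Delta>"
  unfolding pull_def dvd_in_def using \<pi>_zero[OF that] zero_closed by (auto simp: image_iff)

lemma pull_prime:
  assumes F: "F \<in> \<Delta>" and p: "p = 0 \<or> prime_in (A F) p"
  shows "primeideal (pull F p) R"
proof (rule primeidealI)
  note S = subdom_A[OF F]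
  have in_A: "\<pi> F a \<in> A F" if "a \<in> carrier R" for a using that by blast
  show "ideal (pull F p) R"
  proof (rule idealI)
    show "ring R" by (rule ring_axioms)
    show "subgroup (pull F p) (add_monoid R)"
    proof (rule group.subgroupI)
      show "Group.group (add_monoid R)" by (rule add.is_group)
      have "\<zero> \<in> pull F p" unfolding pull_def using \<pi>_zero[OF F] subdomD(1)[OF S] by (auto simp: dvd_in_def intro!: bexI[of _ \<zero>])
      then show "pull F p \<noteq> {}" by blast
      show "inv\<^bsub>add_monoid R\<^esub> a \<in> pull F p" if "a \<in> pull F p" for a
      proof -
        have a: "a \<in> carrier R" "dvd_in (A F) p (\<pi> F a)" using that unfolding pull_def by auto
        have "dvd_in (A F) p (0 - \<pi> F a)"
          by (rule dvd_in_diff[OF S _ a(2)]) (use subdomD(1)[OF S] in \<open>auto simp: dvd_in_def intro!: bexI[of _ \<zero>] simp: \<pi>_zero[OF F]\<close>)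
        then show ?thesis unfolding a_inv_def[symmetric] pull_def using a \<pi>_minus[OF F] by simp
      qed
      show "a \<otimes>\<^bsub>add_monoid R\<^esub> b \<in> pull F p" if "a \<in> pull F p" "b \<in> pull F p" for a b
        using that dvd_in_add[OF S] \<pi>_add[OF F] unfolding pull_def by simp
    qed (auto simp: pull_def)
    show "b \<otimes> a \<in> pull F p" "a \<otimes> b \<in> pull F p" if "a \<in> pull F p" "b \<in> carrier R" for a b
      using that dvd_in_mult[OF S] dvd_in_mult2[OF S] \<pi>_mult[OF F] unfolding pull_def by simp_all
  qed
  show "cring R" by (rule is_cring)
  have "\<not> dvd_in (A F) p (\<pi> F \<one>)"
    using p prime_not_dvd_unit[OF S, of p 1] \<pi>_one[OF F] subdomD(2)[OF S] unfolding unit_in_def dvd_in_def by auto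
  then show "carrier R \<noteq> pull F p" unfolding pull_def by blast
  show "a \<in> pull F p \<or> b \<in> pull F p" if "a \<in> carrier R" "b \<in> carrier R" "a \<otimes> b \<in> pull F p" for a b
  proof -
    have "dvd_in (A F) p (\<pi> F a * \<pi> F b)" using that \<pi>_mult[OF F] unfolding pull_def by simp
    then have "dvd_in (A F) p (\<pi> F a) \<or> dvd_in (A F) p (\<pi> F b)"
      using p prime_inD(4)[OF _ in_A[OF that(1)] in_A[OF that(2)]] \<pi>_zero[OF F] zero_closed
      by (auto simp: dvd_in_def)
    then show ?thesis using that unfolding pull_def by blast
  qed
qed

lemma pull_Spec: "\<lbrakk>F \<in> \<Delta>; p = 0 \<or> prime_in (A F) p\<rbrakk> \<Longrightarrow> pull F p \<in> Spec R"
  using pull_prime by (simp add: Spec_def)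

lemma gen_Spec: "F \<in> \<Delta> \<Longrightarrow> gen F \<in> Spec R"
  by (rule pull_Spec) auto

lemma gen_ideal: "F \<in> \<Delta> \<Longrightarrow> ideal (gen F) R"
  using primeideal.axioms(1)[OF pull_prime[of F 0]] by simp

lemma gen_pull: "F \<in> \<Delta> \<Longrightarrow> gen F \<subseteq> pull F p"
proof
  fix a assume F: "F \<in> \<Delta>" and a: "a \<in> gen F"
  have "dvd_in (A F) p 0" unfolding dvd_in_def using subdomD(1)[OF subdom_A[OF F]] by (intro bexI[of _ 0]) auto
  then show "a \<in> pull F p" using a gen_iff[OF F] unfolding pull_def by auto
qed

lemma gen_mono: "\<lbrakk>G \<in> \<Delta>; F \<subseteq> G\<rbrakk> \<Longrightarrow> gen G \<subseteq> gen F"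
  using gen_iff[of G] gen_iff[of F] down[of G F] \<pi>_mono[of G F] by blast

lemma \<pi>_nonzero: "\<lbrakk>F \<in> \<Delta>; gen F \<subseteq> P; a \<in> carrier R - P\<rbrakk> \<Longrightarrow> \<pi> F a \<noteq> 0"
  using gen_iff by blast

text \<open>There are finitely many faces and their subspaces are closed, so those that miss
  \<open>P\<close> also miss a neighbourhood.\<close>

lemma faces_nbhd:
  assumes P: "P \<in> Spec R"
  shows "\<exists>W. openin X W \<and> P \<in> W \<and> (\<forall>Q\<in>W. \<forall>F\<in>\<Delta>. gen F \<subseteq> Q \<longrightarrow> gen F \<subseteq> P)"
proof -
  have "\<exists>W. openin X W \<and> P \<in> W \<and> (\<forall>Q\<in>W. \<forall>J\<in>gen ` {F \<in> \<Delta>. \<not> gen F \<subseteq> P}. \<not> J \<subseteq> Q)"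
    by (rule avoid_nbhd[OF P]) (use finite_faces gen_ideal in auto)
  then show ?thesis by (elim exE conjE, intro exI conjI) auto
qed

text \<open>\<open>gen F \<subseteq> P\<close> says that the subspace of \<open>F\<close> passes
  through \<open>P\<close>. Other components are set to one, so families over different complexes
  and points have the same type.\<close>

definition face_eval :: "'v set set \<Rightarrow> 'a set \<Rightarrow> 'a \<times> 'a \<Rightarrow> 'v set \<Rightarrow> 't fract" where
  "face_eval \<Gamma> P m = (\<lambda>F. if F \<in> \<Gamma> \<and> gen F \<subseteq> P then Fract (\<pi> F (fst m)) (\<pi> F (snd m)) else 1)"

text \<open>The components come from one pair of elements of \<open>R\<close>, so compatibility
  along common subfaces is built in.\<close>

definition face_stalk :: "'v set set \<Rightarrow> 'a set \<Rightarrow> ('v set \<Rightarrow> 't fract) monoid" where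
  "face_stalk \<Gamma> P = \<lparr>carrier = face_eval \<Gamma> P ` nonvan P, monoid.mult = (\<lambda>u v F. u F * v F), one = (\<lambda>_. 1)\<rparr>"

abbreviation "face_sec \<Gamma> \<equiv> eval_section X nonvan (face_eval \<Gamma>)"

lemma face_eval_mult:
  assumes "\<Gamma> \<subseteq> \<Delta>" "P \<in> Spec R" "m \<in> nonvan P" "n \<in> nonvan P"
  shows "(\<lambda>F. face_eval \<Gamma> P m F * face_eval \<Gamma> P n F) = face_eval \<Gamma> P (fst m \<otimes> fst n, snd m \<otimes> snd n)"
    and "(fst m \<otimes> fst n, snd m \<otimes> snd n) \<in> nonvan P"
  using assms not_in_prime_mult[OF assms(2)] by (auto simp: face_eval_def nonvan_def fun_eq_iff \<pi>_mult subset_iff)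

lemma face_eval_inv:
  assumes "\<Gamma> \<subseteq> \<Delta>" "P \<in> Spec R" "m \<in> nonvan P"
  shows "(\<lambda>F. face_eval \<Gamma> P (snd m, fst m) F * face_eval \<Gamma> P m F) = (\<lambda>_. 1)"
    and "(snd m, fst m) \<in> nonvan P"
proof -
  have "Fract (\<pi> F (snd m)) (\<pi> F (fst m)) * Fract (\<pi> F (fst m)) (\<pi> F (snd m)) = 1" if "F \<in> \<Gamma>" "gen F \<subseteq> P" for F
  proof -
    have "\<pi> F (fst m) \<noteq> 0" "\<pi> F (snd m) \<noteq> 0" using \<pi>_nonzero[of F P] that assms by (auto simp: nonvan_def)
    then show ?thesis by (simp add: One_fract_def eq_fract mult.commute)
  qed
  then show "(\<lambda>F. face_eval \<Gamma> P (snd m, fst m) F * face_eval \<Gamma> P m F) = (\<lambda>_. 1)" by (auto simp: face_eval_def)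
qed (use assms in \<open>auto simp: nonvan_def\<close>)

lemma face_eval_one: "\<Gamma> \<subseteq> \<Delta> \<Longrightarrow> face_eval \<Gamma> P (\<one>, \<one>) = (\<lambda>_. 1)"
  by (auto simp: face_eval_def fun_eq_iff One_fract_def \<pi>_one)

lemma face_comm_group:
  assumes \<Gamma>: "\<Gamma> \<subseteq> \<Delta>" and P: "P \<in> Spec R"
  shows "comm_group (face_stalk \<Gamma> P)"
proof (rule comm_groupI)
  have one: "(\<one>, \<one>) \<in> nonvan P" using one_not_in_prime[OF P] by (simp add: nonvan_def)
  show "\<one>\<^bsub>face_stalk \<Gamma> P\<^esub> \<in> carrier (face_stalk \<Gamma> P)"
    unfolding face_stalk_def using imageI[OF one, of "face_eval \<Gamma> P"] face_eval_one[OF \<Gamma>, of P] by simp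
  fix x y assume "x \<in> carrier (face_stalk \<Gamma> P)" and "y \<in> carrier (face_stalk \<Gamma> P)"
  then obtain m n where m: "x = face_eval \<Gamma> P m" "m \<in> nonvan P" and n: "y = face_eval \<Gamma> P n" "n \<in> nonvan P"
    unfolding face_stalk_def by auto
  show "x \<otimes>\<^bsub>face_stalk \<Gamma> P\<^esub> y \<in> carrier (face_stalk \<Gamma> P)"
    unfolding face_stalk_def m(1) n(1) using face_eval_mult[OF \<Gamma> P m(2) n(2)] by simp
next
  fix x assume "x \<in> carrier (face_stalk \<Gamma> P)"
  then obtain m where m: "x = face_eval \<Gamma> P m" "m \<in> nonvan P" unfolding face_stalk_def by auto
  show "\<exists>y\<in>carrier (face_stalk \<Gamma> P). y \<otimes>\<^bsub>face_stalk \<Gamma> P\<^esub> x = \<one>\<^bsub>face_stalk \<Gamma> P\<^esub>"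
    unfolding m(1) using face_eval_inv[OF \<Gamma> P m(2)]
    by (intro bexI[of _ "face_eval \<Gamma> P (snd m, fst m)"]) (simp_all add: face_stalk_def)
qed (auto simp: face_stalk_def fun_eq_iff mult_ac)

lemma face_eval_sheaf:
  assumes \<Gamma>: "\<Gamma> \<subseteq> \<Delta>"
  shows "eval_sheaf X (face_stalk \<Gamma>) nonvan (face_eval \<Gamma>) (\<lambda>m n. (fst m \<otimes> snd n, snd m \<otimes> fst n)) (\<one>, \<one>)"
proof (rule eval_sheaf.intro; unfold topspace_zariski)
  fix P assume P: "P \<in> Spec R"
  show "comm_group (face_stalk \<Gamma> P)" by (rule face_comm_group[OF \<Gamma> P])
  then interpret g: comm_group "face_stalk \<Gamma> P" .
  show carr: "carrier (face_stalk \<Gamma> P) = face_eval \<Gamma> P ` nonvan P" by (simp add: face_stalk_def)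
  show "(\<one>, \<one>) \<in> nonvan P \<and> face_eval \<Gamma> P (\<one>, \<one>) = \<one>\<^bsub>face_stalk \<Gamma> P\<^esub>"
    using one_not_in_prime[OF P] face_eval_one[OF \<Gamma>] by (simp add: nonvan_def face_stalk_def)
  fix m assume m: "m \<in> nonvan P"
  show "\<exists>W. openin X W \<and> P \<in> W \<and> (\<forall>y\<in>W. m \<in> nonvan y)" by (rule nonvan_open[OF P m])
  fix n assume n: "n \<in> nonvan P"
  have i: "inv\<^bsub>face_stalk \<Gamma> P\<^esub> face_eval \<Gamma> P n = face_eval \<Gamma> P (snd n, fst n)"
    using face_eval_inv[OF \<Gamma> P n] n by (intro g.inv_equality) (simp_all add: face_stalk_def)
  show "(fst m \<otimes> snd n, snd m \<otimes> fst n) \<in> nonvan P \<and>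
      face_eval \<Gamma> P (fst m \<otimes> snd n, snd m \<otimes> fst n) = face_eval \<Gamma> P m \<otimes>\<^bsub>face_stalk \<Gamma> P\<^esub> inv\<^bsub>face_stalk \<Gamma> P\<^esub> face_eval \<Gamma> P n"
    unfolding i using face_eval_mult[OF \<Gamma> P m face_eval_inv(2)[OF \<Gamma> P n]] by (simp add: face_stalk_def)
  assume eq: "face_eval \<Gamma> P m = face_eval \<Gamma> P n"
  obtain W where W: "openin X W" "P \<in> W" "\<forall>Q\<in>W. \<forall>F\<in>\<Delta>. gen F \<subseteq> Q \<longrightarrow> gen F \<subseteq> P" using faces_nbhd[OF P] by blast
  \<comment> \<open>Near \<open>P\<close> no further face comes into play, so equality at
    \<open>P\<close> covers all components at \<open>Q\<close>.\<close>
  have "face_eval \<Gamma> Q m = face_eval \<Gamma> Q n" if "Q \<in> W" for Q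
  proof
    fix F show "face_eval \<Gamma> Q m F = face_eval \<Gamma> Q n F"
      using fun_cong[OF eq, of F] W(3) that \<Gamma> by (auto simp: face_eval_def)
  qed
  then show "\<exists>W. openin X W \<and> P \<in> W \<and> (\<forall>y\<in>W. m \<in> nonvan y \<longrightarrow> n \<in> nonvan y \<longrightarrow> face_eval \<Gamma> y m = face_eval \<Gamma> y n)"
    using W(1,2) by blast
qed

lemma face_etale: "\<Gamma> \<subseteq> \<Delta> \<Longrightarrow> etale X (face_stalk \<Gamma>) (face_sec \<Gamma>)"
  by (rule eval_sheaf.etale[OF face_eval_sheaf])

definition proj :: "'v set set \<Rightarrow> ('v set \<Rightarrow> 't fract) \<Rightarrow> 'v set \<Rightarrow> 't fract" where
  "proj \<Gamma> u = (\<lambda>F. if F \<in> \<Gamma> then u F else 1)"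

lemma proj_eval: "\<Gamma>' \<subseteq> \<Gamma> \<Longrightarrow> proj \<Gamma>' (face_eval \<Gamma> P m) = face_eval \<Gamma>' P m"
  by (auto simp: proj_def face_eval_def fun_eq_iff)

lemma proj_hom:
  assumes "\<Gamma> \<subseteq> \<Delta>" "\<Gamma>' \<subseteq> \<Gamma>"
  shows "etale_hom X (face_stalk \<Gamma>) (face_sec \<Gamma>) (face_stalk \<Gamma>') (face_sec \<Gamma>') (\<lambda>_. proj \<Gamma>')"
proof (rule eval_hom; unfold topspace_zariski)
  fix P assume P: "P \<in> Spec R"
  show "proj \<Gamma>' \<in> hom (face_stalk \<Gamma> P) (face_stalk \<Gamma>' P)"
  proof (rule homI)
    show "proj \<Gamma>' u \<in> carrier (face_stalk \<Gamma>' P)" if "u \<in> carrier (face_stalk \<Gamma> P)" for u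
      using that proj_eval[OF assms(2)] by (auto simp: face_stalk_def)
    show "proj \<Gamma>' (u \<otimes>\<^bsub>face_stalk \<Gamma> P\<^esub> v) = proj \<Gamma>' u \<otimes>\<^bsub>face_stalk \<Gamma>' P\<^esub> proj \<Gamma>' v" for u v
      by (auto simp: face_stalk_def proj_def)
  qed
  fix m assume "m \<in> nonvan P"
  from nonvan_open[OF P this] show "\<exists>W n. openin X W \<and> P \<in> W \<and> (\<forall>y\<in>W. m \<in> nonvan y \<longrightarrow> n \<in> nonvan y \<and> proj \<Gamma>' (face_eval \<Gamma> y m) = face_eval \<Gamma>' y n)"
    using proj_eval[OF assms(2)] by (elim exE, intro exI[of _ _] exI[of _ m]) auto
qed

lemma face_carrier: "carrier (face_stalk \<Gamma> P) = face_eval \<Gamma> P ` nonvan P"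
  by (simp add: face_stalk_def)

lemma proj_surj: "\<lbrakk>\<Gamma>' \<subseteq> \<Gamma>; s \<in> carrier (face_stalk \<Gamma>' P)\<rbrakk> \<Longrightarrow> \<exists>r\<in>carrier (face_stalk \<Gamma> P). proj \<Gamma>' r = s"
  unfolding face_carrier by (auto simp: proj_eval)

lemma eval_one_iff:
  assumes "\<Gamma> \<subseteq> \<Delta>" "P \<in> Spec R" "m \<in> nonvan P"
  shows "face_eval \<Gamma> P m = (\<lambda>_. 1) \<longleftrightarrow> (\<forall>F\<in>\<Gamma>. gen F \<subseteq> P \<longrightarrow> \<pi> F (fst m) = \<pi> F (snd m))"
proof -
  have "Fract (\<pi> F (fst m)) (\<pi> F (snd m)) = 1 \<longleftrightarrow> \<pi> F (fst m) = \<pi> F (snd m)" if "F \<in> \<Gamma>" "gen F \<subseteq> P" for F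
  proof -
    have "\<pi> F (snd m) \<noteq> 0" using \<pi>_nonzero[of F P] that assms by (auto simp: nonvan_def)
    then show ?thesis by (simp add: One_fract_def eq_fract)
  qed
  then show ?thesis by (auto simp: face_eval_def fun_eq_iff)
qed

text \<open>Apply \<open>\<pi>_mono\<close> to the difference of the two elements.\<close>

lemma eval_mono:
  assumes "G \<in> \<Delta>" "F \<subseteq> G" "a \<in> carrier R" "b \<in> carrier R" "\<pi> G a = \<pi> G b"
  shows "\<pi> F a = \<pi> F b"
proof -
  have "\<pi> G (a \<ominus> b) = 0" using \<pi>_diff assms by simp
  then have "\<pi> F (a \<ominus> b) = 0" using \<pi>_mono[OF assms(1,2)] assms(3,4) by blast
  then show ?thesis using \<pi>_diff[OF down[OF assms(1,2)] assms(3,4)] by simp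
qed

text \<open>The component at a face determines those at its subfaces, so forgetting all but the
  large faces is an isomorphism. In particular the full simplex \<open>Pow F\<close> reduces to the
  single face \<open>F\<close>.\<close>

lemma acyclic_cofinal:
  assumes \<Gamma>: "\<Gamma> \<subseteq> \<Delta>" and \<Gamma>': "\<Gamma>' \<subseteq> \<Gamma>" and cof: "\<And>F. F \<in> \<Gamma> \<Longrightarrow> \<exists>G\<in>\<Gamma>'. F \<subseteq> G"
    and ac: "acyclic_etale X (face_stalk \<Gamma>') (face_sec \<Gamma>')"
  shows "acyclic_etale X (face_stalk \<Gamma>) (face_sec \<Gamma>)"
  unfolding acyclic_etale_def
proof (rule iso_acyclic[OF etale.etale_section_presheaf[OF face_etale[OF \<Gamma>]] face_etale[OF order_trans[OF \<Gamma>' \<Gamma>]] proj_hom[OF \<Gamma> \<Gamma>'] _ proj_surj[OF \<Gamma>'] ac]; unfold topspace_zariski)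
  fix P s assume P: "P \<in> Spec R" and s: "s \<in> carrier (face_stalk \<Gamma> P)" "proj \<Gamma>' s = \<one>\<^bsub>face_stalk \<Gamma>' P\<^esub>"
  obtain m where m: "s = face_eval \<Gamma> P m" "m \<in> nonvan P" using s(1) unfolding face_carrier by blast
  have "face_eval \<Gamma>' P m = (\<lambda>_. 1)" using s(2) unfolding m(1) proj_eval[OF \<Gamma>'] by (simp add: face_stalk_def)
  then have 1: "\<forall>F\<in>\<Gamma>'. gen F \<subseteq> P \<longrightarrow> \<pi> F (fst m) = \<pi> F (snd m)" using eval_one_iff[OF order_trans[OF \<Gamma>' \<Gamma>] P m(2)] by blast
  have mR: "fst m \<in> carrier R" "snd m \<in> carrier R" using m(2) by (auto simp: nonvan_def)
  have "\<pi> F (fst m) = \<pi> F (snd m)" if F: "F \<in> \<Gamma>" "gen F \<subseteq> P" for F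
  proof -
    obtain G where G: "G \<in> \<Gamma>'" "F \<subseteq> G" using cof[OF F(1)] by blast
    then have G\<Delta>: "G \<in> \<Delta>" using \<Gamma> \<Gamma>' by blast
    have "gen G \<subseteq> P" using gen_mono[OF G\<Delta> G(2)] F(2) by blast
    then have "\<pi> G (fst m) = \<pi> G (snd m)" using 1 G(1) by blast
    then show ?thesis by (rule eval_mono[OF G\<Delta> G(2) mR])
  qed
  then have "face_eval \<Gamma> P m = (\<lambda>_. 1)" using eval_one_iff[OF \<Gamma> P m(2)] by blast
  then show "s = \<one>\<^bsub>face_stalk \<Gamma> P\<^esub>" unfolding m(1) by (simp add: face_stalk_def)
qed

lemma acyclic_empty: "acyclic_etale X (face_stalk {}) (face_sec {})"
proof (rule etale.flasque_acyclic[OF face_etale], simp)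
  have e: "face_eval {} P m = (\<lambda>_. 1)" for P m by (simp add: face_eval_def)
  show "flasque X (face_sec {})"
    unfolding flasque_def
  proof (intro allI impI)
    fix U f assume U: "openin X U" and f: "\<forall>P\<in>U. face_sec {} P f"
    have "face_sec {} P (\<lambda>_. face_eval {} P (\<one>, \<one>))" if "P \<in> topspace X" for P
      unfolding eval_section_def using that one_not_in_prime unfolding topspace_zariski
      by (intro exI[of _ "Spec R"] exI[of _ "(\<one>, \<one>)"]) (auto simp: e nonvan_def topspace_zariski[symmetric])
    moreover have "f P = (\<lambda>_. 1)" if "P \<in> U" for P using f that unfolding eval_section_def e by blast
    ultimately show "\<exists>g. (\<forall>P\<in>topspace X. face_sec {} P g) \<and> (\<forall>P\<in>U. g P = f P)"
      unfolding e by (intro exI[of _ "\<lambda>_ _. 1"]) auto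
  qed
qed

end

section \<open>A single face\<close>

lemma fractions_facts:
  assumes "subdom A"
  shows "1 \<in> fractions A" "g \<in> fractions A \<Longrightarrow> inverse g \<in> fractions A" "g \<in> fractions A \<Longrightarrow> g \<noteq> 0"
proof -
  show "1 \<in> fractions A" unfolding fractions_def One_fract_def using subdomD(2)[OF assms] by (auto intro!: exI[of _ 1])
  show "inverse g \<in> fractions A" if "g \<in> fractions A"
  proof -
    obtain a s where "g = Fract a s" "a \<in> A" "s \<in> A" "a \<noteq> 0" "s \<noteq> 0" using \<open>g \<in> fractions A\<close> unfolding fractions_def by blast
    then have "inverse g = Fract s a" "a \<in> A" "s \<in> A" "a \<noteq> 0" "s \<noteq> 0" by simp_all
    then show ?thesis unfolding fractions_def by blast
  qed
  show "g \<in> fractions A \<Longrightarrow> g \<noteq> 0" unfolding fractions_def by (auto simp: Zero_fract_def eq_fract)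
qed

lemma (in eval_sheaf) global_flasque:
  assumes "\<And>U f. \<lbrakk>openin X U; \<And>x. x \<in> U \<Longrightarrow> eval_section X M e x f\<rbrakk> \<Longrightarrow>
      \<exists>m. (\<forall>x\<in>topspace X. m \<in> M x) \<and> (\<forall>x\<in>U. f x = e x m)"
  shows "flasque X (eval_section X M e)"
  unfolding flasque_def
proof (intro allI impI)
  fix U f assume "openin X U" "\<forall>x\<in>U. eval_section X M e x f"
  then obtain m where m: "\<forall>x\<in>topspace X. m \<in> M x" "\<forall>x\<in>U. f x = e x m" using assms[of U f] by auto
  have "\<forall>x\<in>topspace X. eval_section X M e x (\<lambda>y. e y m)"
    unfolding eval_section_def using m(1) by (intro ballI exI[of _ "topspace X"] exI[of _ m]) simp
  then show "\<exists>g. (\<forall>x\<in>topspace X. eval_section X M e x g) \<and> (\<forall>x\<in>U. g x = f x)"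
    using m(2) by (intro exI[of _ "\<lambda>y. e y m"]) simp
qed

context face_ring
begin

text \<open>The constant sheaf of nonzero rational functions on the subspace of \<open>F\<close>,
  extended by one.\<close>

definition const_eval :: "'v set \<Rightarrow> 'a set \<Rightarrow> 't fract \<Rightarrow> 't fract" where
  "const_eval F P g = (if gen F \<subseteq> P then g else 1)"

definition const_stalk :: "'v set \<Rightarrow> 'a set \<Rightarrow> 't fract monoid" where
  "const_stalk F P = \<lparr>carrier = const_eval F P ` fractions (A F), monoid.mult = (*), one = 1\<rparr>"

definition divisors :: "'v set \<Rightarrow> ('t \<Rightarrow> int) set" where
  "divisors F = {d. finite {p. d p \<noteq> 0} \<and> {p. d p \<noteq> 0} \<subseteq> prime_reps (A F)}"

text \<open>The germ of a divisor at \<open>P\<close>: only the components through \<open>P\<close>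
  count.\<close>

definition div_eval :: "'v set \<Rightarrow> 'a set \<Rightarrow> ('t \<Rightarrow> int) \<Rightarrow> 't \<Rightarrow> int" where
  "div_eval F P d = (\<lambda>p. if pull F p \<subseteq> P then d p else 0)"

definition div_stalk :: "'v set \<Rightarrow> 'a set \<Rightarrow> ('t \<Rightarrow> int) monoid" where
  "div_stalk F P = \<lparr>carrier = div_eval F P ` divisors F, monoid.mult = (\<lambda>d e p. d p + e p), one = (\<lambda>_. 0)\<rparr>"

definition div_map :: "'v set \<Rightarrow> 'a set \<Rightarrow> 't fract \<Rightarrow> 't \<Rightarrow> int" where
  "div_map F P g = (\<lambda>p. if p \<in> prime_reps (A F) \<and> pull F p \<subseteq> P then val (A F) p g else 0)"

abbreviation "const_sec F \<equiv> eval_section X (\<lambda>_. fractions (A F)) (const_eval F)"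
abbreviation "div_sec F \<equiv> eval_section X (\<lambda>_. divisors F) (div_eval F)"

context
  fixes F assumes F: "F \<in> \<Delta>"
begin

lemma fA: "factorial_in (A F)" by (rule \<pi>_factorial[OF F])
lemma SA: "subdom (A F)" by (rule subdom_A[OF F])
lemma rep_prime: "p \<in> prime_reps (A F) \<Longrightarrow> prime_in (A F) p" by (rule prime_reps_prime[OF SA])
lemma rep_pull: "p \<in> prime_reps (A F) \<Longrightarrow> pull F p \<in> Spec R" by (rule pull_Spec[OF F]) (use rep_prime in blast)

lemma const_eval_in: "g \<in> fractions (A F) \<Longrightarrow> const_eval F P g \<in> fractions (A F)"
  using fractions_facts(1)[OF SA] by (simp add: const_eval_def)

lemma const_comm_group: "comm_group (const_stalk F P)"
proof (rule comm_groupI)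
  have m: "const_eval F P g * const_eval F P h = const_eval F P (g * h)" for g h by (simp add: const_eval_def)
  fix x y assume "x \<in> carrier (const_stalk F P)" "y \<in> carrier (const_stalk F P)"
  then show "x \<otimes>\<^bsub>const_stalk F P\<^esub> y \<in> carrier (const_stalk F P)"
    using fractions_mult[OF fA] by (auto simp: const_stalk_def m)
next
  show "\<one>\<^bsub>const_stalk F P\<^esub> \<in> carrier (const_stalk F P)"
    using imageI[OF fractions_facts(1)[OF SA], of "const_eval F P"] by (simp add: const_stalk_def const_eval_def)
next
  fix x assume "x \<in> carrier (const_stalk F P)"
  then obtain g where g: "g \<in> fractions (A F)" "x = const_eval F P g" by (auto simp: const_stalk_def)
  have "const_eval F P (inverse g) * x = 1" using fractions_facts(3)[OF SA g(1)] g(2) by (simp add: const_eval_def)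
  then show "\<exists>y\<in>carrier (const_stalk F P). y \<otimes>\<^bsub>const_stalk F P\<^esub> x = \<one>\<^bsub>const_stalk F P\<^esub>"
    using imageI[OF fractions_facts(2)[OF SA g(1)], of "const_eval F P"]
    by (intro bexI[of _ "const_eval F P (inverse g)"]) (simp_all add: const_stalk_def)
qed (auto simp: const_stalk_def mult_ac)

lemma const_eval_sheaf:
  "eval_sheaf X (const_stalk F) (\<lambda>_. fractions (A F)) (const_eval F) (\<lambda>g h. g * inverse h) 1"
proof (rule eval_sheaf.intro; unfold topspace_zariski)
  fix P assume P: "P \<in> Spec R"
  interpret g: comm_group "const_stalk F P" by (rule const_comm_group)
  show "comm_group (const_stalk F P)" by (rule const_comm_group)
  show "carrier (const_stalk F P) = const_eval F P ` fractions (A F)" by (simp add: const_stalk_def)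
  show "1 \<in> fractions (A F) \<and> const_eval F P 1 = \<one>\<^bsub>const_stalk F P\<^esub>"
    using fractions_facts(1)[OF SA] by (simp add: const_stalk_def const_eval_def)
  fix m assume m: "m \<in> fractions (A F)"
  show "\<exists>W. openin X W \<and> P \<in> W \<and> (\<forall>y\<in>W. m \<in> fractions (A F))"
    using m P openin_topspace[of X] unfolding topspace_zariski by blast
  fix n assume n: "n \<in> fractions (A F)"
  have i: "inv\<^bsub>const_stalk F P\<^esub> const_eval F P n = const_eval F P (inverse n)"
    using n fractions_facts(2,3)[OF SA n] by (intro g.inv_equality) (auto simp: const_stalk_def const_eval_def)
  show "m * inverse n \<in> fractions (A F) \<and> const_eval F P (m * inverse n) = const_eval F P m \<otimes>\<^bsub>const_stalk F P\<^esub> inv\<^bsub>const_stalk F P\<^esub> const_eval F P n"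
    unfolding i using fractions_mult[OF fA m fractions_facts(2)[OF SA n]] by (simp add: const_stalk_def const_eval_def)
  assume eq: "const_eval F P m = const_eval F P n"
  show "\<exists>W. openin X W \<and> P \<in> W \<and> (\<forall>y\<in>W. m \<in> fractions (A F) \<longrightarrow> n \<in> fractions (A F) \<longrightarrow> const_eval F y m = const_eval F y n)"
  proof (cases "gen F \<subseteq> P")
    case True
    then have "m = n" using eq by (simp add: const_eval_def)
    then show ?thesis using P openin_topspace[of X] unfolding topspace_zariski by blast
  next
    case False
    obtain W where "openin X W" "P \<in> W" "\<forall>Q\<in>W. \<forall>J\<in>{gen F}. \<not> J \<subseteq> Q"
      using avoid_nbhd[OF P, of "{gen F}"] gen_ideal[OF F] False by auto
    then show ?thesis by (intro exI[of _ W]) (simp add: const_eval_def)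
  qed
qed

text \<open>The subspace of \<open>F\<close> is irreducible: every open set meeting it contains the
  generic point \<open>gen F\<close>, and the value there determines the section.\<close>

lemma const_global:
  assumes U: "openin X U" and f: "\<And>P. P \<in> U \<Longrightarrow> const_sec F P f"
  shows "\<exists>g. (\<forall>P\<in>topspace X. g \<in> fractions (A F)) \<and> (\<forall>P\<in>U. f P = const_eval F P g)"
proof (cases "gen F \<in> U")
  case True
  obtain W0 g where W0: "gen F \<in> W0" "\<forall>Q\<in>W0. g \<in> fractions (A F) \<and> f Q = const_eval F Q g"
    using f[OF True] unfolding eval_section_def by (elim exE conjE)
  have g: "g \<in> fractions (A F)" "f (gen F) = g" using W0 by (auto simp: const_eval_def)
  have "f P = const_eval F P g" if P: "P \<in> U" for P
  proof -
    obtain W h where W: "openin X W" "P \<in> W" "\<forall>Q\<in>W. h \<in> fractions (A F) \<and> f Q = const_eval F Q h"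
      using f[OF P] unfolding eval_section_def by (elim exE conjE)
    show ?thesis
    proof (cases "gen F \<subseteq> P")
      case True
      then have "gen F \<in> W" using open_generization[OF W(1,2) gen_Spec[OF F]] by blast
      then have "g = h" using W(3) g(2) by (auto simp: const_eval_def)
      then show ?thesis using W(2,3) by simp
    next
      case False then show ?thesis using W(2,3) by (simp add: const_eval_def)
    qed
  qed
  then show ?thesis using g(1) by blast
next
  case False
  have "f P = const_eval F P 1" if P: "P \<in> U" for P
  proof -
    have "\<not> gen F \<subseteq> P" using open_generization[OF U P gen_Spec[OF F]] False by blast
    moreover obtain W h where W: "openin X W" "P \<in> W" "\<forall>Q\<in>W. h \<in> fractions (A F) \<and> f Q = const_eval F Q h"
      using f[OF P] unfolding eval_section_def by (elim exE conjE)
    ultimately show ?thesis by (simp add: const_eval_def)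
  qed
  then show ?thesis using fractions_facts(1)[OF SA] by blast
qed

lemma div_eval_sheaf:
  "eval_sheaf X (div_stalk F) (\<lambda>_. divisors F) (div_eval F) (\<lambda>d e p. d p - e p) (\<lambda>_. 0)"
proof (rule eval_sheaf.intro; unfold topspace_zariski)
  have z: "(\<lambda>_. 0) \<in> divisors F" by (simp add: divisors_def)
  have mi: "(\<lambda>p. d p - e p) \<in> divisors F" if "d \<in> divisors F" "e \<in> divisors F" for d e
  proof -
    have "{p. d p - e p \<noteq> 0} \<subseteq> {p. d p \<noteq> 0} \<union> {p. e p \<noteq> 0}" by auto
    then show ?thesis using that finite_subset unfolding divisors_def by (simp, blast)
  qed
  fix P assume P: "P \<in> Spec R"
  have z': "div_eval F P (\<lambda>_. 0) = (\<lambda>_. 0)" by (simp add: div_eval_def)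
  show carr: "carrier (div_stalk F P) = div_eval F P ` divisors F" by (simp add: div_stalk_def)
  show cg: "comm_group (div_stalk F P)"
  proof (rule comm_groupI)
    show "\<one>\<^bsub>div_stalk F P\<^esub> \<in> carrier (div_stalk F P)"
      using imageI[OF z, of "div_eval F P"] z' by (simp add: div_stalk_def)
    fix x assume "x \<in> carrier (div_stalk F P)"
    then obtain d where d: "x = div_eval F P d" "d \<in> divisors F" unfolding carr by blast
    have n: "(\<lambda>p. 0 - d p) \<in> divisors F" by (rule mi[OF z d(2)])
    have "(\<lambda>p. div_eval F P (\<lambda>p. 0 - d p) p + x p) = (\<lambda>_. 0)" unfolding d(1) by (auto simp: div_eval_def)
    then show "\<exists>y\<in>carrier (div_stalk F P). y \<otimes>\<^bsub>div_stalk F P\<^esub> x = \<one>\<^bsub>div_stalk F P\<^esub>"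
      using imageI[OF n, of "div_eval F P"] by (intro bexI[of _ "div_eval F P (\<lambda>p. 0 - d p)"]) (simp_all add: div_stalk_def)
    fix y assume "y \<in> carrier (div_stalk F P)"
    then obtain e where e: "y = div_eval F P e" "e \<in> divisors F" unfolding carr by blast
    have "(\<lambda>p. d p - (0 - e p)) \<in> divisors F" by (rule mi[OF d(2) mi[OF z e(2)]])
    moreover have "(\<lambda>p. x p + y p) = div_eval F P (\<lambda>p. d p - (0 - e p))" unfolding d(1) e(1) by (auto simp: div_eval_def)
    ultimately show "x \<otimes>\<^bsub>div_stalk F P\<^esub> y \<in> carrier (div_stalk F P)" by (simp add: div_stalk_def)
  qed (auto simp: div_stalk_def ac_simps)
  then interpret g: comm_group "div_stalk F P" .
  show "(\<lambda>_. 0) \<in> divisors F \<and> div_eval F P (\<lambda>_. 0) = \<one>\<^bsub>div_stalk F P\<^esub>" using z z' by (simp add: div_stalk_def)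
  fix m assume m: "m \<in> divisors F"
  show "\<exists>W. openin X W \<and> P \<in> W \<and> (\<forall>y\<in>W. m \<in> divisors F)"
    using m P openin_topspace[of X] unfolding topspace_zariski by blast
  fix n assume n: "n \<in> divisors F"
  have i: "inv\<^bsub>div_stalk F P\<^esub> div_eval F P n = div_eval F P (\<lambda>p. 0 - n p)"
    using n mi[OF z n] by (intro g.inv_equality) (auto simp: div_stalk_def div_eval_def)
  show "(\<lambda>p. m p - n p) \<in> divisors F \<and> div_eval F P (\<lambda>p. m p - n p) = div_eval F P m \<otimes>\<^bsub>div_stalk F P\<^esub> inv\<^bsub>div_stalk F P\<^esub> div_eval F P n"
    unfolding i using mi[OF m n] by (auto simp: div_stalk_def div_eval_def fun_eq_iff)
  assume eq: "div_eval F P m = div_eval F P n"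
  \<comment> \<open>The finitely many components on which the divisors differ all miss
    \<open>P\<close>, so a neighbourhood avoids them.\<close>
  let ?I = "{p. m p \<noteq> n p}"
  have "?I \<subseteq> {p. m p \<noteq> 0} \<union> {p. n p \<noteq> 0}" by auto
  then have fin: "finite ?I" and reps: "?I \<subseteq> prime_reps (A F)" using m n finite_subset unfolding divisors_def by (simp, blast)+
  have "ideal J R \<and> \<not> J \<subseteq> P" if J: "J \<in> pull F ` ?I" for J
  proof -
    obtain p where p: "J = pull F p" "p \<in> ?I" using J by blast
    have "\<not> pull F p \<subseteq> P" using fun_cong[OF eq, of p] p(2) by (auto simp: div_eval_def split: if_splits)
    moreover have "primeideal (pull F p) R" using rep_pull[of p] reps p(2) by (auto simp: Spec_def)
    ultimately show ?thesis using p(1) primeideal.axioms(1) by blast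
  qed
  then obtain W where W: "openin X W" "P \<in> W" "\<forall>Q\<in>W. \<forall>J\<in>pull F ` ?I. \<not> J \<subseteq> Q"
    using avoid_nbhd[OF P finite_imageI[OF fin, of "pull F"]] by blast
  have "div_eval F Q m = div_eval F Q n" if "Q \<in> W" for Q using W(3) that by (auto simp: div_eval_def fun_eq_iff)
  then show "\<exists>W. openin X W \<and> P \<in> W \<and> (\<forall>y\<in>W. m \<in> divisors F \<longrightarrow> n \<in> divisors F \<longrightarrow> div_eval F y m = div_eval F y n)"
    using W(1,2) by blast
qed

text \<open>The multiplicity along \<open>p\<close> is read off at the generic point
  \<open>pull F p\<close>. Finiteness comes from the generic point of \<open>F\<close>: where some
  \<open>a\<close> does not vanish the section is a single divisor, and only finitely many primes
  divide \<open>\<pi> F a\<close>.\<close>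

lemma div_global:
  assumes U: "openin X U" and f: "\<And>P. P \<in> U \<Longrightarrow> div_sec F P f"
  shows "\<exists>d. (\<forall>P\<in>topspace X. d \<in> divisors F) \<and> (\<forall>P\<in>U. f P = div_eval F P d)"
proof -
  define d where "d p = (if p \<in> prime_reps (A F) \<and> pull F p \<in> U then f (pull F p) p else 0)" for p
  have val: "f P = div_eval F P d" if P: "P \<in> U" for P
  proof
    fix p
    obtain W m where W: "openin X W" "P \<in> W" "\<forall>Q\<in>W. m \<in> divisors F \<and> f Q = div_eval F Q m"
      using f[OF P] unfolding eval_section_def by (elim exE conjE)
    have m: "m \<in> divisors F" "f P = div_eval F P m" using W(2,3) by auto
    have "m p = d p" if "pull F p \<subseteq> P"
    proof (cases "p \<in> prime_reps (A F)")
      case True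
      have "pull F p \<in> W" "pull F p \<in> U"
        using open_generization[OF W(1,2) rep_pull[OF True]] open_generization[OF U P rep_pull[OF True]] that by auto
      then show ?thesis using W(3) True by (simp add: d_def div_eval_def)
    next
      case False then show ?thesis using m(1) by (auto simp: d_def divisors_def)
    qed
    then show "f P p = div_eval F P d p" unfolding m(2) by (simp add: div_eval_def)
  qed
  have sub: "{p. d p \<noteq> 0} \<subseteq> prime_reps (A F)" by (auto simp: d_def)
  have "finite {p. d p \<noteq> 0}"
  proof (cases "gen F \<in> U")
    case True
    obtain W m where W: "openin X W" "gen F \<in> W" "\<forall>Q\<in>W. m \<in> divisors F \<and> f Q = div_eval F Q m"
      using f[OF True] unfolding eval_section_def by (elim exE conjE)
    obtain a where a: "a \<in> carrier R" "a \<notin> gen F" "\<forall>Q\<in>Spec R. a \<notin> Q \<longrightarrow> Q \<in> W"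
      using open_contains_nonvanishing[OF W(1,2)] by blast
    have a0: "\<pi> F a \<noteq> 0" "\<pi> F a \<in> A F" using a(1,2) gen_iff[OF F] by auto
    have "{p. d p \<noteq> 0} \<subseteq> {p. m p \<noteq> 0} \<union> {p \<in> prime_reps (A F). dvd_in (A F) p (\<pi> F a)}"
    proof
      fix p assume "p \<in> {p. d p \<noteq> 0}"
      then have p: "d p \<noteq> 0" "p \<in> prime_reps (A F)" "pull F p \<in> U" by (auto simp: d_def split: if_splits)
      show "p \<in> {p. m p \<noteq> 0} \<union> {p \<in> prime_reps (A F). dvd_in (A F) p (\<pi> F a)}"
      proof (cases "dvd_in (A F) p (\<pi> F a)")
        case False
        then have "a \<notin> pull F p" unfolding pull_def by simp
        then have "pull F p \<in> W" using a(3) rep_pull[OF p(2)] by blast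
        then have "d p = m p" using W(3) p by (simp add: d_def div_eval_def)
        then show ?thesis using p(1) by simp
      qed (use p in simp)
    qed
    moreover have "finite {p. m p \<noteq> 0}" using W(2,3) unfolding divisors_def by blast
    ultimately show ?thesis using finite_prime_divisors[OF fA a0(2,1)] by (meson finite_UnI finite_subset)
  next
    \<comment> \<open>An open set without \<open>gen F\<close> misses the whole subspace, so the
      divisor is zero.\<close>
    case False
    have "pull F p \<notin> U" for p using open_generization[OF U _ gen_Spec[OF F] gen_pull[OF F]] False by blast
    then show ?thesis by (simp add: d_def)
  qed
  then have "d \<in> divisors F" using sub by (simp add: divisors_def)
  then show ?thesis using val by blast
qed

text \<open>Factor the image of \<open>r\<close> on the face. By primality some prime factor has its
  preimages in \<open>P\<close>, and then so does its representative.\<close>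

lemma prime_element_in:
  assumes P: "P \<in> Spec R" "gen F \<subseteq> P" and r: "r \<in> P" "\<pi> F r \<noteq> 0"
  shows "\<exists>p\<in>prime_reps (A F). pull F p \<subseteq> P \<and> dvd_in (A F) p (\<pi> F r)"
proof -
  interpret P: primeideal P R using P by (simp add: Spec_def)
  have PR: "a \<in> carrier R" if "a \<in> P" for a using that P.a_subset by blast
  \<comment> \<open>\<open>P\<close> contains the kernel of \<open>\<pi> F\<close>, so membership in
    \<open>P\<close> depends only on the image.\<close>
  have cong: "a \<in> P" if "b \<in> P" "a \<in> carrier R" "\<pi> F a = \<pi> F b" for a b
  proof -
    have "a \<ominus> b \<in> gen F" unfolding gen_iff[OF F] using that PR \<pi>_diff[OF F] by simp
    then have "(a \<ominus> b) \<oplus> b \<in> P" using P(2) that(1) P.a_closed by blast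
    moreover have "(a \<ominus> b) \<oplus> b = a" using that PR[OF that(1)] by algebra
    ultimately show ?thesis by simp
  qed
  obtain n where "fac (A F) n (\<pi> F r)" using fA r PR unfolding factorial_in_def by blast
  moreover have "\<exists>p\<in>prime_reps (A F). pull F p \<subseteq> P \<and> dvd_in (A F) p b"
    if "fac (A F) n b" "r \<in> P" "b = \<pi> F r" for n b r
    using that
  proof (induction arbitrary: r rule: fac.induct)
    case (unit u)
    obtain v where "v \<in> A F" "u * v = 1" using unit(1) unfolding unit_in_def by blast
    then obtain s where s: "s \<in> carrier R" "\<pi> F r * \<pi> F s = 1" using unit(3) by blast
    have "\<pi> F \<one> = \<pi> F (r \<otimes> s)" using s PR[OF unit(2)] \<pi>_mult[OF F] \<pi>_one[OF F] by simp
    then have "\<one> \<in> P" using cong[of "r \<otimes> s" \<one>] P.I_r_closed[OF unit(2) s(1)] by simp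
    then show ?case using one_not_in_prime[OF P(1)] by blast
  next
    case (prime p n b)
    note S = SA
    have b: "b \<in> A F" using fac_in[OF S prime(2)] by blast
    obtain x where x: "x \<in> carrier R" "p = \<pi> F x" using prime_inD(1)[OF prime(1)] by blast
    obtain y where y: "y \<in> carrier R" "b = \<pi> F y" using b by blast
    have "x \<otimes> y \<in> P" by (rule cong[OF prime(4)]) (use x y prime(5) \<pi>_mult[OF F] in simp_all)
    then have "x \<in> P \<or> y \<in> P" using P.I_prime x(1) y(1) by blast
    then show ?case
    proof
      assume "y \<in> P"
      then obtain q where q: "q \<in> prime_reps (A F)" "pull F q \<subseteq> P" "dvd_in (A F) q b" using prime(3)[OF _ y(2)] by blast
      then show ?thesis using dvd_in_mult2[OF S q(3) prime_inD(1)[OF prime(1)]] by blast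
    next
      assume xP: "x \<in> P"
      let ?q = "prime_rep (A F) p"
      note q = prime_rep[OF S prime(1)]
      have "pull F ?q \<subseteq> P"
      proof
        fix z assume "z \<in> pull F ?q"
        then have z: "z \<in> carrier R" "dvd_in (A F) ?q (\<pi> F z)" unfolding pull_def by auto
        obtain c where c: "c \<in> A F" "\<pi> F z = p * c" using dvd_in_trans[OF S q(2) z(2)] unfolding dvd_in_def by blast
        then obtain w where w: "w \<in> carrier R" "c = \<pi> F w" by blast
        show "z \<in> P"
          by (rule cong[OF P.I_r_closed[OF xP w(1)] z(1)]) (use c w x \<pi>_mult[OF F] in simp)
      qed
      then show ?thesis using prime_rep_in[OF prime(1)] dvd_in_mult[OF S q(3) b] by blast
    qed
  qed
  ultimately show ?thesis using r(1) by blast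
qed

lemma Fract_fractions: "\<lbrakk>gen F \<subseteq> P; m \<in> nonvan P\<rbrakk> \<Longrightarrow> Fract (\<pi> F (fst m)) (\<pi> F (snd m)) \<in> fractions (A F)"
proof -
  assume a: "gen F \<subseteq> P" "m \<in> nonvan P"
  then have "fst m \<in> carrier R - P" "snd m \<in> carrier R - P" by (auto simp: nonvan_def)
  then have "\<pi> F (fst m) \<noteq> 0" "\<pi> F (snd m) \<noteq> 0" "\<pi> F (fst m) \<in> A F" "\<pi> F (snd m) \<in> A F"
    using \<pi>_nonzero[OF F a(1)] by auto
  then show ?thesis unfolding fractions_def by blast
qed

lemma val_Fract_zero:
  assumes m: "m \<in> nonvan P" and p: "p \<in> prime_reps (A F)" "pull F p \<subseteq> P"
  shows "val (A F) p (Fract (\<pi> F (fst m)) (\<pi> F (snd m))) = 0"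
proof -
  have g: "gen F \<subseteq> P" using gen_pull[OF F] p(2) by blast
  have mm: "fst m \<in> carrier R - P" "snd m \<in> carrier R - P" using m by (auto simp: nonvan_def)
  have nz: "\<pi> F (fst m) \<noteq> 0" "\<pi> F (snd m) \<noteq> 0" using \<pi>_nonzero[OF F g] mm by auto
  have in_A: "\<pi> F (fst m) \<in> A F" "\<pi> F (snd m) \<in> A F" using mm by auto
  have "\<not> dvd_in (A F) p (\<pi> F (fst m))" "\<not> dvd_in (A F) p (\<pi> F (snd m))" using p(2) mm unfolding pull_def by blast+
  then show ?thesis
    using val_Fract[OF fA rep_prime[OF p(1)] in_A(1) nz(1) in_A(2) nz(2)]
      ord_zero_iff[OF fA rep_prime[OF p(1)] in_A(1) nz(1)] ord_zero_iff[OF fA rep_prime[OF p(1)] in_A(2) nz(2)] by simp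
qed

lemma value_hom:
  "etale_hom X (face_stalk {F}) (face_sec {F}) (const_stalk F) (const_sec F) (\<lambda>_ u. u F)"
proof (rule eval_hom; unfold topspace_zariski)
  fix P assume P: "P \<in> Spec R"
  have v: "face_eval {F} P m F = const_eval F P (Fract (\<pi> F (fst m)) (\<pi> F (snd m)))" for m and P by (simp add: face_eval_def const_eval_def)
  have c1: "const_eval F P 1 = 1" for P by (simp add: const_eval_def)
  show "(\<lambda>u. u F) \<in> hom (face_stalk {F} P) (const_stalk F P)"
  proof (rule homI)
    fix u assume "u \<in> carrier (face_stalk {F} P)"
    then obtain m where m: "u = face_eval {F} P m" "m \<in> nonvan P" unfolding face_carrier by blast
    show "u F \<in> carrier (const_stalk F P)"
    proof (cases "gen F \<subseteq> P")
      case True then show ?thesis unfolding m(1) v const_stalk_def using Fract_fractions[OF True m(2)] by simp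
    next
      case False
      then have "u F = const_eval F P 1" unfolding m(1) by (simp add: face_eval_def const_eval_def)
      then show ?thesis unfolding const_stalk_def using fractions_facts(1)[OF SA] by simp
    qed
  qed (simp add: face_stalk_def const_stalk_def)
  fix m assume m: "m \<in> nonvan P"
  show "\<exists>W n. openin X W \<and> P \<in> W \<and> (\<forall>y\<in>W. m \<in> nonvan y \<longrightarrow> n \<in> fractions (A F) \<and> face_eval {F} y m F = const_eval F y n)"
  proof (cases "gen F \<subseteq> P")
    case True
    show ?thesis
      by (rule exI[of _ "Spec R"], rule exI[of _ "Fract (\<pi> F (fst m)) (\<pi> F (snd m))"])
        (use P v Fract_fractions[OF True m] openin_topspace[of X] in \<open>simp add: topspace_zariski\<close>)
  next
    case False
    obtain W where W: "openin X W" "P \<in> W" "\<forall>Q\<in>W. \<forall>J\<in>{gen F}. \<not> J \<subseteq> Q"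
      using avoid_nbhd[OF P, of "{gen F}"] gen_ideal[OF F] False by auto
    then show ?thesis using fractions_facts(1)[OF SA]
      by (intro exI[of _ W] exI[of _ 1]) (simp add: face_eval_def const_eval_def)
  qed
qed

lemma div_map_eval:
  assumes "g \<in> fractions (A F)"
  defines "d \<equiv> (\<lambda>p. if p \<in> prime_reps (A F) then val (A F) p g else 0)"
  shows "d \<in> divisors F" "div_map F P (const_eval F P g) = div_eval F P d"
proof -
  have "{p. d p \<noteq> 0} = {p \<in> prime_reps (A F). val (A F) p g \<noteq> 0}" by (auto simp: d_def)
  then show "d \<in> divisors F" using finite_val[OF fA assms(1)] by (auto simp: divisors_def)
  have "gen F \<subseteq> P" if "pull F p \<subseteq> P" for p using gen_pull[OF F] that by blast
  then show "div_map F P (const_eval F P g) = div_eval F P d"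
    by (auto simp: div_map_def div_eval_def d_def const_eval_def fun_eq_iff)
qed

lemma div_hom:
  "etale_hom X (const_stalk F) (const_sec F) (div_stalk F) (div_sec F) (div_map F)"
proof (rule eval_hom; unfold topspace_zariski)
  fix P assume P: "P \<in> Spec R"
  show "div_map F P \<in> hom (const_stalk F P) (div_stalk F P)"
  proof (rule homI)
    fix x assume "x \<in> carrier (const_stalk F P)"
    then obtain g where g: "x = const_eval F P g" "g \<in> fractions (A F)" by (auto simp: const_stalk_def)
    show "div_map F P x \<in> carrier (div_stalk F P)"
      unfolding g(1) div_map_eval(2)[OF g(2)] div_stalk_def using div_map_eval(1)[OF g(2)] by simp
    fix y assume "y \<in> carrier (const_stalk F P)"
    then obtain h where h: "y = const_eval F P h" "h \<in> fractions (A F)" by (auto simp: const_stalk_def)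
    have xy: "x \<in> fractions (A F)" "y \<in> fractions (A F)" using g h const_eval_in by auto
    show "div_map F P (x \<otimes>\<^bsub>const_stalk F P\<^esub> y) = div_map F P x \<otimes>\<^bsub>div_stalk F P\<^esub> div_map F P y"
      using val_mult[OF fA rep_prime xy] by (auto simp: const_stalk_def div_stalk_def div_map_def fun_eq_iff)
  qed
  fix g assume g: "g \<in> fractions (A F)"
  show "\<exists>W n. openin X W \<and> P \<in> W \<and> (\<forall>y\<in>W. g \<in> fractions (A F) \<longrightarrow> n \<in> divisors F \<and> div_map F y (const_eval F y g) = div_eval F y n)"
    by (rule exI[of _ "Spec R"], rule exI[of _ "\<lambda>p. if p \<in> prime_reps (A F) then val (A F) p g else 0"])
      (use P div_map_eval[OF g] openin_topspace[of X] in \<open>simp add: topspace_zariski\<close>)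
qed

lemma div_surj:
  assumes "d \<in> divisors F"
  shows "\<exists>g\<in>fractions (A F). \<forall>P. div_map F P (const_eval F P g) = div_eval F P d"
proof -
  have d: "finite {p. d p \<noteq> 0}" "{p. d p \<noteq> 0} \<subseteq> prime_reps (A F)" using assms by (auto simp: divisors_def)
  obtain g where g: "g \<in> fractions (A F)" "\<forall>p\<in>prime_reps (A F). val (A F) p g = (if p \<in> {p. d p \<noteq> 0} then d p else 0)"
    using val_surj[OF fA d, of d] by blast
  have "(\<lambda>p. if p \<in> prime_reps (A F) then val (A F) p g else 0) = d" using g(2) d(2) by (auto simp: fun_eq_iff)
  then show ?thesis using div_map_eval(2)[OF g(1)] g(1) by (intro bexI[of _ g]) auto
qed

text \<open>The exact sequence of units, rational functions and divisors. Its exactness in the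
  middle is unique factorization: a function without divisor through \<open>P\<close> is a quotient
  of elements outside \<open>P\<close>.\<close>

lemma acyclic_face: "acyclic_etale X (face_stalk {F}) (face_sec {F})"
  unfolding acyclic_etale_def
proof (rule kernel_acyclic[where p="\<lambda>_ u. u F" and a="div_map F" and SG="const_stalk F" and LG="const_sec F"
      and SK="div_stalk F" and LK="div_sec F"])
  have F1: "{F} \<subseteq> \<Delta>" using F by simp
  interpret G: eval_sheaf X "const_stalk F" "\<lambda>_. fractions (A F)" "const_eval F" "\<lambda>g h. g * inverse h" 1
    by (rule const_eval_sheaf)
  interpret K: eval_sheaf X "div_stalk F" "\<lambda>_. divisors F" "div_eval F" "\<lambda>d e p. d p - e p" "\<lambda>_. 0"
    by (rule div_eval_sheaf)
  show "etale_presheaf X (face_stalk {F}) (face_sec {F}) (section_presheaf (face_stalk {F}) (face_sec {F}))"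
    by (rule etale.etale_section_presheaf[OF face_etale[OF F1]])
  show "etale X (const_stalk F) (const_sec F)" "etale X (div_stalk F) (div_sec F)" by (rule G.etale, rule K.etale)
  show "acyclic_etale X (const_stalk F) (const_sec F)"
    by (rule etale.flasque_acyclic[OF G.etale G.global_flasque]) (rule const_global)
  show "acyclic_etale X (div_stalk F) (div_sec F)"
    by (rule etale.flasque_acyclic[OF K.etale K.global_flasque]) (rule div_global)
  show "etale_hom X (face_stalk {F}) (face_sec {F}) (const_stalk F) (const_sec F) (\<lambda>_ u. u F)" by (rule value_hom)
  show "etale_hom X (const_stalk F) (const_sec F) (div_stalk F) (div_sec F) (div_map F)" by (rule div_hom)
  show "\<exists>g. \<forall>P\<in>topspace X. const_sec F P g \<and> div_map F P (g P) = h P"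
    if h: "\<And>P. P \<in> topspace X \<Longrightarrow> div_sec F P h" for h
  proof -
    obtain d where d: "\<forall>P\<in>topspace X. d \<in> divisors F" "\<forall>P\<in>topspace X. h P = div_eval F P d"
      using div_global[OF openin_topspace h] by blast
    show ?thesis
    proof (cases "topspace X = {}")
      case False
      then have "d \<in> divisors F" using d(1) by blast
      then obtain g where g: "g \<in> fractions (A F)" "\<forall>P. div_map F P (const_eval F P g) = div_eval F P d" using div_surj by blast
      have "const_sec F P (\<lambda>P. const_eval F P g)" if "P \<in> topspace X" for P
        unfolding eval_section_def using that g(1) by (intro exI[of _ "topspace X"] exI[of _ g]) simp
      then show ?thesis using g(2) d(2) by (intro exI[of _ "\<lambda>P. const_eval F P g"]) simp
    qed auto
  qed
  fix P assume "P \<in> topspace X"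
  then have P: "P \<in> Spec R" unfolding topspace_zariski .
  show "div_map F P (u F) = \<one>\<^bsub>div_stalk F P\<^esub>" if u: "u \<in> carrier (face_stalk {F} P)" for u
  proof -
    obtain m where m: "u = face_eval {F} P m" "m \<in> nonvan P" using u unfolding face_carrier by blast
    have "gen F \<subseteq> P" if "pull F p \<subseteq> P" for p using gen_pull[OF F] that by blast
    then have "div_map F P (u F) = (\<lambda>_. 0)"
      unfolding m(1) using val_Fract_zero[OF m(2)] by (auto simp: div_map_def face_eval_def fun_eq_iff)
    then show ?thesis by (simp add: div_stalk_def)
  qed
  show "u = \<one>\<^bsub>face_stalk {F} P\<^esub>" if "u \<in> carrier (face_stalk {F} P)" "u F = \<one>\<^bsub>const_stalk F P\<^esub>" for u
    using that unfolding face_carrier by (auto simp: face_stalk_def const_stalk_def face_eval_def fun_eq_iff)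
  show "\<exists>r\<in>carrier (face_stalk {F} P). r F = s"
    if s: "s \<in> carrier (const_stalk F P)" "div_map F P s = \<one>\<^bsub>div_stalk F P\<^esub>" for s
  proof (cases "gen F \<subseteq> P")
    case True
    have sf: "s \<in> fractions (A F)" using s(1) const_eval_in by (auto simp: const_stalk_def)
    let ?Q = "{p \<in> prime_reps (A F). pull F p \<subseteq> P}"
    have "val (A F) p s = 0" if "p \<in> ?Q" for p
      using fun_cong[OF s(2), of p] that by (auto simp: div_map_def div_stalk_def)
    then obtain b t where bt: "b \<in> A F" "t \<in> A F" "b \<noteq> 0" "t \<noteq> 0" "s = Fract b t"
        "\<forall>p\<in>?Q. \<not> dvd_in (A F) p b \<and> \<not> dvd_in (A F) p t"
      using val_zero[OF fA sf, of ?Q] by blast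
    obtain x y where xy: "x \<in> carrier R" "b = \<pi> F x" "y \<in> carrier R" "t = \<pi> F y" using bt(1,2) by blast
    \<comment> \<open>An element of \<open>P\<close> with nonzero image would have a prime factor
      through \<open>P\<close>, which \<open>b\<close> and \<open>t\<close> lack.\<close>
    have "x \<notin> P" "y \<notin> P" using prime_element_in[OF P True] bt(3,4,6) xy by blast+
    then have m: "(x, y) \<in> nonvan P" using xy by (simp add: nonvan_def)
    have "face_eval {F} P (x, y) F = s" unfolding bt(5) xy using True by (simp add: face_eval_def)
    then show ?thesis unfolding face_carrier using m by blast
  next
    case False
    then have "s = 1" using s(1) by (auto simp: const_stalk_def const_eval_def)
    moreover have "(\<one>, \<one>) \<in> nonvan P" using one_not_in_prime[OF P] by (simp add: nonvan_def)
    moreover have "face_eval {F} P (\<one>, \<one>) F = 1" using False by (simp add: face_eval_def)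
    ultimately show ?thesis unfolding face_carrier by blast
  qed
  show "\<exists>s\<in>carrier (const_stalk F P). div_map F P s = k" if k: "k \<in> carrier (div_stalk F P)" for k
  proof -
    obtain d where d: "k = div_eval F P d" "d \<in> divisors F" using k by (auto simp: div_stalk_def)
    obtain g where g: "g \<in> fractions (A F)" "\<forall>P. div_map F P (const_eval F P g) = div_eval F P d" using div_surj[OF d(2)] by blast
    show ?thesis using g d(1) by (intro bexI[of _ "const_eval F P g"]) (simp_all add: const_stalk_def)
  qed
qed

text \<open>Tested at the generic points \<open>pull F p\<close>, the function has valuation zero at
  every prime, so numerator and denominator can be chosen without prime factors, that is, as
  units.\<close>

lemma global_unit:
  assumes u: "\<And>P. \<lbrakk>P \<in> Spec R; gen F \<subseteq> P\<rbrakk> \<Longrightarrow> \<exists>m\<in>nonvan P. u = Fract (\<pi> F (fst m)) (\<pi> F (snd m))"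
  shows "\<exists>r\<in>carrier R. unit_in (A F) (\<pi> F r) \<and> u = Fract (\<pi> F r) 1"
proof -
  have uf: "u \<in> fractions (A F)" using u[OF gen_Spec[OF F] subset_refl] Fract_fractions by blast
  have "val (A F) p u = 0" if p: "p \<in> prime_reps (A F)" for p
    using u[OF rep_pull[OF p] gen_pull[OF F]] val_Fract_zero[OF _ p subset_refl] by blast
  then obtain b t where bt: "b \<in> A F" "t \<in> A F" "b \<noteq> 0" "t \<noteq> 0" "u = Fract b t"
      "\<forall>p\<in>prime_reps (A F). \<not> dvd_in (A F) p b \<and> \<not> dvd_in (A F) p t"
    using val_zero[OF fA uf subset_refl] by blast
  have ub: "unit_in (A F) b" and ut: "unit_in (A F) t" using no_prime_unit[OF fA] bt by blast+
  obtain v where v: "v \<in> A F" "t * v = 1" using ut unfolding unit_in_def by blast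
  then have uv: "unit_in (A F) v" unfolding unit_in_def using bt(2) by (metis mult.commute)
  have "unit_in (A F) (b * v)" by (rule unit_in_mult[OF SA ub uv])
  moreover have "u = Fract (b * v) 1" unfolding bt(5) using bt(4) v(2) by (simp add: eq_fract ac_simps)
  moreover obtain r where "r \<in> carrier R" "b * v = \<pi> F r" using calculation(1) unfolding unit_in_def by blast
  ultimately show ?thesis by auto
qed

end

section \<open>Adding a face\<close>

text \<open>Locally, data on the simplex and on \<Gamma> that agree on the boundary are put over a
  common denominator and glued by extending the difference of the numerators from \<open>F\<close>.
  Globally, a unit on the boundary is constant on each face, and the constants agree because all
  subspaces share the origin.\<close>

lemma add_face:
  assumes \<Gamma>: "\<Gamma> \<subseteq> \<Delta>" "\<And>G H. \<lbrakk>G \<in> \<Gamma>; H \<subseteq> G\<rbrakk> \<Longrightarrow> H \<in> \<Gamma>" and F: "F \<in> \<Delta>" "F \<notin> \<Gamma>" and bd: "\<And>G. G \<subset> F \<Longrightarrow> G \<in> \<Gamma>"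
  defines "B \<equiv> Pow F - {F}"
  shows "mv_square X (face_stalk (insert F \<Gamma>)) (face_sec (insert F \<Gamma>)) (face_stalk (Pow F)) (face_sec (Pow F))
     (face_stalk \<Gamma>) (face_sec \<Gamma>) (face_stalk B) (face_sec B)
     (\<lambda>_. proj (Pow F)) (\<lambda>_. proj \<Gamma>) (\<lambda>_. proj B) (\<lambda>_. proj B)"
proof (intro mv_square.intro mv_square_axioms.intro; (unfold topspace_zariski)?)
  have sub: "insert F \<Gamma> \<subseteq> \<Delta>" "Pow F \<subseteq> \<Delta>" "B \<subseteq> \<Delta>" using \<Gamma>(1) F(1) down[OF F(1)] unfolding B_def by auto
  have inc: "Pow F \<subseteq> insert F \<Gamma>" "\<Gamma> \<subseteq> insert F \<Gamma>" "B \<subseteq> Pow F" "B \<subseteq> \<Gamma>" using bd unfolding B_def by (auto simp: psubset_eq)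
  have BI: "E \<in> B" if "E \<subset> F" for E using that unfolding B_def by auto
  show "etale X (face_stalk (insert F \<Gamma>)) (face_sec (insert F \<Gamma>))" "etale X (face_stalk (Pow F)) (face_sec (Pow F))"
    "etale X (face_stalk \<Gamma>) (face_sec \<Gamma>)" "etale X (face_stalk B) (face_sec B)"
    using face_etale sub \<Gamma>(1) by blast+
  show "etale_hom X (face_stalk (insert F \<Gamma>)) (face_sec (insert F \<Gamma>)) (face_stalk (Pow F)) (face_sec (Pow F)) (\<lambda>_. proj (Pow F))"
    "etale_hom X (face_stalk (insert F \<Gamma>)) (face_sec (insert F \<Gamma>)) (face_stalk \<Gamma>) (face_sec \<Gamma>) (\<lambda>_. proj \<Gamma>)"
    "etale_hom X (face_stalk (Pow F)) (face_sec (Pow F)) (face_stalk B) (face_sec B) (\<lambda>_. proj B)"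
    "etale_hom X (face_stalk \<Gamma>) (face_sec \<Gamma>) (face_stalk B) (face_sec B) (\<lambda>_. proj B)"
    using proj_hom sub inc \<Gamma>(1) by blast+
  show "\<exists>s\<in>carrier (face_stalk (Pow F) P). proj B s = k" if "k \<in> carrier (face_stalk B P)" for P k
    by (rule proj_surj[OF inc(3) that])
  show "proj B (proj (Pow F) s) = proj B (proj \<Gamma> s)" for s
    using inc by (auto simp: proj_def fun_eq_iff)
  {
    fix P s assume s: "s \<in> carrier (face_stalk (insert F \<Gamma>) P)"
      and 1: "proj (Pow F) s = \<one>\<^bsub>face_stalk (Pow F) P\<^esub>" "proj \<Gamma> s = \<one>\<^bsub>face_stalk \<Gamma> P\<^esub>"
    obtain m where m: "s = face_eval (insert F \<Gamma>) P m" using s unfolding face_carrier by blast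
    have "s G = 1" for G
    proof (cases "G \<in> insert F \<Gamma>")
      case True
      then show ?thesis using fun_cong[OF 1(1), of G] fun_cong[OF 1(2), of G] by (auto simp: proj_def face_stalk_def)
    next
      case False then show ?thesis unfolding m by (simp add: face_eval_def)
    qed
    then show "s = \<one>\<^bsub>face_stalk (insert F \<Gamma>) P\<^esub>" by (auto simp: face_stalk_def)
  }
  {
    fix P s t assume P: "P \<in> Spec R" and s: "s \<in> carrier (face_stalk (Pow F) P)" and t: "t \<in> carrier (face_stalk \<Gamma> P)"
      and eq: "proj B s = proj B t"
    interpret P: primeideal P R using P by (simp add: Spec_def)
    obtain a x where a: "s = face_eval (Pow F) P (a, x)" "(a, x) \<in> nonvan P" using s unfolding face_carrier by auto
    obtain b y where b: "t = face_eval \<Gamma> P (b, y)" "(b, y) \<in> nonvan P" using t unfolding face_carrier by auto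
    have nv: "a \<in> carrier R - P" "x \<in> carrier R - P" "b \<in> carrier R - P" "y \<in> carrier R - P" using a(2) b(2) by (auto simp: nonvan_def)
    show "\<exists>r\<in>carrier (face_stalk (insert F \<Gamma>) P). proj (Pow F) r = s \<and> proj \<Gamma> r = t"
    proof (cases "gen F \<subseteq> P")
      case False
      \<comment> \<open>Off the subspace of \<open>F\<close> all subfaces of \<open>F\<close> are
        missed too, so \<open>s\<close> is trivial and \<open>t\<close> alone gives the
        lift.\<close>
      have n: "\<not> gen E \<subseteq> P" if "E \<subseteq> F" for E using gen_mono[OF F(1) that] False by blast
      show ?thesis
      proof (intro bexI conjI)
        show "face_eval (insert F \<Gamma>) P (b, y) \<in> carrier (face_stalk (insert F \<Gamma>) P)" unfolding face_carrier using b(2) by blast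
        show "proj (Pow F) (face_eval (insert F \<Gamma>) P (b, y)) = s"
          unfolding proj_eval[OF inc(1)] a(1) using n by (auto simp: face_eval_def fun_eq_iff)
        show "proj \<Gamma> (face_eval (insert F \<Gamma>) P (b, y)) = t" unfolding proj_eval[OF inc(2)] b(1) ..
      qed
    next
      case True
      have fin: "finite (gen ` {G \<in> \<Delta>. \<not> gen G \<subseteq> P})" using finite_faces by simp
      \<comment> \<open>\<open>w\<close> is a unit at \<open>P\<close> that vanishes on all faces
        missing \<open>P\<close>; multiplying by it turns equalities on the faces through
        \<open>P\<close> into equalities on all relevant faces.\<close>
      obtain w where w: "w \<in> carrier R - P" "\<forall>J\<in>gen ` {G \<in> \<Delta>. \<not> gen G \<subseteq> P}. w \<in> J"
        using prime_avoid[OF P fin] gen_ideal by blast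
      have w0: "\<pi> G w = 0" if "G \<in> \<Delta>" "\<not> gen G \<subseteq> P" for G using w(2) that gen_iff by blast
      \<comment> \<open>Both fractions over the common denominator \<open>w x y\<close>; the
        numerators now agree on every proper subface of \<open>F\<close>.\<close>
      let ?wa = "w \<otimes> (a \<otimes> y)" and ?wb = "w \<otimes> (b \<otimes> x)" and ?d = "w \<otimes> (x \<otimes> y)"
      have cl: "?wa \<in> carrier R - P" "?wb \<in> carrier R - P" "?d \<in> carrier R - P"
        using not_in_prime_mult[OF P] nv w(1) by blast+
      have eqB: "\<pi> E ?wa = \<pi> E ?wb" if E: "E \<subset> F" for E
      proof -
        have E\<Delta>: "E \<in> \<Delta>" using BI[OF E] sub(3) by blast
        show ?thesis
        proof (cases "gen E \<subseteq> P")
          case True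
          have "face_eval B P (a, x) E = face_eval B P (b, y) E"
            using fun_cong[OF eq, of E] unfolding a(1) b(1) proj_eval[OF inc(3)] proj_eval[OF inc(4)] .
          then have "Fract (\<pi> E a) (\<pi> E x) = Fract (\<pi> E b) (\<pi> E y)" using True BI[OF E] by (simp add: face_eval_def)
          then have "\<pi> E a * \<pi> E y = \<pi> E b * \<pi> E x"
            using \<pi>_nonzero[OF E\<Delta> True nv(2)] \<pi>_nonzero[OF E\<Delta> True nv(4)] by (simp add: eq_fract)
          then show ?thesis using nv w(1) by (simp add: \<pi>_mult[OF E\<Delta>])
        next
          case False
          then show ?thesis using nv w(1) w0[OF E\<Delta>] by (simp add: \<pi>_mult[OF E\<Delta>])
        qed
      qed
      define z where "z = ?wa \<ominus> ?wb"
      have z: "z \<in> carrier R" unfolding z_def using cl by simp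
      have z0: "\<pi> E z = 0" if E: "E \<subset> F" for E
        using eqB[OF E] \<pi>_diff[of E ?wa ?wb] BI[OF E] sub(3) cl unfolding z_def by auto
      \<comment> \<open>Extends the difference \<open>z\<close> from \<open>F\<close> to the whole
        ring. A face of \<Gamma> meets \<open>F\<close> in a proper subface, where \<open>z\<close>
        vanishes, so \<open>e\<close> vanishes on all of \<Gamma>.\<close>
      obtain e where e: "e \<in> carrier R" "\<forall>G\<in>\<Delta>. \<pi> G e = \<pi> (G \<inter> F) z" using \<pi>_lift[OF F(1) z] by blast
      \<comment> \<open>The glued numerator: it equals \<open>?wa\<close> on \<open>F\<close> and
        \<open>?wb\<close> on \<Gamma>.\<close>
      let ?n = "?wb \<oplus> e"
      have nR: "?n \<in> carrier R" using cl e by simp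
      have nF: "\<pi> F ?n = \<pi> F ?wa"
        using \<pi>_add[OF F(1), of ?wb e] \<pi>_diff[OF F(1), of ?wa ?wb] cl e F(1) unfolding z_def by simp
      have nG: "\<pi> G ?n = \<pi> G ?wb" if G: "G \<in> \<Gamma>" for G
      proof -
        have "G \<inter> F \<subset> F" using \<Gamma>(2)[OF G, of F] F(2) by blast
        then have "\<pi> (G \<inter> F) z = 0" by (rule z0)
        then have "\<pi> G e = 0" using e(2) G \<Gamma>(1) by auto
        then show ?thesis using \<pi>_add[of G ?wb e] G \<Gamma>(1) cl e(1) by auto
      qed
      have nE: "\<pi> E ?n = \<pi> E ?wa" if E: "E \<subseteq> F" for E
      proof (cases "E = F")
        case False
        then have "E \<subset> F" using E by blast
        then show ?thesis using nG[of E] eqB[of E] bd by simp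
      qed (simp add: nF)
      \<comment> \<open>\<open>?n\<close> and \<open>?wa\<close> differ by an element of
        \<open>gen F\<close>, which is contained in \<open>P\<close>.\<close>
      have "?n \<notin> P"
      proof
        assume n: "?n \<in> P"
        have "?wa \<ominus> ?n \<in> gen F" unfolding gen_iff[OF F(1)] using nF \<pi>_diff[OF F(1), of ?wa ?n] cl nR by simp
        then have "(?wa \<ominus> ?n) \<oplus> ?n \<in> P" using True n P.a_closed by blast
        moreover have "(?wa \<ominus> ?n) \<oplus> ?n = ?wa" using cl nR by (simp add: a_minus_def a_assoc l_neg)
        ultimately show False using cl by simp
      qed
      then have nv': "(?n, ?d) \<in> nonvan P" using nR cl by (simp add: nonvan_def)
      have quot: "Fract (\<pi> E w * (\<alpha> * \<pi> E \<gamma>)) (\<pi> E w * (\<beta> * \<pi> E \<gamma>)) = Fract \<alpha> \<beta>"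
        if "E \<in> \<Delta>" "gen E \<subseteq> P" "\<gamma> \<in> carrier R - P" for E \<alpha> \<beta> \<gamma>
        using \<pi>_nonzero[OF that] \<pi>_nonzero[OF that(1,2) w(1)] mult_fract_cancel[of "\<pi> E w * \<pi> E \<gamma>" \<alpha> \<beta>] by (simp add: ac_simps)
      show ?thesis
      proof (intro bexI conjI)
        show "face_eval (insert F \<Gamma>) P (?n, ?d) \<in> carrier (face_stalk (insert F \<Gamma>) P)" unfolding face_carrier using nv' by blast
        show "proj (Pow F) (face_eval (insert F \<Gamma>) P (?n, ?d)) = s"
          unfolding proj_eval[OF inc(1)] a(1)
        proof
          fix E
          have "Fract (\<pi> E ?n) (\<pi> E ?d) = Fract (\<pi> E a) (\<pi> E x)" if E: "E \<subseteq> F" "gen E \<subseteq> P"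
            unfolding nE[OF E(1)] using quot[OF down[OF F(1) E(1)] E(2) nv(4)] nv w(1) \<pi>_mult[OF down[OF F(1) E(1)]] by simp
          then show "face_eval (Pow F) P (?n, ?d) E = face_eval (Pow F) P (a, x) E" by (simp add: face_eval_def)
        qed
        show "proj \<Gamma> (face_eval (insert F \<Gamma>) P (?n, ?d)) = t"
          unfolding proj_eval[OF inc(2)] b(1)
        proof
          fix E
          have "Fract (\<pi> E ?n) (\<pi> E ?d) = Fract (\<pi> E b) (\<pi> E y)" if E: "E \<in> \<Gamma>" "gen E \<subseteq> P"
          proof -
            have E\<Delta>: "E \<in> \<Delta>" using E(1) \<Gamma>(1) by blast
            show ?thesis unfolding nG[OF E(1)] using quot[OF E\<Delta> E(2) nv(2), of "\<pi> E b" "\<pi> E y"] nv w(1) \<pi>_mult[OF E\<Delta>] by (simp add: mult.commute)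
          qed
          then show "face_eval \<Gamma> P (?n, ?d) E = face_eval \<Gamma> P (b, y) E" by (simp add: face_eval_def)
        qed
      qed
    qed
  }
  {
    fix h assume h: "\<And>P. P \<in> Spec R \<Longrightarrow> face_sec B P h"
    have empty: "{} \<in> \<Delta>" using down[OF F(1)] by blast
    \<comment> \<open>Open sets are stable under generization, so one pair describes
      \<open>h\<close> at \<open>P\<close> and at the generic points of all faces through
      \<open>P\<close>.\<close>
    have loc: "\<exists>m\<in>nonvan P. h P = face_eval B P m \<and> (\<forall>E\<in>\<Delta>. gen E \<subseteq> P \<longrightarrow> h (gen E) = face_eval B (gen E) m)"
      if P: "P \<in> Spec R" for P
    proof -
      obtain W m where W: "openin X W" "P \<in> W" "\<forall>Q\<in>W. m \<in> nonvan Q \<and> h Q = face_eval B Q m"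
        using h[OF P] unfolding eval_section_def by (elim exE conjE)
      have "gen E \<in> W" if "E \<in> \<Delta>" "gen E \<subseteq> P" for E
        by (rule open_generization[OF W(1,2) gen_Spec[OF that(1)] that(2)])
      then show ?thesis using W(2,3) by (intro bexI[of _ m]) auto
    qed
    \<comment> \<open>The rational function that \<open>h\<close> induces on the subspace of
      \<open>E\<close>, read at its generic point.\<close>
    define v where "v E = h (gen E) E" for E
    have loc': "\<exists>m\<in>nonvan P. h P = face_eval B P m \<and> (\<forall>E\<in>B. gen E \<subseteq> P \<longrightarrow> v E = Fract (\<pi> E (fst m)) (\<pi> E (snd m)))"
      if P: "P \<in> Spec R" for P
    proof -
      obtain m where m: "m \<in> nonvan P" "h P = face_eval B P m" "\<forall>E\<in>\<Delta>. gen E \<subseteq> P \<longrightarrow> h (gen E) = face_eval B (gen E) m"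
        using loc[OF P] by blast
      have "v E = Fract (\<pi> E (fst m)) (\<pi> E (snd m))" if "E \<in> B" "gen E \<subseteq> P" for E
        using m(3) that sub(3) unfolding v_def by (auto simp: face_eval_def)
      then show ?thesis using m(1,2) by blast
    qed
    \<comment> \<open>It is a unit at every point of that subspace, hence a global unit and
      therefore a constant.\<close>
    have const: "\<exists>r\<in>carrier R. unit_in (A E) (\<pi> E r) \<and> v E = Fract (\<pi> E r) 1 \<and> \<pi> E r = \<pi> {} r" if E: "E \<in> B" for E
    proof -
      have E\<Delta>: "E \<in> \<Delta>" using E sub(3) by blast
      obtain r where r: "r \<in> carrier R" "unit_in (A E) (\<pi> E r)" "v E = Fract (\<pi> E r) 1"
        using global_unit[OF E\<Delta>, of "v E"] loc' E by blast
      then show ?thesis using \<pi>_unit[OF E\<Delta> r(1,2)] by blast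
    qed
    have "\<exists>c. (\<forall>P\<in>Spec R. c \<in> carrier R - P) \<and> (\<forall>E\<in>B. v E = Fract (\<pi> E c) 1)"
    proof (cases "F = {}")
      \<comment> \<open>The empty face has no boundary, so any global unit will do; one is
        taken.\<close>
      case True
      then have "B = {}" unfolding B_def by auto
      then show ?thesis using one_not_in_prime by blast
    next
      case False
      then have B0: "{} \<in> B" unfolding B_def by auto
      obtain r0 where r0: "r0 \<in> carrier R" "unit_in (A {}) (\<pi> {} r0)" "v {} = Fract (\<pi> {} r0) 1" using const[OF B0] by blast
      \<comment> \<open>At the origin \<open>gen {}\<close>, which lies on every subspace, a single
        pair describes all \<open>v E\<close>; restricting it to the empty face compares the
        constants.\<close>
      have all: "v E = v {}" if E: "E \<in> B" for E
      proof -
        have E\<Delta>: "E \<in> \<Delta>" using E sub(3) by blast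
        obtain r where r: "r \<in> carrier R" "v E = Fract (\<pi> E r) 1" "\<pi> E r = \<pi> {} r" using const[OF E] by blast
        have g0: "gen E \<subseteq> gen {}" by (rule gen_mono[OF E\<Delta>]) simp
        obtain m where m: "m \<in> nonvan (gen {})" "\<forall>E\<in>B. gen E \<subseteq> gen {} \<longrightarrow> v E = Fract (\<pi> E (fst m)) (\<pi> E (snd m))"
          using loc'[OF gen_Spec[OF empty]] by blast
        have mR: "fst m \<in> carrier R - gen {}" "snd m \<in> carrier R - gen {}" using m(1) by (auto simp: nonvan_def)
        have "Fract (\<pi> E r) 1 = Fract (\<pi> E (fst m)) (\<pi> E (snd m))" using m(2) E g0 r(2) by auto
        then have "\<pi> E (r \<otimes> snd m) = \<pi> E (fst m)"
          using \<pi>_nonzero[OF E\<Delta> g0 mR(2)] \<pi>_mult[OF E\<Delta> r(1)] mR by (simp add: eq_fract)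
        then have "\<pi> {} (r \<otimes> snd m) = \<pi> {} (fst m)"
          by (rule eval_mono[OF E\<Delta>, rotated 3]) (use r(1) mR in auto)
        then have "Fract (\<pi> {} r) 1 = Fract (\<pi> {} (fst m)) (\<pi> {} (snd m))"
          using \<pi>_nonzero[OF empty subset_refl mR(2)] \<pi>_mult[OF empty r(1)] mR by (simp add: eq_fract)
        then show ?thesis using r(2,3) m(2) B0 by auto
      qed
      obtain q where q: "q \<in> carrier R" "\<pi> {} r0 * \<pi> {} q = 1" using r0(2) unfolding unit_in_def by blast
      \<comment> \<open>Extending from the empty face gives an element of \<open>R\<close> with the
        same constant value on every face; \<open>c'\<close> does this for the inverse, and
        \<open>\<pi>_inj\<close> yields \<open>c \<otimes> c' = \<one>\<close>.\<close>
      obtain c where c: "c \<in> carrier R" "\<forall>G\<in>\<Delta>. \<pi> G c = \<pi> {} r0" using \<pi>_lift[OF empty r0(1)] by auto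
      obtain c' where c': "c' \<in> carrier R" "\<forall>G\<in>\<Delta>. \<pi> G c' = \<pi> {} q" using \<pi>_lift[OF empty q(1)] by auto
      have "c \<otimes> c' \<ominus> \<one> = \<zero>"
        by (rule \<pi>_inj) (use c c' q(2) \<pi>_diff \<pi>_mult \<pi>_one in auto)
      moreover have "c \<otimes> c' = (c \<otimes> c' \<ominus> \<one>) \<oplus> \<one>" using c(1) c'(1) by (simp add: a_minus_def a_assoc l_neg)
      ultimately have cc: "c \<otimes> c' = \<one>" by simp
      have "c \<in> carrier R - P" if P: "P \<in> Spec R" for P
      proof -
        interpret P: primeideal P R using P by (simp add: Spec_def)
        have "c \<notin> P" using P.I_r_closed[of c c'] c'(1) cc one_not_in_prime[OF P] by auto
        then show ?thesis using c(1) by blast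
      qed
      moreover have "v E = Fract (\<pi> E c) 1" if "E \<in> B" for E using all[OF that] r0(3) c(2) that sub(3) by auto
      ultimately show ?thesis by blast
    qed
    then obtain c where c: "\<forall>P\<in>Spec R. c \<in> carrier R - P" "\<forall>E\<in>B. v E = Fract (\<pi> E c) 1" by blast
    have nv: "(c, \<one>) \<in> nonvan P" if "P \<in> Spec R" for P using c(1) that one_not_in_prime[OF that] by (simp add: nonvan_def)
    have hP: "h P = face_eval B P (c, \<one>)" if P: "P \<in> Spec R" for P
    proof
      fix E
      obtain m where m: "h P = face_eval B P m" "\<forall>E\<in>B. gen E \<subseteq> P \<longrightarrow> v E = Fract (\<pi> E (fst m)) (\<pi> E (snd m))"
        using loc'[OF P] by blast
      show "h P E = face_eval B P (c, \<one>) E"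
        unfolding m(1) using m(2) c(2) sub(3) \<pi>_one by (auto simp: face_eval_def)
    qed
    show "\<exists>g. \<forall>P\<in>Spec R. face_sec (Pow F) P g \<and> proj B (g P) = h P"
    proof (intro exI[of _ "\<lambda>P. face_eval (Pow F) P (c, \<one>)"] ballI conjI)
      fix P assume P: "P \<in> Spec R"
      show "face_sec (Pow F) P (\<lambda>P. face_eval (Pow F) P (c, \<one>))"
        unfolding eval_section_def using nv P openin_topspace[of X] unfolding topspace_zariski
        by (intro exI[of _ "Spec R"] exI[of _ "(c, \<one>)"]) auto
      show "proj B (face_eval (Pow F) P (c, \<one>)) = h P" unfolding proj_eval[OF inc(3)] hP[OF P] ..
    qed
  }
qed

text \<open>Induction on the number of faces. Maximality of the removed face keeps the rest a
  complex; the boundary of that face lies in the rest, so it is smaller as well.\<close>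

theorem acyclic_subcomplex:
  assumes "\<Gamma> \<subseteq> \<Delta>" "\<And>G H. \<lbrakk>G \<in> \<Gamma>; H \<subseteq> G\<rbrakk> \<Longrightarrow> H \<in> \<Gamma>"
  shows "acyclic_etale X (face_stalk \<Gamma>) (face_sec \<Gamma>)"
  using assms
proof (induction "card \<Gamma>" arbitrary: \<Gamma> rule: less_induct)
  case less
  have fin: "finite \<Gamma>" using less(2) finite_faces finite_subset by blast
  show ?case
  proof (cases "\<Gamma> = {}")
    case True then show ?thesis using acyclic_empty by simp
  next
    case False
    obtain F where F: "F \<in> \<Gamma>" "\<And>G. G \<in> \<Gamma> \<Longrightarrow> F \<subseteq> G \<Longrightarrow> G = F"
      using finite_has_maximal[OF fin False] by metis
    let ?\<Gamma> = "\<Gamma> - {F}" and ?B = "Pow F - {F}"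
    have F\<Delta>: "F \<in> \<Delta>" using F(1) less(2) by blast
    have lt: "card ?\<Gamma> < card \<Gamma>" using fin F(1) by (rule card_Diff1_less)
    have "?B \<subseteq> ?\<Gamma>" using less(3)[OF F(1)] by blast
    then have ltB: "card ?B < card \<Gamma>" using lt card_mono[of ?\<Gamma> ?B] fin by (meson finite_Diff le_less_trans)
    have down\<Gamma>: "H \<in> ?\<Gamma>" if "G \<in> ?\<Gamma>" "H \<subseteq> G" for G H using less(3)[of G H] F(2)[of G] that by auto
    have 1: "acyclic_etale X (face_stalk ?\<Gamma>) (face_sec ?\<Gamma>)" 
    proof (rule less(1)[OF lt])
      show "?\<Gamma> \<subseteq> \<Delta>" using less(2) by blast
    qed (rule down\<Gamma>)
    have 2: "acyclic_etale X (face_stalk ?B) (face_sec ?B)"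
    proof (rule less(1)[OF ltB])
      show "?B \<subseteq> \<Delta>" using down[OF F\<Delta>] by blast
      show "H \<in> ?B" if "G \<in> ?B" "H \<subseteq> G" for G H using that by auto
    qed
    have 3: "acyclic_etale X (face_stalk (Pow F)) (face_sec (Pow F))"
    proof (rule acyclic_cofinal[OF _ _ _ acyclic_face[OF F\<Delta>]])
      show "Pow F \<subseteq> \<Delta>" using down[OF F\<Delta>] by blast
    qed auto
    have "mv_square X (face_stalk (insert F ?\<Gamma>)) (face_sec (insert F ?\<Gamma>)) (face_stalk (Pow F)) (face_sec (Pow F))
     (face_stalk ?\<Gamma>) (face_sec ?\<Gamma>) (face_stalk ?B) (face_sec ?B)
     (\<lambda>_. proj (Pow F)) (\<lambda>_. proj ?\<Gamma>) (\<lambda>_. proj ?B) (\<lambda>_. proj ?B)"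
    proof (rule add_face)
      show "?\<Gamma> \<subseteq> \<Delta>" using less(2) by blast
      show "H \<in> ?\<Gamma>" if "G \<in> ?\<Gamma>" "H \<subseteq> G" for G H by (rule down\<Gamma>[OF that])
      show "G \<in> ?\<Gamma>" if "G \<subset> F" for G using that less(3)[OF F(1), of G] by auto
    qed (use F\<Delta> in auto)
    moreover have "insert F ?\<Gamma> = \<Gamma>" using F(1) by blast
    ultimately have "mv_square X (face_stalk \<Gamma>) (face_sec \<Gamma>) (face_stalk (Pow F)) (face_sec (Pow F))
     (face_stalk ?\<Gamma>) (face_sec ?\<Gamma>) (face_stalk ?B) (face_sec ?B)
     (\<lambda>_. proj (Pow F)) (\<lambda>_. proj ?\<Gamma>) (\<lambda>_. proj ?B) (\<lambda>_. proj ?B)" by simp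
    then show ?thesis unfolding acyclic_etale_def[of _ "face_stalk \<Gamma>"]
      by (rule mv_square.acyclic[OF _ 3 1 2 etale.etale_section_presheaf[OF face_etale[OF less(2)]]])
  qed
qed

end

section \<open>The sheaf of units\<close>

context prime_localization
begin

text \<open>If \<open>b/t\<close> inverts \<open>a/s\<close>, some element outside \<open>P\<close>
  annihilates \<open>ab - st\<close>, so \<open>ab - st\<close> lies in \<open>P\<close>; with
  \<open>a\<close> in \<open>P\<close> also \<open>st\<close> would lie there.\<close>

lemma fraction_Units:
  assumes a: "a \<in> carrier R" and s: "s \<in> carrier R - P"
  shows "fraction R P a s \<in> Units (localization R P) \<longleftrightarrow> a \<notin> P"
proof
  assume "fraction R P a s \<in> Units (localization R P)"
  then obtain y where y: "y \<in> carrier (localization R P)" "fraction R P a s \<otimes>\<^bsub>localization R P\<^esub> y = \<one>\<^bsub>localization R P\<^esub>"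
    unfolding Units_def by blast
  obtain b t where b: "y = fraction R P b t" "b \<in> carrier R" "t \<in> carrier R - P" using y(1) unfolding loc_carrier by blast
  have st: "s \<otimes> t \<in> carrier R - P" by (rule mult_S[OF s b(3)])
  have "fraction R P (a \<otimes> b) (s \<otimes> t) = fraction R P \<one> \<one>" using y(2) unfolding b(1) loc_mult[OF a s b(2,3)] loc_one .
  then obtain u where u: "u \<in> carrier R - P" "u \<otimes> (\<one> \<otimes> (a \<otimes> b) \<ominus> s \<otimes> t \<otimes> \<one>) = \<zero>"
    using frac_eq_iff[of "a \<otimes> b" "s \<otimes> t" \<one> \<one>] a b(2) st one_S by blast
  have d: "\<one> \<otimes> (a \<otimes> b) \<ominus> s \<otimes> t \<otimes> \<one> \<in> P"
    using I_prime[of u "\<one> \<otimes> (a \<otimes> b) \<ominus> s \<otimes> t \<otimes> \<one>"] u a b st additive_subgroup.zero_closed[OF ideal.axioms(1)[OF is_ideal]] by simp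
  show "a \<notin> P"
  proof
    assume "a \<in> P"
    then have "a \<otimes> b \<in> P" using b(2) I_r_closed by blast
    then have "(a \<otimes> b) \<ominus> (\<one> \<otimes> (a \<otimes> b) \<ominus> s \<otimes> t \<otimes> \<one>) \<in> P"
      using d a_inv_closed a_closed unfolding a_minus_def by blast
    moreover have "(a \<otimes> b) \<ominus> (\<one> \<otimes> (a \<otimes> b) \<ominus> s \<otimes> t \<otimes> \<one>) = s \<otimes> t"
    proof -
      have "a \<in> carrier R" "b \<in> carrier R" "s \<in> carrier R" "t \<in> carrier R" using a b s by auto
      then show ?thesis by algebra
    qed
    ultimately show False using st by simp
  qed
next
  assume "a \<notin> P"
  then have a': "a \<in> carrier R - P" using a by blast
  have s': "s \<in> carrier R" using s by blast
  have one: "fraction R P (a \<otimes> s) (s \<otimes> a) = \<one>\<^bsub>localization R P\<^esub>"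
    unfolding loc_one by (rule frac_eqI) (use a s' mult_S[OF s a'] one_S in \<open>auto simp: m_comm\<close>)
  have one': "fraction R P (s \<otimes> a) (a \<otimes> s) = \<one>\<^bsub>localization R P\<^esub>"
    unfolding loc_one by (rule frac_eqI) (use a s' mult_S[OF a' s] one_S in \<open>auto simp: m_comm\<close>)
  have "fraction R P a s \<in> carrier (localization R P)" "fraction R P s a \<in> carrier (localization R P)"
    unfolding loc_carrier using a s' a' s by blast+
  then show "fraction R P a s \<in> Units (localization R P)"
    unfolding Units_def using loc_mult[OF a s s' a'] loc_mult[OF s' a' a s] one one' by auto
qed

lemma Units_localization:
  "Units (localization R P) = {fraction R P a s | a s. a \<in> carrier R - P \<and> s \<in> carrier R - P}"
proof (intro equalityI subsetI)
  fix x assume x: "x \<in> Units (localization R P)"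
  then obtain a s where a: "x = fraction R P a s" "a \<in> carrier R" "s \<in> carrier R - P"
    unfolding Units_def loc_carrier by blast
  then show "x \<in> {fraction R P a s | a s. a \<in> carrier R - P \<and> s \<in> carrier R - P}" using fraction_Units[OF a(2,3)] x by blast
next
  fix x assume "x \<in> {fraction R P a s | a s. a \<in> carrier R - P \<and> s \<in> carrier R - P}"
  then obtain a s where "x = fraction R P a s" "a \<in> carrier R - P" "s \<in> carrier R - P" by blast
  then show "x \<in> Units (localization R P)" using fraction_Units[of a s] by blast
qed

end

context cring
begin

definition unit_eval :: "'a set \<Rightarrow> 'a \<times> 'a \<Rightarrow> ('a \<times> 'a) set" where
  "unit_eval P m = fraction R P (fst m) (snd m)"

abbreviation "unit_stalk P \<equiv> units_of (localization R P)"

lemma Spec_prime_localization: "P \<in> Spec R \<Longrightarrow> prime_localization P R"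
  by (simp add: Spec_def prime_localization_def)

lemma unit_stalk_carrier: "P \<in> Spec R \<Longrightarrow> carrier (unit_stalk P) = unit_eval P ` nonvan P"
proof -
  assume P: "P \<in> Spec R"
  have "{fraction R P a s | a s. a \<in> B \<and> s \<in> B} = unit_eval P ` (B \<times> B)" for B
  proof (intro equalityI subsetI)
    fix x assume "x \<in> {fraction R P a s | a s. a \<in> B \<and> s \<in> B}"
    then obtain a s where "x = unit_eval P (a, s)" "(a, s) \<in> B \<times> B" by (auto simp: unit_eval_def)
    then show "x \<in> unit_eval P ` (B \<times> B)" by (rule image_eqI)
  next
    fix x assume "x \<in> unit_eval P ` (B \<times> B)"
    then obtain m where "x = unit_eval P m" "m \<in> B \<times> B" by (rule imageE)
    then show "x \<in> {fraction R P a s | a s. a \<in> B \<and> s \<in> B}"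
      unfolding unit_eval_def by (intro CollectI exI[of _ "fst m"] exI[of _ "snd m"]) auto
  qed
  then show ?thesis
    using prime_localization.Units_localization[OF Spec_prime_localization[OF P]]
    by (simp only: units_of_carrier nonvan_def)
qed

lemma unit_comm_group: "P \<in> Spec R \<Longrightarrow> comm_group (unit_stalk P)"
  using comm_monoid.units_comm_group[OF cring.axioms(2)[OF prime_localization.loc_cring[OF Spec_prime_localization]]] .

lemma unit_eval_mult:
  assumes "P \<in> Spec R" "m \<in> nonvan P" "n \<in> nonvan P"
  shows "unit_eval P m \<otimes>\<^bsub>localization R P\<^esub> unit_eval P n = unit_eval P (fst m \<otimes> fst n, snd m \<otimes> snd n)"
  using prime_localization.loc_mult[OF Spec_prime_localization[OF assms(1)]] assms(2,3)
  by (auto simp: unit_eval_def nonvan_def)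

lemma unit_eval_one: "P \<in> Spec R \<Longrightarrow> unit_eval P (\<one>, \<one>) = \<one>\<^bsub>localization R P\<^esub>"
  using prime_localization.loc_one[OF Spec_prime_localization] by (simp add: unit_eval_def)

lemma unit_eval_eq_iff:
  assumes P: "P \<in> Spec R" and m: "m \<in> nonvan P" and n: "n \<in> nonvan P"
  shows "unit_eval P m = unit_eval P n \<longleftrightarrow> (\<exists>u\<in>carrier R - P. u \<otimes> (snd n \<otimes> fst m \<ominus> snd m \<otimes> fst n) = \<zero>)"
  unfolding unit_eval_def
  by (rule prime_localization.frac_eq_iff[OF Spec_prime_localization[OF P]]) (use m n in \<open>auto simp: nonvan_def\<close>)

lemma unit_eval_inv:
  assumes P: "P \<in> Spec R" and m: "m \<in> nonvan P"
  shows "unit_eval P (snd m, fst m) \<otimes>\<^bsub>localization R P\<^esub> unit_eval P m = \<one>\<^bsub>localization R P\<^esub>" and "(snd m, fst m) \<in> nonvan P"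
proof -
  show m': "(snd m, fst m) \<in> nonvan P" using m by (auto simp: nonvan_def)
  have mm: "fst m \<in> carrier R - P" "snd m \<in> carrier R - P" using m by (auto simp: nonvan_def)
  have 1: "(snd m \<otimes> fst m, fst m \<otimes> snd m) \<in> nonvan P" "(\<one>, \<one>) \<in> nonvan P"
    using not_in_prime_mult[OF P] one_not_in_prime[OF P] mm by (auto simp: nonvan_def)
  have "\<one> \<otimes> (snd m \<otimes> fst m) \<ominus> (fst m \<otimes> snd m) \<otimes> \<one> = \<zero>" using mm by (simp add: m_comm a_minus_def r_neg)
  then have "unit_eval P (snd m \<otimes> fst m, fst m \<otimes> snd m) = unit_eval P (\<one>, \<one>)"
    unfolding unit_eval_eq_iff[OF P 1] using one_not_in_prime[OF P] by (intro bexI[of _ \<one>]) auto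
  then show "unit_eval P (snd m, fst m) \<otimes>\<^bsub>localization R P\<^esub> unit_eval P m = \<one>\<^bsub>localization R P\<^esub>"
    using unit_eval_mult[OF P m' m] unit_eval_one[OF P] by simp
qed

lemma unit_eval_sheaf:
  "eval_sheaf (zariski_topology R) unit_stalk nonvan unit_eval (\<lambda>m n. (fst m \<otimes> snd n, snd m \<otimes> fst n)) (\<one>, \<one>)"
proof (rule eval_sheaf.intro; unfold topspace_zariski)
  fix P assume P: "P \<in> Spec R"
  interpret g: comm_group "unit_stalk P" by (rule unit_comm_group[OF P])
  show "comm_group (unit_stalk P)" by (rule unit_comm_group[OF P])
  show carr: "carrier (unit_stalk P) = unit_eval P ` nonvan P" by (rule unit_stalk_carrier[OF P])
  show "(\<one>, \<one>) \<in> nonvan P \<and> unit_eval P (\<one>, \<one>) = \<one>\<^bsub>unit_stalk P\<^esub>"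
    using one_not_in_prime[OF P] unit_eval_one[OF P] by (simp add: nonvan_def units_of_def)
  fix m assume m: "m \<in> nonvan P"
  show "\<exists>W. openin (zariski_topology R) W \<and> P \<in> W \<and> (\<forall>y\<in>W. m \<in> nonvan y)" by (rule nonvan_open[OF P m])
  fix n assume n: "n \<in> nonvan P"
  have i: "inv\<^bsub>unit_stalk P\<^esub> unit_eval P n = unit_eval P (snd n, fst n)"
    using unit_eval_inv[OF P n] n by (intro g.inv_equality) (simp_all add: carr, simp add: units_of_def)
  show "(fst m \<otimes> snd n, snd m \<otimes> fst n) \<in> nonvan P \<and>
      unit_eval P (fst m \<otimes> snd n, snd m \<otimes> fst n) = unit_eval P m \<otimes>\<^bsub>unit_stalk P\<^esub> inv\<^bsub>unit_stalk P\<^esub> unit_eval P n"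
    unfolding i using unit_eval_mult[OF P m unit_eval_inv(2)[OF P n]] not_in_prime_mult[OF P] m n
    by (auto simp: units_of_def nonvan_def)
  assume "unit_eval P m = unit_eval P n"
  then obtain u where u: "u \<in> carrier R - P" "u \<otimes> (snd n \<otimes> fst m \<ominus> snd m \<otimes> fst n) = \<zero>"
    using unit_eval_eq_iff[OF P m n] by blast
  \<comment> \<open>The annihilator \<open>u\<close> witnesses equality at every prime that does not
    contain it.\<close>
  have "unit_eval Q m = unit_eval Q n" if "Q \<in> {Q \<in> Spec R. u \<notin> Q}" "m \<in> nonvan Q" "n \<in> nonvan Q" for Q
    using unit_eval_eq_iff[OF _ that(2,3)] that(1) u by blast
  then show "\<exists>W. openin (zariski_topology R) W \<and> P \<in> W \<and> (\<forall>y\<in>W. m \<in> nonvan y \<longrightarrow> n \<in> nonvan y \<longrightarrow> unit_eval y m = unit_eval y n)"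
    using open_nonvanishing[of u] u(1) P by (intro exI[of _ "{Q \<in> Spec R. u \<notin> Q}"]) auto
qed

abbreviation "unit_sec \<equiv> eval_section (zariski_topology R) nonvan unit_eval"

lemma open_Spec: "openin (zariski_topology R) U \<Longrightarrow> U \<subseteq> Spec R"
  using openin_subset[of "zariski_topology R" U] unfolding topspace_zariski .

text \<open>Invertibility is a stalkwise matter: the numerator of a local fraction then avoids every
  prime of the neighbourhood. Conversely the pointwise inverses are locally the fractions with
  numerator and denominator exchanged, so they form a section.\<close>

lemma Units_sections:
  assumes U: "openin (zariski_topology R) U"
  shows "Units (structure_sections R U) = {f \<in> extensional U. \<forall>P\<in>U. unit_sec P f}"
proof (intro equalityI subsetI)
  note sec = structure_sections_def
  fix f assume "f \<in> Units (structure_sections R U)"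
  then obtain g where f: "f \<in> carrier (structure_sections R U)" and g: "g \<in> carrier (structure_sections R U)"
    and gf: "g \<otimes>\<^bsub>structure_sections R U\<^esub> f = \<one>\<^bsub>structure_sections R U\<^esub>" "f \<otimes>\<^bsub>structure_sections R U\<^esub> g = \<one>\<^bsub>structure_sections R U\<^esub>"
    unfolding Units_def by blast
  have "unit_sec P f" if P: "P \<in> U" for P
  proof -
    obtain W a s where W: "openin (zariski_topology R) W" "P \<in> W" "W \<subseteq> U" "a \<in> carrier R" "s \<in> carrier R"
        "\<forall>Q\<in>W. s \<notin> Q \<and> f Q = fraction R Q a s"
      using f[unfolded sec_carrier, THEN conjunct2, rule_format, OF P] by (elim exE conjE bexE)
    have "(a, s) \<in> nonvan Q \<and> f Q = unit_eval Q (a, s)" if Q: "Q \<in> W" for Q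
    proof -
      have QU: "Q \<in> U" and QS: "Q \<in> Spec R" using Q W(3) open_Spec[OF U] by auto
      have "f Q \<in> carrier (localization R Q)" "g Q \<in> carrier (localization R Q)" using f g QU unfolding sec_carrier by auto
      moreover have "g Q \<otimes>\<^bsub>localization R Q\<^esub> f Q = \<one>\<^bsub>localization R Q\<^esub>" "f Q \<otimes>\<^bsub>localization R Q\<^esub> g Q = \<one>\<^bsub>localization R Q\<^esub>"
        using fun_cong[OF gf(1), of Q] fun_cong[OF gf(2), of Q] QU by (simp_all add: sec)
      ultimately have "f Q \<in> Units (localization R Q)" unfolding Units_def by blast
      then have "a \<notin> Q" using W(4-6) Q prime_localization.fraction_Units[OF Spec_prime_localization[OF QS], of a s] by simp
      then show ?thesis using W(4-6) Q by (simp add: nonvan_def unit_eval_def)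
    qed
    then show ?thesis unfolding eval_section_def using W(1,2) by blast
  qed
  moreover have "f \<in> extensional U" using f unfolding sec_carrier by (auto simp: PiE_def)
  ultimately show "f \<in> {f \<in> extensional U. \<forall>P\<in>U. unit_sec P f}" by blast
next
  fix f assume f0: "f \<in> {f \<in> extensional U. \<forall>P\<in>U. unit_sec P f}"
  have f: "f \<in> extensional U" "\<exists>W m. openin (zariski_topology R) W \<and> P \<in> W \<and> (\<forall>Q\<in>W. m \<in> nonvan Q \<and> f Q = unit_eval Q m)"
    if "P \<in> U" for P using f0 that unfolding eval_section_def by auto
  have fe: "f \<in> extensional U" using f0 by blast
  have in_carrier: "h \<in> carrier (structure_sections R U)"
    if h: "h \<in> extensional U" "\<And>P. P \<in> U \<Longrightarrow> \<exists>W m. openin (zariski_topology R) W \<and> P \<in> W \<and> W \<subseteq> U \<and> (\<forall>Q\<in>W. m \<in> nonvan Q \<and> h Q = unit_eval Q m)" for h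
    unfolding sec_carrier
  proof (intro conjI ballI)
    show "h \<in> (\<Pi>\<^sub>E P\<in>U. carrier (localization R P))"
    proof (rule PiE_I)
      fix P assume P: "P \<in> U"
      obtain W m where "P \<in> W" "\<forall>Q\<in>W. m \<in> nonvan Q \<and> h Q = unit_eval Q m" using h(2)[OF P] by blast
      then have "h P = fraction R P (fst m) (snd m)" "fst m \<in> carrier R" "snd m \<in> carrier R - P"
        by (auto simp: unit_eval_def nonvan_def)
      then show "h P \<in> carrier (localization R P)" unfolding localization_def partial_object.simps by blast
    qed (use h(1) in \<open>simp add: extensional_def\<close>)
    fix P assume P: "P \<in> U"
    obtain W m where W: "openin (zariski_topology R) W" "P \<in> W" "W \<subseteq> U" "\<forall>Q\<in>W. m \<in> nonvan Q \<and> h Q = unit_eval Q m" using h(2)[OF P] by blast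
    have "fst m \<in> carrier R" "snd m \<in> carrier R" using W(2,4) by (auto simp: nonvan_def)
    moreover have "\<forall>Q\<in>W. snd m \<notin> Q \<and> h Q = fraction R Q (fst m) (snd m)" using W(4) by (auto simp: nonvan_def unit_eval_def)
    ultimately show "\<exists>W. openin (zariski_topology R) W \<and> P \<in> W \<and> W \<subseteq> U \<and> (\<exists>a\<in>carrier R. \<exists>s\<in>carrier R. \<forall>Q\<in>W. s \<notin> Q \<and> h Q = fraction R Q a s)"
      using W(1-3) by blast
  qed
  have loc: "\<exists>W m. openin (zariski_topology R) W \<and> P \<in> W \<and> W \<subseteq> U \<and> (\<forall>Q\<in>W. m \<in> nonvan Q \<and> f Q = unit_eval Q m)" if P: "P \<in> U" for P
  proof -
    obtain W m where "openin (zariski_topology R) W" "P \<in> W" "\<forall>Q\<in>W. m \<in> nonvan Q \<and> f Q = unit_eval Q m" using f(2)[OF P] by blast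
    then show ?thesis using U P by (intro exI[of _ "W \<inter> U"] exI[of _ m]) (auto intro: openin_Int)
  qed
  have fc: "f \<in> carrier (structure_sections R U)" by (rule in_carrier[OF fe loc])
  define g where "g = (\<lambda>P\<in>U. inv\<^bsub>unit_stalk P\<^esub> (f P))"
  have gu: "g Q = unit_eval Q (snd m, fst m)" if "Q \<in> U" "m \<in> nonvan Q" "f Q = unit_eval Q m" for Q m
  proof -
    have Q: "Q \<in> Spec R" using that(1) open_Spec[OF U] by blast
    interpret q: comm_group "unit_stalk Q" by (rule unit_comm_group[OF Q])
    have "inv\<^bsub>unit_stalk Q\<^esub> unit_eval Q m = unit_eval Q (snd m, fst m)"
      using unit_eval_inv[OF Q that(2)] that(2)
      by (intro q.inv_equality) (simp_all add: unit_stalk_carrier[OF Q], simp add: units_of_def)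
    then show ?thesis using that by (simp add: g_def)
  qed
  have gc: "g \<in> carrier (structure_sections R U)"
  proof (rule in_carrier)
    show "g \<in> extensional U" by (simp add: g_def)
    fix P assume P: "P \<in> U"
    obtain W m where W: "openin (zariski_topology R) W" "P \<in> W" "W \<subseteq> U" "\<forall>Q\<in>W. m \<in> nonvan Q \<and> f Q = unit_eval Q m" using loc[OF P] by blast
    have "\<forall>Q\<in>W. (snd m, fst m) \<in> nonvan Q \<and> g Q = unit_eval Q (snd m, fst m)"
    proof (intro ballI conjI)
      fix Q assume "Q \<in> W"
      then have Q: "Q \<in> U" "m \<in> nonvan Q" "f Q = unit_eval Q m" using W(3,4) by auto
      show "(snd m, fst m) \<in> nonvan Q" using Q(2) by (cases m) (auto simp: nonvan_def)
      show "g Q = unit_eval Q (snd m, fst m)" by (rule gu[OF Q])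
    qed
    then show "\<exists>W m. openin (zariski_topology R) W \<and> P \<in> W \<and> W \<subseteq> U \<and> (\<forall>Q\<in>W. m \<in> nonvan Q \<and> g Q = unit_eval Q m)"
      using W(1-3) by blast
  qed
  interpret m: comm_monoid "structure_sections R U" by (rule sec_comm_monoid[OF U])
  have "g \<otimes>\<^bsub>structure_sections R U\<^esub> f = \<one>\<^bsub>structure_sections R U\<^esub>"
  proof -
    have "g P \<otimes>\<^bsub>localization R P\<^esub> f P = \<one>\<^bsub>localization R P\<^esub>" if P: "P \<in> U" for P
    proof -
      obtain W m where m: "P \<in> W" "\<forall>Q\<in>W. m \<in> nonvan Q \<and> f Q = unit_eval Q m" using loc[OF P] by blast
      then have m': "m \<in> nonvan P" "f P = unit_eval P m" by auto
      have "P \<in> Spec R" using P open_Spec[OF U] by blast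
      then show ?thesis using unit_eval_inv(1)[OF _ m'(1)] gu[OF P m'] m'(2) by simp
    qed
    then show ?thesis unfolding structure_sections_def monoid.simps by (rule restrict_ext)
  qed
  then show "f \<in> Units (structure_sections R U)" unfolding Units_def using fc gc m.m_comm[OF gc fc] by (simp, blast)
qed

lemma units_sheaf_etale:
  "etale_presheaf (zariski_topology R) unit_stalk unit_sec (units_sheaf R)"
proof (intro etale_presheaf.intro etale_presheaf_axioms.intro units_presheaf eval_sheaf.etale[OF unit_eval_sheaf])
  show "carrier (sections (units_sheaf R) U) = {s \<in> extensional U. \<forall>x\<in>U. unit_sec x s}"
    if "openin (zariski_topology R) U" for U
    using Units_sections[OF that] by (simp add: units_sheaf_def units_of_def)
  show "s \<otimes>\<^bsub>sections (units_sheaf R) U\<^esub> t = (\<lambda>x\<in>U. s x \<otimes>\<^bsub>unit_stalk x\<^esub> t x)" for U s t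
    by (simp add: units_sheaf_def units_of_def structure_sections_def)
qed (simp add: units_sheaf_def)

end

context face_ring
begin

definition unit_map :: "'a set \<Rightarrow> ('a \<times> 'a) set \<Rightarrow> 'v set \<Rightarrow> 't fract" where
  "unit_map P c = face_eval \<Delta> P (SOME m. m \<in> nonvan P \<and> c = unit_eval P m)"

text \<open>Independence of the representative: an annihilator outside \<open>P\<close> has nonzero
  image on every face through \<open>P\<close>, and there it cancels in a domain.\<close>

lemma unit_map_eval:
  assumes P: "P \<in> Spec R" and m: "m \<in> nonvan P"
  shows "unit_map P (unit_eval P m) = face_eval \<Delta> P m"
proof -
  define n where "n = (SOME n. n \<in> nonvan P \<and> unit_eval P m = unit_eval P n)"
  have n: "n \<in> nonvan P" "unit_eval P m = unit_eval P n"
    using someI[of "\<lambda>n. n \<in> nonvan P \<and> unit_eval P m = unit_eval P n" m] m unfolding n_def by auto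
  obtain u where u: "u \<in> carrier R - P" "u \<otimes> (snd n \<otimes> fst m \<ominus> snd m \<otimes> fst n) = \<zero>"
    using n unit_eval_eq_iff[OF P m n(1)] by blast
  have mn: "fst m \<in> carrier R" "snd m \<in> carrier R - P" "fst n \<in> carrier R" "snd n \<in> carrier R - P"
    using m n(1) by (auto simp: nonvan_def)
  have "Fract (\<pi> F (fst n)) (\<pi> F (snd n)) = Fract (\<pi> F (fst m)) (\<pi> F (snd m))" if F: "F \<in> \<Delta>" "gen F \<subseteq> P" for F
  proof -
    have "\<pi> F u * (\<pi> F (snd n) * \<pi> F (fst m) - \<pi> F (snd m) * \<pi> F (fst n)) = 0"
      using arg_cong[OF u(2), of "\<pi> F"] u(1) mn by (simp add: \<pi>_mult[OF F(1)] \<pi>_diff[OF F(1)] \<pi>_zero[OF F(1)])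
    then have "\<pi> F (snd n) * \<pi> F (fst m) = \<pi> F (snd m) * \<pi> F (fst n)" using \<pi>_nonzero[OF F u(1)] by simp
    then show ?thesis using \<pi>_nonzero[OF F mn(2)] \<pi>_nonzero[OF F mn(4)] by (simp add: eq_fract mult.commute)
  qed
  then show ?thesis unfolding unit_map_def n_def[symmetric] by (auto simp: face_eval_def fun_eq_iff)
qed

text \<open>Units are identified with their families of fractions on all faces. Surjectivity on
  stalks is built into \<open>face_stalk\<close>; injectivity is reducedness of the ring.\<close>

theorem units_acyclic: "acyclic_presheaf X (units_sheaf R)"
proof (rule iso_acyclic[OF units_sheaf_etale face_etale[OF subset_refl], where p="unit_map"]; (unfold topspace_zariski)?)
  show "acyclic_etale X (face_stalk \<Delta>) (face_sec \<Delta>)"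
    by (rule acyclic_subcomplex) (use down in auto)
  show "etale_hom X unit_stalk unit_sec (face_stalk \<Delta>) (face_sec \<Delta>) unit_map"
  proof (rule eval_hom; unfold topspace_zariski)
    fix P assume P: "P \<in> Spec R"
    show "unit_map P \<in> hom (unit_stalk P) (face_stalk \<Delta> P)"
    proof (rule homI)
      fix x assume "x \<in> carrier (unit_stalk P)"
      then obtain m where m: "x = unit_eval P m" "m \<in> nonvan P" unfolding unit_stalk_carrier[OF P] by blast
      show "unit_map P x \<in> carrier (face_stalk \<Delta> P)" unfolding m(1) unit_map_eval[OF P m(2)] face_carrier using m(2) by blast
      fix y assume "y \<in> carrier (unit_stalk P)"
      then obtain n where n: "y = unit_eval P n" "n \<in> nonvan P" unfolding unit_stalk_carrier[OF P] by blast
      note fe = face_eval_mult[OF subset_refl P m(2) n(2)]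
      have "x \<otimes>\<^bsub>unit_stalk P\<^esub> y = unit_eval P (fst m \<otimes> fst n, snd m \<otimes> snd n)"
        using unit_eval_mult[OF P m(2) n(2)] m n by (simp add: units_of_def)
      then show "unit_map P (x \<otimes>\<^bsub>unit_stalk P\<^esub> y) = unit_map P x \<otimes>\<^bsub>face_stalk \<Delta> P\<^esub> unit_map P y"
        using unit_map_eval[OF P fe(2)] unit_map_eval[OF P m(2)] unit_map_eval[OF P n(2)] fe(1) m(1) n(1) by (simp add: face_stalk_def)
    qed
    fix m assume m: "m \<in> nonvan P"
    show "\<exists>W n. openin X W \<and> P \<in> W \<and> (\<forall>y\<in>W. m \<in> nonvan y \<longrightarrow> n \<in> nonvan y \<and> unit_map y (unit_eval y m) = face_eval \<Delta> y n)"
      by (rule exI[of _ "Spec R"], rule exI[of _ m])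
        (use P unit_map_eval openin_topspace[of X] in \<open>simp add: topspace_zariski\<close>)
  qed
  fix P assume P: "P \<in> Spec R"
  show "\<exists>r\<in>carrier (unit_stalk P). unit_map P r = s" if s: "s \<in> carrier (face_stalk \<Delta> P)" for s
  proof -
    obtain m where m: "s = face_eval \<Delta> P m" "m \<in> nonvan P" using s unfolding face_carrier by blast
    then show ?thesis using unit_map_eval[OF P m(2)] unfolding unit_stalk_carrier[OF P] by blast
  qed
  show "s = \<one>\<^bsub>unit_stalk P\<^esub>" if s: "s \<in> carrier (unit_stalk P)" "unit_map P s = \<one>\<^bsub>face_stalk \<Delta> P\<^esub>" for s
  proof -
    obtain m where m: "s = unit_eval P m" "m \<in> nonvan P" using s(1) unfolding unit_stalk_carrier[OF P] by blast
    have "face_eval \<Delta> P m = (\<lambda>_. 1)" using s(2) unfolding m(1) unit_map_eval[OF P m(2)] by (simp add: face_stalk_def)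
    then have eq: "\<forall>F\<in>\<Delta>. gen F \<subseteq> P \<longrightarrow> \<pi> F (fst m) = \<pi> F (snd m)" using eval_one_iff[OF subset_refl P m(2)] by blast
    have mR: "fst m \<in> carrier R" "snd m \<in> carrier R" using m(2) by (auto simp: nonvan_def)
    have fin: "finite (gen ` {G \<in> \<Delta>. \<not> gen G \<subseteq> P})" using finite_faces by simp
    \<comment> \<open>\<open>w\<close> vanishes on the faces missing \<open>P\<close>, while the
      difference vanishes on those through \<open>P\<close>; the product is zero on every face,
      hence zero in \<open>R\<close>.\<close>
    obtain w where w: "w \<in> carrier R - P" "\<forall>J\<in>gen ` {G \<in> \<Delta>. \<not> gen G \<subseteq> P}. w \<in> J"
      using prime_avoid[OF P fin] gen_ideal by blast
    have "w \<otimes> (\<one> \<otimes> fst m \<ominus> snd m \<otimes> \<one>) = \<zero>"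
    proof (rule \<pi>_inj)
      show "w \<otimes> (\<one> \<otimes> fst m \<ominus> snd m \<otimes> \<one>) \<in> carrier R" using w(1) mR by simp
      fix F assume F: "F \<in> \<Delta>"
      have "\<pi> F w = 0 \<or> \<pi> F (fst m) = \<pi> F (snd m)" using eq F w(2) gen_iff[OF F] by blast
      then show "\<pi> F (w \<otimes> (\<one> \<otimes> fst m \<ominus> snd m \<otimes> \<one>)) = 0" using w(1) mR by (auto simp: \<pi>_mult[OF F] \<pi>_diff[OF F])
    qed
    moreover have o: "(\<one>, \<one>) \<in> nonvan P" using one_not_in_prime[OF P] by (simp add: nonvan_def)
    ultimately have "unit_eval P m = unit_eval P (\<one>, \<one>)" unfolding unit_eval_eq_iff[OF P m(2) o] using w(1) by auto
    then show ?thesis unfolding m(1) unit_eval_one[OF P] by (simp add: units_of_def)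
  qed
qed

end

theorem theorem4p21:
  fixes V :: "'v set" and \<Delta> :: "'v set set" and j :: nat
  assumes "finite V" and "abstract_simplicial_complex V \<Delta>" and "j \<ge> 1"
  shows "trivial_group
           (sheaf_cohomology j
             (zariski_topology (stanley_reisner_ring V \<Delta> :: ('v, 'k::field) mpolynomial set ring))
             (units_sheaf (stanley_reisner_ring V \<Delta>)))"
proof -
  \<comment> \<open>Finiteness of \<open>V\<close> provides the renaming into the linearly ordered
    type of naturals.\<close>
  obtain \<iota> :: "'v \<Rightarrow> nat" where "inj_on \<iota> V" using finite_imp_inj_to_nat_seg[OF assms(1)] by blast
  then interpret sr_vars V \<Delta> \<iota> "TYPE('k)" using assms by (simp add: sr_vars_def)
  interpret R: face_ring SR \<Delta> face_map by (rule face_ring)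
  obtain n where "j = Suc n" using assms(3) by (cases j) auto
  then show ?thesis using ab_presheaf.acyclic_cohomology[OF R.units_presheaf R.units_acyclic] by simp
qed

end
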